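(* Let $(R,\mathfrak m,k)$ be a commutative Noetherian local ring, let $M$ be a Burch submodule of some finitely generated $R$-module $L$, and let $N$ be a finitely generated $R$-module. Let $n\ge\operatorname{depth}(N)$ be an integer such that $$\operatorname{Ext}_R^i(M,N)=\operatorname{Ext}_R^j(L,N)=0\quad\text{for all } i=n-1,n,n+1 \text{ and } j=n,n+1.$$ Then $\operatorname{id}_R(N)<\infty$.
   Context: $\operatorname{id}_R$ denotes injective dimension; $\operatorname{Ext}^i_R=0$ for $i<0$; $\operatorname{depth}(0)=\infty$. A submodule $M$ of an $R$-module $L$ is Burch if $\mathfrak m(M:_L\mathfrak m)\neq \mathfrak m M$, where $(M:_L\mathfrak m)=\{y\in L:\mathfrak m y\subseteq M\}$. *)

theory Defs
  imports "HOL-Library.Extended_Real" "HOL-Algebra.Algebra"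
begin

section \<open>Modules over a Noetherian local ring\<close>

definition noetherian_local_ring :: "('a, 'r) ring_scheme \<Rightarrow> 'a set \<Rightarrow> bool" where
  "noetherian_local_ring R \<mm> \<longleftrightarrow>
     cring R \<and> noetherian_ring R \<and> maximalideal \<mm> R \<and> (\<forall>J. maximalideal J R \<longrightarrow> J = \<mm>)"

definition module_homs ::
  "('a, 'r) ring_scheme \<Rightarrow> ('a, 'b, 'm) module_scheme \<Rightarrow> ('a, 'c, 'n) module_scheme \<Rightarrow> ('b \<Rightarrow> 'c) set"
where
  "module_homs R A B =
     {f \<in> hom (add_monoid A) (add_monoid B).
        \<forall>r\<in>carrier R. \<forall>x\<in>carrier A. f (r \<odot>\<^bsub>A\<^esub> x) = r \<odot>\<^bsub>B\<^esub> f x}"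

definition submodule_generated ::
  "('a, 'r) ring_scheme \<Rightarrow> ('a, 'b, 'm) module_scheme \<Rightarrow> 'b set \<Rightarrow> 'b set"
where
  "submodule_generated R A S = \<Inter>{H. submodule H R A \<and> S \<subseteq> H}"

definition fin_gen_module :: "('a, 'r) ring_scheme \<Rightarrow> ('a, 'b, 'm) module_scheme \<Rightarrow> bool" where
  "fin_gen_module R A \<longleftrightarrow>
     Module.module R A \<and> (\<exists>S\<subseteq>carrier A. finite S \<and> submodule_generated R A S = carrier A)"

text \<open>For a submodule \<open>Y\<close>, this is \<open>IY\<close> where \<open>I\<close> may be an ideal or just a set of
  generators of one.\<close>

definition ideal_smult ::
  "('a, 'r) ring_scheme \<Rightarrow> ('a, 'b, 'm) module_scheme \<Rightarrow> 'a set \<Rightarrow> 'b set \<Rightarrow> 'b set"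
where
  "ideal_smult R A I Y = submodule_generated R A ((\<lambda>(a, x). a \<odot>\<^bsub>A\<^esub> x) ` (I \<times> Y))"

definition module_colon :: "('a, 'b, 'm) module_scheme \<Rightarrow> 'b set \<Rightarrow> 'a set \<Rightarrow> 'b set" where
  "module_colon L M I = {y \<in> carrier L. \<forall>a\<in>I. a \<odot>\<^bsub>L\<^esub> y \<in> M}"

definition burch_submodule ::
  "('a, 'r) ring_scheme \<Rightarrow> 'a set \<Rightarrow> 'b set \<Rightarrow> ('a, 'b, 'm) module_scheme \<Rightarrow> bool"
where
  "burch_submodule R \<mm> M L \<longleftrightarrow>
     submodule M R L \<and> ideal_smult R L \<mm> (module_colon L M \<mm>) \<noteq> ideal_smult R L \<mm> M"


section \<open>Depth\<close>

text \<open>The first condition says that \<open>xs ! i\<close> is a nonzerodivisor on the quotient of \<open>A\<close> by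
  the submodule generated by the multiples of the earlier terms.\<close>

definition regular_sequence ::
  "('a, 'r) ring_scheme \<Rightarrow> ('a, 'b, 'm) module_scheme \<Rightarrow> 'a list \<Rightarrow> bool"
where
  "regular_sequence R A xs \<longleftrightarrow>
     set xs \<subseteq> carrier R \<and>
     (\<forall>i<length xs. \<forall>y\<in>carrier A.
        (xs ! i) \<odot>\<^bsub>A\<^esub> y \<in> ideal_smult R A (set (take i xs)) (carrier A) \<longrightarrow>
        y \<in> ideal_smult R A (set (take i xs)) (carrier A)) \<and>
     ideal_smult R A (set xs) (carrier A) \<noteq> carrier A"

definition depth :: "('a, 'r) ring_scheme \<Rightarrow> 'a set \<Rightarrow> ('a, 'b, 'm) module_scheme \<Rightarrow> enat" where
  "depth R \<mm> A =
     (if carrier A = {\<zero>\<^bsub>A\<^esub>} then \<infinity>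
      else Sup {enat (length xs) | xs. set xs \<subseteq> \<mm> \<and> regular_sequence R A xs})"


section \<open>Ext\<close>

text \<open>The free module on the set \<open>B\<close>, consisting of the finitely supported functions from
  \<open>B\<close> to \<open>R\<close>. The fields \<open>mult\<close> and \<open>one\<close> belong to the record type but play no role in a module.\<close>

definition free_module :: "('a, 'r) ring_scheme \<Rightarrow> 'x set \<Rightarrow> ('a, 'x \<Rightarrow> 'a) module" where
  "free_module R B =
     \<lparr>carrier = {f. (\<forall>x. f x \<in> carrier R) \<and> finite {x. f x \<noteq> \<zero>\<^bsub>R\<^esub>} \<and> {x. f x \<noteq> \<zero>\<^bsub>R\<^esub>} \<subseteq> B},
      monoid.mult = undefined, one = undefined,
      ring.zero = (\<lambda>x. \<zero>\<^bsub>R\<^esub>), ring.add = (\<lambda>f g x. f x \<oplus>\<^bsub>R\<^esub> g x),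
      module.smult = (\<lambda>r f x. r \<otimes>\<^bsub>R\<^esub> f x)\<rparr>"

text \<open>An exact sequence \<open>\<cdots> \<rightarrow> F\<^sub>2 \<rightarrow> F\<^sub>1 \<rightarrow> F\<^sub>0 \<rightarrow> A \<rightarrow> 0\<close>, where \<open>F\<^sub>i\<close> is free on \<open>B i\<close>,
  with \<open>d i : F\<^sub>i\<^sub>+\<^sub>1 \<rightarrow> F\<^sub>i\<close> and \<open>\<epsilon> : F\<^sub>0 \<rightarrow> A\<close>.\<close>

definition free_resolution ::
  "('a, 'r) ring_scheme \<Rightarrow> ('a, 'b, 'm) module_scheme \<Rightarrow> (nat \<Rightarrow> 'x set) \<Rightarrow>
   (nat \<Rightarrow> ('x \<Rightarrow> 'a) \<Rightarrow> ('x \<Rightarrow> 'a)) \<Rightarrow> (('x \<Rightarrow> 'a) \<Rightarrow> 'b) \<Rightarrow> bool"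
where
  "free_resolution R A B d \<epsilon> \<longleftrightarrow>
     (\<forall>i. d i \<in> module_homs R (free_module R (B (Suc i))) (free_module R (B i))) \<and>
     \<epsilon> \<in> module_homs R (free_module R (B 0)) A \<and>
     \<epsilon> ` carrier (free_module R (B 0)) = carrier A \<and>
     d 0 ` carrier (free_module R (B 1)) =
       {x \<in> carrier (free_module R (B 0)). \<epsilon> x = \<zero>\<^bsub>A\<^esub>} \<and>
     (\<forall>i. d (Suc i) ` carrier (free_module R (B (Suc (Suc i)))) =
       {x \<in> carrier (free_module R (B (Suc i))). d i x = \<zero>\<^bsub>free_module R (B i)\<^esub>})"

text \<open>Homomorphisms are restricted to the carrier, so that equality of elements is equality
  of maps.\<close>

definition Hom_group ::
  "('a, 'r) ring_scheme \<Rightarrow> ('a, 'b, 'm) module_scheme \<Rightarrow> ('a, 'c, 'n) module_scheme \<Rightarrow> ('b \<Rightarrow> 'c) monoid"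
where
  "Hom_group R A N =
     \<lparr>carrier = module_homs R A N \<inter> extensional (carrier A),
      monoid.mult = (\<lambda>f g. \<lambda>x\<in>carrier A. f x \<oplus>\<^bsub>N\<^esub> g x),
      one = (\<lambda>x\<in>carrier A. \<zero>\<^bsub>N\<^esub>)\<rparr>"

text \<open>\<open>Hom_complex R B N i\<close> is \<open>Hom(F\<^sub>i, N)\<close>; \<open>Hom_coboundary R B d i\<close> is the map
  \<open>Hom(F\<^sub>i, N) \<rightarrow> Hom(F\<^sub>i\<^sub>+\<^sub>1, N)\<close> induced by \<open>d i\<close>.\<close>

definition Hom_complex ::
  "('a, 'r) ring_scheme \<Rightarrow> (nat \<Rightarrow> 'x set) \<Rightarrow> ('a, 'c, 'n) module_scheme \<Rightarrow> nat \<Rightarrow> (('x \<Rightarrow> 'a) \<Rightarrow> 'c) monoid"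
where
  "Hom_complex R B N i = Hom_group R (free_module R (B i)) N"

definition Hom_coboundary ::
  "('a, 'r) ring_scheme \<Rightarrow> (nat \<Rightarrow> 'x set) \<Rightarrow> (nat \<Rightarrow> ('x \<Rightarrow> 'a) \<Rightarrow> ('x \<Rightarrow> 'a)) \<Rightarrow> nat \<Rightarrow>
   (('x \<Rightarrow> 'a) \<Rightarrow> 'c) \<Rightarrow> (('x \<Rightarrow> 'a) \<Rightarrow> 'c)"
where
  "Hom_coboundary R B d i f = (\<lambda>x\<in>carrier (free_module R (B (Suc i))). f (d i x))"

definition cocycles ::
  "('a, 'r) ring_scheme \<Rightarrow> (nat \<Rightarrow> 'x set) \<Rightarrow> (nat \<Rightarrow> ('x \<Rightarrow> 'a) \<Rightarrow> ('x \<Rightarrow> 'a)) \<Rightarrow>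
   ('a, 'c, 'n) module_scheme \<Rightarrow> nat \<Rightarrow> (('x \<Rightarrow> 'a) \<Rightarrow> 'c) set"
where
  "cocycles R B d N i =
     kernel (Hom_complex R B N i) (Hom_complex R B N (Suc i)) (Hom_coboundary R B d i)"

definition coboundaries ::
  "('a, 'r) ring_scheme \<Rightarrow> (nat \<Rightarrow> 'x set) \<Rightarrow> (nat \<Rightarrow> ('x \<Rightarrow> 'a) \<Rightarrow> ('x \<Rightarrow> 'a)) \<Rightarrow>
   ('a, 'c, 'n) module_scheme \<Rightarrow> nat \<Rightarrow> (('x \<Rightarrow> 'a) \<Rightarrow> 'c) set"
where
  "coboundaries R B d N i =
     (case i of 0 \<Rightarrow> {\<one>\<^bsub>Hom_complex R B N 0\<^esub>}
      | Suc j \<Rightarrow> Hom_coboundary R B d j ` carrier (Hom_complex R B N j))"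

definition Hom_cohomology ::
  "('a, 'r) ring_scheme \<Rightarrow> (nat \<Rightarrow> 'x set) \<Rightarrow> (nat \<Rightarrow> ('x \<Rightarrow> 'a) \<Rightarrow> ('x \<Rightarrow> 'a)) \<Rightarrow>
   ('a, 'c, 'n) module_scheme \<Rightarrow> nat \<Rightarrow> (('x \<Rightarrow> 'a) \<Rightarrow> 'c) set monoid"
where
  "Hom_cohomology R B d N i =
     (Hom_complex R B N i)\<lparr>carrier := cocycles R B d N i\<rparr> Mod coboundaries R B d N i"

text \<open>The Ext group is the cohomology for a chosen free resolution of \<open>A\<close>; up to isomorphism the
  choice is immaterial. Bases are taken in \<open>'a \<times> 'b \<times> nat\<close>: the free module on a subset of an
  infinite type at least as large as \<open>R\<close> has no more elements than that type, so every \<open>R\<close>-module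
  with carrier in \<open>'b\<close> has a free resolution with such bases.\<close>

definition Ext ::
  "('a, 'r) ring_scheme \<Rightarrow> ('a, 'b, 'm) module_scheme \<Rightarrow> ('a, 'c, 'n) module_scheme \<Rightarrow> int \<Rightarrow>
   (('a \<times> 'b \<times> nat \<Rightarrow> 'a) \<Rightarrow> 'c) set monoid"
where
  "Ext R A N i =
     (if i < 0 then singleton_group {}
      else let (B, d) = (SOME (B, d). \<exists>\<epsilon>. free_resolution R A B d \<epsilon>)
           in Hom_cohomology R B d N (nat i))"


section \<open>Injective dimension\<close>

text \<open>HOL cannot quantify over all types of test modules. Here the test modules \<open>A\<close>, \<open>B\<close> range
  over the type \<open>'a + 'e\<close>, which contains a copy of \<open>R\<close> and of each of its ideals; by Baer's
  criterion \<open>E\<close> then has the extension property for test modules of every type.\<close>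

definition injective_module :: "('a, 'r) ring_scheme \<Rightarrow> ('a, 'e, 'm) module_scheme \<Rightarrow> bool" where
  "injective_module R E \<longleftrightarrow>
     Module.module R E \<and>
     (\<forall>(A :: ('a, 'a + 'e) module) (B :: ('a, 'a + 'e) module) f g.
        Module.module R A \<and> Module.module R B \<and>
        f \<in> module_homs R A B \<and> inj_on f (carrier A) \<and> g \<in> module_homs R A E \<longrightarrow>
        (\<exists>h\<in>module_homs R B E. \<forall>x\<in>carrier A. h (f x) = g x))"

text \<open>An exact sequence \<open>0 \<rightarrow> N \<rightarrow> E\<^sup>0 \<rightarrow> E\<^sup>1 \<rightarrow> \<cdots>\<close> with all \<open>E\<^sup>i\<close> injective,
  where \<open>\<eta> : N \<rightarrow> E\<^sup>0\<close> and \<open>\<delta> i : E\<^sup>i \<rightarrow> E\<^sup>i\<^sup>+\<^sup>1\<close>.\<close>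

definition injective_resolution ::
  "('a, 'r) ring_scheme \<Rightarrow> ('a, 'b, 'm) module_scheme \<Rightarrow> ('b \<Rightarrow> 'e) \<Rightarrow>
   (nat \<Rightarrow> ('a, 'e) module) \<Rightarrow> (nat \<Rightarrow> 'e \<Rightarrow> 'e) \<Rightarrow> bool"
where
  "injective_resolution R N \<eta> E \<delta> \<longleftrightarrow>
     (\<forall>i. injective_module R (E i)) \<and>
     \<eta> \<in> module_homs R N (E 0) \<and> inj_on \<eta> (carrier N) \<and>
     (\<forall>i. \<delta> i \<in> module_homs R (E i) (E (Suc i))) \<and>
     \<eta> ` carrier N = {x \<in> carrier (E 0). \<delta> 0 x = \<zero>\<^bsub>E 1\<^esub>} \<and>
     (\<forall>i. \<delta> i ` carrier (E i) = {x \<in> carrier (E (Suc i)). \<delta> (Suc i) x = \<zero>\<^bsub>E (Suc (Suc i))\<^esub>})"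

text \<open>The infimum of the lengths of the finite injective resolutions; in particular it is
  \<open>\<infinity>\<close> if there are none, and \<open>0\<close> for the zero module. The resolutions are taken in the type
  \<open>'a \<times> nat \<Rightarrow> 'b + nat\<close>. If \<open>\<kappa>\<close> is its cardinality, then \<open>\<kappa>\<close> to the power of the cardinality of
  \<open>'a\<close> is again \<open>\<kappa>\<close>. Hence a module \<open>G\<close> of cardinality at most \<open>\<kappa>\<close> embeds into the injective module
  of additive maps from \<open>R\<close> to a divisible hull of \<open>G\<close>, which has cardinality at most \<open>\<kappa>\<close> too.
  So the type has room for injective resolutions of \<open>N\<close>, and for one of minimal length.\<close>

definition injective_dim :: "('a, 'r) ring_scheme \<Rightarrow> ('a, 'b, 'm) module_scheme \<Rightarrow> enat" where
  "injective_dim R N =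
     Inf {enat l | l. \<exists>\<eta> (E :: nat \<Rightarrow> ('a, 'a \<times> nat \<Rightarrow> 'b + nat) module) \<delta>.
            injective_resolution R N \<eta> E \<delta> \<and> (\<forall>i>l. carrier (E i) = {\<zero>\<^bsub>E i\<^esub>})}"

end

theory Submission
  imports Defs
begin

text \<open>
  Let \<open>k = R/\<mm>\<close> and let \<open>0 \<rightarrow> N \<rightarrow> I\<^sup>0 \<rightarrow> I\<^sup>1 \<rightarrow> \<dots>\<close> be an injective coresolution. The group
  \<open>Ext\<^sup>i(R/\<aa>, N)\<close> is represented by the cocycles in \<open>I\<^sup>i\<close> that are killed by \<open>\<aa>\<close>, modulo the
  boundaries of elements that are killed by \<open>\<aa>\<close>. The proof works with such elements; the Ext
  groups of the statement, which come from free resolutions, are compared with them by the usual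
  zigzag through the double complex \<open>Hom(F\<^sub>p, I\<^sup>q)\<close> (\<open>balance\<close>).

  \<^emph>\<open>The Burch condition gives \<open>Ext\<^sup>n(k, N) = 0\<close>\<close> (\<open>burch_ext_vanishes\<close>). Take \<open>y \<in> (M :\<^sub>L \<mm>)\<close> and
  \<open>a \<in> \<mm>\<close> with \<open>a y \<notin> \<mm> M\<close>. A linear functional \<open>M \<rightarrow> k\<close> with \<open>a y \<mapsto> 1\<close> turns a cocycle \<open>e \<in> I\<^sup>n\<close>
  killed by \<open>\<mm>\<close> into a cocycle \<open>\<phi> : M \<rightarrow> I\<^sup>n\<close> with \<open>\<phi>(a y) = e\<close>. Vanishing of \<open>Ext\<^sup>n(M, N)\<close> gives
  \<open>\<phi> = d \<psi>\<close>, and \<open>\<psi>\<close> extends to \<open>L\<close>. Then \<open>d (a \<psi>)\<close> is zero on \<open>M\<close>, and vanishing of \<open>Ext\<^sup>n(L, N)\<close>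
  and \<open>Ext\<^sup>n\<^sup>-\<^sup>1(M, N)\<close> makes it \<open>d \<chi>\<close> with \<open>\<chi>\<close> zero on \<open>M\<close>. So \<open>e = d (\<chi>(y))\<close>, and \<open>\<mm> \<chi>(y) = 0\<close>
  because \<open>\<mm> y \<subseteq> M\<close>.

  \<^emph>\<open>The degrees with \<open>Ext(k, N) \<noteq> 0\<close> have no gap\<close> (\<open>no_gap\<close>). Suppose \<open>e'\<close> and \<open>e\<close> are nonzero classes
  in degrees \<open>a < b\<close>, and Ext vanishes in the degrees \<open>a + 1\<close> and \<open>b - 1\<close>. Vanishing in these two
  degrees is what is needed for a linear map from the \<open>\<mm>\<close>-torsion of \<open>I\<^sup>b\<close> to the cocycles of \<open>I\<^sup>a\<close>
  that kills boundaries of torsion elements and sends \<open>e\<close> to \<open>e'\<close> (\<open>socle_map\<close>); it is a map of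
  complexes of negative degree. On the other hand there is a submodule \<open>Q\<close> of \<open>N\<close> such that each
  element of \<open>\<mm>\<close> is nilpotent on \<open>N/Q\<close> and \<open>e'\<close> is still nonzero in \<open>Ext\<^sup>a(k, N/Q)\<close>
  (\<open>detection\<close>). In a coresolution of \<open>N/Q\<close> a power of each \<open>x \<in> \<mm>\<close> is null homotopic, and this
  forces every map of negative degree from the torsion subcomplex of \<open>I\<close> to be null homotopic
  (\<open>torsion_null_homotopy\<close>). So the image of \<open>e'\<close> is zero after all.

  \<^emph>\<open>Conclusion.\<close> If all \<open>Ext\<^sup>i(k, N)\<close> with \<open>i \<le> n\<close> were zero, there would be a regular sequence of
  length \<open>n + 1\<close> (\<open>depth_of_vanishing\<close>), against \<open>depth N \<le> n\<close>. So there is a nonzero group in a degree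
  below \<open>n\<close>, and by the absence of gaps \<open>Ext\<^sup>i(k, N) = 0\<close> for all \<open>i \<ge> n\<close>. Noetherian induction extends
  this to all \<open>R/\<aa>\<close> (\<open>ext_vanishes_all_ideals\<close>), and by Baer's criterion the cocycles in \<open>I\<^sup>n\<close> form an
  injective module (\<open>cosyzygy_injective\<close>). They end a finite coresolution. That it lives in the
  type over which the injective dimension is taken is the content of \<open>coresolution_exists\<close>.
\<close>

section \<open>Linear maps and linear relations\<close>

text \<open>Maps are considered on a submodule \<open>S\<close> and with values in a submodule \<open>T\<close>, so that restricting
  a map or narrowing its range does not change the module records.\<close>

definition lin :: "('a,'r) ring_scheme \<Rightarrow> ('a,'b,'m) module_scheme \<Rightarrow> 'b set \<Rightarrow> ('a,'c,'n) module_scheme \<Rightarrow> 'c set \<Rightarrow> ('b \<Rightarrow> 'c) \<Rightarrow> bool" where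
  "lin R A S B T f \<longleftrightarrow> (\<forall>x\<in>S. f x \<in> T) \<and> (\<forall>x\<in>S. \<forall>y\<in>S. f (x \<oplus>\<^bsub>A\<^esub> y) = f x \<oplus>\<^bsub>B\<^esub> f y) \<and>
     (\<forall>r\<in>carrier R. \<forall>x\<in>S. f (r \<odot>\<^bsub>A\<^esub> x) = r \<odot>\<^bsub>B\<^esub> f x)"

abbreviation lin_map :: "('a,'r) ring_scheme \<Rightarrow> ('a,'b,'m) module_scheme \<Rightarrow> ('a,'c,'n) module_scheme \<Rightarrow> ('b \<Rightarrow> 'c) \<Rightarrow> bool" where
  "lin_map R A B f \<equiv> lin R A (carrier A) B (carrier B) f"

lemma linI:
  assumes "\<And>x. x \<in> S \<Longrightarrow> f x \<in> T" "\<And>x y. x \<in> S \<Longrightarrow> y \<in> S \<Longrightarrow> f (x \<oplus>\<^bsub>A\<^esub> y) = f x \<oplus>\<^bsub>B\<^esub> f y"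
    "\<And>r x. r \<in> carrier R \<Longrightarrow> x \<in> S \<Longrightarrow> f (r \<odot>\<^bsub>A\<^esub> x) = r \<odot>\<^bsub>B\<^esub> f x"
  shows "lin R A S B T f"
  using assms unfolding lin_def by blast

lemma lin_closed: "lin R A S B T f \<Longrightarrow> x \<in> S \<Longrightarrow> f x \<in> T"
  and lin_add: "lin R A S B T f \<Longrightarrow> x \<in> S \<Longrightarrow> y \<in> S \<Longrightarrow> f (x \<oplus>\<^bsub>A\<^esub> y) = f x \<oplus>\<^bsub>B\<^esub> f y"
  and lin_smult: "lin R A S B T f \<Longrightarrow> r \<in> carrier R \<Longrightarrow> x \<in> S \<Longrightarrow> f (r \<odot>\<^bsub>A\<^esub> x) = r \<odot>\<^bsub>B\<^esub> f x"
  unfolding lin_def by blast+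

lemma module_homs_iff_lin: "f \<in> module_homs R A B \<longleftrightarrow> lin_map R A B f"
  unfolding module_homs_def lin_def hom_def by (auto simp: Pi_iff)

lemma submodI:
  assumes "Module.module R A" "S \<subseteq> carrier A" "\<zero>\<^bsub>A\<^esub> \<in> S"
    "\<And>x y. x \<in> S \<Longrightarrow> y \<in> S \<Longrightarrow> x \<oplus>\<^bsub>A\<^esub> y \<in> S" "\<And>r x. r \<in> carrier R \<Longrightarrow> x \<in> S \<Longrightarrow> r \<odot>\<^bsub>A\<^esub> x \<in> S"
  shows "submodule S R A"
proof -
  interpret module R A by fact
  show ?thesis
  proof (rule submoduleI)
    fix a assume a: "a \<in> S"
    then have "\<ominus>\<^bsub>A\<^esub> a = (\<ominus>\<^bsub>R\<^esub> \<one>\<^bsub>R\<^esub>) \<odot>\<^bsub>A\<^esub> a" using assms(2) by (auto simp: smult_l_minus)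
    then show "\<ominus>\<^bsub>A\<^esub> a \<in> S" using assms(5) a by simp
  qed (use assms in auto)
qed

lemma submodD:
  assumes "submodule S R A"
  shows submod_subset: "S \<subseteq> carrier A" and submod_zero: "\<zero>\<^bsub>A\<^esub> \<in> S"
    and submod_add: "\<And>x y. x \<in> S \<Longrightarrow> y \<in> S \<Longrightarrow> x \<oplus>\<^bsub>A\<^esub> y \<in> S"
    and submod_smult: "\<And>r x. r \<in> carrier R \<Longrightarrow> x \<in> S \<Longrightarrow> r \<odot>\<^bsub>A\<^esub> x \<in> S"
proof -
  interpret submodule S R A by fact
  show "S \<subseteq> carrier A" using subset by simp
  show "\<zero>\<^bsub>A\<^esub> \<in> S" using one_closed by simp
  show "\<And>x y. x \<in> S \<Longrightarrow> y \<in> S \<Longrightarrow> x \<oplus>\<^bsub>A\<^esub> y \<in> S" using m_closed by simp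
  show "\<And>r x. r \<in> carrier R \<Longrightarrow> x \<in> S \<Longrightarrow> r \<odot>\<^bsub>A\<^esub> x \<in> S" using smult_closed by simp
qed

lemma submod_carrier: "Module.module R A \<Longrightarrow> submodule (carrier A) R A"
  by (rule module.carrier_is_submodule)

lemma submod_neg: "Module.module R A \<Longrightarrow> submodule S R A \<Longrightarrow> x \<in> S \<Longrightarrow> \<ominus>\<^bsub>A\<^esub> x \<in> S"
  by (rule module.submoduleE(3))

lemma submod_diff: "Module.module R A \<Longrightarrow> submodule S R A \<Longrightarrow> x \<in> S \<Longrightarrow> y \<in> S \<Longrightarrow> x \<ominus>\<^bsub>A\<^esub> y \<in> S"
  unfolding a_minus_def by (metis submod_neg submod_add)

lemma submod_module: "Module.module R A \<Longrightarrow> submodule S R A \<Longrightarrow> Module.module R (A\<lparr>carrier := S\<rparr>)"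
  by (rule submodule.submodule_is_module)

lemma submod_zero_set: "Module.module R A \<Longrightarrow> submodule {\<zero>\<^bsub>A\<^esub>} R A"
proof -
  assume "Module.module R A"
  then interpret module R A .
  show ?thesis by (rule submodI) (auto intro: \<open>Module.module R A\<close>)
qed

context
  fixes R :: "('a,'r) ring_scheme" (structure) and A :: "('a,'b,'m) module_scheme"
  assumes A: "Module.module R A"
begin

interpretation module R A by (rule A)

lemma mod_diff_add: "x \<in> carrier A \<Longrightarrow> y \<in> carrier A \<Longrightarrow> (x \<ominus>\<^bsub>A\<^esub> y) \<oplus>\<^bsub>A\<^esub> y = x"
  by (simp add: a_minus_def a_assoc M.l_neg)

lemma mod_add_diff: "x \<in> carrier A \<Longrightarrow> y \<in> carrier A \<Longrightarrow> (x \<oplus>\<^bsub>A\<^esub> y) \<ominus>\<^bsub>A\<^esub> y = x"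
  by (simp add: a_minus_def a_assoc M.r_neg)

lemma mod_add_diff2: "x \<in> carrier A \<Longrightarrow> y \<in> carrier A \<Longrightarrow> (x \<oplus>\<^bsub>A\<^esub> y) \<ominus>\<^bsub>A\<^esub> x = y"
  by (metis mod_add_diff M.a_comm)

lemma mod_diff_self: "x \<in> carrier A \<Longrightarrow> x \<ominus>\<^bsub>A\<^esub> x = \<zero>\<^bsub>A\<^esub>"
  by (simp add: a_minus_def M.r_neg)

lemma mod_diff_zero: "x \<in> carrier A \<Longrightarrow> x \<ominus>\<^bsub>A\<^esub> \<zero>\<^bsub>A\<^esub> = x"
  by (simp add: a_minus_def)

lemma mod_diff_eq_zero: "x \<in> carrier A \<Longrightarrow> y \<in> carrier A \<Longrightarrow> x \<ominus>\<^bsub>A\<^esub> y = \<zero>\<^bsub>A\<^esub> \<longleftrightarrow> x = y"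
  by (metis mod_diff_add M.l_zero mod_diff_self)

lemma mod_smult_diff: "r \<in> carrier R \<Longrightarrow> x \<in> carrier A \<Longrightarrow> y \<in> carrier A \<Longrightarrow> r \<odot>\<^bsub>A\<^esub> (x \<ominus>\<^bsub>A\<^esub> y) = (r \<odot>\<^bsub>A\<^esub> x) \<ominus>\<^bsub>A\<^esub> (r \<odot>\<^bsub>A\<^esub> y)"
  by (simp add: a_minus_def smult_r_distr smult_r_minus)

lemma mod_diff_smult: "r \<in> carrier R \<Longrightarrow> s \<in> carrier R \<Longrightarrow> x \<in> carrier A \<Longrightarrow> (r \<ominus> s) \<odot>\<^bsub>A\<^esub> x = (r \<odot>\<^bsub>A\<^esub> x) \<ominus>\<^bsub>A\<^esub> (s \<odot>\<^bsub>A\<^esub> x)"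
  by (simp add: a_minus_def smult_l_distr smult_l_minus)

lemma mod_diff_add_diff: "x \<in> carrier A \<Longrightarrow> y \<in> carrier A \<Longrightarrow> z \<in> carrier A \<Longrightarrow> w \<in> carrier A \<Longrightarrow>
  (x \<oplus>\<^bsub>A\<^esub> y) \<ominus>\<^bsub>A\<^esub> (z \<oplus>\<^bsub>A\<^esub> w) = (x \<ominus>\<^bsub>A\<^esub> z) \<oplus>\<^bsub>A\<^esub> (y \<ominus>\<^bsub>A\<^esub> w)"
  by (simp add: a_minus_def M.minus_add M.a_ac)

lemma mod_diff_diff: "x \<in> carrier A \<Longrightarrow> y \<in> carrier A \<Longrightarrow> x \<ominus>\<^bsub>A\<^esub> (x \<ominus>\<^bsub>A\<^esub> y) = y"
  by (metis M.a_comm M.minus_closed mod_diff_add mod_add_diff)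

lemma mod_diff_trans: "x \<in> carrier A \<Longrightarrow> y \<in> carrier A \<Longrightarrow> z \<in> carrier A \<Longrightarrow> (x \<ominus>\<^bsub>A\<^esub> y) \<oplus>\<^bsub>A\<^esub> (y \<ominus>\<^bsub>A\<^esub> z) = x \<ominus>\<^bsub>A\<^esub> z"
  by (metis M.minus_closed a_minus_def mod_diff_add M.a_assoc M.a_inv_closed)

lemma mod_smult_comm: "r \<in> carrier R \<Longrightarrow> s \<in> carrier R \<Longrightarrow> x \<in> carrier A \<Longrightarrow> r \<odot>\<^bsub>A\<^esub> (s \<odot>\<^bsub>A\<^esub> x) = s \<odot>\<^bsub>A\<^esub> (r \<odot>\<^bsub>A\<^esub> x)"
  by (metis smult_assoc1 R.m_comm)

end

context
  fixes R :: "('a,'r) ring_scheme" (structure) and A :: "('a,'b,'m) module_scheme" and B :: "('a,'c,'n) module_scheme"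
  assumes A: "Module.module R A" and B: "Module.module R B"
begin

interpretation A: module R A by (rule A)
interpretation B: module R B by (rule B)

lemma lin_zero: assumes S: "submodule S R A" and f: "lin R A S B (carrier B) f" shows "f \<zero>\<^bsub>A\<^esub> = \<zero>\<^bsub>B\<^esub>"
proof -
  have z: "\<zero>\<^bsub>A\<^esub> \<in> S" by (rule submod_zero[OF S])
  have "f \<zero>\<^bsub>A\<^esub> = f (\<zero> \<odot>\<^bsub>A\<^esub> \<zero>\<^bsub>A\<^esub>)" by simp
  also have "\<dots> = \<zero> \<odot>\<^bsub>B\<^esub> f \<zero>\<^bsub>A\<^esub>" by (rule lin_smult[OF f _ z]) simp
  also have "\<dots> = \<zero>\<^bsub>B\<^esub>" using lin_closed[OF f z] by simp
  finally show ?thesis .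
qed

lemma lin_neg: assumes S: "submodule S R A" and f: "lin R A S B (carrier B) f" and x: "x \<in> S" shows "f (\<ominus>\<^bsub>A\<^esub> x) = \<ominus>\<^bsub>B\<^esub> f x"
proof -
  have xA: "x \<in> carrier A" using x submod_subset[OF S] by blast
  have "f (\<ominus>\<^bsub>A\<^esub> x) = f ((\<ominus> \<one>) \<odot>\<^bsub>A\<^esub> x)" using xA by (simp add: A.smult_l_minus)
  also have "\<dots> = (\<ominus> \<one>) \<odot>\<^bsub>B\<^esub> f x" by (rule lin_smult[OF f _ x]) simp
  also have "\<dots> = \<ominus>\<^bsub>B\<^esub> f x" using lin_closed[OF f x] by (simp add: B.smult_l_minus)
  finally show ?thesis .
qed

lemma lin_sub: "submodule S R A \<Longrightarrow> lin R A S B (carrier B) f \<Longrightarrow> x \<in> S \<Longrightarrow> y \<in> S \<Longrightarrow> f (x \<ominus>\<^bsub>A\<^esub> y) = f x \<ominus>\<^bsub>B\<^esub> f y"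
  unfolding a_minus_def using lin_add[of R A S B "carrier B" f x "\<ominus>\<^bsub>A\<^esub> y"] lin_neg[of S f y] submod_neg[OF A, of S y] by simp

lemma lin_pointwise_add:
  assumes "S \<subseteq> carrier A" "submodule T R B" "lin R A S B T f" "lin R A S B T g" shows "lin R A S B T (\<lambda>x. f x \<oplus>\<^bsub>B\<^esub> g x)"
proof -
  have T: "T \<subseteq> carrier B" by (rule submod_subset) fact
  have c: "f x \<in> carrier B" "g x \<in> carrier B" if "x \<in> S" for x using lin_closed[OF assms(3) that] lin_closed[OF assms(4) that] T by auto
  show ?thesis
    apply (rule linI)
    subgoal for x using submod_add[OF assms(2) lin_closed[OF assms(3), of x] lin_closed[OF assms(4), of x]] by simp
    subgoal using c by (simp add: lin_add[OF assms(3)] lin_add[OF assms(4)] B.M.a_ac)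
    subgoal using c by (simp add: lin_smult[OF assms(3)] lin_smult[OF assms(4)] B.smult_r_distr)
    done
qed

lemma lin_pointwise_smult:
  assumes "S \<subseteq> carrier A" "submodule T R B" "lin R A S B T f" "c \<in> carrier R" shows "lin R A S B T (\<lambda>x. c \<odot>\<^bsub>B\<^esub> f x)"
proof -
  have T: "T \<subseteq> carrier B" by (rule submod_subset) fact
  have c: "f x \<in> carrier B" if "x \<in> S" for x using lin_closed[OF assms(3) that] T by auto
  show ?thesis
    apply (rule linI)
    subgoal for x using submod_smult[OF assms(2,4) lin_closed[OF assms(3), of x]] by simp
    subgoal using c assms(4) by (simp add: lin_add[OF assms(3)] B.smult_r_distr)
    subgoal using c assms(4) by (simp add: lin_smult[OF assms(3)] mod_smult_comm[OF B])
    done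
qed

lemma lin_pointwise_diff:
  assumes "S \<subseteq> carrier A" "submodule T R B" "lin R A S B T f" "lin R A S B T g" shows "lin R A S B T (\<lambda>x. f x \<ominus>\<^bsub>B\<^esub> g x)"
proof -
  have T: "T \<subseteq> carrier B" by (rule submod_subset) fact
  have c: "f x \<in> carrier B" "g x \<in> carrier B" if "x \<in> S" for x using lin_closed[OF assms(3) that] lin_closed[OF assms(4) that] T by auto
  show ?thesis
    apply (rule linI)
    subgoal for x using submod_diff[OF B assms(2) lin_closed[OF assms(3), of x] lin_closed[OF assms(4), of x]] by simp
    subgoal using c by (simp add: lin_add[OF assms(3)] lin_add[OF assms(4)] mod_diff_add_diff[OF B])
    subgoal using c by (simp add: lin_smult[OF assms(3)] lin_smult[OF assms(4)] mod_smult_diff[OF B])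
    done
qed

lemma lin_zero_map: "submodule T R B \<Longrightarrow> lin R A S B T (\<lambda>x. \<zero>\<^bsub>B\<^esub>)"
  by (rule linI) (auto intro: submod_zero)

lemma lin_image:
  assumes "submodule S R A" "lin R A S B (carrier B) f" shows "submodule (f ` S) R B"
  apply (rule submodI[OF B])
  subgoal using lin_closed[OF assms(2)] by auto
  subgoal using lin_zero[OF assms] submod_zero[OF assms(1)] by (metis imageI)
  subgoal by (auto simp: lin_add[OF assms(2), symmetric] intro!: imageI submod_add[OF assms(1)])
  subgoal by (auto simp: lin_smult[OF assms(2), symmetric] intro!: imageI submod_smult[OF assms(1)])
  done

lemma lin_preimage:
  assumes "submodule S R A" "lin R A S B (carrier B) f" "submodule T R B" shows "submodule {x\<in>S. f x \<in> T} R A"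
  apply (rule submodI[OF A])
  subgoal using submod_subset[OF assms(1)] by auto
  subgoal using lin_zero[OF assms(1,2)] submod_zero[OF assms(1)] submod_zero[OF assms(3)] by simp
  subgoal using assms by (auto simp: lin_add[OF assms(2)] intro: submod_add)
  subgoal using assms by (auto simp: lin_smult[OF assms(2)] intro: submod_smult)
  done

lemma lin_kernel:
  assumes "submodule S R A" "lin R A S B (carrier B) f" shows "submodule {x\<in>S. f x = \<zero>\<^bsub>B\<^esub>} R A"
  using lin_preimage[OF assms submod_zero_set[OF B]] by simp

end

lemma lin_comp: "lin R A S B T f \<Longrightarrow> lin R B T' C V g \<Longrightarrow> T \<subseteq> T' \<Longrightarrow> lin R A S C V (\<lambda>x. g (f x))"
  unfolding lin_def by (simp add: subset_iff)

lemma lin_mono: "lin R A S B T f \<Longrightarrow> S' \<subseteq> S \<Longrightarrow> T \<subseteq> T' \<Longrightarrow> lin R A S' B T' f"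
  unfolding lin_def by (simp add: subset_iff)

lemma lin_into: "lin R A S B T f \<Longrightarrow> (\<And>x. x \<in> S \<Longrightarrow> f x \<in> T') \<Longrightarrow> lin R A S B T' f"
  unfolding lin_def by blast

lemma lin_cong: "submodule S R A \<Longrightarrow> lin R A S B T f \<Longrightarrow> (\<And>x. x \<in> S \<Longrightarrow> g x = f x) \<Longrightarrow> lin R A S B T g"
  unfolding lin_def by (simp add: submod_add submod_smult)

lemma lin_smult_map: "Module.module R B \<Longrightarrow> submodule T R B \<Longrightarrow> c \<in> carrier R \<Longrightarrow> lin R B T B T (\<lambda>x. c \<odot>\<^bsub>B\<^esub> x)"
  by (rule linI) (auto intro: submod_smult module.smult_r_distr mod_smult_comm dest: submod_subset)

lemma lin_id: "lin R B T B T (\<lambda>x. x)"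
  by (rule linI) auto

definition Rmod :: "('a,'r) ring_scheme \<Rightarrow> ('a,'a) module" where
  "Rmod R = \<lparr>carrier = carrier R, monoid.mult = monoid.mult R, one = one R, ring.zero = ring.zero R,
     ring.add = ring.add R, module.smult = monoid.mult R\<rparr>"

lemma Rmod_simps [simp]: "carrier (Rmod R) = carrier R" "ring.zero (Rmod R) = ring.zero R" "ring.add (Rmod R) = ring.add R"
  "module.smult (Rmod R) = monoid.mult R" "a_inv (Rmod R) = a_inv R" "a_minus (Rmod R) = a_minus R"
  by (auto simp: Rmod_def a_inv_def a_minus_def m_inv_def fun_eq_iff)

lemma Rmod_module: assumes "cring R" shows "Module.module R (Rmod R)"
proof -
  interpret cring R by fact
  show ?thesis
    by (rule moduleI; (intro abelian_groupI)?; (simp add: is_cring m_assoc l_distr r_distr a_ac)?)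
qed

lemma ideal_submod: assumes "cring R" shows "ideal I R \<longleftrightarrow> submodule I R (Rmod R)"
proof
  interpret cring R by fact
  assume "ideal I R"
  then interpret I: ideal I R .
  show "submodule I R (Rmod R)"
    by (rule submodI[OF Rmod_module[OF assms]]) (use I.a_subset in \<open>auto intro: I.I_l_closed I.a_closed I.zero_closed\<close>)
next
  interpret cring R by fact
  assume I: "submodule I R (Rmod R)"
  show "ideal I R"
  proof (rule idealI)
    have "\<ominus>\<^bsub>R\<^esub> a \<in> I" if "a \<in> I" for a using submod_neg[OF Rmod_module[OF assms] I that] by simp
    moreover have "I \<subseteq> carrier R" "I \<noteq> {}" using submod_subset[OF I] submod_zero[OF I] by auto
    moreover have "a \<oplus>\<^bsub>R\<^esub> b \<in> I" if "a \<in> I" "b \<in> I" for a b using submod_add[OF I that] by simp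
    ultimately show "subgroup I (add_monoid R)"
      by (intro add.subgroupI) (simp_all add: a_inv_def m_inv_def)
  next
    show "\<And>a x. a \<in> I \<Longrightarrow> x \<in> carrier R \<Longrightarrow> x \<otimes>\<^bsub>R\<^esub> a \<in> I" using submod_smult[OF I] by simp
    show "\<And>a x. a \<in> I \<Longrightarrow> x \<in> carrier R \<Longrightarrow> a \<otimes>\<^bsub>R\<^esub> x \<in> I" using submod_smult[OF I] submod_subset[OF I] by (metis Rmod_simps(1,4) m_comm subsetD)
  qed (rule ring_axioms)
qed

subsection \<open>Linear relations\<close>

text \<open>Homomorphisms are built by extending partial ones, and a partial homomorphism is handled as its
  graph. Working with relations separates the two conditions: closure under the operations, and
  single-valuedness, which for a linear relation only has to be checked at zero (\<open>functional\<close>).\<close>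

definition linrel :: "('a,'r) ring_scheme \<Rightarrow> ('a,'b,'m) module_scheme \<Rightarrow> ('a,'c,'n) module_scheme \<Rightarrow> ('b \<times> 'c) set \<Rightarrow> bool" where
  "linrel R A B \<Gamma> \<longleftrightarrow> \<Gamma> \<subseteq> carrier A \<times> carrier B \<and> (\<zero>\<^bsub>A\<^esub>, \<zero>\<^bsub>B\<^esub>) \<in> \<Gamma> \<and>
     (\<forall>x y x' y'. (x,y) \<in> \<Gamma> \<longrightarrow> (x',y') \<in> \<Gamma> \<longrightarrow> (x \<oplus>\<^bsub>A\<^esub> x', y \<oplus>\<^bsub>B\<^esub> y') \<in> \<Gamma>) \<and>
     (\<forall>r\<in>carrier R. \<forall>x y. (x,y) \<in> \<Gamma> \<longrightarrow> (r \<odot>\<^bsub>A\<^esub> x, r \<odot>\<^bsub>B\<^esub> y) \<in> \<Gamma>)"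

lemma linrelD:
  assumes "linrel R A B \<Gamma>"
  shows linrel_sub: "(x,y) \<in> \<Gamma> \<Longrightarrow> x \<in> carrier A" "(x,y) \<in> \<Gamma> \<Longrightarrow> y \<in> carrier B"
    and linrel_zero: "(\<zero>\<^bsub>A\<^esub>, \<zero>\<^bsub>B\<^esub>) \<in> \<Gamma>"
    and linrel_add: "(x,y) \<in> \<Gamma> \<Longrightarrow> (x',y') \<in> \<Gamma> \<Longrightarrow> (x \<oplus>\<^bsub>A\<^esub> x', y \<oplus>\<^bsub>B\<^esub> y') \<in> \<Gamma>"
    and linrel_smult: "r \<in> carrier R \<Longrightarrow> (x,y) \<in> \<Gamma> \<Longrightarrow> (r \<odot>\<^bsub>A\<^esub> x, r \<odot>\<^bsub>B\<^esub> y) \<in> \<Gamma>"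
  using assms unfolding linrel_def by blast+

lemma linrel_domain:
  assumes A: "Module.module R A" and \<Gamma>: "linrel R A B \<Gamma>" shows "submodule (Domain \<Gamma>) R A"
  by (rule submodI[OF A]) (auto simp: Domain_iff intro: linrel_sub[OF \<Gamma>] linrel_zero[OF \<Gamma>] linrel_add[OF \<Gamma>] linrel_smult[OF \<Gamma>])

definition functional :: "('a,'b,'m) module_scheme \<Rightarrow> ('a,'c,'n) module_scheme \<Rightarrow> ('b \<times> 'c) set \<Rightarrow> bool" where
  "functional A B \<Gamma> \<longleftrightarrow> (\<forall>y. (\<zero>\<^bsub>A\<^esub>, y) \<in> \<Gamma> \<longrightarrow> y = \<zero>\<^bsub>B\<^esub>)"

context
  fixes R :: "('a,'r) ring_scheme" (structure) and A :: "('a,'b,'m) module_scheme" and B :: "('a,'c,'n) module_scheme"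
  assumes A: "Module.module R A" and B: "Module.module R B"
begin

interpretation A: module R A by (rule A)
interpretation B: module R B by (rule B)

lemma linrel_neg: assumes "linrel R A B \<Gamma>" "(x,y) \<in> \<Gamma>" shows "(\<ominus>\<^bsub>A\<^esub> x, \<ominus>\<^bsub>B\<^esub> y) \<in> \<Gamma>"
proof -
  have "x \<in> carrier A" "y \<in> carrier B" using assms linrel_sub by metis+
  then have "\<ominus>\<^bsub>A\<^esub> x = (\<ominus> \<one>) \<odot>\<^bsub>A\<^esub> x" "\<ominus>\<^bsub>B\<^esub> y = (\<ominus> \<one>) \<odot>\<^bsub>B\<^esub> y"
    by (simp_all add: A.smult_l_minus B.smult_l_minus)
  then show ?thesis using linrel_smult[OF assms(1) _ assms(2)] by simp
qed

lemma linrel_diff: "linrel R A B \<Gamma> \<Longrightarrow> (x,y) \<in> \<Gamma> \<Longrightarrow> (x',y') \<in> \<Gamma> \<Longrightarrow> (x \<ominus>\<^bsub>A\<^esub> x', y \<ominus>\<^bsub>B\<^esub> y') \<in> \<Gamma>"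
  unfolding a_minus_def using linrel_add linrel_neg by metis

lemma functional_unique:
  assumes "linrel R A B \<Gamma>" "functional A B \<Gamma>" "(x,y) \<in> \<Gamma>" "(x,y') \<in> \<Gamma>" shows "y = y'"
proof -
  have c: "x \<in> carrier A" "y \<in> carrier B" "y' \<in> carrier B" using assms linrel_sub by metis+
  have "(x \<ominus>\<^bsub>A\<^esub> x, y \<ominus>\<^bsub>B\<^esub> y') \<in> \<Gamma>" by (rule linrel_diff) (use assms in auto)
  then have "y \<ominus>\<^bsub>B\<^esub> y' = \<zero>\<^bsub>B\<^esub>" using assms(2) c by (simp add: functional_def mod_diff_self[OF A])
  then show ?thesis using c mod_diff_eq_zero[OF B] by simp
qed

text \<open>Sending \<open>t\<close> to \<open>y\<close> is consistent as soon as it agrees with \<open>\<Gamma>\<close> on the multiples of \<open>t\<close> that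
  already lie in its domain.\<close>

lemma linrel_extend_one:
  assumes \<Gamma>: "linrel R A B \<Gamma>" and f: "functional A B \<Gamma>" and t: "t \<in> carrier A" and y: "y \<in> carrier B"
    and step: "\<And>r z. r \<in> carrier R \<Longrightarrow> (r \<odot>\<^bsub>A\<^esub> t, z) \<in> \<Gamma> \<Longrightarrow> z = r \<odot>\<^bsub>B\<^esub> y"
  defines "\<Gamma>' \<equiv> {(x \<oplus>\<^bsub>A\<^esub> r \<odot>\<^bsub>A\<^esub> t, z \<oplus>\<^bsub>B\<^esub> r \<odot>\<^bsub>B\<^esub> y) |x z r. (x,z) \<in> \<Gamma> \<and> r \<in> carrier R}"
  shows "linrel R A B \<Gamma>'" "functional A B \<Gamma>'" "\<Gamma> \<subseteq> \<Gamma>'" "(t,y) \<in> \<Gamma>'"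
proof -
  note sub = linrel_sub[OF \<Gamma>]
  have mem: "(x \<oplus>\<^bsub>A\<^esub> r \<odot>\<^bsub>A\<^esub> t, z \<oplus>\<^bsub>B\<^esub> r \<odot>\<^bsub>B\<^esub> y) \<in> \<Gamma>'" if "(x,z) \<in> \<Gamma>" "r \<in> carrier R" for x z r
    using that unfolding \<Gamma>'_def by blast
  show sub': "\<Gamma> \<subseteq> \<Gamma>'"
  proof
    fix p assume p: "p \<in> \<Gamma>"
    obtain x z where xz: "p = (x,z)" by fastforce
    have "p = (x \<oplus>\<^bsub>A\<^esub> \<zero> \<odot>\<^bsub>A\<^esub> t, z \<oplus>\<^bsub>B\<^esub> \<zero> \<odot>\<^bsub>B\<^esub> y)" using sub[of x z] p xz t y by simp
    then show "p \<in> \<Gamma>'" using mem[of x z "\<zero>"] p xz by simp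
  qed
  show "(t,y) \<in> \<Gamma>'" using mem[OF linrel_zero[OF \<Gamma>], of "\<one>"] t y by simp
  show "linrel R A B \<Gamma>'"
    unfolding linrel_def
  proof (intro conjI allI impI ballI)
    show "\<Gamma>' \<subseteq> carrier A \<times> carrier B" unfolding \<Gamma>'_def using sub t y by auto
    show "(\<zero>\<^bsub>A\<^esub>, \<zero>\<^bsub>B\<^esub>) \<in> \<Gamma>'" using sub' linrel_zero[OF \<Gamma>] by blast
  next
    fix u v u' v' assume "(u,v) \<in> \<Gamma>'" "(u',v') \<in> \<Gamma>'"
    then obtain x z r x' z' r' where *: "(x,z) \<in> \<Gamma>" "r \<in> carrier R" "(x',z') \<in> \<Gamma>" "r' \<in> carrier R"
      "u = x \<oplus>\<^bsub>A\<^esub> r \<odot>\<^bsub>A\<^esub> t" "v = z \<oplus>\<^bsub>B\<^esub> r \<odot>\<^bsub>B\<^esub> y" "u' = x' \<oplus>\<^bsub>A\<^esub> r' \<odot>\<^bsub>A\<^esub> t" "v' = z' \<oplus>\<^bsub>B\<^esub> r' \<odot>\<^bsub>B\<^esub> y"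
      unfolding \<Gamma>'_def by blast
    note c = sub[OF *(1)] sub[OF *(3)]
    have "u \<oplus>\<^bsub>A\<^esub> u' = (x \<oplus>\<^bsub>A\<^esub> x') \<oplus>\<^bsub>A\<^esub> (r \<oplus> r') \<odot>\<^bsub>A\<^esub> t" "v \<oplus>\<^bsub>B\<^esub> v' = (z \<oplus>\<^bsub>B\<^esub> z') \<oplus>\<^bsub>B\<^esub> (r \<oplus> r') \<odot>\<^bsub>B\<^esub> y"
      using c * t y by (simp_all add: A.smult_l_distr B.smult_l_distr A.M.a_ac B.M.a_ac)
    then show "(u \<oplus>\<^bsub>A\<^esub> u', v \<oplus>\<^bsub>B\<^esub> v') \<in> \<Gamma>'" using mem[OF linrel_add[OF \<Gamma> *(1,3)], of "r \<oplus> r'"] * by simp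
  next
    fix s u v assume s: "s \<in> carrier R" and "(u,v) \<in> \<Gamma>'"
    then obtain x z r where *: "(x,z) \<in> \<Gamma>" "r \<in> carrier R" "u = x \<oplus>\<^bsub>A\<^esub> r \<odot>\<^bsub>A\<^esub> t" "v = z \<oplus>\<^bsub>B\<^esub> r \<odot>\<^bsub>B\<^esub> y"
      unfolding \<Gamma>'_def by blast
    have "s \<odot>\<^bsub>A\<^esub> u = (s \<odot>\<^bsub>A\<^esub> x) \<oplus>\<^bsub>A\<^esub> (s \<otimes> r) \<odot>\<^bsub>A\<^esub> t" "s \<odot>\<^bsub>B\<^esub> v = (s \<odot>\<^bsub>B\<^esub> z) \<oplus>\<^bsub>B\<^esub> (s \<otimes> r) \<odot>\<^bsub>B\<^esub> y"
      using sub[OF *(1)] * s t y by (simp_all add: A.smult_r_distr B.smult_r_distr A.smult_assoc1 B.smult_assoc1)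
    then show "(s \<odot>\<^bsub>A\<^esub> u, s \<odot>\<^bsub>B\<^esub> v) \<in> \<Gamma>'" using mem[OF linrel_smult[OF \<Gamma> s *(1)], of "s \<otimes> r"] * s by simp
  qed
  show "functional A B \<Gamma>'"
    unfolding functional_def
  proof (intro allI impI)
    fix v assume "(\<zero>\<^bsub>A\<^esub>, v) \<in> \<Gamma>'"
    then obtain x z r where *: "(x,z) \<in> \<Gamma>" "r \<in> carrier R" "\<zero>\<^bsub>A\<^esub> = x \<oplus>\<^bsub>A\<^esub> r \<odot>\<^bsub>A\<^esub> t" "v = z \<oplus>\<^bsub>B\<^esub> r \<odot>\<^bsub>B\<^esub> y"
      unfolding \<Gamma>'_def by blast
    note c = sub[OF *(1)]
    have "\<ominus>\<^bsub>A\<^esub> x = r \<odot>\<^bsub>A\<^esub> t" using * c t by (metis A.M.minus_equality A.M.a_comm A.smult_closed)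
    then have "\<ominus>\<^bsub>B\<^esub> z = r \<odot>\<^bsub>B\<^esub> y" using linrel_neg[OF \<Gamma> *(1)] step[OF *(2)] by simp
    then show "v = \<zero>\<^bsub>B\<^esub>" using * c y by (metis B.M.r_neg)
  qed
qed

text \<open>Zorn's lemma with a side condition: besides extending \<open>\<Gamma>0\<close>, the map is kept inside a linear
  relation \<open>C\<close>. The relation expresses requirements on the values such as \<open>d (f x) = x\<close> or
  \<open>d (f x) = 0\<close>. It is enough to be able to add one element at a time.\<close>

lemma linrel_extend:
  assumes \<Gamma>0: "linrel R A B \<Gamma>0" "functional A B \<Gamma>0" "\<Gamma>0 \<subseteq> C" and C: "linrel R A B C"
    and step: "\<And>\<Gamma>. linrel R A B \<Gamma> \<Longrightarrow> functional A B \<Gamma> \<Longrightarrow> \<Gamma>0 \<subseteq> \<Gamma> \<Longrightarrow> \<Gamma> \<subseteq> C \<Longrightarrow> Domain \<Gamma> \<noteq> carrier A \<Longrightarrow>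
      \<exists>t y. t \<in> carrier A \<and> t \<notin> Domain \<Gamma> \<and> (t,y) \<in> C \<and> (\<forall>r\<in>carrier R. \<forall>z. (r \<odot>\<^bsub>A\<^esub> t, z) \<in> \<Gamma> \<longrightarrow> z = r \<odot>\<^bsub>B\<^esub> y)"
  obtains f where "lin_map R A B f" "\<And>x y. (x,y) \<in> \<Gamma>0 \<Longrightarrow> f x = y" "\<And>x. x \<in> carrier A \<Longrightarrow> (x, f x) \<in> C"
proof -
  define Q where "Q = {\<Gamma>. linrel R A B \<Gamma> \<and> functional A B \<Gamma> \<and> \<Gamma>0 \<subseteq> \<Gamma> \<and> \<Gamma> \<subseteq> C}"
  have "\<exists>M\<in>Q. \<forall>W\<in>Q. M \<subseteq> W \<longrightarrow> W = M"
  proof (rule subset_Zorn_nonempty)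
    show "Q \<noteq> {}" using \<Gamma>0 unfolding Q_def by blast
  next
    fix K assume K: "K \<noteq> {}" "subset.chain Q K"
    then have KQ: "\<And>\<Gamma>. \<Gamma> \<in> K \<Longrightarrow> \<Gamma> \<in> Q" unfolding subset.chain_def by blast
    have KQl: "\<And>\<Gamma>. \<Gamma> \<in> K \<Longrightarrow> linrel R A B \<Gamma>" using KQ unfolding Q_def by blast
    have tot: "\<And>\<Gamma> \<Gamma>'. \<Gamma> \<in> K \<Longrightarrow> \<Gamma>' \<in> K \<Longrightarrow> \<Gamma> \<subseteq> \<Gamma>' \<or> \<Gamma>' \<subseteq> \<Gamma>" using K(2) unfolding subset.chain_def by blast
    obtain \<Gamma>1 where \<Gamma>1: "\<Gamma>1 \<in> K" using K by blast
    have "linrel R A B (\<Union>K)"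
      unfolding linrel_def
    proof (intro conjI allI impI ballI)
      show "\<Union>K \<subseteq> carrier A \<times> carrier B" using linrel_sub[OF KQl] by (auto simp: subset_iff)
      show "(\<zero>\<^bsub>A\<^esub>, \<zero>\<^bsub>B\<^esub>) \<in> \<Union>K" using \<Gamma>1 linrel_zero[OF KQl[OF \<Gamma>1]] by blast
    next
      fix x y x' y' assume "(x,y) \<in> \<Union>K" "(x',y') \<in> \<Union>K"
      then obtain \<Gamma> \<Gamma>' where "\<Gamma> \<in> K" "\<Gamma>' \<in> K" "(x,y) \<in> \<Gamma>" "(x',y') \<in> \<Gamma>'" by blast
      then obtain \<Gamma>'' where "\<Gamma>'' \<in> K" "(x,y) \<in> \<Gamma>''" "(x',y') \<in> \<Gamma>''" using tot by blast
      then show "(x \<oplus>\<^bsub>A\<^esub> x', y \<oplus>\<^bsub>B\<^esub> y') \<in> \<Union>K" using linrel_add[OF KQl] by blast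
    next
      fix r x y assume "r \<in> carrier R" "(x,y) \<in> \<Union>K"
      then show "(r \<odot>\<^bsub>A\<^esub> x, r \<odot>\<^bsub>B\<^esub> y) \<in> \<Union>K" using linrel_smult[OF KQl] by blast
    qed
    moreover have "functional A B (\<Union>K)" using KQ unfolding Q_def functional_def by blast
    ultimately show "\<Union>K \<in> Q" using KQ \<Gamma>1 unfolding Q_def by blast
  qed
  then obtain \<Gamma> where \<Gamma>: "\<Gamma> \<in> Q" and max: "\<And>W. W \<in> Q \<Longrightarrow> \<Gamma> \<subseteq> W \<Longrightarrow> W = \<Gamma>" by blast
  have l: "linrel R A B \<Gamma>" "functional A B \<Gamma>" "\<Gamma>0 \<subseteq> \<Gamma>" "\<Gamma> \<subseteq> C" using \<Gamma> unfolding Q_def by auto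
  have dom: "Domain \<Gamma> = carrier A"
  proof (rule ccontr)
    assume "Domain \<Gamma> \<noteq> carrier A"
    then obtain t y where t: "t \<in> carrier A" "t \<notin> Domain \<Gamma>" "(t,y) \<in> C"
      and s: "\<And>r z. r \<in> carrier R \<Longrightarrow> (r \<odot>\<^bsub>A\<^esub> t, z) \<in> \<Gamma> \<Longrightarrow> z = r \<odot>\<^bsub>B\<^esub> y" using step[OF l] by blast
    have y: "y \<in> carrier B" using t C linrel_sub by metis
    define \<Gamma>' where "\<Gamma>' = {(x \<oplus>\<^bsub>A\<^esub> r \<odot>\<^bsub>A\<^esub> t, z \<oplus>\<^bsub>B\<^esub> r \<odot>\<^bsub>B\<^esub> y) |x z r. (x,z) \<in> \<Gamma> \<and> r \<in> carrier R}"
    note e = linrel_extend_one[OF l(1,2) t(1) y s, folded \<Gamma>'_def]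
    have "\<Gamma>' \<subseteq> C"
    proof
      fix p assume "p \<in> \<Gamma>'"
      then obtain x z r where p: "p = (x \<oplus>\<^bsub>A\<^esub> r \<odot>\<^bsub>A\<^esub> t, z \<oplus>\<^bsub>B\<^esub> r \<odot>\<^bsub>B\<^esub> y)" "(x,z) \<in> \<Gamma>" "r \<in> carrier R" unfolding \<Gamma>'_def by blast
      show "p \<in> C" unfolding p(1) by (intro linrel_add[OF C] linrel_smult[OF C p(3) t(3)] subsetD[OF l(4) p(2)])
    qed
    then have "\<Gamma>' \<in> Q" using e l unfolding Q_def by blast
    then have "\<Gamma>' = \<Gamma>" using max e by blast
    then show False using e(4) t(2) by blast
  qed
  define f where "f x = (THE y. (x,y) \<in> \<Gamma>)" for x
  have fI: "f x = y" if "(x,y) \<in> \<Gamma>" for x y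
    unfolding f_def
  proof (rule the_equality)
    show "(x,y) \<in> \<Gamma>" by (rule that)
    fix z assume z: "(x,z) \<in> \<Gamma>"
    show "z = y" by (rule functional_unique[OF l(1,2) z that])
  qed
  have fx: "(x, f x) \<in> \<Gamma>" if xA: "x \<in> carrier A" for x
  proof -
    obtain y where "(x,y) \<in> \<Gamma>" using xA dom by blast
    then show ?thesis using fI[of x y] by simp
  qed
  show thesis
  proof (rule that[of f])
    show "lin_map R A B f"
    proof (rule linI)
      show "\<And>x. x \<in> carrier A \<Longrightarrow> f x \<in> carrier B" using fx linrel_sub[OF l(1)] by blast
      show "\<And>x y. x \<in> carrier A \<Longrightarrow> y \<in> carrier A \<Longrightarrow> f (x \<oplus>\<^bsub>A\<^esub> y) = f x \<oplus>\<^bsub>B\<^esub> f y"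
        by (intro fI linrel_add[OF l(1)] fx)
      show "\<And>r x. r \<in> carrier R \<Longrightarrow> x \<in> carrier A \<Longrightarrow> f (r \<odot>\<^bsub>A\<^esub> x) = r \<odot>\<^bsub>B\<^esub> f x"
        by (intro fI linrel_smult[OF l(1)] fx)
    qed
    show "\<And>x y. (x,y) \<in> \<Gamma>0 \<Longrightarrow> f x = y" using fI l by blast
    show "\<And>x. x \<in> carrier A \<Longrightarrow> (x, f x) \<in> C" using fx l by blast
  qed
qed

lemma linrel_full: "linrel R A B (carrier A \<times> carrier B)"
  unfolding linrel_def by auto

end

lemma linrel_lin_pair:
  assumes A: "Module.module R A" and B: "Module.module R B" and p: "lin R W S A (carrier A) p" and q: "lin R W S B (carrier B) q" and W: "Module.module R W" and S: "submodule S R W"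
  shows "linrel R A B ((\<lambda>x. (p x, q x)) ` S)"
  unfolding linrel_def
proof (intro conjI allI impI ballI)
  show "(\<lambda>x. (p x, q x)) ` S \<subseteq> carrier A \<times> carrier B" by (auto intro: lin_closed[OF p] lin_closed[OF q])
  have "p \<zero>\<^bsub>W\<^esub> = \<zero>\<^bsub>A\<^esub>" "q \<zero>\<^bsub>W\<^esub> = \<zero>\<^bsub>B\<^esub>" by (rule lin_zero[OF W A S p], rule lin_zero[OF W B S q])
  then show "(\<zero>\<^bsub>A\<^esub>, \<zero>\<^bsub>B\<^esub>) \<in> (\<lambda>x. (p x, q x)) ` S" using submod_zero[OF S] by (intro image_eqI[of _ _ "\<zero>\<^bsub>W\<^esub>"]) simp_all
next
  fix x y x' y' assume "(x,y) \<in> (\<lambda>x. (p x, q x)) ` S" "(x',y') \<in> (\<lambda>x. (p x, q x)) ` S"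
  then obtain s s' where "s \<in> S" "s' \<in> S" "x = p s" "y = q s" "x' = p s'" "y' = q s'" by blast
  then show "(x \<oplus>\<^bsub>A\<^esub> x', y \<oplus>\<^bsub>B\<^esub> y') \<in> (\<lambda>x. (p x, q x)) ` S"
    using lin_add[OF p, of s s'] lin_add[OF q, of s s'] submod_add[OF S, of s s'] by (intro image_eqI[of _ _ "s \<oplus>\<^bsub>W\<^esub> s'"]) auto
next
  fix r x y assume r: "r \<in> carrier R" "(x,y) \<in> (\<lambda>x. (p x, q x)) ` S"
  then obtain s where "s \<in> S" "x = p s" "y = q s" by blast
  then show "(r \<odot>\<^bsub>A\<^esub> x, r \<odot>\<^bsub>B\<^esub> y) \<in> (\<lambda>x. (p x, q x)) ` S" using r
    lin_smult[OF p, of r s] lin_smult[OF q, of r s] submod_smult[OF S, of r s] by (intro image_eqI[of _ _ "r \<odot>\<^bsub>W\<^esub> s"]) auto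
qed

section \<open>Injective modules\<close>

text \<open>Baer's criterion, taken as the definition of injectivity: it does not quantify over types of test
  modules.\<close>

definition baer :: "('a,'r) ring_scheme \<Rightarrow> ('a,'e,'m) module_scheme \<Rightarrow> bool" where
  "baer R E \<longleftrightarrow> Module.module R E \<and>
     (\<forall>\<Gamma>. linrel R (Rmod R) E \<Gamma> \<longrightarrow> functional (Rmod R) E \<Gamma> \<longrightarrow> (\<exists>e\<in>carrier E. \<forall>(r,y)\<in>\<Gamma>. y = r \<odot>\<^bsub>E\<^esub> e))"

lemma baer_module: "baer R E \<Longrightarrow> Module.module R E" unfolding baer_def by blast

lemma baerI:
  assumes R: "cring R" and E: "Module.module R E"
    and ext: "\<And>\<aa> \<phi>. ideal \<aa> R \<Longrightarrow> lin R (Rmod R) \<aa> E (carrier E) \<phi> \<Longrightarrow> \<exists>e\<in>carrier E. \<forall>r\<in>\<aa>. \<phi> r = r \<odot>\<^bsub>E\<^esub> e"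
  shows "baer R E"
  unfolding baer_def
proof (intro conjI allI impI)
  show "Module.module R E" by (rule E)
  fix \<Gamma> assume \<Gamma>: "linrel R (Rmod R) E \<Gamma>" and f: "functional (Rmod R) E \<Gamma>"
  note MR = Rmod_module[OF R]
  define \<phi> where "\<phi> r = (THE y. (r,y) \<in> \<Gamma>)" for r
  have \<phi>: "\<phi> r = y" if xy: "(r,y) \<in> \<Gamma>" for r y
    unfolding \<phi>_def
  proof (rule the_equality)
    show "(r, y) \<in> \<Gamma>" by (rule xy)
    show "z = y" if z: "(r, z) \<in> \<Gamma>" for z by (rule functional_unique[OF MR E \<Gamma> f z xy])
  qed
  have "ideal (Domain \<Gamma>) R"
    unfolding ideal_submod[OF R] by (rule linrel_domain[OF MR \<Gamma>])
  moreover have "lin R (Rmod R) (Domain \<Gamma>) E (carrier E) \<phi>"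
  proof (rule linI)
    show "\<phi> x \<in> carrier E" if "x \<in> Domain \<Gamma>" for x using that \<phi> linrel_sub(2)[OF \<Gamma>] by (auto simp: Domain_iff)
    show "\<phi> (x \<oplus>\<^bsub>Rmod R\<^esub> y) = \<phi> x \<oplus>\<^bsub>E\<^esub> \<phi> y" if "x \<in> Domain \<Gamma>" "y \<in> Domain \<Gamma>" for x y
      using that \<phi> \<phi>[OF linrel_add[OF \<Gamma>]] by (auto simp: Domain_iff)
    show "\<phi> (r \<odot>\<^bsub>Rmod R\<^esub> x) = r \<odot>\<^bsub>E\<^esub> \<phi> x" if "r \<in> carrier R" "x \<in> Domain \<Gamma>" for r x
      using that \<phi> \<phi>[OF linrel_smult[OF \<Gamma>]] by (auto simp: Domain_iff)
  qed
  ultimately obtain e where e: "e \<in> carrier E" "\<forall>r\<in>Domain \<Gamma>. \<phi> r = r \<odot>\<^bsub>E\<^esub> e" using ext by blast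
  have "y = r \<odot>\<^bsub>E\<^esub> e" if "(r,y) \<in> \<Gamma>" for r y using e(2) \<phi>[OF that] DomainI[OF that] by simp
  then show "\<exists>e\<in>carrier E. \<forall>(r,y)\<in>\<Gamma>. y = r \<odot>\<^bsub>E\<^esub> e" using e(1) by auto
qed

lemma baer_extend:
  assumes A: "Module.module R A" and E: "baer R E" and \<Gamma>0: "linrel R A E \<Gamma>0" "functional A E \<Gamma>0"
  obtains f where "lin_map R A E f" "\<And>x y. (x,y) \<in> \<Gamma>0 \<Longrightarrow> f x = y"
proof -
  note ME = baer_module[OF E]
  interpret A: module R A by (rule A)
  interpret E: module R E by (rule ME)
  show thesis
  proof (rule linrel_extend[OF A ME \<Gamma>0 _ linrel_full[OF A ME]])
    show "\<Gamma>0 \<subseteq> carrier A \<times> carrier E" using \<Gamma>0(1) unfolding linrel_def by blast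
  next
    fix \<Gamma> assume \<Gamma>: "linrel R A E \<Gamma>" "functional A E \<Gamma>" "\<Gamma> \<subseteq> carrier A \<times> carrier E" "Domain \<Gamma> \<noteq> carrier A"
    then obtain t where t: "t \<in> carrier A" "t \<notin> Domain \<Gamma>" by blast
    define \<Delta> where "\<Delta> = {(r,z). r \<in> carrier R \<and> (r \<odot>\<^bsub>A\<^esub> t, z) \<in> \<Gamma>}"
    have "linrel R (Rmod R) E \<Delta>"
      unfolding linrel_def
    proof (intro conjI allI impI ballI)
      show "\<Delta> \<subseteq> carrier (Rmod R) \<times> carrier E" unfolding \<Delta>_def using linrel_sub[OF \<Gamma>(1)] by auto
      show "(\<zero>\<^bsub>Rmod R\<^esub>, \<zero>\<^bsub>E\<^esub>) \<in> \<Delta>" unfolding \<Delta>_def using linrel_zero[OF \<Gamma>(1)] t by auto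
      fix x y x' y' assume "(x,y) \<in> \<Delta>" "(x',y') \<in> \<Delta>"
      then show "(x \<oplus>\<^bsub>Rmod R\<^esub> x', y \<oplus>\<^bsub>E\<^esub> y') \<in> \<Delta>" unfolding \<Delta>_def using linrel_add[OF \<Gamma>(1)] t by (auto simp: A.smult_l_distr)
    next
      fix r x y assume "r \<in> carrier R" "(x,y) \<in> \<Delta>"
      then show "(r \<odot>\<^bsub>Rmod R\<^esub> x, r \<odot>\<^bsub>E\<^esub> y) \<in> \<Delta>" unfolding \<Delta>_def using linrel_smult[OF \<Gamma>(1)] t by (auto simp: A.smult_assoc1)
    qed
    moreover have "functional (Rmod R) E \<Delta>" unfolding functional_def \<Delta>_def using \<Gamma>(2) t unfolding functional_def by auto
    ultimately obtain y where "y \<in> carrier E" "\<forall>(r,z)\<in>\<Delta>. z = r \<odot>\<^bsub>E\<^esub> y" using E unfolding baer_def by blast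
    then show "\<exists>t y. t \<in> carrier A \<and> t \<notin> Domain \<Gamma> \<and> (t,y) \<in> carrier A \<times> carrier E \<and> (\<forall>r\<in>carrier R. \<forall>z. (r \<odot>\<^bsub>A\<^esub> t, z) \<in> \<Gamma> \<longrightarrow> z = r \<odot>\<^bsub>E\<^esub> y)"
      using t unfolding \<Delta>_def by blast
  qed (use that in blast)
qed

text \<open>The form in which injectivity is mostly used: \<open>q\<close> factors through \<open>p\<close> if it kills the kernel
  of \<open>p\<close>.\<close>

lemma baer_factor:
  assumes W: "Module.module R W" "submodule S R W" and A: "Module.module R A" and E: "baer R E"
    and p: "lin R W S A (carrier A) p" and q: "lin R W S E (carrier E) q"
    and ker: "\<And>x. x \<in> S \<Longrightarrow> p x = \<zero>\<^bsub>A\<^esub> \<Longrightarrow> q x = \<zero>\<^bsub>E\<^esub>"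
  obtains f where "lin_map R A E f" "\<And>x. x \<in> S \<Longrightarrow> f (p x) = q x"
proof -
  have "linrel R A E ((\<lambda>x. (p x, q x)) ` S)" by (rule linrel_lin_pair[OF A baer_module[OF E] p q W])
  moreover have "functional A E ((\<lambda>x. (p x, q x)) ` S)" unfolding functional_def using ker by auto
  ultimately obtain f where "lin_map R A E f" "\<And>x y. (x,y) \<in> (\<lambda>x. (p x, q x)) ` S \<Longrightarrow> f x = y"
    using baer_extend[OF A E] by blast
  then show thesis using that[of f] by blast
qed

lemma baer_restrict:
  assumes A: "Module.module R A" "submodule S R A" and E: "baer R E" and q: "lin R A S E (carrier E) q"
  obtains f where "lin_map R A E f" "\<And>x. x \<in> S \<Longrightarrow> f x = q x"
proof (rule baer_factor[OF A A(1) E _ q, where p="\<lambda>x. x"])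
  show "lin R A S A (carrier A) (\<lambda>x. x)" using lin_mono[OF lin_id _ submod_subset[OF A(2)]] by blast
  show "\<And>x. x \<in> S \<Longrightarrow> x = \<zero>\<^bsub>A\<^esub> \<Longrightarrow> q x = \<zero>\<^bsub>E\<^esub>" using lin_zero[OF A(1) baer_module[OF E] A(2) q] by simp
qed (use A that in auto)

lemma baer_ideal:
  assumes R: "cring R" and E: "baer R E" and I: "ideal I R" and q: "lin R (Rmod R) I E (carrier E) q"
  obtains e where "e \<in> carrier E" "\<And>r. r \<in> I \<Longrightarrow> q r = r \<odot>\<^bsub>E\<^esub> e"
proof -
  interpret cring R by fact
  obtain f where f: "lin_map R (Rmod R) E f" "\<And>x. x \<in> I \<Longrightarrow> f x = q x"
    using baer_restrict[OF Rmod_module[OF R] _ E q] I ideal_submod[OF R] by blast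
  show thesis
  proof (rule that[of "f \<one>\<^bsub>R\<^esub>"])
    show "f \<one>\<^bsub>R\<^esub> \<in> carrier E" using lin_closed[OF f(1)] by simp
    fix r assume r: "r \<in> I"
    then have "r \<in> carrier R" using ideal.Icarr[OF I] by blast
    then show "q r = r \<odot>\<^bsub>E\<^esub> f \<one>\<^bsub>R\<^esub>" using lin_smult[OF f(1), of r "\<one>\<^bsub>R\<^esub>"] f(2)[OF r] by simp
  qed
qed

text \<open>Divisibility inside the part killed by an ideal: \<open>e = x e'\<close> can be solved with \<open>\<aa> e' = 0\<close> exactly
  if \<open>e\<close> is killed by \<open>(\<aa> : x)\<close>, since then \<open>r x + a \<mapsto> r e\<close> is well defined on \<open>R x + \<aa>\<close>.\<close>

lemma baer_solve:
  assumes R: "cring R" and E: "baer R E" and \<aa>: "ideal \<aa> R" and x: "x \<in> carrier R" and e: "e \<in> carrier E"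
    and k: "\<And>r. r \<in> carrier R \<Longrightarrow> r \<otimes>\<^bsub>R\<^esub> x \<in> \<aa> \<Longrightarrow> r \<odot>\<^bsub>E\<^esub> e = \<zero>\<^bsub>E\<^esub>"
  obtains e' where "e' \<in> carrier E" "x \<odot>\<^bsub>E\<^esub> e' = e" "\<And>a. a \<in> \<aa> \<Longrightarrow> a \<odot>\<^bsub>E\<^esub> e' = \<zero>\<^bsub>E\<^esub>"
proof -
  interpret cring R by fact
  interpret E: module R E by (rule baer_module[OF E])
  interpret I: ideal \<aa> R by fact
  define \<Gamma> where "\<Gamma> = {(r \<otimes>\<^bsub>R\<^esub> x \<oplus>\<^bsub>R\<^esub> a, r \<odot>\<^bsub>E\<^esub> e) | r a. r \<in> carrier R \<and> a \<in> \<aa>}"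
  have mem: "(r \<otimes>\<^bsub>R\<^esub> x \<oplus>\<^bsub>R\<^esub> a, r \<odot>\<^bsub>E\<^esub> e) \<in> \<Gamma>" if "r \<in> carrier R" "a \<in> \<aa>" for r a using that unfolding \<Gamma>_def by blast
  have "linrel R (Rmod R) E \<Gamma>"
    unfolding linrel_def
  proof (intro conjI allI impI ballI)
    show "\<Gamma> \<subseteq> carrier (Rmod R) \<times> carrier E" unfolding \<Gamma>_def using x e I.Icarr by auto
    show "(\<zero>\<^bsub>Rmod R\<^esub>, \<zero>\<^bsub>E\<^esub>) \<in> \<Gamma>" using mem[of "\<zero>\<^bsub>R\<^esub>" "\<zero>\<^bsub>R\<^esub>"] x e I.zero_closed by simp
    fix u v u' v' assume "(u,v) \<in> \<Gamma>" "(u',v') \<in> \<Gamma>"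
    then obtain r a r' a' where *: "r \<in> carrier R" "a \<in> \<aa>" "r' \<in> carrier R" "a' \<in> \<aa>"
      "u = r \<otimes>\<^bsub>R\<^esub> x \<oplus>\<^bsub>R\<^esub> a" "v = r \<odot>\<^bsub>E\<^esub> e" "u' = r' \<otimes>\<^bsub>R\<^esub> x \<oplus>\<^bsub>R\<^esub> a'" "v' = r' \<odot>\<^bsub>E\<^esub> e" unfolding \<Gamma>_def by blast
    have "a \<in> carrier R" "a' \<in> carrier R" using * I.Icarr by auto
    then have "u \<oplus>\<^bsub>R\<^esub> u' = (r \<oplus>\<^bsub>R\<^esub> r') \<otimes>\<^bsub>R\<^esub> x \<oplus>\<^bsub>R\<^esub> (a \<oplus>\<^bsub>R\<^esub> a')" "v \<oplus>\<^bsub>E\<^esub> v' = (r \<oplus>\<^bsub>R\<^esub> r') \<odot>\<^bsub>E\<^esub> e"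
      using * x e by (simp_all add: l_distr a_ac E.smult_l_distr E.M.a_ac)
    then show "(u \<oplus>\<^bsub>Rmod R\<^esub> u', v \<oplus>\<^bsub>E\<^esub> v') \<in> \<Gamma>" using mem[of "r \<oplus>\<^bsub>R\<^esub> r'" "a \<oplus>\<^bsub>R\<^esub> a'"] * I.a_closed by simp
  next
    fix s u v assume s: "s \<in> carrier R" "(u,v) \<in> \<Gamma>"
    then obtain r a where *: "r \<in> carrier R" "a \<in> \<aa>" "u = r \<otimes>\<^bsub>R\<^esub> x \<oplus>\<^bsub>R\<^esub> a" "v = r \<odot>\<^bsub>E\<^esub> e" unfolding \<Gamma>_def by blast
    have "a \<in> carrier R" using * I.Icarr by auto
    then have "s \<otimes>\<^bsub>R\<^esub> u = (s \<otimes>\<^bsub>R\<^esub> r) \<otimes>\<^bsub>R\<^esub> x \<oplus>\<^bsub>R\<^esub> (s \<otimes>\<^bsub>R\<^esub> a)" "s \<odot>\<^bsub>E\<^esub> v = (s \<otimes>\<^bsub>R\<^esub> r) \<odot>\<^bsub>E\<^esub> e"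
      using * x e s by (simp_all add: r_distr m_assoc E.smult_assoc1)
    then show "(s \<odot>\<^bsub>Rmod R\<^esub> u, s \<odot>\<^bsub>E\<^esub> v) \<in> \<Gamma>" using mem[of "s \<otimes>\<^bsub>R\<^esub> r" "s \<otimes>\<^bsub>R\<^esub> a"] * s I.I_l_closed by simp
  qed
  moreover have "functional (Rmod R) E \<Gamma>"
    unfolding functional_def
  proof (intro allI impI)
    fix v assume "(\<zero>\<^bsub>Rmod R\<^esub>, v) \<in> \<Gamma>"
    then obtain r a where *: "r \<in> carrier R" "a \<in> \<aa>" "\<zero>\<^bsub>R\<^esub> = r \<otimes>\<^bsub>R\<^esub> x \<oplus>\<^bsub>R\<^esub> a" "v = r \<odot>\<^bsub>E\<^esub> e" unfolding \<Gamma>_def by auto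
    have "a \<in> carrier R" using * I.Icarr by auto
    then have "r \<otimes>\<^bsub>R\<^esub> x = \<ominus>\<^bsub>R\<^esub> a" using * x by (metis m_closed minus_equality)
    then have "r \<otimes>\<^bsub>R\<^esub> x \<in> \<aa>" using * I.a_inv_closed by simp
    then show "v = \<zero>\<^bsub>E\<^esub>" using k * by simp
  qed
  ultimately obtain e' where e': "e' \<in> carrier E" "\<forall>(r,y)\<in>\<Gamma>. y = r \<odot>\<^bsub>E\<^esub> e'" using E unfolding baer_def by blast
  show thesis
  proof (rule that[OF e'(1)])
    show "x \<odot>\<^bsub>E\<^esub> e' = e" using e'(2) mem[of "\<one>\<^bsub>R\<^esub>" "\<zero>\<^bsub>R\<^esub>"] x e I.zero_closed by force
    show "\<And>a. a \<in> \<aa> \<Longrightarrow> a \<odot>\<^bsub>E\<^esub> e' = \<zero>\<^bsub>E\<^esub>" using e'(2) mem[of "\<zero>\<^bsub>R\<^esub>"] x e I.Icarr by force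
  qed
qed

lemma baer_injective_module:
  fixes E :: "('a,'e,'m) module_scheme"
  assumes E: "baer R E" shows "injective_module R E"
  unfolding injective_module_def
proof (intro conjI allI impI)
  show "Module.module R E" by (rule baer_module[OF E])
  fix A B :: "('a, 'a + 'e) module" and f g
  assume *: "Module.module R A \<and> Module.module R B \<and> f \<in> module_homs R A B \<and> inj_on f (carrier A) \<and> g \<in> module_homs R A E"
  then have f: "lin_map R A B f" and g: "lin_map R A E g" by (simp_all add: module_homs_iff_lin)
  have A: "Module.module R A" and B: "Module.module R B" using * by blast+
  have inj: "inj_on f (carrier A)" using * by blast
  note Ac = submod_carrier[OF A]
  have f0: "f \<zero>\<^bsub>A\<^esub> = \<zero>\<^bsub>B\<^esub>" by (rule lin_zero[OF A B Ac f])
  have g0: "g \<zero>\<^bsub>A\<^esub> = \<zero>\<^bsub>E\<^esub>" by (rule lin_zero[OF A baer_module[OF E] Ac g])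
  have k: "g x = \<zero>\<^bsub>E\<^esub>" if x: "x \<in> carrier A" "f x = \<zero>\<^bsub>B\<^esub>" for x
  proof -
    have "x = \<zero>\<^bsub>A\<^esub>" using inj_onD[OF inj, of x] x f0 submod_zero[OF Ac] by simp
    then show ?thesis using g0 by simp
  qed
  obtain h where h: "lin_map R B E h" "\<And>x. x \<in> carrier A \<Longrightarrow> h (f x) = g x"
    by (rule baer_factor[OF A Ac B E f g k]) auto
  have "h \<in> module_homs R B E" using h(1) by (simp add: module_homs_iff_lin)
  then show "\<exists>h\<in>module_homs R B E. \<forall>x\<in>carrier A. h (f x) = g x" using h(2) by blast
qed

section \<open>Quotient modules\<close>

text \<open>Cosets are represented by chosen elements, so a quotient has the same element type as the module.
  This lets the coresolutions of \<open>N\<close> and of its quotients live in one type.\<close>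

definition qrep :: "('a,'b,'m) module_scheme \<Rightarrow> 'b set \<Rightarrow> 'b \<Rightarrow> 'b" where
  "qrep A H x = (SOME y. y \<in> carrier A \<and> x \<ominus>\<^bsub>A\<^esub> y \<in> H)"

definition quo :: "('a,'b,'m) module_scheme \<Rightarrow> 'b set \<Rightarrow> ('a,'b) module" where
  "quo A H = \<lparr>carrier = qrep A H ` carrier A, monoid.mult = undefined, one = undefined, ring.zero = qrep A H \<zero>\<^bsub>A\<^esub>,
     ring.add = (\<lambda>x y. qrep A H (x \<oplus>\<^bsub>A\<^esub> y)), module.smult = (\<lambda>r x. qrep A H (r \<odot>\<^bsub>A\<^esub> x))\<rparr>"

lemma quo_simps [simp]: "carrier (quo A H) = qrep A H ` carrier A" "\<zero>\<^bsub>quo A H\<^esub> = qrep A H \<zero>\<^bsub>A\<^esub>"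
  "x \<oplus>\<^bsub>quo A H\<^esub> y = qrep A H (x \<oplus>\<^bsub>A\<^esub> y)" "r \<odot>\<^bsub>quo A H\<^esub> x = qrep A H (r \<odot>\<^bsub>A\<^esub> x)"
  by (simp_all add: quo_def)

context
  fixes R :: "('a,'r) ring_scheme" (structure) and A :: "('a,'b,'m) module_scheme" and H
  assumes A: "Module.module R A" and H: "submodule H R A"
begin

interpretation A: module R A by (rule A)

lemma qrep_props: assumes "x \<in> carrier A" shows qrep_closed: "qrep A H x \<in> carrier A" and qrep_diff: "x \<ominus>\<^bsub>A\<^esub> qrep A H x \<in> H"
proof -
  have "\<exists>y. y \<in> carrier A \<and> x \<ominus>\<^bsub>A\<^esub> y \<in> H" using assms mod_diff_self[OF A assms] submod_zero[OF H] by (intro exI[of _ x]) simp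
  then have "qrep A H x \<in> carrier A \<and> x \<ominus>\<^bsub>A\<^esub> qrep A H x \<in> H" unfolding qrep_def by (rule someI_ex)
  then show "qrep A H x \<in> carrier A" "x \<ominus>\<^bsub>A\<^esub> qrep A H x \<in> H" by auto
qed

lemma sub_trans: "x \<in> carrier A \<Longrightarrow> y \<in> carrier A \<Longrightarrow> z \<in> carrier A \<Longrightarrow> x \<ominus>\<^bsub>A\<^esub> y \<in> H \<Longrightarrow> y \<ominus>\<^bsub>A\<^esub> z \<in> H \<Longrightarrow> x \<ominus>\<^bsub>A\<^esub> z \<in> H"
  using mod_diff_trans[OF A, of x y z] submod_add[OF H, of "x \<ominus>\<^bsub>A\<^esub> y" "y \<ominus>\<^bsub>A\<^esub> z"] by simp

lemma sub_sym: assumes "x \<in> carrier A" "y \<in> carrier A" "x \<ominus>\<^bsub>A\<^esub> y \<in> H" shows "y \<ominus>\<^bsub>A\<^esub> x \<in> H"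
proof -
  have "y \<ominus>\<^bsub>A\<^esub> x = \<ominus>\<^bsub>A\<^esub> (x \<ominus>\<^bsub>A\<^esub> y)" using assms by (simp add: a_minus_def A.M.minus_add A.M.a_comm)
  then show ?thesis using submod_neg[OF A H assms(3)] by simp
qed

lemma qrep_eq_iff: assumes "x \<in> carrier A" "y \<in> carrier A" shows "qrep A H x = qrep A H y \<longleftrightarrow> x \<ominus>\<^bsub>A\<^esub> y \<in> H"
proof
  assume "qrep A H x = qrep A H y"
  then show "x \<ominus>\<^bsub>A\<^esub> y \<in> H"
    using sub_trans[OF assms(1) qrep_closed[OF assms(1)] assms(2) qrep_diff[OF assms(1)]]
      sub_sym[OF assms(2) qrep_closed[OF assms(2)] qrep_diff[OF assms(2)]] by simp
next
  assume *: "x \<ominus>\<^bsub>A\<^esub> y \<in> H"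
  have "(z \<in> carrier A \<and> x \<ominus>\<^bsub>A\<^esub> z \<in> H) = (z \<in> carrier A \<and> y \<ominus>\<^bsub>A\<^esub> z \<in> H)" for z
    using sub_trans[OF assms(1,2), of z] sub_trans[OF assms(2,1), of z] sub_sym[OF assms] * by blast
  then show "qrep A H x = qrep A H y" unfolding qrep_def by presburger
qed

lemma qrep_eqI: "x \<in> carrier A \<Longrightarrow> y \<in> carrier A \<Longrightarrow> x \<ominus>\<^bsub>A\<^esub> y \<in> H \<Longrightarrow> qrep A H x = qrep A H y"
  by (simp add: qrep_eq_iff)

lemma qrep_zero_iff: "x \<in> carrier A \<Longrightarrow> qrep A H x = qrep A H \<zero>\<^bsub>A\<^esub> \<longleftrightarrow> x \<in> H"
  by (simp add: qrep_eq_iff mod_diff_zero[OF A])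

lemma qrep_idem: "x \<in> carrier A \<Longrightarrow> qrep A H (qrep A H x) = qrep A H x"
  by (rule qrep_eqI) (auto intro: qrep_closed sub_sym qrep_diff)

lemma qrep_add1: assumes "x \<in> carrier A" "y \<in> carrier A" shows "qrep A H (qrep A H x \<oplus>\<^bsub>A\<^esub> y) = qrep A H (x \<oplus>\<^bsub>A\<^esub> y)"
proof (rule qrep_eqI)
  have "(qrep A H x \<oplus>\<^bsub>A\<^esub> y) \<ominus>\<^bsub>A\<^esub> (x \<oplus>\<^bsub>A\<^esub> y) = qrep A H x \<ominus>\<^bsub>A\<^esub> x"
    using assms qrep_closed by (simp add: mod_diff_add_diff[OF A] mod_diff_self[OF A])
  then show "(qrep A H x \<oplus>\<^bsub>A\<^esub> y) \<ominus>\<^bsub>A\<^esub> (x \<oplus>\<^bsub>A\<^esub> y) \<in> H" using assms sub_sym[OF _ qrep_closed qrep_diff] by simp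
qed (use assms qrep_closed in auto)

lemma qrep_add2: "x \<in> carrier A \<Longrightarrow> y \<in> carrier A \<Longrightarrow> qrep A H (x \<oplus>\<^bsub>A\<^esub> qrep A H y) = qrep A H (x \<oplus>\<^bsub>A\<^esub> y)"
  using qrep_add1[of y x] qrep_closed by (simp add: A.M.a_comm)

lemma qrep_smult: assumes "r \<in> carrier R" "x \<in> carrier A" shows "qrep A H (r \<odot>\<^bsub>A\<^esub> qrep A H x) = qrep A H (r \<odot>\<^bsub>A\<^esub> x)"
proof (rule qrep_eqI)
  have "r \<odot>\<^bsub>A\<^esub> (qrep A H x \<ominus>\<^bsub>A\<^esub> x) \<in> H"
    using assms sub_sym[OF _ qrep_closed qrep_diff] submod_smult[OF H] by simp
  then show "(r \<odot>\<^bsub>A\<^esub> qrep A H x) \<ominus>\<^bsub>A\<^esub> (r \<odot>\<^bsub>A\<^esub> x) \<in> H" using assms qrep_closed by (simp add: mod_smult_diff[OF A])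
qed (use assms qrep_closed in auto)

lemma quo_module: "Module.module R (quo A H)"
proof (rule moduleI)
  show "cring R" by (rule A.R.is_cring)
  show "abelian_group (quo A H)"
  proof (rule abelian_groupI)
    fix x assume "x \<in> carrier (quo A H)"
    then obtain a where a: "a \<in> carrier A" "x = qrep A H a" by auto
    then show "\<exists>y\<in>carrier (quo A H). y \<oplus>\<^bsub>quo A H\<^esub> x = \<zero>\<^bsub>quo A H\<^esub>"
      by (intro bexI[of _ "qrep A H (\<ominus>\<^bsub>A\<^esub> a)"]) (auto simp: qrep_add1 qrep_add2 qrep_closed A.M.l_neg)
  next
    fix x y z assume "x \<in> carrier (quo A H)" "y \<in> carrier (quo A H)" "z \<in> carrier (quo A H)"
    then obtain a b c where "a \<in> carrier A" "x = qrep A H a" "b \<in> carrier A" "y = qrep A H b" "c \<in> carrier A" "z = qrep A H c" by auto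
    then show "x \<oplus>\<^bsub>quo A H\<^esub> y \<oplus>\<^bsub>quo A H\<^esub> z = x \<oplus>\<^bsub>quo A H\<^esub> (y \<oplus>\<^bsub>quo A H\<^esub> z)"
      by (simp add: qrep_add1 qrep_add2 qrep_closed A.M.a_assoc)
  qed (auto simp: qrep_add1 qrep_add2 qrep_closed qrep_idem A.M.a_comm)
next
  fix a b x assume a: "a \<in> carrier R" and b: "b \<in> carrier R" and "x \<in> carrier (quo A H)"
  then obtain y where y: "y \<in> carrier A" "x = qrep A H y" by auto
  note q = qrep_smult[OF _ y(1)]
  show "(a \<oplus> b) \<odot>\<^bsub>quo A H\<^esub> x = a \<odot>\<^bsub>quo A H\<^esub> x \<oplus>\<^bsub>quo A H\<^esub> b \<odot>\<^bsub>quo A H\<^esub> x"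
    using a b y(1) by (simp add: y(2) q qrep_add1 qrep_add2 qrep_closed) (simp add: A.smult_l_distr)
  show "(a \<otimes> b) \<odot>\<^bsub>quo A H\<^esub> x = a \<odot>\<^bsub>quo A H\<^esub> (b \<odot>\<^bsub>quo A H\<^esub> x)"
    using a b y(1) by (simp add: y(2) q qrep_smult qrep_closed) (simp add: A.smult_assoc1)
qed (auto simp: qrep_add1 qrep_add2 qrep_closed qrep_idem qrep_smult A.smult_r_distr)

lemma qrep_lin: "lin_map R A (quo A H) (qrep A H)"
  by (rule linI) (auto simp: qrep_add1 qrep_add2 qrep_closed qrep_smult)

end

section \<open>Noetherian modules\<close>

text \<open>The maximum condition is stated for the submodules inside \<open>D\<close>, because induction over finitely many
  coordinates passes to kernels, which are submodules rather than modules of their own.\<close>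

definition noeth_on :: "('a,'r) ring_scheme \<Rightarrow> ('a,'b,'m) module_scheme \<Rightarrow> 'b set \<Rightarrow> bool" where
  "noeth_on R A D \<longleftrightarrow> (\<forall>C. C \<noteq> {} \<longrightarrow> (\<forall>S\<in>C. submodule S R A \<and> S \<subseteq> D) \<longrightarrow> (\<exists>M\<in>C. \<forall>S\<in>C. M \<subseteq> S \<longrightarrow> S = M))"

definition noeth :: "('a,'r) ring_scheme \<Rightarrow> ('a,'b,'m) module_scheme \<Rightarrow> bool" where
  "noeth R A \<longleftrightarrow> Module.module R A \<and> noeth_on R A (carrier A)"

lemma noeth_max:
  assumes "noeth R A" "S0 \<in> C" "\<And>S. S \<in> C \<Longrightarrow> submodule S R A"
  obtains M where "M \<in> C" "\<And>S. S \<in> C \<Longrightarrow> M \<subseteq> S \<Longrightarrow> S = M"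
proof -
  have "\<exists>M\<in>C. \<forall>S\<in>C. M \<subseteq> S \<longrightarrow> S = M"
    using assms unfolding noeth_def noeth_on_def by (metis empty_iff submod_subset)
  then show thesis using that by blast
qed

lemma noeth_stable:
  assumes "noeth R A" and S: "\<And>n::nat. submodule (S n) R A" and inc: "\<And>n. S n \<subseteq> S (Suc n)"
  obtains n where "\<And>m. m \<ge> n \<Longrightarrow> S m = S n"
proof -
  obtain M where M: "M \<in> range S" "\<And>T. T \<in> range S \<Longrightarrow> M \<subseteq> T \<Longrightarrow> T = M"
    by (rule noeth_max[OF assms(1), of "S 0" "range S"]) (use S in auto)
  then obtain n where n: "M = S n" by blast
  have "S n \<subseteq> S m" if "m \<ge> n" for m using lift_Suc_mono_le[of S n m] inc that by blast
  then show thesis using that[of n] M(2) n by blast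
qed

lemma noeth_Rmod: assumes "cring R" "noetherian_ring R" shows "noeth R (Rmod R)"
  unfolding noeth_def noeth_on_def
proof (intro conjI allI impI)
  show "Module.module R (Rmod R)" by (rule Rmod_module) fact
  fix C assume C: "C \<noteq> {}" "\<forall>S\<in>C. submodule S R (Rmod R) \<and> S \<subseteq> carrier (Rmod R)"
  show "\<exists>M\<in>C. \<forall>S\<in>C. M \<subseteq> S \<longrightarrow> S = M"
  proof (rule subset_Zorn_nonempty[OF C(1)])
    fix K assume K: "K \<noteq> {}" "subset.chain C K"
    have KC: "K \<subseteq> C" using K(2) by (simp add: subset.chain_def)
    have "K \<subseteq> {I. ideal I R}"
    proof
      fix S assume "S \<in> K"
      then have "submodule S R (Rmod R)" using C(2) KC by auto
      then show "S \<in> {I. ideal I R}" by (simp add: ideal_submod[OF assms(1)])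
    qed
    then have "subset.chain {I. ideal I R} K" using K(2) by (simp add: subset.chain_def)
    then have "\<Union>K \<in> K" using noetherian_ring.ideal_chain_is_trivial[OF assms(2) K(1)] by blast
    then show "\<Union>K \<in> C" using KC by auto
  qed
qed

text \<open>Choose a member with maximal image under \<open>p\<close>, and among those with that image one with maximal
  intersection with the kernel.\<close>

lemma noeth_on_extension:
  assumes A: "Module.module R A" and B: "noeth R B" and D: "submodule D R A" and p: "lin R A D B (carrier B) p"
    and k: "noeth_on R A {x\<in>D. p x = \<zero>\<^bsub>B\<^esub>}"
  shows "noeth_on R A D"
  unfolding noeth_on_def
proof (intro allI impI)
  fix C assume C: "C \<noteq> {}" "\<forall>S\<in>C. submodule S R A \<and> S \<subseteq> D"
  have MB: "Module.module R B" using B unfolding noeth_def by blast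
  interpret A: module R A by (rule A)
  interpret B: module R B by (rule MB)
  have pS: "lin R A S B (carrier B) p" if "S \<in> C" for S using lin_mono[OF p] C(2) that by blast
  obtain S1 where S1: "S1 \<in> C" using C by blast
  obtain P where P: "P \<in> (\<lambda>S. p ` S) ` C" "\<And>T. T \<in> (\<lambda>S. p ` S) ` C \<Longrightarrow> P \<subseteq> T \<Longrightarrow> T = P"
    by (rule noeth_max[OF B, of "p ` S1" "(\<lambda>S. p ` S) ` C"]) (use S1 C lin_image[OF A MB _ pS] in auto)
  define C' where "C' = {S\<in>C. p ` S = P}"
  define K where "K S = {x\<in>S. p x = \<zero>\<^bsub>B\<^esub>}" for S
  have "K ` C' \<noteq> {}" using P(1) unfolding C'_def by blast
  moreover have "\<forall>T\<in>K ` C'. submodule T R A \<and> T \<subseteq> {x\<in>D. p x = \<zero>\<^bsub>B\<^esub>}"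
    using C(2) lin_kernel[OF A MB _ pS] unfolding C'_def K_def by blast
  ultimately obtain Q where "Q \<in> K ` C'" "\<forall>T\<in>K ` C'. Q \<subseteq> T \<longrightarrow> T = Q" using k unfolding noeth_on_def by meson
  then obtain M where M: "M \<in> C'" "\<And>S. S \<in> C' \<Longrightarrow> K M \<subseteq> K S \<Longrightarrow> K S = K M" by blast
  show "\<exists>M\<in>C. \<forall>S\<in>C. M \<subseteq> S \<longrightarrow> S = M"
  proof (intro bexI[of _ M] ballI impI)
    show MC: "M \<in> C" using M(1) unfolding C'_def by blast
    fix S assume S: "S \<in> C" "M \<subseteq> S"
    have "p ` S = P" using P(2)[of "p ` S"] S M(1) unfolding C'_def by blast
    then have SC: "S \<in> C'" using S unfolding C'_def by blast
    have KS: "K S = K M" using M(2)[OF SC] S(2) unfolding K_def by blast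
    have sS: "submodule S R A" and sM: "submodule M R A" using C(2) S MC by auto
    have "S \<subseteq> M"
    proof
      fix x assume x: "x \<in> S"
      have "p x \<in> p ` M" using x \<open>p ` S = P\<close> M(1) unfolding C'_def by blast
      then obtain y where y: "y \<in> M" "p x = p y" by blast
      have yS: "y \<in> S" using y S by blast
      have xy: "x \<in> carrier A" "y \<in> carrier A" using x yS submod_subset[OF sS] by auto
      have "p (x \<ominus>\<^bsub>A\<^esub> y) = \<zero>\<^bsub>B\<^esub>"
        using lin_sub[OF A MB sS pS[OF S(1)] x yS] y(2) mod_diff_self[OF MB lin_closed[OF pS[OF S(1)] yS]] by simp
      then have "x \<ominus>\<^bsub>A\<^esub> y \<in> K M" using submod_diff[OF A sS x yS] unfolding KS[symmetric] unfolding K_def by simp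
      then have "(x \<ominus>\<^bsub>A\<^esub> y) \<oplus>\<^bsub>A\<^esub> y \<in> M" using submod_add[OF sM] y unfolding K_def by blast
      then show "x \<in> M" using mod_diff_add[OF A xy] by simp
    qed
    then show "S = M" using S by blast
  qed
qed

lemma noeth_on_zero: "Module.module R A \<Longrightarrow> noeth_on R A {\<zero>\<^bsub>A\<^esub>}"
  unfolding noeth_on_def
proof (intro allI impI)
  fix C assume A: "Module.module R A" and C: "C \<noteq> {}" "\<forall>S\<in>C. submodule S R A \<and> S \<subseteq> {\<zero>\<^bsub>A\<^esub>}"
  then have "S = {\<zero>\<^bsub>A\<^esub>}" if "S \<in> C" for S using submod_zero[of S R A] that by blast
  then show "\<exists>M\<in>C. \<forall>S\<in>C. M \<subseteq> S \<longrightarrow> S = M" using C by blast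
qed

text \<open>One coordinate is removed at a time; this covers finite free modules and finite powers of a
  Noetherian module.\<close>

lemma noeth_coords:
  assumes A: "Module.module R A" and C: "noeth R C" and fin: "finite J" and p: "\<And>j. j \<in> J \<Longrightarrow> lin_map R A C (p j)"
    and sep: "\<And>x. x \<in> carrier A \<Longrightarrow> (\<And>j. j \<in> J \<Longrightarrow> p j x = \<zero>\<^bsub>C\<^esub>) \<Longrightarrow> x = \<zero>\<^bsub>A\<^esub>"
  shows "noeth R A"
proof -
  have MC: "Module.module R C" using C unfolding noeth_def by blast
  have "noeth_on R A D" if "J' \<subseteq> J" "submodule D R A" "\<And>x. x \<in> D \<Longrightarrow> (\<And>j. j \<in> J' \<Longrightarrow> p j x = \<zero>\<^bsub>C\<^esub>) \<Longrightarrow> x = \<zero>\<^bsub>A\<^esub>" for J' D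
    using finite_subset[OF that(1) fin] that
  proof (induction J' arbitrary: D rule: finite_induct)
    case empty
    then have "D = {\<zero>\<^bsub>A\<^esub>}" using submod_zero[of D R A] by blast
    then show ?case using noeth_on_zero[OF A] by simp
  next
    case (insert j J')
    have pj: "lin R A D C (carrier C) (p j)" using lin_mono[OF p[of j] submod_subset[OF insert.prems(2)]] insert.prems(1) by blast
    show ?case
    proof (rule noeth_on_extension[OF A C insert.prems(2) pj])
      show "noeth_on R A {x\<in>D. p j x = \<zero>\<^bsub>C\<^esub>}"
      proof (rule insert.IH)
        show "submodule {x \<in> D. p j x = \<zero>\<^bsub>C\<^esub>} R A" by (rule lin_kernel[OF A MC insert.prems(2) pj])
        show "x = \<zero>\<^bsub>A\<^esub>" if "x \<in> {x \<in> D. p j x = \<zero>\<^bsub>C\<^esub>}" "\<And>i. i \<in> J' \<Longrightarrow> p i x = \<zero>\<^bsub>C\<^esub>" for x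
          using insert.prems(3)[of x] that by auto
      qed (use insert in auto)
    qed
  qed
  then have "noeth_on R A (carrier A)" using submod_carrier[OF A] sep by blast
  then show ?thesis using A unfolding noeth_def by blast
qed

lemma noeth_image:
  assumes A: "noeth R A" and B: "Module.module R B" and p: "lin_map R A B p" and surj: "p ` carrier A = carrier B"
  shows "noeth R B"
  unfolding noeth_def noeth_on_def
proof (intro conjI allI impI)
  have MA: "Module.module R A" using A unfolding noeth_def by blast
  show "Module.module R B" by fact
  fix C assume C: "C \<noteq> {}" "\<forall>S\<in>C. submodule S R B \<and> S \<subseteq> carrier B"
  define g where "g S = {x\<in>carrier A. p x \<in> S}" for S
  have gS: "submodule (g S) R A" if "S \<in> C" for S unfolding g_def using lin_preimage[OF MA B submod_carrier[OF MA] p] C that by blast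
  have pg: "p ` g S = S" if S: "S \<in> C" for S
  proof -
    have "S \<subseteq> p ` carrier A" using C(2) S surj by auto
    then show ?thesis unfolding g_def by auto
  qed
  obtain S0 where S0: "S0 \<in> C" using C by blast
  obtain P where P: "P \<in> g ` C" "\<And>T. T \<in> g ` C \<Longrightarrow> P \<subseteq> T \<Longrightarrow> T = P"
    by (rule noeth_max[OF A, of "g S0" "g ` C"]) (use S0 gS in auto)
  then obtain M where M: "M \<in> C" "P = g M" by blast
  have "S = M" if "S \<in> C" "M \<subseteq> S" for S
  proof -
    have "g M \<subseteq> g S" using that unfolding g_def by blast
    then have "g S = g M" using P(2)[of "g S"] that M by blast
    then show ?thesis using pg[OF that(1)] pg[OF M(1)] by metis
  qed
  then show "\<exists>M\<in>C. \<forall>S\<in>C. M \<subseteq> S \<longrightarrow> S = M" using M by blast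
qed

lemma submod_Inter:
  assumes A: "Module.module R A" and C: "C \<noteq> {}" "\<And>S. S \<in> C \<Longrightarrow> submodule S R A" shows "submodule (\<Inter>C) R A"
proof (rule submodI[OF A])
  show "\<Inter>C \<subseteq> carrier A" using C submod_subset by blast
  show "\<zero>\<^bsub>A\<^esub> \<in> \<Inter>C" using C(2) by (auto dest: submod_zero)
  show "\<And>x y. x \<in> \<Inter>C \<Longrightarrow> y \<in> \<Inter>C \<Longrightarrow> x \<oplus>\<^bsub>A\<^esub> y \<in> \<Inter>C" using C(2) by (auto intro: submod_add)
  show "\<And>r x. r \<in> carrier R \<Longrightarrow> x \<in> \<Inter>C \<Longrightarrow> r \<odot>\<^bsub>A\<^esub> x \<in> \<Inter>C" using C(2) by (auto intro: submod_smult)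
qed

lemma span_submod: "Module.module R A \<Longrightarrow> S \<subseteq> carrier A \<Longrightarrow> submodule (submodule_generated R A S) R A"
  unfolding submodule_generated_def by (rule submod_Inter) (auto intro: submod_carrier)

lemma span_incl: "S \<subseteq> submodule_generated R A S"
  unfolding submodule_generated_def by blast

lemma span_least: "submodule H R A \<Longrightarrow> S \<subseteq> H \<Longrightarrow> submodule_generated R A S \<subseteq> H"
  unfolding submodule_generated_def by blast

lemma noeth_fg:
  assumes A: "noeth R A" and H: "submodule H R A"
  obtains F where "finite F" "F \<subseteq> H" "submodule_generated R A F = H"
proof -
  have MA: "Module.module R A" using A unfolding noeth_def by blast
  note HA = submod_subset[OF H]
  define C where "C = {submodule_generated R A F | F. finite F \<and> F \<subseteq> H}"
  obtain M where M: "M \<in> C" "\<And>S. S \<in> C \<Longrightarrow> M \<subseteq> S \<Longrightarrow> S = M"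
  proof (rule noeth_max[OF A, of "submodule_generated R A {}" C])
    show "submodule_generated R A {} \<in> C" unfolding C_def by blast
    show "submodule S R A" if "S \<in> C" for S
      using that HA unfolding C_def by (auto intro!: span_submod[OF MA])
  qed blast
  then obtain F where F: "finite F" "F \<subseteq> H" "M = submodule_generated R A F" unfolding C_def by blast
  have "H \<subseteq> M"
  proof
    fix x assume x: "x \<in> H"
    have "submodule_generated R A (insert x F) \<in> C" using F x unfolding C_def by (auto intro!: exI[of _ "insert x F"])
    moreover have "M \<subseteq> submodule_generated R A (insert x F)" unfolding F(3)
      by (rule span_least[OF span_submod[OF MA]]) (use x F HA span_incl[of "insert x F" R A] in auto)
    ultimately have "submodule_generated R A (insert x F) = M" using M(2) by blast
    then show "x \<in> M" using span_incl[of "insert x F" R A] by blast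
  qed
  moreover have "M \<subseteq> H" unfolding F(3) by (rule span_least[OF H F(2)])
  ultimately show thesis using that[of F] F by blast
qed

lemma annihilator_ideal:
  assumes A: "Module.module R A" and H: "submodule H R A" and x: "x \<in> carrier A" shows "ideal {r\<in>carrier R. r \<odot>\<^bsub>A\<^esub> x \<in> H} R"
proof -
  interpret A: module R A by fact
  have c: "cring R" by (rule A.R.is_cring)
  show ?thesis unfolding ideal_submod[OF c]
    by (rule submodI[OF Rmod_module[OF c]]) (use x in \<open>auto simp: A.smult_l_distr A.smult_assoc1 intro: submod_add[OF H] submod_smult[OF H] submod_zero[OF H]\<close>)
qed

section \<open>Injective coresolutions and homotopies\<close>

text \<open>Degrees are shifted by one: \<open>Y (Suc i)\<close> is \<open>I\<^sup>i\<close> and \<open>Y 0\<close> is the zero module. Degree \<open>0\<close> of Ext then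
  needs no separate treatment: the boundaries in \<open>I\<^sup>0\<close> are the image of \<open>Y 0\<close>.\<close>

locale injective_complex =
  fixes R :: "('a,'r) ring_scheme" (structure) and Y :: "nat \<Rightarrow> ('a,'e) module" and d :: "nat \<Rightarrow> 'e \<Rightarrow> 'e"
  assumes R_cring: "cring R" and baerY: "baer R (Y i)"
    and carrier_Y0: "carrier (Y 0) = {\<zero>\<^bsub>Y 0\<^esub>}"
    and d_lin: "lin_map R (Y i) (Y (Suc i)) (d i)"
    and dd: "y \<in> carrier (Y i) \<Longrightarrow> d (Suc i) (d i y) = \<zero>\<^bsub>Y (Suc (Suc i))\<^esub>"
begin

text \<open>Vanishing of \<open>Ext\<^sup>i(S, N)\<close> computed from the coresolution, for a submodule \<open>S\<close> of \<open>A\<close>: cocycles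
  \<open>S \<rightarrow> I\<^sup>i\<close> are boundaries.\<close>

definition maps_lift :: "('a,'c,'k) module_scheme \<Rightarrow> 'c set \<Rightarrow> nat \<Rightarrow> bool" where
  "maps_lift A S i \<longleftrightarrow> (\<forall>\<phi>. lin R A S (Y (Suc i)) (carrier (Y (Suc i))) \<phi> \<longrightarrow> (\<forall>x\<in>S. d (Suc i) (\<phi> x) = \<zero>\<^bsub>Y (Suc (Suc i))\<^esub>) \<longrightarrow>
     (\<exists>\<psi>. lin R A S (Y i) (carrier (Y i)) \<psi> \<and> (\<forall>x\<in>S. \<phi> x = d i (\<psi> x))))"

lemma modY: "Module.module R (Y i)" by (rule baer_module[OF baerY])

lemma d_closed: "y \<in> carrier (Y i) \<Longrightarrow> d i y \<in> carrier (Y (Suc i))" by (rule lin_closed[OF d_lin])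

lemma subY: "submodule (carrier (Y i)) R (Y i)" by (rule submod_carrier[OF modY])

lemma d_zero: "d i \<zero>\<^bsub>Y i\<^esub> = \<zero>\<^bsub>Y (Suc i)\<^esub>" by (rule lin_zero[OF modY modY subY d_lin])

lemma d_add: "x \<in> carrier (Y i) \<Longrightarrow> y \<in> carrier (Y i) \<Longrightarrow> d i (x \<oplus>\<^bsub>Y i\<^esub> y) = d i x \<oplus>\<^bsub>Y (Suc i)\<^esub> d i y" by (rule lin_add[OF d_lin])

lemma d_diff: "x \<in> carrier (Y i) \<Longrightarrow> y \<in> carrier (Y i) \<Longrightarrow> d i (x \<ominus>\<^bsub>Y i\<^esub> y) = d i x \<ominus>\<^bsub>Y (Suc i)\<^esub> d i y"
  by (rule lin_sub[OF modY modY subY d_lin])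

lemma d_smult: "r \<in> carrier R \<Longrightarrow> x \<in> carrier (Y i) \<Longrightarrow> d i (r \<odot>\<^bsub>Y i\<^esub> x) = r \<odot>\<^bsub>Y (Suc i)\<^esub> d i x" by (rule lin_smult[OF d_lin])

lemma Y0: "y \<in> carrier (Y 0) \<Longrightarrow> y = \<zero>\<^bsub>Y 0\<^esub>" using carrier_Y0 by blast

end

locale coresolution = injective_complex R Y d
  for R :: "('a,'r) ring_scheme" (structure) and Y :: "nat \<Rightarrow> ('a,'e) module" and d :: "nat \<Rightarrow> 'e \<Rightarrow> 'e" +
  fixes N :: "('a,'b,'m) module_scheme" and \<eta> :: "'b \<Rightarrow> 'e"
  assumes modN: "Module.module R N" and \<eta>_lin: "lin_map R N (Y (Suc 0)) \<eta>"
    and \<eta>_inj: "inj_on \<eta> (carrier N)"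
    and exact_\<eta>: "y \<in> carrier (Y (Suc 0)) \<Longrightarrow> d (Suc 0) y = \<zero>\<^bsub>Y (Suc (Suc 0))\<^esub> \<Longrightarrow> y \<in> \<eta> ` carrier N"
    and d_\<eta>: "x \<in> carrier N \<Longrightarrow> d (Suc 0) (\<eta> x) = \<zero>\<^bsub>Y (Suc (Suc 0))\<^esub>"
    and exact: "y \<in> carrier (Y (Suc (Suc i))) \<Longrightarrow> d (Suc (Suc i)) y = \<zero>\<^bsub>Y (Suc (Suc (Suc i)))\<^esub> \<Longrightarrow> y \<in> d (Suc i) ` carrier (Y (Suc i))"
begin

lemma \<eta>_zero: "\<eta> \<zero>\<^bsub>N\<^esub> = \<zero>\<^bsub>Y (Suc 0)\<^esub>" by (rule lin_zero[OF modN modY submod_carrier[OF modN] \<eta>_lin])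

lemma \<eta>_zero_iff: "x \<in> carrier N \<Longrightarrow> \<eta> x = \<zero>\<^bsub>Y (Suc 0)\<^esub> \<longleftrightarrow> x = \<zero>\<^bsub>N\<^esub>"
  using \<eta>_zero inj_onD[OF \<eta>_inj, of x "\<zero>\<^bsub>N\<^esub>"] submod_zero[OF submod_carrier[OF modN]] by auto

lemma \<eta>_closed: "x \<in> carrier N \<Longrightarrow> \<eta> x \<in> carrier (Y (Suc 0))" by (rule lin_closed[OF \<eta>_lin])

text \<open>The homotopy is built degree by degree: \<open>f - d' s\<close> kills the kernel of \<open>d\<close>, so it factors through
  \<open>d\<close> by injectivity.\<close>

lemma null_homotopy:
  assumes J: "injective_complex R Y' d'"
    and f: "\<And>i. lin_map R (Y (i + c)) (Y' i) (f i)"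
    and comm: "\<And>i y. y \<in> carrier (Y (i + c)) \<Longrightarrow> d' i (f i y) = f (Suc i) (d (i + c) y)"
    and kill: "\<And>y. y \<in> carrier (Y (Suc c)) \<Longrightarrow> d (Suc c) y = \<zero>\<^bsub>Y (Suc (Suc c))\<^esub> \<Longrightarrow> f (Suc 0) y = \<zero>\<^bsub>Y' (Suc 0)\<^esub>"
  obtains s where "\<And>i. lin_map R (Y (Suc (i + c))) (Y' i) (s i)"
    "\<And>i y. y \<in> carrier (Y (Suc (i + c))) \<Longrightarrow> f (Suc i) y = d' i (s i y) \<oplus>\<^bsub>Y' (Suc i)\<^esub> s (Suc i) (d (Suc (i + c)) y)"
proof -
  interpret J: injective_complex R Y' d' by (rule J)
  interpret Jm: module R "Y' i" for i by (rule J.modY)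
  define P where "P i s \<longleftrightarrow> lin_map R (Y (Suc (i + c))) (Y' i) s \<and>
     (\<forall>y\<in>carrier (Y (Suc (i + c))). d (Suc (i + c)) y = \<zero>\<^bsub>Y (Suc (Suc (i + c)))\<^esub> \<longrightarrow> f (Suc i) y = d' i (s y))" for i s
  define Q where "Q i s s' \<longleftrightarrow> (\<forall>y\<in>carrier (Y (Suc (i + c))). f (Suc i) y = d' i (s y) \<oplus>\<^bsub>Y' (Suc i)\<^esub> s' (d (Suc (i + c)) y))" for i s s'
  have step: "\<exists>s'. P (Suc i) s' \<and> Q i s s'" if P: "P i s" for i s
  proof -
    have sl: "lin_map R (Y (Suc (i + c))) (Y' i) s"
      and sk: "\<And>y. y \<in> carrier (Y (Suc (i + c))) \<Longrightarrow> d (Suc (i + c)) y = \<zero>\<^bsub>Y (Suc (Suc (i + c)))\<^esub> \<Longrightarrow> f (Suc i) y = d' i (s y)"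
      using P unfolding P_def by auto
    note fl = f[of "Suc i", simplified]
    define q where "q y = f (Suc i) y \<ominus>\<^bsub>Y' (Suc i)\<^esub> d' i (s y)" for y
    have c1: "f (Suc i) y \<in> carrier (Y' (Suc i))" "s y \<in> carrier (Y' i)" "d' i (s y) \<in> carrier (Y' (Suc i))"
      if y: "y \<in> carrier (Y (Suc (i + c)))" for y
      using lin_closed[OF fl y] lin_closed[OF sl y] J.d_closed[OF lin_closed[OF sl y]] by auto
    have ds: "lin_map R (Y (Suc (i + c))) (Y' (Suc i)) (\<lambda>y. d' i (s y))"
      by (rule lin_comp[OF sl J.d_lin]) simp
    have ql: "lin_map R (Y (Suc (i + c))) (Y' (Suc i)) q"
      unfolding q_def by (rule lin_pointwise_diff[OF modY J.modY _ J.subY fl ds]) simp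
    obtain s' where s': "lin_map R (Y (Suc (Suc (i + c)))) (Y' (Suc i)) s'"
      "\<And>y. y \<in> carrier (Y (Suc (i + c))) \<Longrightarrow> s' (d (Suc (i + c)) y) = q y"
    proof (rule baer_factor[OF modY subY modY J.baerY d_lin ql])
      fix y assume y: "y \<in> carrier (Y (Suc (i + c)))" "d (Suc (i + c)) y = \<zero>\<^bsub>Y (Suc (Suc (i + c)))\<^esub>"
      show "q y = \<zero>\<^bsub>Y' (Suc i)\<^esub>" unfolding q_def using sk[OF y] c1[OF y(1)] mod_diff_self[OF J.modY] by simp
    qed blast
    have Qs: "Q i s s'" unfolding Q_def
    proof
      fix y assume y: "y \<in> carrier (Y (Suc (i + c)))"
      have "d' i (s y) \<oplus>\<^bsub>Y' (Suc i)\<^esub> q y = f (Suc i) y" unfolding q_def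
        using mod_diff_add[OF J.modY c1(1,3)[OF y]] c1[OF y] Jm.M.a_comm by simp
      then show "f (Suc i) y = d' i (s y) \<oplus>\<^bsub>Y' (Suc i)\<^esub> s' (d (Suc (i + c)) y)" using s'(2)[OF y] by simp
    qed
    have "P (Suc i) s'" unfolding P_def
    proof (intro conjI ballI impI)
      show "lin_map R (Y (Suc (Suc i + c))) (Y' (Suc i)) s'" using s'(1) by simp
      fix y assume y: "y \<in> carrier (Y (Suc (Suc i + c)))" "d (Suc (Suc i + c)) y = \<zero>\<^bsub>Y (Suc (Suc (Suc i + c)))\<^esub>"
      then obtain z where z: "z \<in> carrier (Y (Suc (i + c)))" "y = d (Suc (i + c)) z" using exact[of y "i + c"] by auto
      have "f (Suc (Suc i)) y = d' (Suc i) (f (Suc i) z)" using comm[of z "Suc i"] z by simp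
      also have "\<dots> = d' (Suc i) (q z \<oplus>\<^bsub>Y' (Suc i)\<^esub> d' i (s z))" unfolding q_def using mod_diff_add[OF J.modY c1(1,3)[OF z(1)]] by simp
      also have "\<dots> = d' (Suc i) (q z) \<oplus>\<^bsub>Y' (Suc (Suc i))\<^esub> \<zero>\<^bsub>Y' (Suc (Suc i))\<^esub>"
        using J.d_add[OF lin_closed[OF ql z(1)] c1(3)[OF z(1)]] J.dd[OF c1(2)[OF z(1)]] by simp
      also have "\<dots> = d' (Suc i) (s' y)" using s'(2)[OF z(1)] z(2) J.d_closed[OF lin_closed[OF ql z(1)]] by simp
      finally show "f (Suc (Suc i)) y = d' (Suc i) (s' y)" .
    qed
    then show ?thesis using Qs by blast
  qed
  have "P 0 (\<lambda>y. \<zero>\<^bsub>Y' 0\<^esub>)" unfolding P_def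
  proof (intro conjI ballI impI)
    show "lin_map R (Y (Suc (0 + c))) (Y' 0) (\<lambda>y. \<zero>\<^bsub>Y' 0\<^esub>)"
      by (rule lin_zero_map[OF modY J.modY J.subY])
  qed (use kill J.d_zero in auto)
  then have "\<exists>s. \<forall>n. P n (s n) \<and> Q n (s n) (s (Suc n))" using dependent_nat_choice[of P Q] step by blast
  then obtain s where s: "\<And>n. P n (s n)" "\<And>n. Q n (s n) (s (Suc n))" by blast
  show thesis by (rule that[of s]) (use s in \<open>auto simp: P_def Q_def\<close>)
qed

text \<open>Each component is obtained from the previous one by factoring through \<open>d\<close>, whose kernel is the image
  of the previous differential.\<close>

lemma comparison:
  assumes J: "coresolution R Y' d' N' \<eta>'" and \<phi>: "lin_map R N N' \<phi>"
  obtains \<iota> where "\<And>i. lin_map R (Y i) (Y' i) (\<iota> i)"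
    "\<And>i y. y \<in> carrier (Y i) \<Longrightarrow> d' i (\<iota> i y) = \<iota> (Suc i) (d i y)"
    "\<And>x. x \<in> carrier N \<Longrightarrow> \<iota> (Suc 0) (\<eta> x) = \<eta>' (\<phi> x)"
proof -
  interpret J: coresolution R Y' d' N' \<eta>' by (rule J)
  define P where "P i t \<longleftrightarrow> lin_map R (Y (Suc i)) (Y' (Suc i)) t \<and>
     (\<forall>y\<in>carrier (Y (Suc i)). d (Suc i) y = \<zero>\<^bsub>Y (Suc (Suc i))\<^esub> \<longrightarrow> d' (Suc i) (t y) = \<zero>\<^bsub>Y' (Suc (Suc i))\<^esub>) \<and>
     (i = 0 \<longrightarrow> (\<forall>x\<in>carrier N. t (\<eta> x) = \<eta>' (\<phi> x)))" for i t
  define Q where "Q i t t' \<longleftrightarrow> (\<forall>y\<in>carrier (Y (Suc i)). d' (Suc i) (t y) = t' (d (Suc i) y))" for i t t'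
  have "\<exists>t. P 0 t"
  proof -
    have "lin_map R N (Y' (Suc 0)) (\<lambda>x. \<eta>' (\<phi> x))" by (rule lin_comp[OF \<phi> J.\<eta>_lin]) simp
    then obtain t where t: "lin_map R (Y (Suc 0)) (Y' (Suc 0)) t"
      "\<And>x. x \<in> carrier N \<Longrightarrow> t (\<eta> x) = \<eta>' (\<phi> x)"
    proof (rule baer_factor[OF modN submod_carrier[OF modN] modY J.baerY \<eta>_lin])
      fix x assume "x \<in> carrier N" "\<eta> x = \<zero>\<^bsub>Y (Suc 0)\<^esub>"
      then have "x = \<zero>\<^bsub>N\<^esub>" using \<eta>_zero_iff by simp
      then show "\<eta>' (\<phi> x) = \<zero>\<^bsub>Y' (Suc 0)\<^esub>" using lin_zero[OF modN J.modN submod_carrier[OF modN] \<phi>] J.\<eta>_zero by simp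
    qed blast
    have "d' (Suc 0) (t y) = \<zero>\<^bsub>Y' (Suc (Suc 0))\<^esub>" if y: "y \<in> carrier (Y (Suc 0))" "d (Suc 0) y = \<zero>\<^bsub>Y (Suc (Suc 0))\<^esub>" for y
    proof -
      obtain x where x: "x \<in> carrier N" "y = \<eta> x" using exact_\<eta>[OF y] by blast
      show ?thesis unfolding x(2) t(2)[OF x(1)] by (rule J.d_\<eta>[OF lin_closed[OF \<phi> x(1)]])
    qed
    then show ?thesis using t unfolding P_def by blast
  qed
  moreover have "\<exists>t'. P (Suc i) t' \<and> Q i t t'" if P: "P i t" for i t
  proof -
    have tl: "lin_map R (Y (Suc i)) (Y' (Suc i)) t"
      and tk: "\<And>y. y \<in> carrier (Y (Suc i)) \<Longrightarrow> d (Suc i) y = \<zero>\<^bsub>Y (Suc (Suc i))\<^esub> \<Longrightarrow> d' (Suc i) (t y) = \<zero>\<^bsub>Y' (Suc (Suc i))\<^esub>"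
      using P unfolding P_def by auto
    have ql: "lin_map R (Y (Suc i)) (Y' (Suc (Suc i))) (\<lambda>y. d' (Suc i) (t y))"
      by (rule lin_comp[OF tl J.d_lin]) simp
    obtain t' where t': "lin_map R (Y (Suc (Suc i))) (Y' (Suc (Suc i))) t'"
      "\<And>y. y \<in> carrier (Y (Suc i)) \<Longrightarrow> t' (d (Suc i) y) = d' (Suc i) (t y)"
      by (rule baer_factor[OF modY subY modY J.baerY d_lin ql tk]) (auto intro: that)
    have "d' (Suc (Suc i)) (t' y) = \<zero>\<^bsub>Y' (Suc (Suc (Suc i)))\<^esub>"
      if y: "y \<in> carrier (Y (Suc (Suc i)))" "d (Suc (Suc i)) y = \<zero>\<^bsub>Y (Suc (Suc (Suc i)))\<^esub>" for y
    proof -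
      obtain z where z: "z \<in> carrier (Y (Suc i))" "y = d (Suc i) z" using exact[OF y] by auto
      show ?thesis unfolding z(2) t'(2)[OF z(1)] by (rule J.dd[OF lin_closed[OF tl z(1)]])
    qed
    then have "P (Suc i) t'" using t' unfolding P_def by simp
    moreover have "Q i t t'" unfolding Q_def using t'(2) by simp
    ultimately show ?thesis by blast
  qed
  ultimately have "\<exists>t. \<forall>n. P n (t n) \<and> Q n (t n) (t (Suc n))" using dependent_nat_choice[of P Q] by blast
  then obtain t where t: "\<And>n. P n (t n)" "\<And>n. Q n (t n) (t (Suc n))" by blast
  define \<iota> where "\<iota> i = (case i of 0 \<Rightarrow> (\<lambda>y. \<zero>\<^bsub>Y' 0\<^esub>) | Suc j \<Rightarrow> t j)" for i
  show thesis
  proof (rule that[of \<iota>])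
    show "lin_map R (Y i) (Y' i) (\<iota> i)" for i
    proof (cases i)
      case 0 then show ?thesis unfolding \<iota>_def using lin_zero_map[OF modY J.modY J.subY] by simp
    next
      case (Suc j) then show ?thesis unfolding \<iota>_def using t(1)[of j] P_def by simp
    qed
    show "d' i (\<iota> i y) = \<iota> (Suc i) (d i y)" if y: "y \<in> carrier (Y i)" for i y
    proof (cases i)
      case 0
      have "lin_map R (Y (Suc 0)) (Y' (Suc 0)) (t 0)" using t(1)[of 0] P_def by simp
      then have "t 0 \<zero>\<^bsub>Y (Suc 0)\<^esub> = \<zero>\<^bsub>Y' (Suc 0)\<^esub>" by (rule lin_zero[OF modY J.modY subY])
      moreover have "y = \<zero>\<^bsub>Y 0\<^esub>" using y 0 Y0 by simp
      ultimately show ?thesis using 0 by (simp add: \<iota>_def d_zero J.d_zero)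
    next
      case (Suc j) then show ?thesis unfolding \<iota>_def using t(2)[of j] y Q_def by simp
    qed
    show "\<iota> (Suc 0) (\<eta> x) = \<eta>' (\<phi> x)" if "x \<in> carrier N" for x using t(1)[of 0] that unfolding P_def \<iota>_def by simp
  qed
qed

end

section \<open>Torsion in injective modules\<close>

text \<open>The elements killed by a power of each element of \<open>S\<close>. If \<open>S\<close> is finite and generates \<open>\<aa>\<close> this is
  the \<open>\<aa>\<close>-power torsion; adding one generator to \<open>S\<close> at a time allows induction.\<close>

definition tors :: "('a,'r) ring_scheme \<Rightarrow> ('a,'b,'m) module_scheme \<Rightarrow> 'a set \<Rightarrow> 'b set" where
  "tors R A S = {y\<in>carrier A. \<forall>x\<in>S. \<exists>s::nat. (x [^]\<^bsub>R\<^esub> s) \<odot>\<^bsub>A\<^esub> y = \<zero>\<^bsub>A\<^esub>}"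

context
  fixes R :: "('a,'r) ring_scheme" (structure) and A :: "('a,'b,'m) module_scheme"
  assumes A: "Module.module R A"
begin

interpretation A: module R A by (rule A)

lemma pow_kill_mono: assumes x: "x \<in> carrier R" and y: "y \<in> carrier A" and k: "(x [^] (s::nat)) \<odot>\<^bsub>A\<^esub> y = \<zero>\<^bsub>A\<^esub>" and st: "s \<le> t"
  shows "(x [^] t) \<odot>\<^bsub>A\<^esub> y = \<zero>\<^bsub>A\<^esub>"
proof -
  have "x [^] t = x [^] (t - s) \<otimes> x [^] s" using x st by (simp add: A.R.nat_pow_mult)
  then show ?thesis using x y k by (simp add: A.smult_assoc1)
qed

lemma tors_submod: assumes S: "S \<subseteq> carrier R" shows "submodule (tors R A S) R A"
proof (rule submodI[OF A])
  show "tors R A S \<subseteq> carrier A" unfolding tors_def by auto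
  show "\<zero>\<^bsub>A\<^esub> \<in> tors R A S" unfolding tors_def using S by auto
next
  fix y z assume yz: "y \<in> tors R A S" "z \<in> tors R A S"
  then have c: "y \<in> carrier A" "z \<in> carrier A" unfolding tors_def by auto
  have "\<exists>s::nat. (x [^] s) \<odot>\<^bsub>A\<^esub> (y \<oplus>\<^bsub>A\<^esub> z) = \<zero>\<^bsub>A\<^esub>" if x: "x \<in> S" for x
  proof -
    obtain s t :: nat where st: "(x [^] s) \<odot>\<^bsub>A\<^esub> y = \<zero>\<^bsub>A\<^esub>" "(x [^] t) \<odot>\<^bsub>A\<^esub> z = \<zero>\<^bsub>A\<^esub>" using yz x unfolding tors_def by blast
    have xR: "x \<in> carrier R" using x S by blast
    have "(x [^] (max s t)) \<odot>\<^bsub>A\<^esub> y = \<zero>\<^bsub>A\<^esub>" "(x [^] (max s t)) \<odot>\<^bsub>A\<^esub> z = \<zero>\<^bsub>A\<^esub>"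
      by (rule pow_kill_mono[OF xR c(1) st(1)], simp) (rule pow_kill_mono[OF xR c(2) st(2)], simp)
    then show ?thesis using c xR by (intro exI[of _ "max s t"]) (simp add: A.smult_r_distr)
  qed
  then show "y \<oplus>\<^bsub>A\<^esub> z \<in> tors R A S" unfolding tors_def using c by auto
next
  fix r y assume r: "r \<in> carrier R" and y: "y \<in> tors R A S"
  have c: "y \<in> carrier A" using y unfolding tors_def by auto
  have "\<exists>s::nat. (x [^] s) \<odot>\<^bsub>A\<^esub> (r \<odot>\<^bsub>A\<^esub> y) = \<zero>\<^bsub>A\<^esub>" if x: "x \<in> S" for x
  proof -
    obtain s :: nat where s: "(x [^] s) \<odot>\<^bsub>A\<^esub> y = \<zero>\<^bsub>A\<^esub>" using y x unfolding tors_def by blast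
    have xR: "x \<in> carrier R" using x S by blast
    show ?thesis using s r c xR by (intro exI[of _ s]) (simp add: mod_smult_comm[OF A _ r])
  qed
  then show "r \<odot>\<^bsub>A\<^esub> y \<in> tors R A S" unfolding tors_def using c r by auto
qed

lemma tors_closed: "y \<in> tors R A S \<Longrightarrow> y \<in> carrier A" unfolding tors_def by auto

lemma tors_mono: "S \<subseteq> S' \<Longrightarrow> tors R A S' \<subseteq> tors R A S" unfolding tors_def by blast

lemma tors_insertI: "y \<in> tors R A S \<Longrightarrow> (x [^] (s::nat)) \<odot>\<^bsub>A\<^esub> y = \<zero>\<^bsub>A\<^esub> \<Longrightarrow> y \<in> tors R A (insert x S)"
  unfolding tors_def by blast

text \<open>The ideals
  \<open>(0 : x\<^sup>n g)\<close> become constant, say from \<open>n\<close> on, so that \<open>baer_solve\<close> solves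
  \<open>x\<^sup>n\<^sup>+\<^sup>u g' = x\<^sup>n g\<close> with \<open>g'\<close> killed by the annihilator of \<open>g\<close>, hence again torsion.\<close>

lemma tors_divide:
  assumes NR: "noeth R (Rmod R)" and E: "baer R A" and S: "S \<subseteq> carrier R" and x: "x \<in> carrier R" and g: "g \<in> tors R A S"
  obtains g' where "g' \<in> tors R A S" "g \<ominus>\<^bsub>A\<^esub> (x [^] (u::nat)) \<odot>\<^bsub>A\<^esub> g' \<in> tors R A (insert x S)"
proof -
  have gA: "g \<in> carrier A" using g by (rule tors_closed)
  have cR: "cring R" by (rule A.R.is_cring)
  define K where "K n = {r\<in>carrier R. r \<odot>\<^bsub>A\<^esub> ((x [^] n) \<odot>\<^bsub>A\<^esub> g) \<in> {\<zero>\<^bsub>A\<^esub>}}" for n :: nat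
  have Kid: "ideal (K n) R" for n unfolding K_def by (rule annihilator_ideal[OF A submod_zero_set[OF A]]) (use x gA in simp)
  have Kinc: "K n \<subseteq> K (Suc n)" for n
  proof
    fix r assume r: "r \<in> K n"
    then have rR: "r \<in> carrier R" and k: "r \<odot>\<^bsub>A\<^esub> ((x [^] n) \<odot>\<^bsub>A\<^esub> g) = \<zero>\<^bsub>A\<^esub>" unfolding K_def by auto
    have "(x [^] Suc n) \<odot>\<^bsub>A\<^esub> g = x \<odot>\<^bsub>A\<^esub> ((x [^] n) \<odot>\<^bsub>A\<^esub> g)" using x gA by (simp add: A.smult_assoc1 mod_smult_comm[OF A])
    then have "r \<odot>\<^bsub>A\<^esub> ((x [^] Suc n) \<odot>\<^bsub>A\<^esub> g) = x \<odot>\<^bsub>A\<^esub> (r \<odot>\<^bsub>A\<^esub> ((x [^] n) \<odot>\<^bsub>A\<^esub> g))"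
      using mod_smult_comm[OF A rR x, of "(x [^] n) \<odot>\<^bsub>A\<^esub> g"] x gA by simp
    then show "r \<in> K (Suc n)" unfolding K_def using k rR x by simp
  qed
  obtain n where n: "\<And>m. m \<ge> n \<Longrightarrow> K m = K n"
    by (rule noeth_stable[OF NR, of K]) (use Kid Kinc ideal_submod[OF cR] in auto)
  define \<aa> where "\<aa> = {r\<in>carrier R. r \<odot>\<^bsub>A\<^esub> g \<in> {\<zero>\<^bsub>A\<^esub>}}"
  have \<aa>: "ideal \<aa> R" unfolding \<aa>_def by (rule annihilator_ideal[OF A submod_zero_set[OF A] gA])
  obtain e where e: "e \<in> carrier A" "(x [^] (n + u)) \<odot>\<^bsub>A\<^esub> e = (x [^] n) \<odot>\<^bsub>A\<^esub> g" "\<And>a. a \<in> \<aa> \<Longrightarrow> a \<odot>\<^bsub>A\<^esub> e = \<zero>\<^bsub>A\<^esub>"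
  proof (rule baer_solve[OF cR E \<aa>, of "x [^] (n + u)" "(x [^] n) \<odot>\<^bsub>A\<^esub> g"])
    fix r assume r: "r \<in> carrier R" "r \<otimes> x [^] (n + u) \<in> \<aa>"
    then have "r \<in> K (n + u)" unfolding \<aa>_def K_def using x gA by (simp add: A.smult_assoc1)
    then have "r \<in> K n" using n[of "n + u"] by simp
    then show "r \<odot>\<^bsub>A\<^esub> ((x [^] n) \<odot>\<^bsub>A\<^esub> g) = \<zero>\<^bsub>A\<^esub>" unfolding K_def by simp
  qed (use x gA in auto)
  have eS: "e \<in> tors R A S" unfolding tors_def
  proof (intro CollectI conjI ballI e(1))
    fix y assume y: "y \<in> S"
    then obtain s :: nat where "(y [^] s) \<odot>\<^bsub>A\<^esub> g = \<zero>\<^bsub>A\<^esub>" using g unfolding tors_def by blast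
    moreover have "y [^] s \<in> carrier R" using y S by auto
    ultimately have "y [^] s \<in> \<aa>" unfolding \<aa>_def by simp
    then show "\<exists>s::nat. (y [^] s) \<odot>\<^bsub>A\<^esub> e = \<zero>\<^bsub>A\<^esub>" using e(3) by blast
  qed
  show thesis
  proof (rule that[OF eS tors_insertI])
    show "g \<ominus>\<^bsub>A\<^esub> (x [^] u) \<odot>\<^bsub>A\<^esub> e \<in> tors R A S"
      using submod_diff[OF A tors_submod[OF S] g submod_smult[OF tors_submod[OF S] _ eS]] x by simp
    have "(x [^] n) \<odot>\<^bsub>A\<^esub> ((x [^] u) \<odot>\<^bsub>A\<^esub> e) = (x [^] (n + u)) \<odot>\<^bsub>A\<^esub> e"
      using x e(1) by (simp add: A.smult_assoc1[symmetric] A.R.nat_pow_mult)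
    then show "(x [^] n) \<odot>\<^bsub>A\<^esub> (g \<ominus>\<^bsub>A\<^esub> (x [^] u) \<odot>\<^bsub>A\<^esub> e) = \<zero>\<^bsub>A\<^esub>"
      using x e gA by (simp add: mod_smult_diff[OF A] mod_diff_self[OF A])
  qed
qed

text \<open>To reach the socle modulo \<open>D\<close>, multiply by the last power of \<open>x\<close> that does not lead into \<open>D\<close>,
  for one \<open>x\<close> after the other.\<close>

lemma tors_socle_step:
  assumes S: "S \<subseteq> carrier R" and fin: "finite S'" and sub: "S' \<subseteq> S" and D: "submodule D R A" and t: "t \<in> tors R A S" "t \<notin> D"
  obtains t' r where "r \<in> carrier R" "t' = r \<odot>\<^bsub>A\<^esub> t" "t' \<notin> D" "\<And>x. x \<in> S' \<Longrightarrow> x \<odot>\<^bsub>A\<^esub> t' \<in> D"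
proof -
  have tA: "t \<in> carrier A" using t(1) by (rule tors_closed)
  have "\<exists>r\<in>carrier R. r \<odot>\<^bsub>A\<^esub> t \<notin> D \<and> (\<forall>x\<in>S'. x \<odot>\<^bsub>A\<^esub> (r \<odot>\<^bsub>A\<^esub> t) \<in> D)"
    using fin sub
  proof (induction S' rule: finite_induct)
    case empty
    then show ?case using t(2) tA by (intro bexI[of _ "\<one>"]) auto
  next
    case (insert x S')
    then obtain r where r: "r \<in> carrier R" "r \<odot>\<^bsub>A\<^esub> t \<notin> D" "\<forall>y\<in>S'. y \<odot>\<^bsub>A\<^esub> (r \<odot>\<^bsub>A\<^esub> t) \<in> D" by auto
    have x: "x \<in> carrier R" using insert S by auto
    have "r \<odot>\<^bsub>A\<^esub> t \<in> tors R A S" using submod_smult[OF tors_submod[OF S] r(1) t(1)] .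
    then obtain s0 :: nat where "(x [^] s0) \<odot>\<^bsub>A\<^esub> (r \<odot>\<^bsub>A\<^esub> t) = \<zero>\<^bsub>A\<^esub>" using insert.prems unfolding tors_def by auto
    then have ex: "(x [^] s0) \<odot>\<^bsub>A\<^esub> (r \<odot>\<^bsub>A\<^esub> t) \<in> D" using submod_zero[OF D] by simp
    define s where "s = (LEAST s::nat. (x [^] s) \<odot>\<^bsub>A\<^esub> (r \<odot>\<^bsub>A\<^esub> t) \<in> D)"
    have sD: "(x [^] s) \<odot>\<^bsub>A\<^esub> (r \<odot>\<^bsub>A\<^esub> t) \<in> D" unfolding s_def by (rule LeastI[of _ s0]) (rule ex)
    have "s \<noteq> 0" using sD r tA by (metis A.R.nat_pow_0 A.smult_one A.smult_closed)
    then obtain s' where s': "s = Suc s'" by (cases s) auto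
    then have nD: "(x [^] s') \<odot>\<^bsub>A\<^esub> (r \<odot>\<^bsub>A\<^esub> t) \<notin> D" unfolding s_def using not_less_Least lessI by metis
    show ?case
    proof (intro bexI[of _ "(x [^] s') \<otimes> r"] conjI ballI)
      have eq: "((x [^] s') \<otimes> r) \<odot>\<^bsub>A\<^esub> t = (x [^] s') \<odot>\<^bsub>A\<^esub> (r \<odot>\<^bsub>A\<^esub> t)" using x r tA by (simp add: A.smult_assoc1)
      show "((x [^] s') \<otimes> r) \<odot>\<^bsub>A\<^esub> t \<notin> D" using nD eq by simp
      fix y assume y: "y \<in> insert x S'"
      show "y \<odot>\<^bsub>A\<^esub> (((x [^] s') \<otimes> r) \<odot>\<^bsub>A\<^esub> t) \<in> D"
      proof (cases "y = x")
        case True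
        have "x \<odot>\<^bsub>A\<^esub> ((x [^] s') \<odot>\<^bsub>A\<^esub> (r \<odot>\<^bsub>A\<^esub> t)) = (x [^] s) \<odot>\<^bsub>A\<^esub> (r \<odot>\<^bsub>A\<^esub> t)"
          unfolding s' using x r tA by (simp add: A.smult_assoc1 mod_smult_comm[OF A])
        then show ?thesis using sD eq True by simp
      next
        case False
        then have "y \<odot>\<^bsub>A\<^esub> (r \<odot>\<^bsub>A\<^esub> t) \<in> D" "y \<in> carrier R" using y r insert.prems S by auto
        then have "y \<odot>\<^bsub>A\<^esub> ((x [^] s') \<odot>\<^bsub>A\<^esub> (r \<odot>\<^bsub>A\<^esub> t)) \<in> D"
          using mod_smult_comm[OF A, of y "x [^] s'" "r \<odot>\<^bsub>A\<^esub> t"] submod_smult[OF D, of "x [^] s'"] x r tA by simp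
        then show ?thesis using eq by simp
      qed
    qed (use x r in auto)
  qed
  then show thesis using that by blast
qed

end

lemma lin_tors:
  assumes A: "Module.module R A" and B: "Module.module R B" and f: "lin_map R A B f" and S: "S \<subseteq> carrier R" and y: "y \<in> tors R A S"
  shows "f y \<in> tors R B S"
  unfolding tors_def
proof (intro CollectI conjI ballI)
  have yA: "y \<in> carrier A" using y by (rule tors_closed[OF A])
  show "f y \<in> carrier B" by (rule lin_closed[OF f yA])
  fix x assume x: "x \<in> S"
  interpret module R A by (rule A)
  obtain s :: nat where s: "(x [^]\<^bsub>R\<^esub> s) \<odot>\<^bsub>A\<^esub> y = \<zero>\<^bsub>A\<^esub>" using y x unfolding tors_def by blast
  have "x [^]\<^bsub>R\<^esub> s \<in> carrier R" using x S by auto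
  then have "(x [^]\<^bsub>R\<^esub> s) \<odot>\<^bsub>B\<^esub> f y = f ((x [^]\<^bsub>R\<^esub> s) \<odot>\<^bsub>A\<^esub> y)" using lin_smult[OF f _ yA] by simp
  also have "\<dots> = \<zero>\<^bsub>B\<^esub>" unfolding s by (rule lin_zero[OF A B submod_carrier[OF A] f])
  finally show "\<exists>s::nat. (x [^]\<^bsub>R\<^esub> s) \<odot>\<^bsub>B\<^esub> f y = \<zero>\<^bsub>B\<^esub>" by blast
qed

section \<open>Null homotopies on torsion subcomplexes\<close>

lemma mod_diff_swap:
  assumes A: "Module.module R A" and c: "a \<in> carrier A" "b \<in> carrier A" "c \<in> carrier A" "e \<in> carrier A" and eq: "a \<ominus>\<^bsub>A\<^esub> b = c \<ominus>\<^bsub>A\<^esub> e"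
  shows "a \<ominus>\<^bsub>A\<^esub> c = b \<ominus>\<^bsub>A\<^esub> e"
proof -
  interpret A: module R A by (rule A)
  have "a \<ominus>\<^bsub>A\<^esub> c = (b \<ominus>\<^bsub>A\<^esub> c) \<oplus>\<^bsub>A\<^esub> (c \<ominus>\<^bsub>A\<^esub> e)"
    using mod_diff_trans[OF A c(1,2,3)] eq c A.M.a_comm[of "b \<ominus>\<^bsub>A\<^esub> c" "c \<ominus>\<^bsub>A\<^esub> e"] by simp
  then show ?thesis using mod_diff_trans[OF A c(2,3,4)] by simp
qed

context coresolution
begin

text \<open>Multiplication by \<open>r\<close> is a map of complexes over the zero map of \<open>N\<close>.\<close>

lemma multiplication_null_homotopic:
  assumes r: "r \<in> carrier R" and k: "\<And>x. x \<in> carrier N \<Longrightarrow> r \<odot>\<^bsub>N\<^esub> x = \<zero>\<^bsub>N\<^esub>"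
  obtains \<sigma> where "\<And>i. lin_map R (Y (Suc i)) (Y i) (\<sigma> i)"
    "\<And>i y. y \<in> carrier (Y (Suc i)) \<Longrightarrow> r \<odot>\<^bsub>Y (Suc i)\<^esub> y = d i (\<sigma> i y) \<oplus>\<^bsub>Y (Suc i)\<^esub> \<sigma> (Suc i) (d (Suc i) y)"
proof -
  obtain \<sigma> where s: "\<And>i. lin_map R (Y (Suc (i + 0))) (Y i) (\<sigma> i)"
    "\<And>i y. y \<in> carrier (Y (Suc (i + 0))) \<Longrightarrow> r \<odot>\<^bsub>Y (Suc i)\<^esub> y = d i (\<sigma> i y) \<oplus>\<^bsub>Y (Suc i)\<^esub> \<sigma> (Suc i) (d (Suc (i + 0)) y)"
  proof (rule null_homotopy[OF injective_complex_axioms, of 0 "\<lambda>i y. r \<odot>\<^bsub>Y i\<^esub> y"])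
    show "lin_map R (Y (i + 0)) (Y i) (\<lambda>y. r \<odot>\<^bsub>Y i\<^esub> y)" for i
      using lin_smult_map[OF modY subY r] by simp
    show "d i (r \<odot>\<^bsub>Y i\<^esub> y) = r \<odot>\<^bsub>Y (Suc i)\<^esub> d (i + 0) y" if "y \<in> carrier (Y (i + 0))" for i y using d_smult[OF r] that by simp
    fix y assume y: "y \<in> carrier (Y (Suc 0))" "d (Suc 0) y = \<zero>\<^bsub>Y (Suc (Suc 0))\<^esub>"
    then obtain x where x: "x \<in> carrier N" "y = \<eta> x" using exact_\<eta> by blast
    have "r \<odot>\<^bsub>Y (Suc 0)\<^esub> y = \<eta> (r \<odot>\<^bsub>N\<^esub> x)" unfolding x(2) using lin_smult[OF \<eta>_lin r x(1)] by simp
    then show "r \<odot>\<^bsub>Y (Suc 0)\<^esub> y = \<zero>\<^bsub>Y (Suc 0)\<^esub>" using k[OF x(1)] \<eta>_zero by simp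
  qed blast
  show thesis by (rule that[of \<sigma>]) (use s in auto)
qed

lemma d_tors: "S \<subseteq> carrier R \<Longrightarrow> y \<in> tors R (Y i) S \<Longrightarrow> d i y \<in> tors R (Y (Suc i)) S"
  by (rule lin_tors[OF modY modY d_lin])

text \<open>Induction on \<open>S\<close>. For \<open>S = {}\<close> the source is exact in
  the relevant degrees and \<open>null_homotopy\<close> applies. For the step from \<open>S\<close> to \<open>insert x S\<close>, write \<open>G\<close> for
  the \<open>S\<close>-torsion and \<open>G'\<close> for the part of it that is \<open>x\<close>-torsion. The components of \<open>f\<close> extend from \<open>G'\<close>
  to maps \<open>F\<close>, which fail to commute with the differentials by some \<open>h\<close> that kills \<open>G'\<close>. On \<open>G/G'\<close>
  multiplication by \<open>x\<^sup>u\<close> is injective, and it is surjective by \<open>tors_divide\<close>. If \<open>\<sigma>\<close> is the homotopy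
  for \<open>x\<^sup>u\<close>, then \<open>T = \<sigma> h x\<^sup>-\<^sup>u\<close> has the same defect \<open>h\<close>, so \<open>F - T\<close> is a map of complexes on \<open>G\<close> that
  agrees with \<open>f\<close> on \<open>G'\<close>, and the induction hypothesis applies to it.\<close>

lemma torsion_null_homotopy:
  assumes J: "injective_complex R Y' d'" and NR: "noeth R (Rmod R)" and fin: "finite S" and S: "S \<subseteq> carrier R"
    and nil: "\<And>x. x \<in> S \<Longrightarrow> \<exists>u::nat. \<exists>\<sigma>. (\<forall>i. lin_map R (Y' (Suc i)) (Y' i) (\<sigma> i)) \<and>
      (\<forall>i. \<forall>y\<in>carrier (Y' (Suc i)). (x [^] u) \<odot>\<^bsub>Y' (Suc i)\<^esub> y = d' i (\<sigma> i y) \<oplus>\<^bsub>Y' (Suc i)\<^esub> \<sigma> (Suc i) (d' (Suc i) y))"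
    and f: "\<And>i. lin R (Y (Suc (i + c))) (tors R (Y (Suc (i + c))) S) (Y' i) (carrier (Y' i)) (f i)"
    and comm: "\<And>i y. y \<in> tors R (Y (Suc (i + c))) S \<Longrightarrow> d' i (f i y) = f (Suc i) (d (Suc (i + c)) y)"
  shows "\<exists>s. (\<forall>i. lin_map R (Y (Suc (Suc (i + c)))) (Y' i) (s i)) \<and>
    (\<forall>i. \<forall>y\<in>tors R (Y (Suc (Suc (i + c)))) S. f (Suc i) y = d' i (s i y) \<oplus>\<^bsub>Y' (Suc i)\<^esub> s (Suc i) (d (Suc (Suc (i + c))) y))"
  using fin S nil f comm
proof (induction S arbitrary: f rule: finite_induct)
  case empty
  interpret J: injective_complex R Y' d' by (rule J)
  have te: "tors R A {} = carrier A" for A :: "('a,'e) module" unfolding tors_def by simp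
  note f = empty.prems(3)[unfolded te] and cm = empty.prems(4)[unfolded te]
  obtain s where s: "\<And>i. lin_map R (Y (Suc (i + Suc c))) (Y' i) (s i)"
    "\<And>i y. y \<in> carrier (Y (Suc (i + Suc c))) \<Longrightarrow> f (Suc i) y = d' i (s i y) \<oplus>\<^bsub>Y' (Suc i)\<^esub> s (Suc i) (d (Suc (i + Suc c)) y)"
  proof (rule null_homotopy[OF J, of "Suc c" f])
    show "lin_map R (Y (i + Suc c)) (Y' i) (f i)" for i using f[of i] by simp
    show "d' i (f i y) = f (Suc i) (d (i + Suc c) y)" if "y \<in> carrier (Y (i + Suc c))" for i y using cm[of y i] that by simp
    fix y assume y: "y \<in> carrier (Y (Suc (Suc c)))" "d (Suc (Suc c)) y = \<zero>\<^bsub>Y (Suc (Suc (Suc c)))\<^esub>"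
    then obtain z where z: "z \<in> carrier (Y (Suc c))" "y = d (Suc c) z" using exact by blast
    have "f (Suc 0) y = d' 0 (f 0 z)" using cm[of z 0] z by simp
    moreover have "f 0 z = \<zero>\<^bsub>Y' 0\<^esub>" using lin_closed[OF f[of 0], of z] z by (simp add: J.carrier_Y0)
    ultimately show "f (Suc 0) y = \<zero>\<^bsub>Y' (Suc 0)\<^esub>" using J.d_zero by simp
  qed blast
  show ?case unfolding te by (rule exI[of _ s]) (use s in auto)
next
  case (insert x S f)
  interpret J: injective_complex R Y' d' by (rule J)
  interpret Jm: module R "Y' i" for i by (rule J.modY)
  interpret Ym: module R "Y i" for i by (rule modY)
  define n where "n i = Suc (i + c)" for i
  have nS: "n (Suc i) = Suc (n i)" for i unfolding n_def by simp
  note f = insert.prems(3)[folded n_def] and cm = insert.prems(4)[folded n_def]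
  have x: "x \<in> carrier R" and S: "S \<subseteq> carrier R" "insert x S \<subseteq> carrier R" using insert.prems by auto
  define G where "G i = tors R (Y (n i)) S" for i
  define G' where "G' i = tors R (Y (n i)) (insert x S)" for i
  have Gs: "submodule (G i) R (Y (n i))" for i unfolding G_def by (rule tors_submod[OF modY S(1)])
  have Gs': "submodule (G' i) R (Y (n i))" for i unfolding G'_def by (rule tors_submod[OF modY S(2)])
  have GG: "G' i \<subseteq> G i" for i unfolding G_def G'_def by (rule tors_mono[OF modY]) auto
  have Gc: "y \<in> G i \<Longrightarrow> y \<in> carrier (Y (n i))" for y i unfolding G_def by (rule tors_closed[OF modY])
  have dG: "y \<in> G i \<Longrightarrow> d (n i) y \<in> G (Suc i)" for y i unfolding G_def nS by (rule d_tors[OF S(1)])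
  have dG': "y \<in> G' i \<Longrightarrow> d (n i) y \<in> G' (Suc i)" for y i unfolding G'_def nS by (rule d_tors[OF S(2)])
  obtain u :: nat and \<sigma> where \<sigma>: "\<And>i. lin_map R (Y' (Suc i)) (Y' i) (\<sigma> i)"
    "\<And>i y. y \<in> carrier (Y' (Suc i)) \<Longrightarrow> (x [^] u) \<odot>\<^bsub>Y' (Suc i)\<^esub> y = d' i (\<sigma> i y) \<oplus>\<^bsub>Y' (Suc i)\<^esub> \<sigma> (Suc i) (d' (Suc i) y)"
    using insert.prems(2)[of x] by blast
  define X' where "X' = x [^] u"
  have XR: "X' \<in> carrier R" unfolding X'_def using x by simp
  have "\<exists>F. lin_map R (Y (n i)) (Y' i) F \<and> (\<forall>y\<in>G' i. F y = f i y)" for i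
    by (rule baer_restrict[OF modY Gs' J.baerY f[of i, folded G'_def]]) blast
  then obtain F where F: "\<And>i. lin_map R (Y (n i)) (Y' i) (F i)" "\<And>i y. y \<in> G' i \<Longrightarrow> F i y = f i y" by metis
  define h where "h i y = d' i (F i y) \<ominus>\<^bsub>Y' (Suc i)\<^esub> F (Suc i) (d (n i) y)" for i y
  have dF: "lin_map R (Y (n i)) (Y' (Suc i)) (\<lambda>y. d' i (F i y))" for i
    by (rule lin_comp[OF F(1) J.d_lin]) simp
  have Fd: "lin_map R (Y (n i)) (Y' (Suc i)) (\<lambda>y. F (Suc i) (d (n i) y))" for i
    by (rule lin_comp[OF d_lin F(1)[of "Suc i", unfolded nS]]) simp
  have hl: "lin_map R (Y (n i)) (Y' (Suc i)) (h i)" for i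
    unfolding h_def by (rule lin_pointwise_diff[OF modY J.modY _ J.subY dF Fd]) simp
  have hG': "h i y = \<zero>\<^bsub>Y' (Suc i)\<^esub>" if y: "y \<in> G' i" for i y
  proof -
    have "d' i (F i y) = F (Suc i) (d (n i) y)" using cm[of y i] y dG'[OF y] F(2)[OF y] F(2)[OF dG'[OF y]] unfolding G'_def by simp
    then show ?thesis unfolding h_def using lin_closed[OF Fd] GG y Gc by (metis mod_diff_self[OF J.modY] subsetD)
  qed
  \<comment> \<open>\<open>H\<close> plays the role of \<open>h x\<^sup>-\<^sup>u\<close>. It exists because \<open>x\<^sup>u y \<in> G'\<close> implies \<open>y \<in> G'\<close>.\<close>
  have "\<exists>H. lin_map R (Y (n i)) (Y' (Suc i)) H \<and> (\<forall>y\<in>G' i. H y = \<zero>\<^bsub>Y' (Suc i)\<^esub>) \<and>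
     (\<forall>y\<in>G i. H (X' \<odot>\<^bsub>Y (n i)\<^esub> y) = h i y)" for i
  proof -
    let ?Q = "quo (Y (n i)) (G' i)" and ?q = "qrep (Y (n i)) (G' i)"
    have MQ: "Module.module R ?Q" by (rule quo_module[OF modY Gs'])
    have ql: "lin_map R (Y (n i)) ?Q ?q" by (rule qrep_lin[OF modY Gs'])
    have pl: "lin R (Y (n i)) (G i) ?Q (carrier ?Q) (\<lambda>y. ?q (X' \<odot>\<^bsub>Y (n i)\<^esub> y))"
      by (rule lin_mono[OF lin_comp[OF lin_smult_map[OF modY subY XR] ql]]) (use Gc in auto)
    have hG: "lin R (Y (n i)) (G i) (Y' (Suc i)) (carrier (Y' (Suc i))) (h i)" by (rule lin_mono[OF hl]) (use Gc in auto)
    obtain k where k: "lin_map R ?Q (Y' (Suc i)) k" "\<And>y. y \<in> G i \<Longrightarrow> k (?q (X' \<odot>\<^bsub>Y (n i)\<^esub> y)) = h i y"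
    proof (rule baer_factor[OF modY Gs MQ J.baerY pl hG])
      fix y assume y: "y \<in> G i" "?q (X' \<odot>\<^bsub>Y (n i)\<^esub> y) = \<zero>\<^bsub>?Q\<^esub>"
      have yc: "y \<in> carrier (Y (n i))" by (rule Gc[OF y(1)])
      have "X' \<odot>\<^bsub>Y (n i)\<^esub> y \<in> G' i" using y(2) qrep_zero_iff[OF modY Gs', of "X' \<odot>\<^bsub>Y (n i)\<^esub> y"] yc XR by simp
      then obtain s :: nat where "(x [^] s) \<odot>\<^bsub>Y (n i)\<^esub> (X' \<odot>\<^bsub>Y (n i)\<^esub> y) = \<zero>\<^bsub>Y (n i)\<^esub>" unfolding G'_def tors_def by blast
      then have "(x [^] (s + u)) \<odot>\<^bsub>Y (n i)\<^esub> y = \<zero>\<^bsub>Y (n i)\<^esub>" unfolding X'_def using x yc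
        by (simp add: Ym.smult_assoc1[symmetric] Jm.R.nat_pow_mult)
      then have "y \<in> G' i" using tors_insertI[OF modY] y(1) unfolding G_def G'_def by blast
      then show "h i y = \<zero>\<^bsub>Y' (Suc i)\<^esub>" by (rule hG')
    qed blast
    have k0: "k \<zero>\<^bsub>?Q\<^esub> = \<zero>\<^bsub>Y' (Suc i)\<^esub>" by (rule lin_zero[OF MQ J.modY submod_carrier[OF MQ] k(1)])
    show ?thesis
    proof (intro exI[of _ "\<lambda>y. k (?q y)"] conjI ballI)
      show "lin_map R (Y (n i)) (Y' (Suc i)) (\<lambda>y. k (?q y))" by (rule lin_comp[OF ql k(1)]) simp
      fix y assume y: "y \<in> G' i"
      then have "?q y = \<zero>\<^bsub>?Q\<^esub>" using qrep_zero_iff[OF modY Gs' Gc[OF subsetD[OF GG y]]] by simp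
      then show "k (?q y) = \<zero>\<^bsub>Y' (Suc i)\<^esub>" using k0 by simp
    qed (use k(2) in auto)
  qed
  then have "\<exists>H. \<forall>i. lin_map R (Y (n i)) (Y' (Suc i)) (H i) \<and> (\<forall>y\<in>G' i. H i y = \<zero>\<^bsub>Y' (Suc i)\<^esub>) \<and>
     (\<forall>y\<in>G i. H i (X' \<odot>\<^bsub>Y (n i)\<^esub> y) = h i y)" by (intro choice allI)
  then obtain H where H: "\<And>i. lin_map R (Y (n i)) (Y' (Suc i)) (H i)"
    "\<And>i y. y \<in> G' i \<Longrightarrow> H i y = \<zero>\<^bsub>Y' (Suc i)\<^esub>" "\<And>i y. y \<in> G i \<Longrightarrow> H i (X' \<odot>\<^bsub>Y (n i)\<^esub> y) = h i y" by blast
  define T where "T i y = \<sigma> i (H i y)" for i y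
  have Tl: "lin_map R (Y (n i)) (Y' i) (T i)" for i
    unfolding T_def by (rule lin_comp[OF H(1) \<sigma>(1)]) simp
  have T0: "T i y = \<zero>\<^bsub>Y' i\<^esub>" if "y \<in> G' i" for i y
    unfolding T_def using H(2)[OF that] lin_zero[OF J.modY J.modY J.subY \<sigma>(1)] by simp
  have dT: "lin_map R (Y (n i)) (Y' (Suc i)) (\<lambda>y. d' i (T i y))" for i
    by (rule lin_comp[OF Tl J.d_lin]) simp
  have Td: "lin_map R (Y (n i)) (Y' (Suc i)) (\<lambda>y. T (Suc i) (d (n i) y))" for i
    by (rule lin_comp[OF d_lin Tl[of "Suc i", unfolded nS]]) simp
  define D where "D i y = d' i (T i y) \<ominus>\<^bsub>Y' (Suc i)\<^esub> T (Suc i) (d (n i) y)" for i y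
  have Dl: "lin_map R (Y (n i)) (Y' (Suc i)) (D i)" for i
    unfolding D_def by (rule lin_pointwise_diff[OF modY J.modY _ J.subY dT Td]) simp
  \<comment> \<open>The defect of \<open>T\<close> at \<open>x\<^sup>u y\<close> is \<open>d' \<sigma> h y + \<sigma> d' h y = x\<^sup>u h y\<close>, because \<open>h d = - d' h\<close>.\<close>
  have DX: "D i (X' \<odot>\<^bsub>Y (n i)\<^esub> y) = X' \<odot>\<^bsub>Y' (Suc i)\<^esub> h i y" if y: "y \<in> G i" for i y
  proof -
    have yc: "y \<in> carrier (Y (n i))" by (rule Gc[OF y])
    have hc: "h i y \<in> carrier (Y' (Suc i))" by (rule lin_closed[OF hl yc])
    have e1: "T i (X' \<odot>\<^bsub>Y (n i)\<^esub> y) = \<sigma> i (h i y)" unfolding T_def using H(3)[OF y] by simp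
    have "d (n i) (X' \<odot>\<^bsub>Y (n i)\<^esub> y) = X' \<odot>\<^bsub>Y (n (Suc i))\<^esub> d (n i) y" unfolding nS by (rule d_smult[OF XR yc])
    then have e2: "T (Suc i) (d (n i) (X' \<odot>\<^bsub>Y (n i)\<^esub> y)) = \<sigma> (Suc i) (h (Suc i) (d (n i) y))" unfolding T_def using H(3)[OF dG[OF y]] by simp
    have Fdy: "F (Suc i) (d (n i) y) \<in> carrier (Y' (Suc i))" by (rule lin_closed[OF Fd yc])
    have Fy: "F i y \<in> carrier (Y' i)" by (rule lin_closed[OF F(1) yc])
    have "d (n (Suc i)) (d (n i) y) = \<zero>\<^bsub>Y (n (Suc (Suc i)))\<^esub>" unfolding nS by (rule dd[OF yc])
    then have "F (Suc (Suc i)) (d (n (Suc i)) (d (n i) y)) = \<zero>\<^bsub>Y' (Suc (Suc i))\<^esub>"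
      using lin_zero[OF modY J.modY subY F(1)[of "Suc (Suc i)"]] by simp
    then have "h (Suc i) (d (n i) y) = d' (Suc i) (F (Suc i) (d (n i) y))"
      unfolding h_def using mod_diff_zero[OF J.modY J.d_closed[OF Fdy]] by simp
    moreover have "d' (Suc i) (h i y) = \<ominus>\<^bsub>Y' (Suc (Suc i))\<^esub> d' (Suc i) (F (Suc i) (d (n i) y))"
      using J.d_diff[OF J.d_closed[OF Fy] Fdy] J.dd[OF Fy] J.d_closed[OF Fdy] unfolding h_def by (simp add: a_minus_def[of "Y' (Suc (Suc i))"])
    ultimately have "h (Suc i) (d (n i) y) = \<ominus>\<^bsub>Y' (Suc (Suc i))\<^esub> d' (Suc i) (h i y)" using J.d_closed[OF Fdy] by simp
    then have "\<sigma> (Suc i) (h (Suc i) (d (n i) y)) = \<ominus>\<^bsub>Y' (Suc i)\<^esub> \<sigma> (Suc i) (d' (Suc i) (h i y))"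
      using lin_neg[OF J.modY J.modY J.subY \<sigma>(1) J.d_closed[OF hc]] by simp
    then have "D i (X' \<odot>\<^bsub>Y (n i)\<^esub> y) = d' i (\<sigma> i (h i y)) \<oplus>\<^bsub>Y' (Suc i)\<^esub> \<sigma> (Suc i) (d' (Suc i) (h i y))"
      unfolding D_def e1 e2 a_minus_def using lin_closed[OF \<sigma>(1) J.d_closed[OF hc]] by simp
    then show ?thesis using \<sigma>(2)[OF hc] unfolding X'_def by simp
  qed
  have D0: "D i y = \<zero>\<^bsub>Y' (Suc i)\<^esub>" if y: "y \<in> G' i" for i y
    unfolding D_def T0[OF y] T0[OF dG'[OF y]] J.d_zero using mod_diff_self[OF J.modY] by simp
  \<comment> \<open>Since \<open>G = x\<^sup>u G + G'\<close>, the two defects agree everywhere on \<open>G\<close>.\<close>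
  have hD: "h i y = D i y" if y: "y \<in> G i" for i y
  proof -
    obtain y' where y': "y' \<in> G i" "y \<ominus>\<^bsub>Y (n i)\<^esub> X' \<odot>\<^bsub>Y (n i)\<^esub> y' \<in> G' i"
      using tors_divide[OF modY NR baerY S(1) x y[unfolded G_def], of u] unfolding G_def G'_def X'_def by blast
    let ?y0 = "y \<ominus>\<^bsub>Y (n i)\<^esub> X' \<odot>\<^bsub>Y (n i)\<^esub> y'" and ?y1 = "X' \<odot>\<^bsub>Y (n i)\<^esub> y'"
    have c: "y \<in> carrier (Y (n i))" "y' \<in> carrier (Y (n i))" "?y0 \<in> carrier (Y (n i))" "?y1 \<in> carrier (Y (n i))"
      using y y'(1) Gc XR by auto
    have yy: "y = ?y0 \<oplus>\<^bsub>Y (n i)\<^esub> ?y1" using mod_diff_add[OF modY c(1,4)] by simp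
    have "h i y = h i ?y0 \<oplus>\<^bsub>Y' (Suc i)\<^esub> h i ?y1" by (subst yy) (rule lin_add[OF hl c(3,4)])
    also have "\<dots> = \<zero>\<^bsub>Y' (Suc i)\<^esub> \<oplus>\<^bsub>Y' (Suc i)\<^esub> D i ?y1" using hG'[OF y'(2)] DX[OF y'(1)] lin_smult[OF hl XR c(2)] by simp
    also have "\<dots> = D i ?y0 \<oplus>\<^bsub>Y' (Suc i)\<^esub> D i ?y1" using D0[OF y'(2)] by simp
    also have "\<dots> = D i y" by (rule trans[OF lin_add[OF Dl c(3,4), symmetric] arg_cong[OF yy[symmetric], of "D i"]])
    finally show ?thesis .
  qed
  define f2 where "f2 i y = F i y \<ominus>\<^bsub>Y' i\<^esub> T i y" for i y
  have f2l: "lin_map R (Y (n i)) (Y' i) (f2 i)" for i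
    unfolding f2_def by (rule lin_pointwise_diff[OF modY J.modY _ J.subY F(1) Tl]) simp
  have cm2: "d' i (f2 i y) = f2 (Suc i) (d (n i) y)" if y: "y \<in> G i" for i y
  proof -
    have yc: "y \<in> carrier (Y (n i))" by (rule Gc[OF y])
    have cc: "d' i (F i y) \<in> carrier (Y' (Suc i))" "F (Suc i) (d (n i) y) \<in> carrier (Y' (Suc i))"
        "d' i (T i y) \<in> carrier (Y' (Suc i))" "T (Suc i) (d (n i) y) \<in> carrier (Y' (Suc i))"
      using lin_closed[OF dF yc] lin_closed[OF Fd yc] lin_closed[OF dT yc] lin_closed[OF Td yc] by auto
    have "d' i (F i y) \<ominus>\<^bsub>Y' (Suc i)\<^esub> F (Suc i) (d (n i) y) = d' i (T i y) \<ominus>\<^bsub>Y' (Suc i)\<^esub> T (Suc i) (d (n i) y)"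
      using hD[OF y] unfolding h_def D_def .
    then have "d' i (F i y) \<ominus>\<^bsub>Y' (Suc i)\<^esub> d' i (T i y) = F (Suc i) (d (n i) y) \<ominus>\<^bsub>Y' (Suc i)\<^esub> T (Suc i) (d (n i) y)"
      by (rule mod_diff_swap[OF J.modY cc])
    then show ?thesis unfolding f2_def using J.d_diff[OF lin_closed[OF F(1) yc] lin_closed[OF Tl yc]] by simp
  qed
  have "\<exists>s. (\<forall>i. lin_map R (Y (Suc (Suc (i + c)))) (Y' i) (s i)) \<and>
    (\<forall>i. \<forall>y\<in>tors R (Y (Suc (Suc (i + c)))) S. f2 (Suc i) y = d' i (s i y) \<oplus>\<^bsub>Y' (Suc i)\<^esub> s (Suc i) (d (Suc (Suc (i + c))) y))"
  proof (rule insert.IH)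
    show "lin R (Y (Suc (i + c))) (tors R (Y (Suc (i + c))) S) (Y' i) (carrier (Y' i)) (f2 i)" for i
      using lin_mono[OF f2l[of i] _ order_refl, of "G i"] Gc unfolding n_def G_def by blast
    show "d' i (f2 i y) = f2 (Suc i) (d (Suc (i + c)) y)" if "y \<in> tors R (Y (Suc (i + c))) S" for i y
      using cm2[of y i] that unfolding n_def G_def by blast
  qed (use S insert.prems in auto)
  then obtain s where s: "\<And>i. lin_map R (Y (Suc (Suc (i + c)))) (Y' i) (s i)"
    "\<And>i y. y \<in> tors R (Y (Suc (Suc (i + c)))) S \<Longrightarrow> f2 (Suc i) y = d' i (s i y) \<oplus>\<^bsub>Y' (Suc i)\<^esub> s (Suc i) (d (Suc (Suc (i + c))) y)" by blast
  show ?case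
  proof (intro exI[of _ s] conjI allI ballI s(1))
    fix i y assume y: "y \<in> tors R (Y (Suc (Suc (i + c)))) (insert x S)"
    then have yG: "y \<in> G' (Suc i)" unfolding G'_def n_def by simp
    have "f2 (Suc i) y = f (Suc i) y" unfolding f2_def F(2)[OF yG] T0[OF yG]
      using lin_closed[OF f[of "Suc i"], of y] yG mod_diff_zero[OF J.modY] unfolding G'_def by blast
    moreover have "y \<in> tors R (Y (Suc (Suc (i + c)))) S" using yG GG[of "Suc i"] unfolding G_def n_def by auto
    ultimately show "f (Suc i) y = d' i (s i y) \<oplus>\<^bsub>Y' (Suc i)\<^esub> s (Suc i) (d (Suc (Suc (i + c))) y)" using s(2)[of y i] by simp
  qed
qed

end

section \<open>Local rings\<close>

locale local_noetherian =
  fixes R :: "('a,'r) ring_scheme" (structure) and \<mm> :: "'a set"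
  assumes nlr: "noetherian_local_ring R \<mm>"
begin

lemma cR: "cring R" and nR: "noetherian_ring R" and maxm: "maximalideal \<mm> R" and uniq: "maximalideal J R \<Longrightarrow> J = \<mm>"
  using nlr unfolding noetherian_local_ring_def by auto

sublocale R: cring R by (rule cR)

lemma NR: "noeth R (Rmod R)" by (rule noeth_Rmod[OF cR nR])

lemma idm: "ideal \<mm> R" using maxm by (rule maximalideal.axioms(1))

lemma m_carr: "x \<in> \<mm> \<Longrightarrow> x \<in> carrier R" by (rule ideal.Icarr[OF idm])

lemma one_notin: "\<one> \<notin> \<mm>"
  using maximalideal.I_notcarr[OF maxm] ideal.one_imp_carrier[OF idm] by blast

text \<open>An ideal maximal among the proper ones that contain \<open>r\<close> would be a second maximal ideal.\<close>

lemma unit_of_notin: assumes r: "r \<in> carrier R" "r \<notin> \<mm>" obtains s where "s \<in> carrier R" "s \<otimes> r = \<one>"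
proof (rule ccontr)
  assume "\<not> thesis"
  then have no: "\<And>s. s \<in> carrier R \<Longrightarrow> s \<otimes> r \<noteq> \<one>" using that by blast
  have P: "ideal (PIdl r) R" by (rule R.cgenideal_ideal[OF r(1)])
  have P1: "\<one> \<notin> PIdl r"
  proof
    assume "\<one> \<in> PIdl r"
    then obtain s where s: "s \<in> carrier R" "\<one> = s \<otimes> r" unfolding cgenideal_def by blast
    show False using no[OF s(1)] s(2)[symmetric] by contradiction
  qed
  define C where "C = {J. ideal J R \<and> PIdl r \<subseteq> J \<and> \<one> \<notin> J}"
  obtain M where M: "M \<in> C" "\<And>S. S \<in> C \<Longrightarrow> M \<subseteq> S \<Longrightarrow> S = M"
  proof (rule noeth_max[OF NR, of "PIdl r" C])
    show "PIdl r \<in> C" using P P1 unfolding C_def by simp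
    show "submodule S R (Rmod R)" if "S \<in> C" for S using that unfolding C_def ideal_submod[OF cR] by simp
  qed blast
  have idM: "ideal M R" using M(1) unfolding C_def by simp
  have "maximalideal M R"
  proof (rule maximalidealI[OF idM])
    show "carrier R \<noteq> M" using M(1) unfolding C_def by auto
    fix J assume J: "ideal J R" "M \<subseteq> J" "J \<subseteq> carrier R"
    show "J = M \<or> J = carrier R"
    proof (cases "\<one> \<in> J")
      case True then show ?thesis using ideal.one_imp_carrier[OF J(1)] by simp
    next
      case False
      then have "J \<in> C" using J M(1) unfolding C_def by auto
      then show ?thesis using M(2) J(2) by blast
    qed
  qed
  then have "M = \<mm>" by (rule uniq)
  moreover have "r \<in> M" using M(1) R.cgenideal_self[OF r(1)] unfolding C_def by auto
  ultimately show False using r(2) by simp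
qed

definition gens :: "'a set" where
  "gens = (SOME S. S \<subseteq> carrier R \<and> finite S \<and> \<mm> = Idl S)"

lemma gens: shows gens_finite: "finite gens" and gens_sub: "gens \<subseteq> \<mm>" and gens_carr: "gens \<subseteq> carrier R"
  and gens_least: "ideal J R \<Longrightarrow> gens \<subseteq> J \<Longrightarrow> \<mm> \<subseteq> J"
proof -
  have "\<exists>S. S \<subseteq> carrier R \<and> finite S \<and> \<mm> = Idl S" using noetherian_ring.finetely_gen[OF nR idm] by blast
  then have g: "gens \<subseteq> carrier R \<and> finite gens \<and> \<mm> = Idl gens" unfolding gens_def by (rule someI_ex)
  then show "finite gens" "gens \<subseteq> carrier R" by auto
  show "gens \<subseteq> \<mm>" using g R.genideal_self by auto
  show "ideal J R \<Longrightarrow> gens \<subseteq> J \<Longrightarrow> \<mm> \<subseteq> J" using R.genideal_minimal[of J gens] conjunct2[OF conjunct2[OF g]] by simp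
qed

lemma m_smult_in:
  assumes A: "Module.module R A" and D: "submodule D R A" and t: "t \<in> carrier A" and g: "\<And>x. x \<in> gens \<Longrightarrow> x \<odot>\<^bsub>A\<^esub> t \<in> D" and r: "r \<in> \<mm>"
  shows "r \<odot>\<^bsub>A\<^esub> t \<in> D"
  using gens_least[OF annihilator_ideal[OF A D t]] g gens_carr r by blast

lemma mem_of_unit_smult:
  assumes A: "Module.module R A" and D: "submodule D R A" and t: "t \<in> carrier A" and r: "r \<in> carrier R" "r \<notin> \<mm>" and rt: "r \<odot>\<^bsub>A\<^esub> t \<in> D"
  shows "t \<in> D"
proof -
  interpret A: module R A by (rule A)
  obtain s where s: "s \<in> carrier R" "s \<otimes> r = \<one>" using unit_of_notin[OF r] by blast
  have "s \<odot>\<^bsub>A\<^esub> (r \<odot>\<^bsub>A\<^esub> t) = t" using s r t A.smult_assoc1[of s r t] by simp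
  then show ?thesis using submod_smult[OF D s(1) rt] by simp
qed

text \<open>\<open>linrel_extend\<close> for a source that is \<open>\<mm>\<close>-torsion. Only elements \<open>t\<close> with \<open>\<mm> t\<close> in the domain of the partial
  map need to be added, by \<open>tors_socle_step\<close>. Injectivity provides a value \<open>y\<close> for \<open>t\<close>, and \<open>y\<close> may be
  changed by any element killed by \<open>\<mm>\<close>. Thus the side condition \<open>C\<close> has to be achieved only up to
  socle elements (\<open>adj\<close>), which is where vanishing of \<open>Ext(k, N)\<close> enters.\<close>

lemma torsion_extension:
  assumes A: "Module.module R A" and T: "submodule T R A" "T \<subseteq> tors R A gens" and E: "baer R E" and C: "linrel R A E C"
    and adj: "\<And>t y. t \<in> T \<Longrightarrow> y \<in> carrier E \<Longrightarrow> (\<And>r. r \<in> \<mm> \<Longrightarrow> (r \<odot>\<^bsub>A\<^esub> t, r \<odot>\<^bsub>E\<^esub> y) \<in> C) \<Longrightarrow>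
       \<exists>y1\<in>carrier E. (\<forall>r\<in>\<mm>. r \<odot>\<^bsub>E\<^esub> y1 = \<zero>\<^bsub>E\<^esub>) \<and> (t, y \<ominus>\<^bsub>E\<^esub> y1) \<in> C"
    and \<Gamma>0: "linrel R A E \<Gamma>0" "functional A E \<Gamma>0" "\<Gamma>0 \<subseteq> C" "Domain \<Gamma>0 \<subseteq> T"
  obtains f where "lin R A T E (carrier E) f" "\<And>x y. (x,y) \<in> \<Gamma>0 \<Longrightarrow> f x = y" "\<And>x. x \<in> T \<Longrightarrow> (x, f x) \<in> C"
proof -
  note ME = baer_module[OF E]
  interpret A: module R A by (rule A)
  interpret E: module R E by (rule ME)
  define AT where "AT = A\<lparr>carrier := T\<rparr>"
  have AT: "Module.module R AT" unfolding AT_def by (rule submod_module[OF A T(1)])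
  have TA: "T \<subseteq> carrier A" by (rule submod_subset[OF T(1)])
  have iff: "linrel R AT E \<Gamma> \<longleftrightarrow> linrel R A E \<Gamma> \<and> Domain \<Gamma> \<subseteq> T" for \<Gamma>
    unfolding linrel_def AT_def using TA by auto
  have fn: "functional AT E \<Gamma> = functional A E \<Gamma>" for \<Gamma> unfolding functional_def AT_def by simp
  define C' where "C' = {(x,y)\<in>C. x \<in> T}"
  have C': "linrel R AT E C'" unfolding linrel_def C'_def AT_def
    using submod_zero[OF T(1)] submod_add[OF T(1)] submod_smult[OF T(1)] linrel_sub[OF C] linrel_zero[OF C] linrel_add[OF C] linrel_smult[OF C] by auto
  obtain f where f: "lin_map R AT E f" "\<And>x y. (x,y) \<in> \<Gamma>0 \<Longrightarrow> f x = y" "\<And>x. x \<in> carrier AT \<Longrightarrow> (x, f x) \<in> C'"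
  proof (rule linrel_extend[OF AT ME _ _ _ C'])
    show "linrel R AT E \<Gamma>0" using \<Gamma>0 iff by blast
    show "functional AT E \<Gamma>0" using \<Gamma>0 fn by blast
    show "\<Gamma>0 \<subseteq> C'" using \<Gamma>0(3,4) unfolding C'_def by auto
  next
    fix \<Gamma> assume G: "linrel R AT E \<Gamma>" "functional AT E \<Gamma>" "\<Gamma>0 \<subseteq> \<Gamma>" "\<Gamma> \<subseteq> C'" "Domain \<Gamma> \<noteq> carrier AT"
    have \<Gamma>: "linrel R A E \<Gamma>" "functional A E \<Gamma>" "Domain \<Gamma> \<subseteq> T" using G iff fn by auto
    have GC: "\<Gamma> \<subseteq> C" using G(4) unfolding C'_def by blast
    have D: "submodule (Domain \<Gamma>) R A" by (rule linrel_domain[OF A \<Gamma>(1)])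
    obtain t0 where t0: "t0 \<in> T" "t0 \<notin> Domain \<Gamma>" using G(5) \<Gamma>(3) unfolding AT_def by auto
    obtain t r0 where t: "r0 \<in> carrier R" "t = r0 \<odot>\<^bsub>A\<^esub> t0" "t \<notin> Domain \<Gamma>" "\<And>x. x \<in> gens \<Longrightarrow> x \<odot>\<^bsub>A\<^esub> t \<in> Domain \<Gamma>"
      by (rule tors_socle_step[OF A gens_carr gens_finite order_refl D subsetD[OF T(2) t0(1)] t0(2)]) blast
    have tT: "t \<in> T" unfolding t(2) by (rule submod_smult[OF T(1) t(1) t0(1)])
    have tA: "t \<in> carrier A" using tT TA by blast
    have mt: "r \<odot>\<^bsub>A\<^esub> t \<in> Domain \<Gamma>" if "r \<in> \<mm>" for r by (rule m_smult_in[OF A D tA t(4) that])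
    define \<Delta> where "\<Delta> = {(r,z). r \<in> carrier R \<and> (r \<odot>\<^bsub>A\<^esub> t, z) \<in> \<Gamma>}"
    have "linrel R (Rmod R) E \<Delta>"
      unfolding linrel_def
    proof (intro conjI allI impI ballI)
      show "\<Delta> \<subseteq> carrier (Rmod R) \<times> carrier E" unfolding \<Delta>_def using linrel_sub[OF \<Gamma>(1)] by auto
      show "(\<zero>\<^bsub>Rmod R\<^esub>, \<zero>\<^bsub>E\<^esub>) \<in> \<Delta>" unfolding \<Delta>_def using linrel_zero[OF \<Gamma>(1)] tA by auto
      fix x y x' y' assume "(x,y) \<in> \<Delta>" "(x',y') \<in> \<Delta>"
      then show "(x \<oplus>\<^bsub>Rmod R\<^esub> x', y \<oplus>\<^bsub>E\<^esub> y') \<in> \<Delta>" unfolding \<Delta>_def using linrel_add[OF \<Gamma>(1)] tA by (auto simp: A.smult_l_distr)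
    next
      fix r x y assume "r \<in> carrier R" "(x,y) \<in> \<Delta>"
      then show "(r \<odot>\<^bsub>Rmod R\<^esub> x, r \<odot>\<^bsub>E\<^esub> y) \<in> \<Delta>" unfolding \<Delta>_def using linrel_smult[OF \<Gamma>(1)] tA by (auto simp: A.smult_assoc1)
    qed
    moreover have "functional (Rmod R) E \<Delta>" unfolding functional_def \<Delta>_def using \<Gamma>(2) tA unfolding functional_def by auto
    ultimately obtain y where y: "y \<in> carrier E" "\<forall>(r,z)\<in>\<Delta>. z = r \<odot>\<^bsub>E\<^esub> y" using E unfolding baer_def by blast
    have yz: "z = r \<odot>\<^bsub>E\<^esub> y" if "r \<in> carrier R" "(r \<odot>\<^bsub>A\<^esub> t, z) \<in> \<Gamma>" for r z using y(2) that unfolding \<Delta>_def by auto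
    have "(r \<odot>\<^bsub>A\<^esub> t, r \<odot>\<^bsub>E\<^esub> y) \<in> C" if r: "r \<in> \<mm>" for r
    proof -
      obtain z where "(r \<odot>\<^bsub>A\<^esub> t, z) \<in> \<Gamma>" using mt[OF r] by blast
      then show ?thesis using yz[OF m_carr[OF r], of z] GC by auto
    qed
    then obtain y1 where y1: "y1 \<in> carrier E" "\<forall>r\<in>\<mm>. r \<odot>\<^bsub>E\<^esub> y1 = \<zero>\<^bsub>E\<^esub>" "(t, y \<ominus>\<^bsub>E\<^esub> y1) \<in> C" using adj[OF tT y(1)] by blast
    have "z = r \<odot>\<^bsub>E\<^esub> (y \<ominus>\<^bsub>E\<^esub> y1)" if r: "r \<in> carrier R" "(r \<odot>\<^bsub>A\<^esub> t, z) \<in> \<Gamma>" for r z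
    proof -
      have "r \<in> \<mm>" using mem_of_unit_smult[OF A D tA r(1)] r(2) t(3) by blast
      then show ?thesis using yz[OF r] y(1) y1 r(1) by (simp add: mod_smult_diff[OF ME] mod_diff_zero[OF ME])
    qed
    then show "\<exists>t y. t \<in> carrier AT \<and> t \<notin> Domain \<Gamma> \<and> (t,y) \<in> C' \<and> (\<forall>r\<in>carrier R. \<forall>z. (r \<odot>\<^bsub>AT\<^esub> t, z) \<in> \<Gamma> \<longrightarrow> z = r \<odot>\<^bsub>E\<^esub> y)"
      by (intro exI[of _ t] exI[of _ "y \<ominus>\<^bsub>E\<^esub> y1"]) (use tT t(3) y1(3) in \<open>auto simp: AT_def C'_def\<close>)
  qed blast
  show thesis
  proof (rule that[of f])
    show "lin R A T E (carrier E) f" using f(1) unfolding lin_def AT_def by simp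
    show "\<And>x. x \<in> T \<Longrightarrow> (x, f x) \<in> C" using f(3) unfolding AT_def C'_def by auto
  qed (use f in auto)
qed

end

section \<open>Maps between torsion subcomplexes from vanishing of Ext\<close>

text \<open>A map out of \<open>R/\<aa>\<close> is an element killed by \<open>\<aa>\<close>, so this is \<open>Ext\<^sup>i(R/\<aa>, N) = 0\<close>.\<close>

definition (in injective_complex) ext_vanishes :: "'a set \<Rightarrow> nat \<Rightarrow> bool" where
  "ext_vanishes \<aa> i \<longleftrightarrow> (\<forall>e\<in>carrier (Y (Suc i)). d (Suc i) e = \<zero>\<^bsub>Y (Suc (Suc i))\<^esub> \<longrightarrow> (\<forall>a\<in>\<aa>. a \<odot>\<^bsub>Y (Suc i)\<^esub> e = \<zero>\<^bsub>Y (Suc i)\<^esub>) \<longrightarrow>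
     (\<exists>e'\<in>carrier (Y i). (\<forall>a\<in>\<aa>. a \<odot>\<^bsub>Y i\<^esub> e' = \<zero>\<^bsub>Y i\<^esub>) \<and> d i e' = e))"

lemma (in injective_complex) ext_vanishesD:
  assumes "ext_vanishes \<aa> i" "e \<in> carrier (Y (Suc i))" "d (Suc i) e = \<zero>\<^bsub>Y (Suc (Suc i))\<^esub>" "\<And>a. a \<in> \<aa> \<Longrightarrow> a \<odot>\<^bsub>Y (Suc i)\<^esub> e = \<zero>\<^bsub>Y (Suc i)\<^esub>"
  obtains e' where "e' \<in> carrier (Y i)" "\<And>a. a \<in> \<aa> \<Longrightarrow> a \<odot>\<^bsub>Y i\<^esub> e' = \<zero>\<^bsub>Y i\<^esub>" "d i e' = e"
  using assms unfolding ext_vanishes_def by blast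

locale local_coresolution = coresolution R Y d N \<eta> + local_noetherian R \<mm>
  for R :: "('a,'r) ring_scheme" (structure) and Y :: "nat \<Rightarrow> ('a,'e) module" and d :: "nat \<Rightarrow> 'e \<Rightarrow> 'e" and N :: "('a,'b,'m) module_scheme" and \<eta> :: "'b \<Rightarrow> 'e" and \<mm>
begin

text \<open>\<open>torsion_extension\<close> with the side condition \<open>d (\<psi> z) = z\<close> gives a linear section of the differential
  onto the torsion cocycles; \<open>Ext\<^sup>i(k, N) = 0\<close> provides the corrections by socle elements.\<close>

lemma lift_torsion_cocycles:
  assumes van: "ext_vanishes \<mm> i"
  defines "T \<equiv> {z\<in>tors R (Y (Suc i)) gens. d (Suc i) z = \<zero>\<^bsub>Y (Suc (Suc i))\<^esub>}"
  obtains \<psi> where "lin R (Y (Suc i)) T (Y i) (carrier (Y i)) \<psi>" "\<And>z. z \<in> T \<Longrightarrow> d i (\<psi> z) = z"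
proof -
  interpret Ym: module R "Y j" for j by (rule modY)
  have Ts: "submodule (tors R (Y (Suc i)) gens) R (Y (Suc i))" by (rule tors_submod[OF modY gens_carr])
  have tc: "z \<in> carrier (Y (Suc i))" if "z \<in> tors R (Y (Suc i)) gens" for z by (rule tors_closed[OF modY that])
  have T: "submodule T R (Y (Suc i))" unfolding T_def
    using lin_kernel[OF modY modY Ts lin_mono[OF d_lin submod_subset[OF Ts] order_refl]] .
  define C where "C = {(t,y). t \<in> carrier (Y (Suc i)) \<and> y \<in> carrier (Y i) \<and> d i y = t}"
  have C: "linrel R (Y (Suc i)) (Y i) C" unfolding linrel_def C_def
    by (auto simp: d_zero d_add d_smult)
  define \<Gamma>0 where "\<Gamma>0 = {(\<zero>\<^bsub>Y (Suc i)\<^esub>, \<zero>\<^bsub>Y i\<^esub>)}"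
  obtain \<psi> where \<psi>: "lin R (Y (Suc i)) T (Y i) (carrier (Y i)) \<psi>" "\<And>x. x \<in> T \<Longrightarrow> (x, \<psi> x) \<in> C"
  proof (rule torsion_extension[OF modY T _ baerY C, of \<Gamma>0])
    show "T \<subseteq> tors R (Y (Suc i)) gens" unfolding T_def by blast
    show "linrel R (Y (Suc i)) (Y i) \<Gamma>0" unfolding linrel_def \<Gamma>0_def by auto
    show "functional (Y (Suc i)) (Y i) \<Gamma>0" unfolding functional_def \<Gamma>0_def by auto
    show "\<Gamma>0 \<subseteq> C" unfolding \<Gamma>0_def C_def by (simp add: d_zero)
    show "Domain \<Gamma>0 \<subseteq> T" unfolding \<Gamma>0_def using submod_zero[OF T] by auto
  next
    fix t y assume t: "t \<in> T" and y: "y \<in> carrier (Y i)" and rC: "\<And>r. r \<in> \<mm> \<Longrightarrow> (r \<odot>\<^bsub>Y (Suc i)\<^esub> t, r \<odot>\<^bsub>Y i\<^esub> y) \<in> C"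
    have tY: "t \<in> carrier (Y (Suc i))" and dt: "d (Suc i) t = \<zero>\<^bsub>Y (Suc (Suc i))\<^esub>" using t tc unfolding T_def by auto
    have dy: "d i y \<in> carrier (Y (Suc i))" by (rule d_closed[OF y])
    obtain y1 where y1: "y1 \<in> carrier (Y i)" "\<And>r. r \<in> \<mm> \<Longrightarrow> r \<odot>\<^bsub>Y i\<^esub> y1 = \<zero>\<^bsub>Y i\<^esub>" "d i y1 = d i y \<ominus>\<^bsub>Y (Suc i)\<^esub> t"
    proof (rule ext_vanishesD[OF van])
      show "d i y \<ominus>\<^bsub>Y (Suc i)\<^esub> t \<in> carrier (Y (Suc i))" using dy tY by simp
      show "d (Suc i) (d i y \<ominus>\<^bsub>Y (Suc i)\<^esub> t) = \<zero>\<^bsub>Y (Suc (Suc i))\<^esub>"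
        using d_diff[OF dy tY] dt dd[OF y] mod_diff_self[OF modY] by simp
      fix r assume r: "r \<in> \<mm>"
      have "r \<odot>\<^bsub>Y (Suc i)\<^esub> d i y = r \<odot>\<^bsub>Y (Suc i)\<^esub> t" using rC[OF r] d_smult[OF m_carr[OF r] y] unfolding C_def by simp
      then show "r \<odot>\<^bsub>Y (Suc i)\<^esub> (d i y \<ominus>\<^bsub>Y (Suc i)\<^esub> t) = \<zero>\<^bsub>Y (Suc i)\<^esub>"
        using mod_smult_diff[OF modY m_carr[OF r] dy tY] mod_diff_self[OF modY] tY m_carr[OF r] by simp
    qed blast
    have "d i (y \<ominus>\<^bsub>Y i\<^esub> y1) = t" using d_diff[OF y y1(1)] y1(3) mod_diff_diff[OF modY dy tY] by simp
    then show "\<exists>y1\<in>carrier (Y i). (\<forall>r\<in>\<mm>. r \<odot>\<^bsub>Y i\<^esub> y1 = \<zero>\<^bsub>Y i\<^esub>) \<and> (t, y \<ominus>\<^bsub>Y i\<^esub> y1) \<in> C"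
      using y y1 tY unfolding C_def by auto
  qed blast
  show thesis by (rule that[OF \<psi>(1)]) (use \<psi>(2) in \<open>auto simp: C_def\<close>)
qed

text \<open>The section of \<open>lift_torsion_cocycles\<close>, applied to \<open>\<mm> w\<close>, gives a linear map \<open>\<mm> \<rightarrow> I\<^sup>i\<^sup>-\<^sup>1\<close>, which is
  multiplication by some \<open>z\<close>. Then \<open>w - d z\<close> is killed by \<open>\<mm>\<close> and has the same boundary.\<close>

lemma torsion_boundary_from_socle:
  assumes van: "ext_vanishes \<mm> i" and w: "w \<in> tors R (Y (Suc i)) gens"
    and k: "\<And>r. r \<in> \<mm> \<Longrightarrow> r \<odot>\<^bsub>Y (Suc (Suc i))\<^esub> d (Suc i) w = \<zero>\<^bsub>Y (Suc (Suc i))\<^esub>"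
  obtains w' where "w' \<in> carrier (Y (Suc i))" "\<And>r. r \<in> \<mm> \<Longrightarrow> r \<odot>\<^bsub>Y (Suc i)\<^esub> w' = \<zero>\<^bsub>Y (Suc i)\<^esub>" "d (Suc i) w' = d (Suc i) w"
proof -
  interpret Ym: module R "Y j" for j by (rule modY)
  define T where "T = {z\<in>tors R (Y (Suc i)) gens. d (Suc i) z = \<zero>\<^bsub>Y (Suc (Suc i))\<^esub>}"
  obtain \<psi> where \<psi>: "lin R (Y (Suc i)) T (Y i) (carrier (Y i)) \<psi>" "\<And>z. z \<in> T \<Longrightarrow> d i (\<psi> z) = z"
    using lift_torsion_cocycles[OF van] unfolding T_def by blast
  have wY: "w \<in> carrier (Y (Suc i))" by (rule tors_closed[OF modY w])
  have Ts: "submodule (tors R (Y (Suc i)) gens) R (Y (Suc i))" by (rule tors_submod[OF modY gens_carr])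
  have rw: "r \<odot>\<^bsub>Y (Suc i)\<^esub> w \<in> T" if "r \<in> \<mm>" for r
    unfolding T_def using submod_smult[OF Ts m_carr[OF that] w] d_smult[OF m_carr[OF that] wY] k[OF that] by simp
  have l1: "lin R (Rmod R) \<mm> (Y (Suc i)) T (\<lambda>r. r \<odot>\<^bsub>Y (Suc i)\<^esub> w)"
    by (rule linI) (auto simp: rw Ym.smult_l_distr Ym.smult_assoc1 wY m_carr)
  have "lin R (Rmod R) \<mm> (Y i) (carrier (Y i)) (\<lambda>r. \<psi> (r \<odot>\<^bsub>Y (Suc i)\<^esub> w))" by (rule lin_comp[OF l1 \<psi>(1)]) simp
  then obtain z where z: "z \<in> carrier (Y i)" "\<And>r. r \<in> \<mm> \<Longrightarrow> \<psi> (r \<odot>\<^bsub>Y (Suc i)\<^esub> w) = r \<odot>\<^bsub>Y i\<^esub> z"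
    by (rule baer_ideal[OF cR baerY idm]) (auto intro: that)
  have dz: "d i z \<in> carrier (Y (Suc i))" by (rule d_closed[OF z(1)])
  show thesis
  proof (rule that[of "w \<ominus>\<^bsub>Y (Suc i)\<^esub> d i z"])
    show "w \<ominus>\<^bsub>Y (Suc i)\<^esub> d i z \<in> carrier (Y (Suc i))" using wY dz by simp
    show "d (Suc i) (w \<ominus>\<^bsub>Y (Suc i)\<^esub> d i z) = d (Suc i) w"
      using d_diff[OF wY dz] dd[OF z(1)] mod_diff_zero[OF modY d_closed[OF wY]] by simp
    fix r assume r: "r \<in> \<mm>"
    have "r \<odot>\<^bsub>Y (Suc i)\<^esub> d i z = r \<odot>\<^bsub>Y (Suc i)\<^esub> w" using \<psi>(2)[OF rw[OF r]] z(2)[OF r] d_smult[OF m_carr[OF r] z(1)] by simp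
    then show "r \<odot>\<^bsub>Y (Suc i)\<^esub> (w \<ominus>\<^bsub>Y (Suc i)\<^esub> d i z) = \<zero>\<^bsub>Y (Suc i)\<^esub>"
      using mod_smult_diff[OF modY m_carr[OF r] wY dz] mod_diff_self[OF modY] wY m_carr[OF r] by simp
  qed
qed

text \<open>Since \<open>e\<close> is not a boundary of torsion and the ring is local, sending \<open>e\<close> to \<open>e'\<close> and all boundaries of
  torsion to zero is a consistent prescription. It extends with cocycles as values: for a new
  element injectivity gives a value \<open>y\<close> with \<open>\<mm> d y = 0\<close>, and as \<open>Ext\<^sup>a\<^sup>+\<^sup>1(k, N) = 0\<close> there is an
  element with the same boundary that is killed by \<open>\<mm>\<close> and can be subtracted.\<close>

lemma socle_map:
  assumes van: "ext_vanishes \<mm> (Suc a)"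
    and e': "e' \<in> carrier (Y (Suc a))" "d (Suc a) e' = \<zero>\<^bsub>Y (Suc (Suc a))\<^esub>" "\<And>r. r \<in> \<mm> \<Longrightarrow> r \<odot>\<^bsub>Y (Suc a)\<^esub> e' = \<zero>\<^bsub>Y (Suc a)\<^esub>"
    and e: "e \<in> carrier (Y (Suc b))" "\<And>r. r \<in> \<mm> \<Longrightarrow> r \<odot>\<^bsub>Y (Suc b)\<^esub> e = \<zero>\<^bsub>Y (Suc b)\<^esub>"
    and ne: "\<And>w. w \<in> tors R (Y b) gens \<Longrightarrow> d b w \<noteq> e"
  obtains f where "lin R (Y (Suc b)) (tors R (Y (Suc b)) gens) (Y (Suc a)) (carrier (Y (Suc a))) f"
    "\<And>t. t \<in> tors R (Y (Suc b)) gens \<Longrightarrow> d (Suc a) (f t) = \<zero>\<^bsub>Y (Suc (Suc a))\<^esub>"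
    "\<And>w. w \<in> tors R (Y b) gens \<Longrightarrow> f (d b w) = \<zero>\<^bsub>Y (Suc a)\<^esub>" "e \<in> tors R (Y (Suc b)) gens" "f e = e'"
proof -
  interpret Ym: module R "Y j" for j by (rule modY)
  let ?T = "tors R (Y (Suc b)) gens"
  have T: "submodule ?T R (Y (Suc b))" by (rule tors_submod[OF modY gens_carr])
  have Tb: "submodule (tors R (Y b) gens) R (Y b)" by (rule tors_submod[OF modY gens_carr])
  have tb: "w \<in> tors R (Y b) gens \<Longrightarrow> w \<in> carrier (Y b)" for w by (rule tors_closed[OF modY])
  have eT: "e \<in> ?T" unfolding tors_def
  proof (intro CollectI conjI ballI e(1))
    fix x assume x: "x \<in> gens"
    then have "(x [^] (1::nat)) \<odot>\<^bsub>Y (Suc b)\<^esub> e = \<zero>\<^bsub>Y (Suc b)\<^esub>" using e(2)[of x] gens_sub gens_carr by (auto simp: subset_iff)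
    then show "\<exists>s::nat. (x [^] s) \<odot>\<^bsub>Y (Suc b)\<^esub> e = \<zero>\<^bsub>Y (Suc b)\<^esub>" by blast
  qed
  define C where "C = {(t,y). t \<in> carrier (Y (Suc b)) \<and> y \<in> carrier (Y (Suc a)) \<and> d (Suc a) y = \<zero>\<^bsub>Y (Suc (Suc a))\<^esub>}"
  have C: "linrel R (Y (Suc b)) (Y (Suc a)) C" unfolding linrel_def C_def by (auto simp: d_zero d_add d_smult)
  define G1 where "G1 = {(d b w, \<zero>\<^bsub>Y (Suc a)\<^esub>) |w. w \<in> tors R (Y b) gens}"
  have G1: "linrel R (Y (Suc b)) (Y (Suc a)) G1"
    unfolding linrel_def
  proof (intro conjI allI impI ballI)
    show "G1 \<subseteq> carrier (Y (Suc b)) \<times> carrier (Y (Suc a))" unfolding G1_def using tb d_closed by auto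
    show "(\<zero>\<^bsub>Y (Suc b)\<^esub>, \<zero>\<^bsub>Y (Suc a)\<^esub>) \<in> G1" unfolding G1_def using submod_zero[OF Tb] d_zero[of b] by (intro CollectI exI[of _ "\<zero>\<^bsub>Y b\<^esub>"]) simp
    fix x y x' y' assume "(x,y) \<in> G1" "(x',y') \<in> G1"
    then obtain w w' where "w \<in> tors R (Y b) gens" "w' \<in> tors R (Y b) gens" "x = d b w" "x' = d b w'" "y = \<zero>\<^bsub>Y (Suc a)\<^esub>" "y' = \<zero>\<^bsub>Y (Suc a)\<^esub>"
      unfolding G1_def by blast
    then show "(x \<oplus>\<^bsub>Y (Suc b)\<^esub> x', y \<oplus>\<^bsub>Y (Suc a)\<^esub> y') \<in> G1" unfolding G1_def using submod_add[OF Tb, of w w'] d_add[of w b w'] tb by (intro CollectI exI[of _ "w \<oplus>\<^bsub>Y b\<^esub> w'"]) simp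
  next
    fix r x y assume r: "r \<in> carrier R" and "(x,y) \<in> G1"
    then obtain w where "w \<in> tors R (Y b) gens" "x = d b w" "y = \<zero>\<^bsub>Y (Suc a)\<^esub>" unfolding G1_def by blast
    then show "(r \<odot>\<^bsub>Y (Suc b)\<^esub> x, r \<odot>\<^bsub>Y (Suc a)\<^esub> y) \<in> G1" unfolding G1_def using submod_smult[OF Tb r, of w] d_smult[OF r, of w b] tb r by (intro CollectI exI[of _ "r \<odot>\<^bsub>Y b\<^esub> w"]) simp
  qed
  have G1f: "functional (Y (Suc b)) (Y (Suc a)) G1" unfolding functional_def G1_def by auto
  have DG1: "submodule (Domain G1) R (Y (Suc b))" by (rule linrel_domain[OF modY G1])
  have eD: "e \<notin> Domain G1" using ne unfolding G1_def by auto
  define \<Gamma>0 where "\<Gamma>0 = {(x \<oplus>\<^bsub>Y (Suc b)\<^esub> r \<odot>\<^bsub>Y (Suc b)\<^esub> e, z \<oplus>\<^bsub>Y (Suc a)\<^esub> r \<odot>\<^bsub>Y (Suc a)\<^esub> e') |x z r. (x,z) \<in> G1 \<and> r \<in> carrier R}"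
  have stp: "z = r \<odot>\<^bsub>Y (Suc a)\<^esub> e'" if r: "r \<in> carrier R" "(r \<odot>\<^bsub>Y (Suc b)\<^esub> e, z) \<in> G1" for r z
  proof -
    have "r \<in> \<mm>" using mem_of_unit_smult[OF modY DG1 e(1) r(1)] r(2) eD by blast
    moreover have "z = \<zero>\<^bsub>Y (Suc a)\<^esub>" using r(2) unfolding G1_def by blast
    ultimately show ?thesis using e'(3) by simp
  qed
  note ext = linrel_extend_one[OF modY modY G1 G1f e(1) e'(1) stp, folded \<Gamma>0_def]
  obtain f where f: "lin R (Y (Suc b)) ?T (Y (Suc a)) (carrier (Y (Suc a))) f" "\<And>x y. (x,y) \<in> \<Gamma>0 \<Longrightarrow> f x = y" "\<And>x. x \<in> ?T \<Longrightarrow> (x, f x) \<in> C"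
  proof (rule torsion_extension[OF modY T order_refl baerY C _ ext(1,2)])
    show "\<Gamma>0 \<subseteq> C" unfolding \<Gamma>0_def C_def G1_def using e(1) e'(1,2) tb d_closed by (auto simp: d_add d_smult d_zero)
    show "Domain \<Gamma>0 \<subseteq> ?T" unfolding \<Gamma>0_def G1_def
      using submod_add[OF T d_tors[OF gens_carr] submod_smult[OF T _ eT]] by auto
  next
    fix t y assume t: "t \<in> ?T" and y: "y \<in> carrier (Y (Suc a))" and rC: "\<And>r. r \<in> \<mm> \<Longrightarrow> (r \<odot>\<^bsub>Y (Suc b)\<^esub> t, r \<odot>\<^bsub>Y (Suc a)\<^esub> y) \<in> C"
    obtain y1 where y1: "y1 \<in> carrier (Y (Suc a))" "\<And>r. r \<in> \<mm> \<Longrightarrow> r \<odot>\<^bsub>Y (Suc a)\<^esub> y1 = \<zero>\<^bsub>Y (Suc a)\<^esub>" "d (Suc a) y1 = d (Suc a) y"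
    proof (rule ext_vanishesD[OF van d_closed[OF y] dd[OF y]])
      fix r assume r: "r \<in> \<mm>"
      show "r \<odot>\<^bsub>Y (Suc (Suc a))\<^esub> d (Suc a) y = \<zero>\<^bsub>Y (Suc (Suc a))\<^esub>"
        using rC[OF r] d_smult[OF m_carr[OF r] y] unfolding C_def by simp
    qed blast
    have "d (Suc a) (y \<ominus>\<^bsub>Y (Suc a)\<^esub> y1) = \<zero>\<^bsub>Y (Suc (Suc a))\<^esub>" using d_diff[OF y y1(1)] y1(3) mod_diff_self[OF modY d_closed[OF y]] by simp
    then show "\<exists>y1\<in>carrier (Y (Suc a)). (\<forall>r\<in>\<mm>. r \<odot>\<^bsub>Y (Suc a)\<^esub> y1 = \<zero>\<^bsub>Y (Suc a)\<^esub>) \<and> (t, y \<ominus>\<^bsub>Y (Suc a)\<^esub> y1) \<in> C"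
      using y y1 tors_closed[OF modY t] unfolding C_def by auto
  qed (auto intro: that)
  show thesis
  proof (rule that[OF f(1) _ _ eT])
    show "\<And>t. t \<in> ?T \<Longrightarrow> d (Suc a) (f t) = \<zero>\<^bsub>Y (Suc (Suc a))\<^esub>" using f(3) unfolding C_def by blast
    show "f (d b w) = \<zero>\<^bsub>Y (Suc a)\<^esub>" if "w \<in> tors R (Y b) gens" for w
      using f(2) ext(3) that unfolding G1_def by blast
    show "f e = e'" using f(2)[OF ext(4)] .
  qed
qed

text \<open>The map of \<open>socle_map\<close>, followed by \<open>\<iota>\<close> and extended by zero to the other degrees, is a map of
  complexes of degree \<open>a - b < 0\<close>. It is null homotopic by \<open>torsion_null_homotopy\<close>, and evaluating the
  homotopy at the cocycle \<open>e\<close> shows that \<open>\<iota> e'\<close> is a boundary in the part killed by \<open>\<mm>\<close>. With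
  \<open>b = a + c + 2\<close>, the two assumed vanishing degrees are \<open>a + 1\<close> and \<open>b - 1\<close>.\<close>

lemma gap_trivialises:
  assumes van1: "ext_vanishes \<mm> (Suc a)" and van2: "ext_vanishes \<mm> (Suc (a + c))"
    and e': "e' \<in> carrier (Y (Suc a))" "d (Suc a) e' = \<zero>\<^bsub>Y (Suc (Suc a))\<^esub>" "\<And>r. r \<in> \<mm> \<Longrightarrow> r \<odot>\<^bsub>Y (Suc a)\<^esub> e' = \<zero>\<^bsub>Y (Suc a)\<^esub>"
    and nv: "\<not> ext_vanishes \<mm> (Suc (Suc (a + c)))"
    and J: "coresolution R Y' d' N' \<eta>'" and \<iota>: "\<And>i. lin_map R (Y i) (Y' i) (\<iota> i)"
    "\<And>i y. y \<in> carrier (Y i) \<Longrightarrow> d' i (\<iota> i y) = \<iota> (Suc i) (d i y)"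
    and nil: "\<And>x. x \<in> \<mm> \<Longrightarrow> \<exists>u::nat. \<forall>y\<in>carrier N'. (x [^] u) \<odot>\<^bsub>N'\<^esub> y = \<zero>\<^bsub>N'\<^esub>"
  obtains s where "s \<in> carrier (Y' a)" "\<And>r. r \<in> \<mm> \<Longrightarrow> r \<odot>\<^bsub>Y' a\<^esub> s = \<zero>\<^bsub>Y' a\<^esub>" "d' a s = \<iota> (Suc a) e'"
proof -
  interpret J: coresolution R Y' d' N' \<eta>' by (rule J)
  interpret Jm: module R "Y' j" for j by (rule J.modY)
  interpret Ym: module R "Y j" for j by (rule modY)
  let ?b = "Suc (Suc (a + c))"
  obtain e where e: "e \<in> carrier (Y (Suc ?b))" "d (Suc ?b) e = \<zero>\<^bsub>Y (Suc (Suc ?b))\<^esub>" "\<And>r. r \<in> \<mm> \<Longrightarrow> r \<odot>\<^bsub>Y (Suc ?b)\<^esub> e = \<zero>\<^bsub>Y (Suc ?b)\<^esub>"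
    "\<And>w. w \<in> carrier (Y ?b) \<Longrightarrow> (\<And>r. r \<in> \<mm> \<Longrightarrow> r \<odot>\<^bsub>Y ?b\<^esub> w = \<zero>\<^bsub>Y ?b\<^esub>) \<Longrightarrow> d ?b w \<noteq> e"
    using nv unfolding ext_vanishes_def by blast
  have ne: "d ?b w \<noteq> e" if w: "w \<in> tors R (Y ?b) gens" for w
  proof
    assume dw: "d ?b w = e"
    have k: "\<And>r. r \<in> \<mm> \<Longrightarrow> r \<odot>\<^bsub>Y (Suc ?b)\<^esub> d ?b w = \<zero>\<^bsub>Y (Suc ?b)\<^esub>" using e(3) dw by simp
    obtain w' where "w' \<in> carrier (Y ?b)" "\<And>r. r \<in> \<mm> \<Longrightarrow> r \<odot>\<^bsub>Y ?b\<^esub> w' = \<zero>\<^bsub>Y ?b\<^esub>" "d ?b w' = d ?b w"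
      by (rule torsion_boundary_from_socle[OF van2 w k]) auto
    then show False using e(4) dw by blast
  qed
  obtain f where f: "lin R (Y (Suc ?b)) (tors R (Y (Suc ?b)) gens) (Y (Suc a)) (carrier (Y (Suc a))) f"
    "\<And>t. t \<in> tors R (Y (Suc ?b)) gens \<Longrightarrow> d (Suc a) (f t) = \<zero>\<^bsub>Y (Suc (Suc a))\<^esub>"
    "\<And>w. w \<in> tors R (Y ?b) gens \<Longrightarrow> f (d ?b w) = \<zero>\<^bsub>Y (Suc a)\<^esub>" and eT: "e \<in> tors R (Y (Suc ?b)) gens" and fe: "f e = e'"
    by (rule socle_map[OF van1 e' e(1,3) ne]) auto
  define F where "F i y = (if i = Suc a then \<iota> (Suc a) (f y) else \<zero>\<^bsub>Y' i\<^esub>)" for i y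
  have \<iota>0: "\<iota> i \<zero>\<^bsub>Y i\<^esub> = \<zero>\<^bsub>Y' i\<^esub>" for i by (rule lin_zero[OF modY J.modY subY \<iota>(1)])
  have \<iota>f: "lin R (Y (Suc ?b)) (tors R (Y (Suc ?b)) gens) (Y' (Suc a)) (carrier (Y' (Suc a))) (\<lambda>y. \<iota> (Suc a) (f y))"
    by (rule lin_comp[OF f(1) \<iota>(1)]) simp
  have "\<exists>s. (\<forall>i. lin_map R (Y (Suc (Suc (i + Suc c)))) (Y' i) (s i)) \<and>
    (\<forall>i. \<forall>y\<in>tors R (Y (Suc (Suc (i + Suc c)))) gens. F (Suc i) y = d' i (s i y) \<oplus>\<^bsub>Y' (Suc i)\<^esub> s (Suc i) (d (Suc (Suc (i + Suc c))) y))"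
  proof (rule torsion_null_homotopy[OF J.injective_complex_axioms NR gens_finite gens_carr])
    show "lin R (Y (Suc (i + Suc c))) (tors R (Y (Suc (i + Suc c))) gens) (Y' i) (carrier (Y' i)) (F i)" for i
    proof (cases "i = Suc a")
      case True then show ?thesis unfolding F_def using \<iota>f by simp
    next
      case False then show ?thesis unfolding F_def using lin_zero_map[OF modY J.modY J.subY] by simp
    qed
    show "d' i (F i y) = F (Suc i) (d (Suc (i + Suc c)) y)" if y: "y \<in> tors R (Y (Suc (i + Suc c))) gens" for i y
    proof -
      consider "i = Suc a" | "i = a" | "i \<noteq> Suc a" "i \<noteq> a" by blast
      then show ?thesis
      proof cases
        case 1
        then have yT: "y \<in> tors R (Y (Suc ?b)) gens" using y by simp
        have "d' (Suc a) (\<iota> (Suc a) (f y)) = \<iota> (Suc (Suc a)) (d (Suc a) (f y))" by (rule \<iota>(2)[OF lin_closed[OF f(1) yT]])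
        then show ?thesis unfolding F_def using 1 f(2)[OF yT] \<iota>0 by simp
      next
        case 2
        then have yT: "y \<in> tors R (Y ?b) gens" using y by simp
        then show ?thesis unfolding F_def using 2 f(3)[OF yT] \<iota>0 J.d_zero by simp
      next
        case 3 then show ?thesis unfolding F_def using J.d_zero by simp
      qed
    qed
    show "\<exists>u::nat. \<exists>\<sigma>. (\<forall>i. lin_map R (Y' (Suc i)) (Y' i) (\<sigma> i)) \<and>
      (\<forall>i. \<forall>y\<in>carrier (Y' (Suc i)). (x [^] u) \<odot>\<^bsub>Y' (Suc i)\<^esub> y = d' i (\<sigma> i y) \<oplus>\<^bsub>Y' (Suc i)\<^esub> \<sigma> (Suc i) (d' (Suc i) y))"
      if x: "x \<in> gens" for x
    proof -
      obtain u :: nat where u: "\<forall>y\<in>carrier N'. (x [^] u) \<odot>\<^bsub>N'\<^esub> y = \<zero>\<^bsub>N'\<^esub>" using nil gens_sub x by blast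
      have "x [^] u \<in> carrier R" using gens_carr x by auto
      then obtain \<sigma> where "\<And>i. lin_map R (Y' (Suc i)) (Y' i) (\<sigma> i)"
        "\<And>i y. y \<in> carrier (Y' (Suc i)) \<Longrightarrow> (x [^] u) \<odot>\<^bsub>Y' (Suc i)\<^esub> y = d' i (\<sigma> i y) \<oplus>\<^bsub>Y' (Suc i)\<^esub> \<sigma> (Suc i) (d' (Suc i) y)"
        by (rule J.multiplication_null_homotopic) (use u in auto)
      then show ?thesis by blast
    qed
  qed
  then obtain s where s: "\<And>i. lin_map R (Y (Suc (Suc (i + Suc c)))) (Y' i) (s i)"
    "\<And>i y. y\<in>tors R (Y (Suc (Suc (i + Suc c)))) gens \<Longrightarrow> F (Suc i) y = d' i (s i y) \<oplus>\<^bsub>Y' (Suc i)\<^esub> s (Suc i) (d (Suc (Suc (i + Suc c))) y)" by blast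
  have sa: "lin_map R (Y (Suc ?b)) (Y' a) (s a)" using s(1)[of a] by simp
  have sSa: "lin_map R (Y (Suc (Suc ?b))) (Y' (Suc a)) (s (Suc a))" using s(1)[of "Suc a"] by simp
  have "F (Suc a) e = d' a (s a e) \<oplus>\<^bsub>Y' (Suc a)\<^esub> s (Suc a) (d (Suc ?b) e)" using s(2)[of e a] eT by simp
  then have eq: "\<iota> (Suc a) e' = d' a (s a e)" unfolding F_def e(2) lin_zero[OF modY J.modY subY sSa]
    using fe J.d_closed[OF lin_closed[OF sa e(1)]] by simp
  show thesis
  proof (rule that[of "s a e"])
    show "s a e \<in> carrier (Y' a)" by (rule lin_closed[OF sa e(1)])
    show "d' a (s a e) = \<iota> (Suc a) e'" using eq by simp
    fix r assume r: "r \<in> \<mm>"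
    show "r \<odot>\<^bsub>Y' a\<^esub> s a e = \<zero>\<^bsub>Y' a\<^esub>" using lin_smult[OF sa m_carr[OF r] e(1)] e(3)[OF r] lin_zero[OF modY J.modY subY sa] by simp
  qed
qed

end

section \<open>Free modules\<close>

definition fbasis :: "('a,'r) ring_scheme \<Rightarrow> 'x \<Rightarrow> ('x \<Rightarrow> 'a)" where
  "fbasis R b = (\<lambda>x. if x = b then \<one>\<^bsub>R\<^esub> else \<zero>\<^bsub>R\<^esub>)"

lemma free_module_simps [simp]:
  "\<zero>\<^bsub>free_module R B\<^esub> = (\<lambda>x. \<zero>\<^bsub>R\<^esub>)" "f \<oplus>\<^bsub>free_module R B\<^esub> g = (\<lambda>x. f x \<oplus>\<^bsub>R\<^esub> g x)" "r \<odot>\<^bsub>free_module R B\<^esub> f = (\<lambda>x. r \<otimes>\<^bsub>R\<^esub> f x)"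
  by (simp_all add: free_module_def)

lemma free_carrier: "f \<in> carrier (free_module R B) \<longleftrightarrow> (\<forall>x. f x \<in> carrier R) \<and> finite {x. f x \<noteq> \<zero>\<^bsub>R\<^esub>} \<and> {x. f x \<noteq> \<zero>\<^bsub>R\<^esub>} \<subseteq> B"
  by (simp add: free_module_def)

lemma free_carrierI:
  assumes "{x. g x \<noteq> \<zero>\<^bsub>R\<^esub>} \<subseteq> S" "\<And>x. g x \<in> carrier R" "finite S" "S \<subseteq> B" shows "g \<in> carrier (free_module R B)"
  unfolding free_carrier using assms finite_subset[OF assms(1,3)] by blast

context
  fixes R :: "('a,'r) ring_scheme" (structure)
  assumes cR: "cring R"
begin

interpretation cring R by (rule cR)

lemma free_add_closed: assumes "f \<in> carrier (free_module R B)" "g \<in> carrier (free_module R B)" shows "(\<lambda>x. f x \<oplus> g x) \<in> carrier (free_module R B)"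
proof -
  have "{x. f x \<oplus> g x \<noteq> \<zero>} \<subseteq> {x. f x \<noteq> \<zero>} \<union> {x. g x \<noteq> \<zero>}" by auto
  then show ?thesis using assms unfolding free_carrier by (auto dest: finite_subset)
qed

lemma free_smult_closed: assumes "r \<in> carrier R" "f \<in> carrier (free_module R B)" shows "(\<lambda>x. r \<otimes> f x) \<in> carrier (free_module R B)"
proof -
  have "{x. r \<otimes> f x \<noteq> \<zero>} \<subseteq> {x. f x \<noteq> \<zero>}" using assms by auto
  then show ?thesis using assms unfolding free_carrier by (auto dest: finite_subset)
qed

lemma free_module_module: "Module.module R (free_module R B)"
proof (rule moduleI)
  show "cring R" by (rule cR)
  show "abelian_group (free_module R B)"
  proof (rule abelian_groupI)
    fix f assume f: "f \<in> carrier (free_module R B)"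
    have "{x. \<ominus> f x \<noteq> \<zero>} \<subseteq> {x. f x \<noteq> \<zero>}" by auto
    then have "(\<lambda>x. \<ominus> f x) \<in> carrier (free_module R B)" using f unfolding free_carrier by (auto dest: finite_subset)
    moreover have "(\<lambda>x. \<ominus> f x) \<oplus>\<^bsub>free_module R B\<^esub> f = \<zero>\<^bsub>free_module R B\<^esub>" using f by (auto simp: free_carrier l_neg)
    ultimately show "\<exists>g\<in>carrier (free_module R B). g \<oplus>\<^bsub>free_module R B\<^esub> f = \<zero>\<^bsub>free_module R B\<^esub>" by blast
  qed (auto simp: free_add_closed, auto simp: free_carrier fun_eq_iff a_ac)
qed (auto simp: free_smult_closed, auto simp: free_carrier fun_eq_iff l_distr r_distr m_assoc)

lemma fbasis_closed: "b \<in> B \<Longrightarrow> fbasis R b \<in> carrier (free_module R B)"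
proof -
  assume b: "b \<in> B"
  have "{x. fbasis R b x \<noteq> \<zero>} \<subseteq> {b}" unfolding fbasis_def by auto
  then show ?thesis using b unfolding free_carrier by (auto simp: fbasis_def dest: finite_subset)
qed

lemma free_lin_unique:
  assumes A: "Module.module R A" and \<phi>: "lin_map R (free_module R B) A \<phi>"
    and \<psi>: "lin_map R (free_module R B) A \<psi>"
    and eq: "\<And>b. b \<in> B \<Longrightarrow> \<phi> (fbasis R b) = \<psi> (fbasis R b)" and f: "f \<in> carrier (free_module R B)"
  shows "\<phi> f = \<psi> f"
proof -
  note M = free_module_module[of B]
  have "\<forall>f. f \<in> carrier (free_module R B) \<longrightarrow> {x. f x \<noteq> \<zero>} \<subseteq> J \<longrightarrow> \<phi> f = \<psi> f" if "finite J" for J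
    using that
  proof (induction J rule: finite_induct)
    case empty
    show ?case
    proof (intro allI impI)
      fix f assume "f \<in> carrier (free_module R B)" "{x. f x \<noteq> \<zero>} \<subseteq> {}"
      then have "f = \<zero>\<^bsub>free_module R B\<^esub>" by auto
      then show "\<phi> f = \<psi> f" using lin_zero[OF M A submod_carrier[OF M] \<phi>] lin_zero[OF M A submod_carrier[OF M] \<psi>] by simp
    qed
  next
    case (insert b J)
    show ?case
    proof (intro allI impI)
      fix f assume f: "f \<in> carrier (free_module R B)" "{x. f x \<noteq> \<zero>} \<subseteq> insert b J"
      show "\<phi> f = \<psi> f"
      proof (cases "f b = \<zero>")
        case True
        then have "{x. f x \<noteq> \<zero>} \<subseteq> J" using f by auto
        then show ?thesis using insert f by blast
      next
        case False
        then have b: "b \<in> B" using f unfolding free_carrier by auto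
        let ?g = "f(b := \<zero>)"
        have "{x. ?g x \<noteq> \<zero>} \<subseteq> {x. f x \<noteq> \<zero>}" by auto
        then have g: "?g \<in> carrier (free_module R B)"
          by (rule free_carrierI) (use f(1) in \<open>auto simp: free_carrier\<close>)
        have "{x. ?g x \<noteq> \<zero>} \<subseteq> J" using f(2) by auto
        then have gg: "\<phi> ?g = \<psi> ?g" using insert g by blast
        have fb: "f b \<in> carrier R" using f unfolding free_carrier by blast
        have e: "fbasis R b \<in> carrier (free_module R B)" by (rule fbasis_closed[OF b])
        have eq1: "f = ?g \<oplus>\<^bsub>free_module R B\<^esub> (f b \<odot>\<^bsub>free_module R B\<^esub> fbasis R b)"
          using f(1) by (auto simp: fun_eq_iff fbasis_def free_carrier)
        have c: "f b \<odot>\<^bsub>free_module R B\<^esub> fbasis R b \<in> carrier (free_module R B)" using free_smult_closed[OF fb e] by simp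
        have "\<phi> f = \<phi> ?g \<oplus>\<^bsub>A\<^esub> f b \<odot>\<^bsub>A\<^esub> \<phi> (fbasis R b)" by (subst eq1) (simp only: lin_add[OF \<phi> g c] lin_smult[OF \<phi> fb e])
        moreover have "\<psi> f = \<psi> ?g \<oplus>\<^bsub>A\<^esub> f b \<odot>\<^bsub>A\<^esub> \<psi> (fbasis R b)" by (subst eq1) (simp only: lin_add[OF \<psi> g c] lin_smult[OF \<psi> fb e])
        ultimately show ?thesis using gg eq[OF b] by simp
      qed
    qed
  qed
  then show ?thesis using f unfolding free_carrier by blast
qed

lemma free_lin_exists:
  assumes A: "Module.module R A" and y: "\<And>b. b \<in> B \<Longrightarrow> y b \<in> carrier A"
  obtains \<phi> where "lin_map R (free_module R B) A \<phi>" "\<And>b. b \<in> B \<Longrightarrow> \<phi> (fbasis R b) = y b"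
proof -
  interpret A: module R A by (rule A)
  define \<phi> where "\<phi> f = (\<Oplus>\<^bsub>A\<^esub>b\<in>{x. f x \<noteq> \<zero>}. f b \<odot>\<^bsub>A\<^esub> y b)" for f
  have \<phi>: "\<phi> f = (\<Oplus>\<^bsub>A\<^esub>b\<in>J. f b \<odot>\<^bsub>A\<^esub> y b)" if f: "f \<in> carrier (free_module R B)" and J: "finite J" "{x. f x \<noteq> \<zero>} \<subseteq> J" "J \<subseteq> B" for f J
    unfolding \<phi>_def
    by (rule A.M.add.finprod_mono_neutral_cong_left[OF J(1,2)]) (use f J y in \<open>auto simp: free_carrier\<close>)
  have fin: "finite {x. f x \<noteq> \<zero>}" "{x. f x \<noteq> \<zero>} \<subseteq> B" if "f \<in> carrier (free_module R B)" for f using that unfolding free_carrier by auto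
  have yc: "f b \<odot>\<^bsub>A\<^esub> y b \<in> carrier A" if "f \<in> carrier (free_module R B)" "b \<in> B" for f b using that y unfolding free_carrier by auto
  show thesis
  proof (rule that[of \<phi>])
    show "lin_map R (free_module R B) A \<phi>"
    proof (rule linI)
      fix f assume f: "f \<in> carrier (free_module R B)"
      show "\<phi> f \<in> carrier A" unfolding \<phi>_def by (rule A.M.finsum_closed) (use fin[OF f] yc[OF f] in auto)
      fix g assume g: "g \<in> carrier (free_module R B)"
      let ?J = "{x. f x \<noteq> \<zero>} \<union> {x. g x \<noteq> \<zero>}"
      have J: "finite ?J" "?J \<subseteq> B" using fin f g by auto
      have "\<phi> (f \<oplus>\<^bsub>free_module R B\<^esub> g) = (\<Oplus>\<^bsub>A\<^esub>b\<in>?J. (f b \<oplus> g b) \<odot>\<^bsub>A\<^esub> y b)"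
      proof -
        have "f x = \<zero> \<Longrightarrow> g x = \<zero> \<Longrightarrow> f x \<oplus> g x = \<zero>" for x by simp
        then have "{x. (f \<oplus>\<^bsub>free_module R B\<^esub> g) x \<noteq> \<zero>} \<subseteq> ?J" by auto
        then show ?thesis using \<phi>[of "f \<oplus>\<^bsub>free_module R B\<^esub> g" ?J] free_add_closed[OF f g] J by simp
      qed
      also have "\<dots> = (\<Oplus>\<^bsub>A\<^esub>b\<in>?J. f b \<odot>\<^bsub>A\<^esub> y b \<oplus>\<^bsub>A\<^esub> g b \<odot>\<^bsub>A\<^esub> y b)"
        by (rule A.M.finsum_cong') (use J y f g yc in \<open>auto simp: A.smult_l_distr free_carrier subset_iff\<close>)
      also have "\<dots> = (\<Oplus>\<^bsub>A\<^esub>b\<in>?J. f b \<odot>\<^bsub>A\<^esub> y b) \<oplus>\<^bsub>A\<^esub> (\<Oplus>\<^bsub>A\<^esub>b\<in>?J. g b \<odot>\<^bsub>A\<^esub> y b)"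
        by (rule A.M.finsum_addf) (use J f g yc in auto)
      also have "\<dots> = \<phi> f \<oplus>\<^bsub>A\<^esub> \<phi> g" using \<phi>[OF f J(1) _ J(2)] \<phi>[OF g J(1) _ J(2)] by simp
      finally show "\<phi> (f \<oplus>\<^bsub>free_module R B\<^esub> g) = \<phi> f \<oplus>\<^bsub>A\<^esub> \<phi> g" .
    next
      fix r f assume r: "r \<in> carrier R" and f: "f \<in> carrier (free_module R B)"
      let ?J = "{x. f x \<noteq> \<zero>}"
      have "\<phi> (r \<odot>\<^bsub>free_module R B\<^esub> f) = (\<Oplus>\<^bsub>A\<^esub>b\<in>?J. (r \<otimes> f b) \<odot>\<^bsub>A\<^esub> y b)"
      proof -
        have "{x. (r \<odot>\<^bsub>free_module R B\<^esub> f) x \<noteq> \<zero>} \<subseteq> ?J" using r by auto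
        then show ?thesis using \<phi>[of "r \<odot>\<^bsub>free_module R B\<^esub> f" ?J] free_smult_closed[OF r f] fin[OF f] by simp
      qed
      also have "\<dots> = (\<Oplus>\<^bsub>A\<^esub>b\<in>?J. r \<odot>\<^bsub>A\<^esub> (f b \<odot>\<^bsub>A\<^esub> y b))"
        by (rule A.M.finsum_cong') (use fin[OF f] y f r yc in \<open>auto simp: A.smult_assoc1 free_carrier subset_iff\<close>)
      also have "\<dots> = r \<odot>\<^bsub>A\<^esub> \<phi> f" unfolding \<phi>_def
        by (rule A.finsum_smult_ldistr[symmetric]) (use fin[OF f] f r yc in auto)
      finally show "\<phi> (r \<odot>\<^bsub>free_module R B\<^esub> f) = r \<odot>\<^bsub>A\<^esub> \<phi> f" .
    qed
    fix b assume b: "b \<in> B"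
    have "\<phi> (fbasis R b) = (\<Oplus>\<^bsub>A\<^esub>c\<in>{b}. fbasis R b c \<odot>\<^bsub>A\<^esub> y c)"
    proof -
      have "{x. fbasis R b x \<noteq> \<zero>} \<subseteq> {b}" by (auto simp: fbasis_def)
      then show ?thesis using \<phi>[OF fbasis_closed[OF b], of "{b}"] b by simp
    qed
    also have "\<dots> = y b" using y[OF b] by (simp add: fbasis_def)
    finally show "\<phi> (fbasis R b) = y b" .
  qed
qed

text \<open>The values on the basis are lifted and extended linearly.\<close>

lemma free_lift:
  assumes A: "Module.module R A" and C: "Module.module R C" and S: "submodule S R A" and p: "lin R A S C (carrier C) p"
    and \<phi>: "lin_map R (free_module R B) C \<phi>"
    and sub: "\<And>f. f \<in> carrier (free_module R B) \<Longrightarrow> \<phi> f \<in> p ` S"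
  obtains \<psi> where "lin R (free_module R B) (carrier (free_module R B)) A S \<psi>" "\<And>f. f \<in> carrier (free_module R B) \<Longrightarrow> p (\<psi> f) = \<phi> f"
proof -
  have "\<forall>b. \<exists>y. b \<in> B \<longrightarrow> y \<in> S \<and> p y = \<phi> (fbasis R b)" using sub[OF fbasis_closed] by (metis imageE)
  then obtain y where y: "\<And>b. b \<in> B \<Longrightarrow> y b \<in> S" "\<And>b. b \<in> B \<Longrightarrow> p (y b) = \<phi> (fbasis R b)" by metis
  obtain \<psi> where \<psi>: "lin_map R (free_module R B) (A\<lparr>carrier := S\<rparr>) \<psi>" "\<And>b. b \<in> B \<Longrightarrow> \<psi> (fbasis R b) = y b"
    by (rule free_lin_exists[OF submod_module[OF A S], of B y]) (use y in auto)
  have \<psi>S: "lin R (free_module R B) (carrier (free_module R B)) A S \<psi>" using \<psi>(1) unfolding lin_def by simp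
  show thesis
  proof (rule that[OF \<psi>S])
    have p\<psi>: "lin_map R (free_module R B) C (\<lambda>f. p (\<psi> f))" by (rule lin_comp[OF \<psi>S p]) simp
    show "p (\<psi> f) = \<phi> f" if "f \<in> carrier (free_module R B)" for f
      by (rule free_lin_unique[OF C p\<psi> \<phi> _ that]) (simp add: \<psi>(2) y(2))
  qed
qed

end

section \<open>Free resolutions against injective coresolutions\<close>

text \<open>The two ways to compute \<open>Ext(A, N)\<close>: a free resolution \<open>F\<close> of \<open>A\<close> and an injective coresolution of \<open>N\<close>.\<close>

locale resolved = coresolution R Y d N \<eta>
  for R :: "('a,'r) ring_scheme" (structure) and Y :: "nat \<Rightarrow> ('a,'e) module" and d :: "nat \<Rightarrow> 'e \<Rightarrow> 'e" and N :: "('a,'b,'m) module_scheme" and \<eta> :: "'b \<Rightarrow> 'e" +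
  fixes A :: "('a,'c,'k) module_scheme" and B :: "nat \<Rightarrow> 'x set" and \<delta> :: "nat \<Rightarrow> ('x \<Rightarrow> 'a) \<Rightarrow> ('x \<Rightarrow> 'a)" and \<epsilon> :: "('x \<Rightarrow> 'a) \<Rightarrow> 'c"
  assumes modA: "Module.module R A" and fr: "free_resolution R A B \<delta> \<epsilon>"
begin

abbreviation "F p \<equiv> free_module R (B p)"
abbreviation "cF p \<equiv> carrier (free_module R (B p))"

lemma modF: "Module.module R (F p)" by (rule free_module_module[OF R_cring])
lemma subF: "submodule (cF p) R (F p)" by (rule submod_carrier[OF modF])

lemma \<delta>_lin: "lin_map R (F (Suc p)) (F p) (\<delta> p)"
  using fr unfolding free_resolution_def module_homs_iff_lin by blast

lemma \<epsilon>_lin: "lin_map R (F 0) A \<epsilon>"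
  using fr unfolding free_resolution_def module_homs_iff_lin by blast

lemma \<epsilon>_surj: "\<epsilon> ` cF 0 = carrier A" using fr unfolding free_resolution_def by blast

lemma \<delta>_closed: "f \<in> cF (Suc p) \<Longrightarrow> \<delta> p f \<in> cF p" by (rule lin_closed[OF \<delta>_lin])

lemma ker_\<epsilon>: "f \<in> cF 0 \<Longrightarrow> \<epsilon> f = \<zero>\<^bsub>A\<^esub> \<Longrightarrow> f \<in> \<delta> 0 ` cF (Suc 0)"
  using fr unfolding free_resolution_def by auto

lemma ker_\<delta>: "f \<in> cF (Suc p) \<Longrightarrow> \<delta> p f = \<zero>\<^bsub>F p\<^esub> \<Longrightarrow> f \<in> \<delta> (Suc p) ` cF (Suc (Suc p))"
  using fr unfolding free_resolution_def by blast

lemma \<epsilon>\<delta>: "f \<in> cF (Suc 0) \<Longrightarrow> \<epsilon> (\<delta> 0 f) = \<zero>\<^bsub>A\<^esub>"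
  using fr unfolding free_resolution_def by (simp add: set_eq_iff image_iff) blast

lemma \<delta>\<delta>: "f \<in> cF (Suc (Suc p)) \<Longrightarrow> \<delta> p (\<delta> (Suc p) f) = \<zero>\<^bsub>F p\<^esub>"
  using fr unfolding free_resolution_def by blast

text \<open>In the double complex \<open>Hom(F\<^sub>p, I\<^sup>j)\<close>, \<open>cocyc p j\<close> are the elements killed by both differentials. They
  are the connecting terms of the zigzag between a map \<open>A \<rightarrow> I\<^sup>i\<close> (at \<open>p = 0\<close>) and a map \<open>F\<^sub>i \<rightarrow> N\<close> (at
  \<open>j = 0\<close>).\<close>

definition cocyc :: "nat \<Rightarrow> nat \<Rightarrow> (('x \<Rightarrow> 'a) \<Rightarrow> 'e) \<Rightarrow> bool" where
  "cocyc p j c \<longleftrightarrow> lin_map R (F p) (Y (Suc j)) c \<and>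
     (\<forall>f\<in>cF p. d (Suc j) (c f) = \<zero>\<^bsub>Y (Suc (Suc j))\<^esub>) \<and> (\<forall>f\<in>cF (Suc p). c (\<delta> p f) = \<zero>\<^bsub>Y (Suc j)\<^esub>)"

text \<open>The class of the element is zero. For \<open>p > 0\<close> it comes from \<open>F\<^sub>p\<^sub>-\<^sub>1\<close> by a map into cocycles; for \<open>p = 0\<close>
  it is the boundary of a map from \<open>A\<close>.\<close>

definition triv :: "nat \<Rightarrow> nat \<Rightarrow> (('x \<Rightarrow> 'a) \<Rightarrow> 'e) \<Rightarrow> bool" where
  "triv p j c \<longleftrightarrow> (case p of
      0 \<Rightarrow> \<exists>\<psi>. lin_map R A (Y j) \<psi> \<and> (\<forall>f\<in>cF 0. c f = d j (\<psi> (\<epsilon> f)))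
    | Suc q \<Rightarrow> \<exists>v. lin_map R (F q) (Y (Suc j)) v \<and> (\<forall>f\<in>cF q. d (Suc j) (v f) = \<zero>\<^bsub>Y (Suc (Suc j))\<^esub>) \<and>
               (\<forall>f\<in>cF p. c f = v (\<delta> q f)))"

text \<open>Lift \<open>c\<close> through \<open>d\<close> to \<open>w\<close> and restrict \<open>w\<close> along \<open>\<delta>\<close>.\<close>

definition zstep :: "nat \<Rightarrow> nat \<Rightarrow> (('x \<Rightarrow> 'a) \<Rightarrow> 'e) \<Rightarrow> (('x \<Rightarrow> 'a) \<Rightarrow> 'e) \<Rightarrow> bool" where
  "zstep p j c c' \<longleftrightarrow> (\<exists>w. lin_map R (F p) (Y (Suc j)) w \<and> (\<forall>f\<in>cF p. d (Suc j) (w f) = c f) \<and> (\<forall>f\<in>cF (Suc p). c' f = w (\<delta> p f)))"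

primrec zigzag :: "nat \<Rightarrow> nat \<Rightarrow> (('x \<Rightarrow> 'a) \<Rightarrow> 'e) \<Rightarrow> (('x \<Rightarrow> 'a) \<Rightarrow> 'e) \<Rightarrow> bool" where
  "zigzag 0 p c c' \<longleftrightarrow> c = c'"
| "zigzag (Suc j) p c c' \<longleftrightarrow> (\<exists>c1. cocyc (Suc p) j c1 \<and> zstep p j c c1 \<and> zigzag j (Suc p) c1 c')"

lemma cocycD: assumes "cocyc p j c" shows cocyc_lin: "lin_map R (F p) (Y (Suc j)) c"
  and cocyc_d: "\<And>f. f \<in> cF p \<Longrightarrow> d (Suc j) (c f) = \<zero>\<^bsub>Y (Suc (Suc j))\<^esub>" and cocyc_\<delta>: "\<And>f. f \<in> cF (Suc p) \<Longrightarrow> c (\<delta> p f) = \<zero>\<^bsub>Y (Suc j)\<^esub>"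
  using assms unfolding cocyc_def by blast+

text \<open>Here freeness of \<open>F\<^sub>p\<close> and exactness of the coresolution are used; going back, injectivity of \<open>I\<^sup>j\<close> and
  exactness of \<open>F\<close>.\<close>

lemma lift_through_d:
  assumes c: "lin_map R (F p) (Y (Suc (Suc j))) c" and dc: "\<And>f. f \<in> cF p \<Longrightarrow> d (Suc (Suc j)) (c f) = \<zero>\<^bsub>Y (Suc (Suc (Suc j)))\<^esub>"
  obtains w where "lin_map R (F p) (Y (Suc j)) w" "\<And>f. f \<in> cF p \<Longrightarrow> d (Suc j) (w f) = c f"
proof -
  have "c f \<in> d (Suc j) ` carrier (Y (Suc j))" if "f \<in> cF p" for f by (rule exact[OF lin_closed[OF c that] dc[OF that]])
  then show thesis by (rule free_lift[OF R_cring modY modY subY d_lin c]) (auto intro: that)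
qed

lemma zstep_forward:
  assumes c: "cocyc p (Suc j) c" obtains c' where "cocyc (Suc p) j c'" "zstep p j c c'"
proof -
  obtain w where w: "lin_map R (F p) (Y (Suc j)) w" "\<And>f. f \<in> cF p \<Longrightarrow> d (Suc j) (w f) = c f"
    by (rule lift_through_d[OF cocyc_lin[OF c] cocyc_d[OF c]]) (auto intro: that)
  define c' where "c' f = w (\<delta> p f)" for f
  have "lin_map R (F (Suc p)) (Y (Suc j)) c'" unfolding c'_def by (rule lin_comp[OF \<delta>_lin w(1)]) simp
  moreover have "w \<zero>\<^bsub>F p\<^esub> = \<zero>\<^bsub>Y (Suc j)\<^esub>" by (rule lin_zero[OF modF modY subF w(1)])
  ultimately have "cocyc (Suc p) j c'" unfolding cocyc_def c'_def using w(2)[OF \<delta>_closed] cocyc_\<delta>[OF c] \<delta>\<delta> by simp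
  moreover have "zstep p j c c'" unfolding zstep_def c'_def using w by blast
  ultimately show thesis by (rule that)
qed

lemma zstep_backward:
  assumes c': "cocyc (Suc p) j c'" obtains c where "cocyc p (Suc j) c" "zstep p j c c'"
proof -
  obtain w where w: "lin_map R (F p) (Y (Suc j)) w" "\<And>f. f \<in> cF (Suc p) \<Longrightarrow> w (\<delta> p f) = c' f"
  proof (rule baer_factor[OF modF subF modF baerY \<delta>_lin cocyc_lin[OF c']])
    fix f assume f: "f \<in> cF (Suc p)" "\<delta> p f = \<zero>\<^bsub>F p\<^esub>"
    then obtain g where "g \<in> cF (Suc (Suc p))" "f = \<delta> (Suc p) g" using ker_\<delta> by blast
    then show "c' f = \<zero>\<^bsub>Y (Suc j)\<^esub>" using cocyc_\<delta>[OF c'] by simp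
  qed (auto intro: that)
  define c where "c f = d (Suc j) (w f)" for f
  have "lin_map R (F p) (Y (Suc (Suc j))) c" unfolding c_def by (rule lin_comp[OF w(1) d_lin]) simp
  then have "cocyc p (Suc j) c" unfolding cocyc_def c_def using dd[OF lin_closed[OF w(1)]] w(2) cocyc_d[OF c'] by simp
  moreover have "zstep p j c c'" unfolding zstep_def c_def using w by auto
  ultimately show thesis by (rule that)
qed

text \<open>If \<open>c = d w\<close> and \<open>c' = w \<delta>\<close>, then writing \<open>c'\<close> as \<open>v \<delta>\<close> with \<open>d v = 0\<close> means that \<open>w - v\<close> kills
  the image of \<open>\<delta>\<close>, that is, comes from \<open>F\<^sub>p\<^sub>-\<^sub>1\<close> or \<open>A\<close>; its boundary is still \<open>c\<close>. The converse
  reverses this.\<close>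

lemma triv_zstep:
  assumes c: "cocyc p (Suc j) c" and z: "zstep p j c c'"
  shows "triv p (Suc j) c \<longleftrightarrow> triv (Suc p) j c'"
proof -
  interpret Ym: module R "Y k" for k by (rule modY)
  obtain w where w: "lin_map R (F p) (Y (Suc j)) w" "\<And>f. f \<in> cF p \<Longrightarrow> d (Suc j) (w f) = c f" "\<And>f. f \<in> cF (Suc p) \<Longrightarrow> c' f = w (\<delta> p f)"
    using z unfolding zstep_def by blast
  have cFc: "cF p \<subseteq> carrier (F p)" by simp
  show ?thesis
  proof
    assume "triv (Suc p) j c'"
    then obtain v where v: "lin_map R (F p) (Y (Suc j)) v" "\<And>f. f \<in> cF p \<Longrightarrow> d (Suc j) (v f) = \<zero>\<^bsub>Y (Suc (Suc j))\<^esub>"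
      "\<And>f. f \<in> cF (Suc p) \<Longrightarrow> c' f = v (\<delta> p f)" unfolding triv_def by auto
    define g where "g f = w f \<ominus>\<^bsub>Y (Suc j)\<^esub> v f" for f
    have gl: "lin_map R (F p) (Y (Suc j)) g" unfolding g_def by (rule lin_pointwise_diff[OF modF modY cFc subY w(1) v(1)])
    have g0: "g (\<delta> p f) = \<zero>\<^bsub>Y (Suc j)\<^esub>" if "f \<in> cF (Suc p)" for f
      unfolding g_def using w(3)[OF that] v(3)[OF that] mod_diff_self[OF modY lin_closed[OF v(1) \<delta>_closed[OF that]]] by simp
    have dg: "d (Suc j) (g f) = c f" if f: "f \<in> cF p" for f
      unfolding g_def using d_diff[OF lin_closed[OF w(1) f] lin_closed[OF v(1) f]] w(2)[OF f] v(2)[OF f]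
        mod_diff_zero[OF modY] lin_closed[OF cocyc_lin[OF c] f] by simp
    show "triv p (Suc j) c"
    proof (cases p)
      case 0
      obtain \<psi> where \<psi>: "lin_map R A (Y (Suc j)) \<psi>" "\<And>f. f \<in> cF 0 \<Longrightarrow> \<psi> (\<epsilon> f) = g f"
      proof (rule baer_factor[OF modF subF modA baerY \<epsilon>_lin gl[unfolded 0]])
        fix f assume "f \<in> cF 0" "\<epsilon> f = \<zero>\<^bsub>A\<^esub>"
        then show "g f = \<zero>\<^bsub>Y (Suc j)\<^esub>" using ker_\<epsilon> g0 0 by blast
      qed (auto intro: that)
      then show ?thesis unfolding triv_def 0 using dg[unfolded 0] by auto
    next
      case (Suc q)
      obtain y where y: "lin_map R (F q) (Y (Suc j)) y" "\<And>f. f \<in> cF (Suc q) \<Longrightarrow> y (\<delta> q f) = g f"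
      proof (rule baer_factor[OF modF subF modF baerY \<delta>_lin gl[unfolded Suc]])
        fix f assume "f \<in> cF (Suc q)" "\<delta> q f = \<zero>\<^bsub>F q\<^esub>"
        then show "g f = \<zero>\<^bsub>Y (Suc j)\<^esub>" using ker_\<delta> g0 Suc by blast
      qed (auto intro: that)
      have "lin_map R (F q) (Y (Suc (Suc j))) (\<lambda>f. d (Suc j) (y f))" by (rule lin_comp[OF y(1) d_lin]) simp
      then show ?thesis unfolding triv_def Suc using dg[unfolded Suc] y(2) dd[OF lin_closed[OF y(1)]]
        by (auto intro!: exI[of _ "\<lambda>f. d (Suc j) (y f)"])
    qed
  next
    assume t: "triv p (Suc j) c"
    have "\<exists>u. lin_map R (F p) (Y (Suc j)) u \<and> (\<forall>f\<in>cF p. d (Suc j) (u f) = c f) \<and> (\<forall>f\<in>cF (Suc p). u (\<delta> p f) = \<zero>\<^bsub>Y (Suc j)\<^esub>)"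
    proof (cases p)
      case 0
      then obtain \<psi> where \<psi>: "lin_map R A (Y (Suc j)) \<psi>" "\<And>f. f \<in> cF 0 \<Longrightarrow> c f = d (Suc j) (\<psi> (\<epsilon> f))"
        using t unfolding triv_def by auto
      have "lin_map R (F 0) (Y (Suc j)) (\<lambda>f. \<psi> (\<epsilon> f))" by (rule lin_comp[OF \<epsilon>_lin \<psi>(1)]) simp
      moreover have "\<psi> \<zero>\<^bsub>A\<^esub> = \<zero>\<^bsub>Y (Suc j)\<^esub>" by (rule lin_zero[OF modA modY submod_carrier[OF modA] \<psi>(1)])
      ultimately show ?thesis unfolding 0 using \<psi>(2) \<epsilon>\<delta> by (intro exI[of _ "\<lambda>f. \<psi> (\<epsilon> f)"]) simp
    next
      case (Suc q)
      then obtain v where v: "lin_map R (F q) (Y (Suc (Suc j))) v" "\<And>f. f \<in> cF q \<Longrightarrow> d (Suc (Suc j)) (v f) = \<zero>\<^bsub>Y (Suc (Suc (Suc j)))\<^esub>"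
        "\<And>f. f \<in> cF (Suc q) \<Longrightarrow> c f = v (\<delta> q f)" using t unfolding triv_def by auto
      obtain v' where v': "lin_map R (F q) (Y (Suc j)) v'" "\<And>f. f \<in> cF q \<Longrightarrow> d (Suc j) (v' f) = v f"
        by (rule lift_through_d[OF v(1,2)]) (auto intro: that)
      have "lin_map R (F (Suc q)) (Y (Suc j)) (\<lambda>f. v' (\<delta> q f))" by (rule lin_comp[OF \<delta>_lin v'(1)]) simp
      moreover have "v' \<zero>\<^bsub>F q\<^esub> = \<zero>\<^bsub>Y (Suc j)\<^esub>" by (rule lin_zero[OF modF modY subF v'(1)])
      ultimately show ?thesis unfolding Suc using v(3) v'(2)[OF \<delta>_closed] \<delta>\<delta> by (intro exI[of _ "\<lambda>f. v' (\<delta> q f)"]) simp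
    qed
    then obtain u where u: "lin_map R (F p) (Y (Suc j)) u" "\<And>f. f \<in> cF p \<Longrightarrow> d (Suc j) (u f) = c f" "\<And>f. f \<in> cF (Suc p) \<Longrightarrow> u (\<delta> p f) = \<zero>\<^bsub>Y (Suc j)\<^esub>" by blast
    define v where "v f = w f \<ominus>\<^bsub>Y (Suc j)\<^esub> u f" for f
    have vl: "lin_map R (F p) (Y (Suc j)) v" unfolding v_def by (rule lin_pointwise_diff[OF modF modY cFc subY w(1) u(1)])
    have dv: "d (Suc j) (v f) = \<zero>\<^bsub>Y (Suc (Suc j))\<^esub>" if f: "f \<in> cF p" for f
      unfolding v_def using d_diff[OF lin_closed[OF w(1) f] lin_closed[OF u(1) f]] w(2)[OF f] u(2)[OF f]
        mod_diff_self[OF modY lin_closed[OF cocyc_lin[OF c] f]] by simp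
    have "c' f = v (\<delta> p f)" if f: "f \<in> cF (Suc p)" for f
      unfolding v_def using w(3)[OF f] u(3)[OF f] mod_diff_zero[OF modY lin_closed[OF w(1) \<delta>_closed[OF f]]] by simp
    then show "triv (Suc p) j c'" unfolding triv_def using vl dv by auto
  qed
qed

lemma zigzag_forward: "cocyc p j c \<Longrightarrow> \<exists>c'. cocyc (p + j) 0 c' \<and> zigzag j p c c'"
proof (induction j arbitrary: p c)
  case 0 then show ?case by auto
next
  case (Suc j)
  obtain c1 where c1: "cocyc (Suc p) j c1" "zstep p j c c1" using zstep_forward[OF Suc.prems] by blast
  then show ?case using Suc.IH[OF c1(1)] by auto
qed

lemma zigzag_backward: "cocyc (p + j) 0 c' \<Longrightarrow> \<exists>c. cocyc p j c \<and> zigzag j p c c'"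
proof (induction j arbitrary: p)
  case 0 then show ?case by auto
next
  case (Suc j)
  obtain c1 where c1: "cocyc (Suc p) j c1" "zigzag j (Suc p) c1 c'" using Suc.IH[of "Suc p"] Suc.prems by auto
  obtain c where "cocyc p (Suc j) c" "zstep p j c c1" using zstep_backward[OF c1(1)] by blast
  then show ?case using c1 by auto
qed

lemma triv_zigzag: "cocyc p j c \<Longrightarrow> zigzag j p c c' \<Longrightarrow> triv p j c \<longleftrightarrow> triv (p + j) 0 c'"
proof (induction j arbitrary: p c)
  case 0 then show ?case by simp
next
  case (Suc j)
  then obtain c1 where "cocyc (Suc p) j c1" "zstep p j c c1" "zigzag j (Suc p) c1 c'" by auto
  then show ?case using triv_zstep[OF Suc.prems(1)] Suc.IH by simp
qed

text \<open>The end of the zigzag: cocycles with values in \<open>I\<^sup>0\<close> take their values in \<open>N\<close>.\<close>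

definition coboundary :: "nat \<Rightarrow> (('x \<Rightarrow> 'a) \<Rightarrow> 'b) \<Rightarrow> bool" where
  "coboundary p z \<longleftrightarrow> (case p of 0 \<Rightarrow> \<forall>f\<in>cF 0. z f = \<zero>\<^bsub>N\<^esub>
     | Suc q \<Rightarrow> \<exists>v. lin_map R (F q) N v \<and> (\<forall>f\<in>cF p. z f = v (\<delta> q f)))"

definition cocycle :: "nat \<Rightarrow> (('x \<Rightarrow> 'a) \<Rightarrow> 'b) \<Rightarrow> bool" where
  "cocycle p z \<longleftrightarrow> lin_map R (F p) N z \<and> (\<forall>f\<in>cF (Suc p). z (\<delta> p f) = \<zero>\<^bsub>N\<^esub>)"

lemma lift_through_\<eta>:
  assumes c: "lin_map R (F p) (Y (Suc 0)) c" and dc: "\<And>f. f \<in> cF p \<Longrightarrow> d (Suc 0) (c f) = \<zero>\<^bsub>Y (Suc (Suc 0))\<^esub>"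
  obtains z where "lin_map R (F p) N z" "\<And>f. f \<in> cF p \<Longrightarrow> \<eta> (z f) = c f"
proof -
  have "c f \<in> \<eta> ` carrier N" if "f \<in> cF p" for f by (rule exact_\<eta>[OF lin_closed[OF c that] dc[OF that]])
  then show thesis by (rule free_lift[OF R_cring modN modY submod_carrier[OF modN] \<eta>_lin c]) (auto intro: that)
qed

lemma cocyc_cocycle:
  assumes c: "cocyc p 0 c"
  obtains z where "cocycle p z" "\<And>f. f \<in> cF p \<Longrightarrow> \<eta> (z f) = c f"
proof -
  obtain z where z: "lin_map R (F p) N z" "\<And>f. f \<in> cF p \<Longrightarrow> \<eta> (z f) = c f"
    by (rule lift_through_\<eta>[OF cocyc_lin[OF c] cocyc_d[OF c]]) (auto intro: that)
  have "z (\<delta> p f) = \<zero>\<^bsub>N\<^esub>" if f: "f \<in> cF (Suc p)" for f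
    using z(2)[OF \<delta>_closed[OF f]] cocyc_\<delta>[OF c f] \<eta>_zero_iff[OF lin_closed[OF z(1) \<delta>_closed[OF f]]] by simp
  then have "cocycle p z" unfolding cocycle_def using z(1) by blast
  then show thesis using z(2) by (rule that)
qed

lemma cocycle_cocyc: assumes z: "cocycle p z" shows "cocyc p 0 (\<lambda>f. \<eta> (z f))"
proof -
  have zl: "lin_map R (F p) N z" using z unfolding cocycle_def by blast
  have "lin_map R (F p) (Y (Suc 0)) (\<lambda>f. \<eta> (z f))" by (rule lin_comp[OF zl \<eta>_lin]) simp
  then show ?thesis unfolding cocyc_def using d_\<eta>[OF lin_closed[OF zl]] z \<eta>_zero unfolding cocycle_def by simp
qed

lemma triv_coboundary:
  assumes z: "lin_map R (F p) N z" and c: "\<And>f. f \<in> cF p \<Longrightarrow> \<eta> (z f) = c f"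
  shows "triv p 0 c \<longleftrightarrow> coboundary p z"
proof (cases p)
  case 0
  have z0: "z f = \<zero>\<^bsub>N\<^esub> \<longleftrightarrow> c f = \<zero>\<^bsub>Y (Suc 0)\<^esub>" if "f \<in> cF 0" for f using c[of f] \<eta>_zero_iff[OF lin_closed[OF z, of f]] that 0 by simp
  show ?thesis
  proof
    assume "triv p 0 c"
    then obtain \<psi> where \<psi>: "lin_map R A (Y 0) \<psi>" "\<And>f. f \<in> cF 0 \<Longrightarrow> c f = d 0 (\<psi> (\<epsilon> f))" unfolding triv_def 0 by auto
    have "c f = \<zero>\<^bsub>Y (Suc 0)\<^esub>" if f: "f \<in> cF 0" for f
      using \<psi>(2)[OF f] Y0[OF lin_closed[OF \<psi>(1) lin_closed[OF \<epsilon>_lin f]]] d_zero by simp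
    then show "coboundary p z" unfolding coboundary_def 0 using z0 by simp
  next
    assume "coboundary p z"
    then have "\<forall>f\<in>cF 0. c f = \<zero>\<^bsub>Y (Suc 0)\<^esub>" unfolding coboundary_def 0 using z0 by simp
    moreover have "lin_map R A (Y 0) (\<lambda>x. \<zero>\<^bsub>Y 0\<^esub>)" by (rule lin_zero_map[OF modA modY subY])
    ultimately show "triv p 0 c" unfolding triv_def 0 using d_zero
      by (auto intro!: exI[of _ "\<lambda>x. \<zero>\<^bsub>Y 0\<^esub>"])
  qed
next
  case (Suc q)
  show ?thesis
  proof
    assume "triv p 0 c"
    then obtain v where v: "lin_map R (F q) (Y (Suc 0)) v" "\<And>f. f \<in> cF q \<Longrightarrow> d (Suc 0) (v f) = \<zero>\<^bsub>Y (Suc (Suc 0))\<^esub>"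
      "\<And>f. f \<in> cF p \<Longrightarrow> c f = v (\<delta> q f)" unfolding triv_def Suc by auto
    obtain v' where v': "lin_map R (F q) N v'" "\<And>f. f \<in> cF q \<Longrightarrow> \<eta> (v' f) = v f"
      by (rule lift_through_\<eta>[OF v(1,2)]) (auto intro: that)
    have "z f = v' (\<delta> q f)" if f: "f \<in> cF (Suc q)" for f
    proof (rule inj_onD[OF \<eta>_inj])
      show "\<eta> (z f) = \<eta> (v' (\<delta> q f))" using c v(3) v'(2)[OF \<delta>_closed[OF f]] f Suc by simp
      show "z f \<in> carrier N" using lin_closed[OF z] f Suc by simp
      show "v' (\<delta> q f) \<in> carrier N" by (rule lin_closed[OF v'(1) \<delta>_closed[OF f]])
    qed
    then show "coboundary p z" unfolding coboundary_def Suc using v'(1) by auto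
  next
    assume "coboundary p z"
    then obtain v where v: "lin_map R (F q) N v" "\<And>f. f \<in> cF (Suc q) \<Longrightarrow> z f = v (\<delta> q f)" unfolding coboundary_def Suc by auto
    have "lin_map R (F q) (Y (Suc 0)) (\<lambda>f. \<eta> (v f))" by (rule lin_comp[OF v(1) \<eta>_lin]) simp
    moreover have "c f = \<eta> (v (\<delta> q f))" if "f \<in> cF (Suc q)" for f using c[of f] v(2)[OF that] that Suc by simp
    ultimately show "triv p 0 c" unfolding triv_def Suc using d_\<eta>[OF lin_closed[OF v(1)]] by (auto intro!: exI[of _ "\<lambda>f. \<eta> (v f)"])
  qed
qed

text \<open>The start of the zigzag: an element of \<open>Hom(F\<^sub>0, I\<^sup>i)\<close> that vanishes on the image of \<open>F\<^sub>1\<close> comes from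
  \<open>A\<close>.\<close>

lemma cocyc_of_hom:
  assumes \<phi>: "lin_map R A (Y (Suc i)) \<phi>" and d\<phi>: "\<And>x. x \<in> carrier A \<Longrightarrow> d (Suc i) (\<phi> x) = \<zero>\<^bsub>Y (Suc (Suc i))\<^esub>"
  shows "cocyc 0 i (\<lambda>f. \<phi> (\<epsilon> f))"
proof -
  have "lin_map R (F 0) (Y (Suc i)) (\<lambda>f. \<phi> (\<epsilon> f))" by (rule lin_comp[OF \<epsilon>_lin \<phi>]) simp
  moreover have "\<phi> \<zero>\<^bsub>A\<^esub> = \<zero>\<^bsub>Y (Suc i)\<^esub>" by (rule lin_zero[OF modA modY submod_carrier[OF modA] \<phi>])
  ultimately show ?thesis unfolding cocyc_def using d\<phi> lin_closed[OF \<epsilon>_lin] \<epsilon>\<delta> by simp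
qed

lemma hom_of_cocyc:
  assumes c: "cocyc 0 i c"
  obtains \<phi> where "lin_map R A (Y (Suc i)) \<phi>" "\<And>x. x \<in> carrier A \<Longrightarrow> d (Suc i) (\<phi> x) = \<zero>\<^bsub>Y (Suc (Suc i))\<^esub>"
    "\<And>f. f \<in> cF 0 \<Longrightarrow> \<phi> (\<epsilon> f) = c f"
proof -
  obtain \<phi> where \<phi>: "lin_map R A (Y (Suc i)) \<phi>" "\<And>f. f \<in> cF 0 \<Longrightarrow> \<phi> (\<epsilon> f) = c f"
  proof (rule baer_factor[OF modF subF modA baerY \<epsilon>_lin cocyc_lin[OF c]])
    fix f assume "f \<in> cF 0" "\<epsilon> f = \<zero>\<^bsub>A\<^esub>"
    then show "c f = \<zero>\<^bsub>Y (Suc i)\<^esub>" using ker_\<epsilon> cocyc_\<delta>[OF c] by blast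
  qed (auto intro: that)
  have "d (Suc i) (\<phi> x) = \<zero>\<^bsub>Y (Suc (Suc i))\<^esub>" if "x \<in> carrier A" for x
  proof -
    obtain f where "f \<in> cF 0" "x = \<epsilon> f" using \<epsilon>_surj \<open>x \<in> carrier A\<close> by blast
    then show ?thesis using \<phi>(2) cocyc_d[OF c] by simp
  qed
  then show thesis using that[OF \<phi>(1) _ \<phi>(2)] by blast
qed

lemma triv_hom:
  "triv 0 i (\<lambda>f. \<phi> (\<epsilon> f)) \<longleftrightarrow> (\<exists>\<psi>. lin_map R A (Y i) \<psi> \<and> (\<forall>x\<in>carrier A. \<phi> x = d i (\<psi> x)))"
  unfolding triv_def using \<epsilon>_surj by (auto simp: image_iff set_eq_iff) (metis \<epsilon>_surj imageE)

lemma balance: "maps_lift A (carrier A) i \<longleftrightarrow> (\<forall>z. cocycle i z \<longrightarrow> coboundary i z)"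
proof
  assume L: "maps_lift A (carrier A) i"
  show "\<forall>z. cocycle i z \<longrightarrow> coboundary i z"
  proof (intro allI impI)
    fix z assume z: "cocycle i z"
    have zl: "lin_map R (F i) N z" using z unfolding cocycle_def by blast
    obtain c where c: "cocyc 0 i c" "zigzag i 0 c (\<lambda>f. \<eta> (z f))" using zigzag_backward[of 0 i] cocycle_cocyc[OF z] by auto
    obtain \<phi> where \<phi>: "lin_map R A (Y (Suc i)) \<phi>" "\<And>x. x \<in> carrier A \<Longrightarrow> d (Suc i) (\<phi> x) = \<zero>\<^bsub>Y (Suc (Suc i))\<^esub>"
      "\<And>f. f \<in> cF 0 \<Longrightarrow> \<phi> (\<epsilon> f) = c f" using hom_of_cocyc[OF c(1)] by blast
    have "triv 0 i (\<lambda>f. \<phi> (\<epsilon> f))" unfolding triv_hom using L \<phi>(1,2) unfolding maps_lift_def by blast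
    then have "triv 0 i c" unfolding triv_def using \<phi>(3) by simp
    then have "triv i 0 (\<lambda>f. \<eta> (z f))" using triv_zigzag[OF c] by simp
    then show "coboundary i z" using triv_coboundary[OF zl] by simp
  qed
next
  assume Rt: "\<forall>z. cocycle i z \<longrightarrow> coboundary i z"
  show "maps_lift A (carrier A) i" unfolding maps_lift_def
  proof (intro allI impI)
    fix \<phi> assume \<phi>: "lin_map R A (Y (Suc i)) \<phi>" "\<forall>x\<in>carrier A. d (Suc i) (\<phi> x) = \<zero>\<^bsub>Y (Suc (Suc i))\<^esub>"
    have c: "cocyc 0 i (\<lambda>f. \<phi> (\<epsilon> f))" by (rule cocyc_of_hom) (use \<phi> in auto)
    obtain c' where c': "cocyc i 0 c'" "zigzag i 0 (\<lambda>f. \<phi> (\<epsilon> f)) c'" using zigzag_forward[OF c] by auto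
    obtain z where z: "cocycle i z" "\<And>f. f \<in> cF i \<Longrightarrow> \<eta> (z f) = c' f" using cocyc_cocycle[OF c'(1)] by blast
    have zl: "lin_map R (F i) N z" using z unfolding cocycle_def by blast
    have "triv i 0 c'" using triv_coboundary[OF zl z(2)] Rt z(1) by blast
    then have "triv 0 i (\<lambda>f. \<phi> (\<epsilon> f))" using triv_zigzag[OF c c'(2)] by simp
    then show "\<exists>\<psi>. lin_map R A (Y i) \<psi> \<and> (\<forall>x\<in>carrier A. \<phi> x = d i (\<psi> x))" unfolding triv_hom .
  qed
qed

end

section \<open>Finite free resolutions\<close>

lemma noeth_free:
  assumes cR: "cring R" and NR: "noeth R (Rmod R)" and B: "finite B" shows "noeth R (free_module R B)"
proof (rule noeth_coords[OF free_module_module[OF cR] NR B, where p="\<lambda>b f. f b"])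
  show "lin_map R (free_module R B) (Rmod R) (\<lambda>f. f b)" for b
    by (rule linI) (auto simp: free_carrier)
  show "f = \<zero>\<^bsub>free_module R B\<^esub>" if "f \<in> carrier (free_module R B)" "\<And>b. b \<in> B \<Longrightarrow> f b = \<zero>\<^bsub>Rmod R\<^esub>" for f
    using that by (auto simp: free_carrier fun_eq_iff)
qed

lemma free_cover:
  fixes A :: "('a,'b,'m) module_scheme"
  assumes cR: "cring R" and A: "Module.module R A" and H: "submodule H R A" and F: "finite F" "F \<subseteq> H" "submodule_generated R A F = H"
    and inf: "infinite (UNIV :: 'x set)"
  shows "\<exists>(B::'x set) \<pi>. finite B \<and> lin_map R (free_module R B) A \<pi> \<and> \<pi> ` carrier (free_module R B) = H"
proof -
  obtain B :: "'x set" where B: "finite B" "card B = card F" using infinite_arbitrarily_large[OF inf] by blast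
  then obtain g where g: "bij_betw g B F" using finite_same_card_bij[OF B(1) F(1)] by blast
  have gF: "b \<in> B \<Longrightarrow> g b \<in> F" for b using g by (auto simp: bij_betw_def)
  obtain \<pi> where \<pi>: "lin_map R (free_module R B) (A\<lparr>carrier := H\<rparr>) \<pi>" "\<And>b. b \<in> B \<Longrightarrow> \<pi> (fbasis R b) = g b"
    by (rule free_lin_exists[OF cR submod_module[OF A H], of B g]) (use gF F in auto)
  have \<pi>': "lin R (free_module R B) (carrier (free_module R B)) A H \<pi>" using \<pi>(1) unfolding lin_def by simp
  have \<pi>A: "lin_map R (free_module R B) A \<pi>" by (rule lin_mono[OF \<pi>' order_refl submod_subset[OF H]])
  have M: "Module.module R (free_module R B)" by (rule free_module_module[OF cR])
  have im: "submodule (\<pi> ` carrier (free_module R B)) R A" by (rule lin_image[OF M A submod_carrier[OF M] \<pi>A])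
  have "F \<subseteq> \<pi> ` carrier (free_module R B)"
  proof
    fix x assume "x \<in> F"
    then obtain b where "b \<in> B" "x = g b" using g by (auto simp: bij_betw_def)
    then show "x \<in> \<pi> ` carrier (free_module R B)" using \<pi>(2)[of b] fbasis_closed[OF cR, of b B] by (metis imageI)
  qed
  then have "H \<subseteq> \<pi> ` carrier (free_module R B)" using span_least[OF im] F(3) by blast
  moreover have "\<pi> ` carrier (free_module R B) \<subseteq> H" using lin_closed[OF \<pi>'] by blast
  ultimately show ?thesis using B \<pi>A by blast
qed

text \<open>The kernels are finitely generated again, and covered by finite free modules over any infinite type
  of basis elements.\<close>

lemma finite_free_resolution:
  fixes A :: "('a,'b,'m) module_scheme" and R :: "('a,'r) ring_scheme"
  assumes cR: "cring R" and NR: "noeth R (Rmod R)" and A: "Module.module R A" and S: "finite S" "S \<subseteq> carrier A" "submodule_generated R A S = carrier A"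
    and inf: "infinite (UNIV :: 'x set)"
  obtains B :: "nat \<Rightarrow> 'x set" and \<delta> \<epsilon> where "free_resolution R A B \<delta> \<epsilon>" "\<And>i. finite (B i)"
proof -
  define ker where "ker B \<delta> C = {f \<in> carrier (free_module R B). \<delta> f = \<zero>\<^bsub>free_module R C\<^esub>}" for B :: "'x set" and \<delta> :: "('x \<Rightarrow> 'a) \<Rightarrow> 'x \<Rightarrow> 'a" and C :: "'x set"
  note M = free_module_module[OF cR]
  obtain B0 :: "'x set" and \<epsilon> where B0: "finite B0" and \<epsilon>: "lin_map R (free_module R B0) A \<epsilon>" "\<epsilon> ` carrier (free_module R B0) = carrier A"
    using free_cover[OF cR A submod_carrier[OF A] S inf] by blast
  define K0 where "K0 = {f \<in> carrier (free_module R B0). \<epsilon> f = \<zero>\<^bsub>A\<^esub>}"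
  have K0: "submodule K0 R (free_module R B0)" unfolding K0_def using lin_kernel[OF M A submod_carrier[OF M] \<epsilon>(1)] .
  define P where "P n s \<longleftrightarrow> finite (fst s) \<and> submodule (snd s) R (free_module R (fst s)) \<and> (n = 0 \<longrightarrow> s = (B0, K0))" for n :: nat and s :: "'x set \<times> ('x \<Rightarrow> 'a) set"
  define Qd where "Qd s s' \<delta> \<longleftrightarrow> lin_map R (free_module R (fst s')) (free_module R (fst s)) \<delta> \<and>
      \<delta> ` carrier (free_module R (fst s')) = snd s \<and> snd s' = ker (fst s') \<delta> (fst s)" for s s' :: "'x set \<times> ('x \<Rightarrow> 'a) set" and \<delta>
  have "\<exists>t. P 0 t" unfolding P_def using B0 K0 by auto
  moreover have "\<exists>s'. P (Suc n) s' \<and> (\<exists>\<delta>. Qd s s' \<delta>)" if P: "P n s" for n s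
  proof -
    have f: "finite (fst s)" and K: "submodule (snd s) R (free_module R (fst s))" using P unfolding P_def by auto
    obtain G where G: "finite G" "G \<subseteq> snd s" "submodule_generated R (free_module R (fst s)) G = snd s"
      using noeth_fg[OF noeth_free[OF cR NR f] K] by blast
    obtain B' :: "'x set" and \<delta> where B': "finite B'" and \<delta>: "lin_map R (free_module R B') (free_module R (fst s)) \<delta>"
      "\<delta> ` carrier (free_module R B') = snd s"
      using free_cover[OF cR M K G inf] by blast
    have "submodule (ker B' \<delta> (fst s)) R (free_module R B')" unfolding ker_def using lin_kernel[OF M M submod_carrier[OF M] \<delta>(1)] .
    then have "P (Suc n) (B', ker B' \<delta> (fst s)) \<and> Qd s (B', ker B' \<delta> (fst s)) \<delta>" unfolding P_def Qd_def using B' \<delta> by simp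
    then show ?thesis by blast
  qed
  ultimately have "\<exists>t. \<forall>n. P n (t n) \<and> (\<exists>\<delta>. Qd (t n) (t (Suc n)) \<delta>)"
    using dependent_nat_choice[of P "\<lambda>n s s'. \<exists>\<delta>. Qd s s' \<delta>"] by blast
  then obtain t where t: "\<And>n. P n (t n)" "\<And>n. \<exists>\<delta>. Qd (t n) (t (Suc n)) \<delta>" by blast
  then obtain \<delta> where \<delta>: "\<And>n. Qd (t n) (t (Suc n)) (\<delta> n)" by metis
  define B where "B n = fst (t n)" for n
  have t0: "t 0 = (B0, K0)" using t(1)[of 0] unfolding P_def by simp
  have "free_resolution R A B \<delta> \<epsilon>"
    unfolding free_resolution_def module_homs_iff_lin
  proof (intro conjI allI)
    show "lin_map R (free_module R (B (Suc i))) (free_module R (B i)) (\<delta> i)" for i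
      using \<delta>[of i] unfolding Qd_def B_def by blast
    show "\<delta> 0 ` carrier (free_module R (B 1)) = {x \<in> carrier (free_module R (B 0)). \<epsilon> x = \<zero>\<^bsub>A\<^esub>}"
      using \<delta>[of 0] t0 unfolding Qd_def B_def K0_def by simp
    show "\<delta> (Suc i) ` carrier (free_module R (B (Suc (Suc i)))) = {x \<in> carrier (free_module R (B (Suc i))). \<delta> i x = \<zero>\<^bsub>free_module R (B i)\<^esub>}" for i
      using \<delta>[of i] \<delta>[of "Suc i"] unfolding Qd_def B_def ker_def by simp
  qed (use \<epsilon> t0 in \<open>auto simp: B_def\<close>)
  moreover have "finite (B i)" for i using t(1)[of i] unfolding P_def B_def by blast
  ultimately show thesis by (rule that)
qed

section \<open>Submodules with nilpotent quotient\<close>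

text \<open>\<open>Hom(F, N)\<close> for \<open>F\<close> free on a finite set \<open>J\<close>, as the tuples of values on the basis.\<close>

definition fun_module :: "('a,'b,'m) module_scheme \<Rightarrow> 'x set \<Rightarrow> ('a, 'x \<Rightarrow> 'b) module" where
  "fun_module N J = \<lparr>carrier = {w. (\<forall>b\<in>J. w b \<in> carrier N) \<and> (\<forall>b. b \<notin> J \<longrightarrow> w b = \<zero>\<^bsub>N\<^esub>)}, monoid.mult = undefined, one = undefined,
     ring.zero = (\<lambda>b. \<zero>\<^bsub>N\<^esub>), ring.add = (\<lambda>v w b. v b \<oplus>\<^bsub>N\<^esub> w b), module.smult = (\<lambda>r w b. r \<odot>\<^bsub>N\<^esub> w b)\<rparr>"

lemma fun_module_simps [simp]: "carrier (fun_module N J) = {w. (\<forall>b\<in>J. w b \<in> carrier N) \<and> (\<forall>b. b \<notin> J \<longrightarrow> w b = \<zero>\<^bsub>N\<^esub>)}"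
  "\<zero>\<^bsub>fun_module N J\<^esub> = (\<lambda>b. \<zero>\<^bsub>N\<^esub>)" "v \<oplus>\<^bsub>fun_module N J\<^esub> w = (\<lambda>b. v b \<oplus>\<^bsub>N\<^esub> w b)" "r \<odot>\<^bsub>fun_module N J\<^esub> w = (\<lambda>b. r \<odot>\<^bsub>N\<^esub> w b)"
  by (simp_all add: fun_module_def)

lemma fun_module_module: assumes N: "Module.module R N" shows "Module.module R (fun_module N J)"
proof -
  interpret N: module R N by (rule N)
  have c: "w b \<in> carrier N" if "w \<in> carrier (fun_module N J)" for w b using that by (cases "b \<in> J") auto
  show ?thesis
  proof (rule moduleI)
    show "cring R" by (rule N.R.is_cring)
    show "abelian_group (fun_module N J)"
    proof (rule abelian_groupI)
      fix w assume w: "w \<in> carrier (fun_module N J)"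
      show "\<zero>\<^bsub>fun_module N J\<^esub> \<oplus>\<^bsub>fun_module N J\<^esub> w = w" using c[OF w] by simp
      show "\<exists>v\<in>carrier (fun_module N J). v \<oplus>\<^bsub>fun_module N J\<^esub> w = \<zero>\<^bsub>fun_module N J\<^esub>"
        using w c[OF w] by (intro bexI[of _ "\<lambda>b. \<ominus>\<^bsub>N\<^esub> w b"]) (auto simp: N.M.l_neg)
      fix v assume v: "v \<in> carrier (fun_module N J)"
      show "w \<oplus>\<^bsub>fun_module N J\<^esub> v \<in> carrier (fun_module N J)" using v w by simp
      show "w \<oplus>\<^bsub>fun_module N J\<^esub> v = v \<oplus>\<^bsub>fun_module N J\<^esub> w" using c[OF v] c[OF w] by (simp add: N.M.a_comm)
      fix u assume u: "u \<in> carrier (fun_module N J)"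
      show "w \<oplus>\<^bsub>fun_module N J\<^esub> v \<oplus>\<^bsub>fun_module N J\<^esub> u = w \<oplus>\<^bsub>fun_module N J\<^esub> (v \<oplus>\<^bsub>fun_module N J\<^esub> u)"
        using c[OF v] c[OF w] c[OF u] by (simp add: N.M.a_assoc)
    qed simp
  next
    fix a w assume a: "a \<in> carrier R" and w: "w \<in> carrier (fun_module N J)"
    show "a \<odot>\<^bsub>fun_module N J\<^esub> w \<in> carrier (fun_module N J)" using a w by simp
    fix v assume v: "v \<in> carrier (fun_module N J)"
    show "a \<odot>\<^bsub>fun_module N J\<^esub> (w \<oplus>\<^bsub>fun_module N J\<^esub> v) = a \<odot>\<^bsub>fun_module N J\<^esub> w \<oplus>\<^bsub>fun_module N J\<^esub> a \<odot>\<^bsub>fun_module N J\<^esub> v"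
      using a c[OF v] c[OF w] by (simp add: N.smult_r_distr)
  next
    fix a b w assume a: "a \<in> carrier R" and b: "b \<in> carrier R" and w: "w \<in> carrier (fun_module N J)"
    show "(a \<oplus>\<^bsub>R\<^esub> b) \<odot>\<^bsub>fun_module N J\<^esub> w = a \<odot>\<^bsub>fun_module N J\<^esub> w \<oplus>\<^bsub>fun_module N J\<^esub> b \<odot>\<^bsub>fun_module N J\<^esub> w"
      using a b c[OF w] by (simp add: N.smult_l_distr)
    show "(a \<otimes>\<^bsub>R\<^esub> b) \<odot>\<^bsub>fun_module N J\<^esub> w = a \<odot>\<^bsub>fun_module N J\<^esub> (b \<odot>\<^bsub>fun_module N J\<^esub> w)"
      using a b c[OF w] by (simp add: N.smult_assoc1)
  next
    fix w assume w: "w \<in> carrier (fun_module N J)"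
    show "\<one>\<^bsub>R\<^esub> \<odot>\<^bsub>fun_module N J\<^esub> w = w" using c[OF w] by simp
  qed
qed

lemma noeth_fun_module: assumes N: "noeth R N" and J: "finite J" shows "noeth R (fun_module N J)"
proof -
  have MN: "Module.module R N" using N unfolding noeth_def by blast
  interpret N: module R N by (rule MN)
  show ?thesis
  proof (rule noeth_coords[OF fun_module_module[OF MN] N J, where p="\<lambda>b w. w b"])
    show "lin_map R (fun_module N J) N (\<lambda>w. w b)" for b
    proof (rule linI)
      show "w b \<in> carrier N" if "w \<in> carrier (fun_module N J)" for w using that by (cases "b \<in> J") auto
    qed auto
    show "w = \<zero>\<^bsub>fun_module N J\<^esub>" if "w \<in> carrier (fun_module N J)" "\<And>b. b \<in> J \<Longrightarrow> w b = \<zero>\<^bsub>N\<^esub>" for w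
      using that by (auto simp: fun_eq_iff)
  qed
qed

definition msum :: "('a,'b,'m) module_scheme \<Rightarrow> 'b set \<Rightarrow> 'b set \<Rightarrow> 'b set" where
  "msum A S T = {x \<oplus>\<^bsub>A\<^esub> y | x y. x \<in> S \<and> y \<in> T}"

lemma msumI: "x \<in> S \<Longrightarrow> y \<in> T \<Longrightarrow> x \<oplus>\<^bsub>A\<^esub> y \<in> msum A S T" unfolding msum_def by blast

lemma msum_submod:
  assumes A: "Module.module R A" and S: "submodule S R A" and T: "submodule T R A"
  shows "submodule (msum A S T) R A" "S \<subseteq> msum A S T" "T \<subseteq> msum A S T"
proof -
  interpret A: module R A by (rule A)
  have Sc: "x \<in> S \<Longrightarrow> x \<in> carrier A" for x using submod_subset[OF S] by blast
  have Tc: "x \<in> T \<Longrightarrow> x \<in> carrier A" for x using submod_subset[OF T] by blast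
  show s: "S \<subseteq> msum A S T"
  proof
    fix x assume x: "x \<in> S"
    then have "x \<oplus>\<^bsub>A\<^esub> \<zero>\<^bsub>A\<^esub> \<in> msum A S T" by (intro msumI submod_zero[OF T])
    then show "x \<in> msum A S T" using Sc[OF x] by simp
  qed
  show "T \<subseteq> msum A S T"
  proof
    fix x assume x: "x \<in> T"
    then have "\<zero>\<^bsub>A\<^esub> \<oplus>\<^bsub>A\<^esub> x \<in> msum A S T" by (intro msumI submod_zero[OF S])
    then show "x \<in> msum A S T" using Tc[OF x] by simp
  qed
  show "submodule (msum A S T) R A"
  proof (rule submodI[OF A])
    show "msum A S T \<subseteq> carrier A" unfolding msum_def using Sc Tc by auto
    show "\<zero>\<^bsub>A\<^esub> \<in> msum A S T" using s submod_zero[OF S] by blast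
    fix x y assume "x \<in> msum A S T" "y \<in> msum A S T"
    then obtain a b a' b' where *: "a \<in> S" "b \<in> T" "a' \<in> S" "b' \<in> T" "x = a \<oplus>\<^bsub>A\<^esub> b" "y = a' \<oplus>\<^bsub>A\<^esub> b'" unfolding msum_def by blast
    have "x \<oplus>\<^bsub>A\<^esub> y = (a \<oplus>\<^bsub>A\<^esub> a') \<oplus>\<^bsub>A\<^esub> (b \<oplus>\<^bsub>A\<^esub> b')" using * Sc Tc by (simp add: A.M.a_ac)
    then show "x \<oplus>\<^bsub>A\<^esub> y \<in> msum A S T" using msumI[OF submod_add[OF S *(1,3)] submod_add[OF T *(2,4)], of A] by simp
  next
    fix r x assume r: "r \<in> carrier R" and "x \<in> msum A S T"
    then obtain a b where *: "a \<in> S" "b \<in> T" "x = a \<oplus>\<^bsub>A\<^esub> b" unfolding msum_def by blast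
    have "r \<odot>\<^bsub>A\<^esub> x = r \<odot>\<^bsub>A\<^esub> a \<oplus>\<^bsub>A\<^esub> r \<odot>\<^bsub>A\<^esub> b" using * r Sc Tc by (simp add: A.smult_r_distr)
    then show "r \<odot>\<^bsub>A\<^esub> x \<in> msum A S T" using msumI[OF submod_smult[OF S r *(1)] submod_smult[OF T r *(2)], of A] by simp
  qed
qed

lemma lin_cyclic: "Module.module R A \<Longrightarrow> x \<in> carrier A \<Longrightarrow> lin_map R (Rmod R) A (\<lambda>r. r \<odot>\<^bsub>A\<^esub> x)"
  by (rule linI) (auto intro: module.smult_closed module.smult_l_distr module.smult_assoc1)

lemma (in local_noetherian) one_minus_m: assumes "r \<in> \<mm>" shows "\<one> \<ominus> r \<in> carrier R" "\<one> \<ominus> r \<notin> \<mm>"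
proof -
  have r: "r \<in> carrier R" by (rule m_carr[OF assms])
  then show "\<one> \<ominus> r \<in> carrier R" by simp
  show "\<one> \<ominus> r \<notin> \<mm>"
  proof
    assume "\<one> \<ominus> r \<in> \<mm>"
    then have "(\<one> \<ominus> r) \<oplus> r \<in> \<mm>" using assms idm by (simp add: additive_subgroup.a_closed ideal.axioms(1))
    moreover have "(\<one> \<ominus> r) \<oplus> r = \<one>" using mod_diff_add[OF Rmod_module[OF cR], of "\<one>" r] r by simp
    ultimately show False using one_notin by simp
  qed
qed

text \<open>\<open>x z \<in> V\<close> by Nakayama's argument, and if \<open>(V : x\<^sup>n) = (V : x\<^sup>n\<^sup>+\<^sup>1)\<close>, then \<open>z \<in> V + x\<^sup>n W\<close> is impossible, so
  \<open>x\<^sup>n W \<subseteq> V\<close> by maximality. This replaces the Artin-Rees lemma and Krull's intersection theorem.\<close>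

lemma (in local_noetherian) maximal_avoiding:
  assumes W: "noeth R W" and V: "submodule V R W" and z: "z \<in> carrier W" "z \<notin> V"
    and max: "\<And>T. submodule T R W \<Longrightarrow> V \<subseteq> T \<Longrightarrow> z \<notin> T \<Longrightarrow> T = V" and x: "x \<in> \<mm>"
  shows "x \<odot>\<^bsub>W\<^esub> z \<in> V" "\<exists>u::nat. \<forall>w\<in>carrier W. (x [^] u) \<odot>\<^bsub>W\<^esub> w \<in> V"
proof -
  have MW: "Module.module R W" using W unfolding noeth_def by blast
  interpret W: module R W by (rule MW)
  note Vc = submod_subset[OF V]
  have xR: "x \<in> carrier R" by (rule m_carr[OF x])
  show mz: "x \<odot>\<^bsub>W\<^esub> z \<in> V"
  proof (rule ccontr)
    assume nV: "x \<odot>\<^bsub>W\<^esub> z \<notin> V"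
    have xz: "x \<odot>\<^bsub>W\<^esub> z \<in> carrier W" using xR z by simp
    define C where "C = (\<lambda>r. r \<odot>\<^bsub>W\<^esub> (x \<odot>\<^bsub>W\<^esub> z)) ` carrier (Rmod R)"
    have C: "submodule C R W" unfolding C_def
      by (rule lin_image[OF Rmod_module[OF cR] MW submod_carrier[OF Rmod_module[OF cR]] lin_cyclic[OF MW xz]])
    have "x \<odot>\<^bsub>W\<^esub> z = \<one> \<odot>\<^bsub>W\<^esub> (x \<odot>\<^bsub>W\<^esub> z)" using xz by simp
    then have "x \<odot>\<^bsub>W\<^esub> z \<in> C" unfolding C_def by auto
    then have "msum W V C \<noteq> V" using nV msum_submod(3)[OF MW V C] by blast
    then have "z \<in> msum W V C" using max[OF msum_submod(1,2)[OF MW V C]] by blast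
    then obtain v s where vs: "v \<in> V" "s \<in> carrier R" "z = v \<oplus>\<^bsub>W\<^esub> s \<odot>\<^bsub>W\<^esub> (x \<odot>\<^bsub>W\<^esub> z)" unfolding msum_def C_def by auto
    have vc: "v \<in> carrier W" using vs Vc by blast
    have sx: "s \<otimes> x \<in> \<mm>" using ideal.I_l_closed[OF idm x vs(2)] .
    have "(\<one> \<ominus> s \<otimes> x) \<odot>\<^bsub>W\<^esub> z = z \<ominus>\<^bsub>W\<^esub> s \<odot>\<^bsub>W\<^esub> (x \<odot>\<^bsub>W\<^esub> z)"
      using mod_diff_smult[OF MW R.one_closed R.m_closed[OF vs(2) xR] z(1)] z(1) W.smult_assoc1[OF vs(2) xR z(1)] by simp
    also have "\<dots> = v" using arg_cong[OF vs(3), of "\<lambda>t. t \<ominus>\<^bsub>W\<^esub> s \<odot>\<^bsub>W\<^esub> (x \<odot>\<^bsub>W\<^esub> z)"] mod_add_diff[OF MW vc W.smult_closed[OF vs(2) xz]] by (rule trans)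
    finally have "(\<one> \<ominus> s \<otimes> x) \<odot>\<^bsub>W\<^esub> z \<in> V" using vs(1) by simp
    then have "z \<in> V" by (rule mem_of_unit_smult[OF MW V z(1) one_minus_m[OF sx]])
    then show False using z by simp
  qed
  have pR: "x [^] n \<in> carrier R" for n :: nat using xR by simp
  have pS: "(x [^] Suc n) \<odot>\<^bsub>W\<^esub> w = x \<odot>\<^bsub>W\<^esub> ((x [^] n) \<odot>\<^bsub>W\<^esub> w)" if w: "w \<in> carrier W" for n :: nat and w
    using xR w pR by (simp add: R.m_comm W.smult_assoc1)
  define S where "S n = {w\<in>carrier W. (x [^] n) \<odot>\<^bsub>W\<^esub> w \<in> V}" for n :: nat
  have sub: "submodule (S n) R W" for n
    unfolding S_def by (rule lin_preimage[OF MW MW submod_carrier[OF MW] lin_smult_map[OF MW submod_carrier[OF MW] pR] V])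
  have inc: "S n \<subseteq> S (Suc n)" for n
  proof
    fix w assume w: "w \<in> S n"
    then have "w \<in> carrier W" "(x [^] n) \<odot>\<^bsub>W\<^esub> w \<in> V" unfolding S_def by auto
    then show "w \<in> S (Suc n)" using pS[of w n] submod_smult[OF V xR] unfolding S_def by (simp del: R.nat_pow_Suc)
  qed
  obtain n where n: "\<And>m. m \<ge> n \<Longrightarrow> S m = S n" by (rule noeth_stable[OF W, of S]) (use sub inc in auto)
  define T where "T = (\<lambda>w. (x [^] n) \<odot>\<^bsub>W\<^esub> w) ` carrier W"
  have T: "submodule T R W" unfolding T_def
    by (rule lin_image[OF MW MW submod_carrier[OF MW] lin_smult_map[OF MW submod_carrier[OF MW] pR]])
  have "z \<notin> msum W V T"
  proof
    assume "z \<in> msum W V T"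
    then obtain v w where vw: "v \<in> V" "w \<in> carrier W" "z = v \<oplus>\<^bsub>W\<^esub> (x [^] n) \<odot>\<^bsub>W\<^esub> w" unfolding msum_def T_def by auto
    have vc: "v \<in> carrier W" using vw Vc by blast
    have pw: "(x [^] n) \<odot>\<^bsub>W\<^esub> w \<in> carrier W" by (rule W.smult_closed[OF pR vw(2)])
    have eq: "z \<ominus>\<^bsub>W\<^esub> v = (x [^] n) \<odot>\<^bsub>W\<^esub> w" unfolding vw(3) by (rule mod_add_diff2[OF MW vc pw])
    have "x \<odot>\<^bsub>W\<^esub> z \<ominus>\<^bsub>W\<^esub> x \<odot>\<^bsub>W\<^esub> v \<in> V" by (rule submod_diff[OF MW V mz submod_smult[OF V xR vw(1)]])
    then have "x \<odot>\<^bsub>W\<^esub> (z \<ominus>\<^bsub>W\<^esub> v) \<in> V" using mod_smult_diff[OF MW xR z(1) vc] by simp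
    then have "(x [^] Suc n) \<odot>\<^bsub>W\<^esub> w \<in> V" unfolding eq pS[OF vw(2)] .
    then have "w \<in> S (Suc n)" using vw(2) unfolding S_def by blast
    then have "w \<in> S n" using n[of "Suc n"] by simp
    then have "(x [^] n) \<odot>\<^bsub>W\<^esub> w \<in> V" unfolding S_def by blast
    then have "v \<oplus>\<^bsub>W\<^esub> (x [^] n) \<odot>\<^bsub>W\<^esub> w \<in> V" by (rule submod_add[OF V vw(1)])
    then show False using z(2) vw(3) by simp
  qed
  then have "msum W V T = V" by (rule max[OF msum_submod(1,2)[OF MW V T]])
  then have "T \<subseteq> V" using msum_submod(3)[OF MW V T] by simp
  then show "\<exists>u::nat. \<forall>w\<in>carrier W. (x [^] u) \<odot>\<^bsub>W\<^esub> w \<in> V" unfolding T_def by blast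
qed

text \<open>The tuples with all entries in \<open>Q\<close> lie in the submodule \<open>V\<close> of \<open>maximal_avoiding\<close> if \<open>Q\<close> consists of the
  elements whose copies in all coordinates lie in \<open>V\<close>.\<close>

lemma (in local_noetherian) cofinite_submodule:
  fixes J :: "'x set"
  assumes N: "noeth R N" and J: "finite J" and D: "submodule D R (fun_module N J)" and z: "z \<in> carrier (fun_module N J)" "z \<notin> D"
  obtains Q where "submodule Q R N" "\<And>x. x \<in> \<mm> \<Longrightarrow> \<exists>u::nat. \<forall>y\<in>carrier N. (x [^] u) \<odot>\<^bsub>N\<^esub> y \<in> Q"
    "\<And>v. v \<in> D \<Longrightarrow> \<not> (\<forall>b\<in>J. z b \<ominus>\<^bsub>N\<^esub> v b \<in> Q)"
proof -
  let ?W = "fun_module N J"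
  have MN: "Module.module R N" using N unfolding noeth_def by blast
  interpret N: module R N by (rule MN)
  have MW: "Module.module R ?W" by (rule fun_module_module[OF MN])
  have NW: "noeth R ?W" by (rule noeth_fun_module[OF N J])
  define C where "C = {V. submodule V R ?W \<and> D \<subseteq> V \<and> z \<notin> V}"
  obtain V where VC: "V \<in> C" and Vmax: "\<And>S. S \<in> C \<Longrightarrow> V \<subseteq> S \<Longrightarrow> S = V"
    by (rule noeth_max[OF NW, of D C]) (use D z in \<open>auto simp: C_def\<close>)
  have V: "submodule V R ?W" and DV: "D \<subseteq> V" and zV: "z \<notin> V" using VC unfolding C_def by auto
  have max: "T = V" if "submodule T R ?W" "V \<subseteq> T" "z \<notin> T" for T
    using Vmax[of T] that DV unfolding C_def by blast
  define sing where "sing (b::'x) y = (\<lambda>c. if c = b then y else \<zero>\<^bsub>N\<^esub>)" for b y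
  have sl: "lin_map R N ?W (sing b)" if "b \<in> J" for b
    by (rule linI) (use that in \<open>auto simp: sing_def fun_eq_iff\<close>)
  define Q where "Q = {y\<in>carrier N. \<forall>b\<in>J. sing b y \<in> V}"
  have Qs: "submodule Q R N"
  proof (rule submodI[OF MN])
    show "\<zero>\<^bsub>N\<^esub> \<in> Q" unfolding Q_def using lin_zero[OF MN MW submod_carrier[OF MN] sl] submod_zero[OF V] by auto
    show "x \<oplus>\<^bsub>N\<^esub> y \<in> Q" if "x \<in> Q" "y \<in> Q" for x y
      using that lin_add[OF sl, of _ x y] submod_add[OF V] unfolding Q_def by (auto simp del: fun_module_simps)
    show "r \<odot>\<^bsub>N\<^esub> y \<in> Q" if "r \<in> carrier R" "y \<in> Q" for r y
      using that lin_smult[OF sl, of _ r y] submod_smult[OF V] unfolding Q_def by (auto simp del: fun_module_simps)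
  qed (auto simp: Q_def)
  have inV: "w \<in> V" if w: "w \<in> carrier ?W" and wQ: "\<And>b. b \<in> J \<Longrightarrow> w b \<in> Q" for w
  proof -
    have "(\<lambda>c. if c \<in> J' then w c else \<zero>\<^bsub>N\<^esub>) \<in> V" if "J' \<subseteq> J" for J'
      using finite_subset[OF that J] that
    proof (induction J' rule: finite_induct)
      case empty then show ?case using submod_zero[OF V] by simp
    next
      case (insert b J')
      have b: "sing b (w b) \<in> V" using wQ[of b] insert.prems unfolding Q_def by auto
      have c: "w c \<in> carrier N" for c using w by (cases "c \<in> J") auto
      have "(\<lambda>c. if c \<in> J' then w c else \<zero>\<^bsub>N\<^esub>) \<oplus>\<^bsub>?W\<^esub> sing b (w b) = (\<lambda>c. if c \<in> insert b J' then w c else \<zero>\<^bsub>N\<^esub>)"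
        using insert.hyps c by (auto simp: sing_def fun_eq_iff)
      moreover have "(\<lambda>c. if c \<in> J' then w c else \<zero>\<^bsub>N\<^esub>) \<in> V" using insert by simp
      ultimately show ?case using submod_add[OF V _ b] by metis
    qed
    from this[of J] have "(\<lambda>c. if c \<in> J then w c else \<zero>\<^bsub>N\<^esub>) \<in> V" by simp
    moreover have "(\<lambda>c. if c \<in> J then w c else \<zero>\<^bsub>N\<^esub>) = w" using w by (auto simp: fun_eq_iff)
    ultimately show ?thesis by simp
  qed
  show thesis
  proof (rule that[OF Qs])
    fix x assume x: "x \<in> \<mm>"
    have pR: "x [^] n \<in> carrier R" for n :: nat using m_carr[OF x] by simp
    obtain u :: nat where u: "\<forall>w\<in>carrier ?W. (x [^] u) \<odot>\<^bsub>?W\<^esub> w \<in> V" using maximal_avoiding(2)[OF NW V z(1) zV max x] by blast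
    have "(x [^] u) \<odot>\<^bsub>N\<^esub> y \<in> Q" if y: "y \<in> carrier N" for y
    proof -
      have "sing b ((x [^] u) \<odot>\<^bsub>N\<^esub> y) \<in> V" if b: "b \<in> J" for b
        using lin_smult[OF sl[OF b] pR y] u lin_closed[OF sl[OF b] y] by (simp del: fun_module_simps)
      then show ?thesis unfolding Q_def using pR y by simp
    qed
    then show "\<exists>u::nat. \<forall>y\<in>carrier N. (x [^] u) \<odot>\<^bsub>N\<^esub> y \<in> Q" by blast
  next
    fix v assume v: "v \<in> D"
    have vc: "v \<in> carrier ?W" using v submod_subset[OF D] by blast
    show "\<not> (\<forall>b\<in>J. z b \<ominus>\<^bsub>N\<^esub> v b \<in> Q)"
    proof
      assume a: "\<forall>b\<in>J. z b \<ominus>\<^bsub>N\<^esub> v b \<in> Q"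
      define w where "w = (\<lambda>b. z b \<ominus>\<^bsub>N\<^esub> v b)"
      have wc: "w \<in> carrier ?W" unfolding w_def using z(1) vc mod_diff_self[OF MN] by auto
      have "w \<in> V" by (rule inV[OF wc]) (use a in \<open>auto simp: w_def\<close>)
      then have "w \<oplus>\<^bsub>?W\<^esub> v \<in> V" using submod_add[OF V] v DV by blast
      moreover have "w \<oplus>\<^bsub>?W\<^esub> v = z"
      proof (rule ext)
        fix b
        have "z b \<in> carrier N" "v b \<in> carrier N" using z(1) vc by (cases "b \<in> J"; auto)+
        then show "(w \<oplus>\<^bsub>?W\<^esub> v) b = z b" unfolding w_def using mod_diff_add[OF MN] by simp
      qed
      ultimately show False using zV by simp
    qed
  qed
qed

context resolved
begin

lemma coboundary_zero: "coboundary p (\<lambda>f. \<zero>\<^bsub>N\<^esub>)"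
proof (cases p)
  case 0 then show ?thesis unfolding coboundary_def by simp
next
  case (Suc q)
  have "lin_map R (F q) N (\<lambda>f. \<zero>\<^bsub>N\<^esub>)" by (rule lin_zero_map[OF modF modN submod_carrier[OF modN]])
  then show ?thesis unfolding coboundary_def Suc by auto
qed

lemma coboundary_add:
  assumes "coboundary p z" "coboundary p z'" shows "coboundary p (\<lambda>f. z f \<oplus>\<^bsub>N\<^esub> z' f)"
proof (cases p)
  interpret N: module R N by (rule modN)
  case 0 then show ?thesis using assms unfolding coboundary_def by simp
next
  case (Suc q)
  obtain v where v: "lin_map R (F q) N v" "\<forall>f\<in>cF p. z f = v (\<delta> q f)" using assms(1) unfolding coboundary_def Suc by auto
  obtain v' where v': "lin_map R (F q) N v'" "\<forall>f\<in>cF p. z' f = v' (\<delta> q f)" using assms(2) unfolding coboundary_def Suc by auto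
  have "lin_map R (F q) N (\<lambda>f. v f \<oplus>\<^bsub>N\<^esub> v' f)" by (rule lin_pointwise_add[OF modF modN order_refl submod_carrier[OF modN] v(1) v'(1)])
  then show ?thesis unfolding coboundary_def Suc using v(2) v'(2) Suc by (auto intro!: exI[of _ "\<lambda>f. v f \<oplus>\<^bsub>N\<^esub> v' f"])
qed

lemma coboundary_smult:
  assumes "coboundary p z" and r: "r \<in> carrier R" shows "coboundary p (\<lambda>f. r \<odot>\<^bsub>N\<^esub> z f)"
proof (cases p)
  interpret N: module R N by (rule modN)
  case 0 then show ?thesis using assms unfolding coboundary_def by simp
next
  case (Suc q)
  obtain v where v: "lin_map R (F q) N v" "\<forall>f\<in>cF p. z f = v (\<delta> q f)" using assms(1) unfolding coboundary_def Suc by auto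
  have "lin_map R (F q) N (\<lambda>f. r \<odot>\<^bsub>N\<^esub> v f)" by (rule lin_pointwise_smult[OF modF modN order_refl submod_carrier[OF modN] v(1) r])
  then show ?thesis unfolding coboundary_def Suc using v(2) Suc by (auto intro!: exI[of _ "\<lambda>f. r \<odot>\<^bsub>N\<^esub> v f"])
qed

definition cob_tuples :: "nat \<Rightarrow> ('x \<Rightarrow> 'b) set" where
  "cob_tuples p = {w \<in> carrier (fun_module N (B p)). \<exists>z. lin_map R (F p) N z \<and> coboundary p z \<and> (\<forall>b\<in>B p. w b = z (fbasis R b))}"

lemma cob_tuples_submod: "submodule (cob_tuples p) R (fun_module N (B p))"
proof -
  interpret N: module R N by (rule modN)
  note sN = submod_carrier[OF modN]
  interpret W: module R "fun_module N (B p)" by (rule fun_module_module[OF modN])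
  show ?thesis
  proof (rule submodI[OF fun_module_module[OF modN]])
    show "cob_tuples p \<subseteq> carrier (fun_module N (B p))" unfolding cob_tuples_def by blast
    show "\<zero>\<^bsub>fun_module N (B p)\<^esub> \<in> cob_tuples p" unfolding cob_tuples_def
      using lin_zero_map[OF modF modN sN] coboundary_zero by (auto intro!: exI[of _ "\<lambda>f. \<zero>\<^bsub>N\<^esub>"])
    fix w w' assume "w \<in> cob_tuples p" "w' \<in> cob_tuples p"
    then obtain z z' where *: "w \<in> carrier (fun_module N (B p))" "w' \<in> carrier (fun_module N (B p))"
      "lin_map R (F p) N z" "coboundary p z" "\<forall>b\<in>B p. w b = z (fbasis R b)"
      "lin_map R (F p) N z'" "coboundary p z'" "\<forall>b\<in>B p. w' b = z' (fbasis R b)" unfolding cob_tuples_def by blast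
    show "w \<oplus>\<^bsub>fun_module N (B p)\<^esub> w' \<in> cob_tuples p"
      unfolding cob_tuples_def
      using W.M.a_closed[OF *(1,2)] lin_pointwise_add[OF modF modN order_refl sN *(3,6)] coboundary_add[OF *(4,7)] *(5,8)
      by (intro CollectI conjI exI[of _ "\<lambda>f. z f \<oplus>\<^bsub>N\<^esub> z' f"]) auto
  next
    fix r w assume r: "r \<in> carrier R" and "w \<in> cob_tuples p"
    then obtain z where *: "w \<in> carrier (fun_module N (B p))"
      "lin_map R (F p) N z" "coboundary p z" "\<forall>b\<in>B p. w b = z (fbasis R b)" unfolding cob_tuples_def by blast
    show "r \<odot>\<^bsub>fun_module N (B p)\<^esub> w \<in> cob_tuples p"
      unfolding cob_tuples_def
      using W.smult_closed[OF r *(1)] lin_pointwise_smult[OF modF modN order_refl sN *(2) r] coboundary_smult[OF *(3) r] *(4)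
      by (intro CollectI conjI exI[of _ "\<lambda>f. r \<odot>\<^bsub>N\<^esub> z f"]) auto
  qed
qed

lemma noncoboundary_detected:
  assumes loc: "local_noetherian R \<mm>" and N: "noeth R N" and fin: "finite (B p)" and z: "lin_map R (F p) N z" and nc: "\<not> coboundary p z"
  obtains Q where "submodule Q R N" "\<And>x. x \<in> \<mm> \<Longrightarrow> \<exists>u::nat. \<forall>y\<in>carrier N. (x [^] u) \<odot>\<^bsub>N\<^esub> y \<in> Q"
    "\<And>z'. lin_map R (F p) N z' \<Longrightarrow> coboundary p z' \<Longrightarrow> \<exists>f\<in>cF p. z f \<ominus>\<^bsub>N\<^esub> z' f \<notin> Q"
proof -
  interpret L: local_noetherian R \<mm> by (rule loc)
  define tup where "tup z = (\<lambda>b. if b \<in> B p then z (fbasis R b) else \<zero>\<^bsub>N\<^esub>)" for z :: "('x \<Rightarrow> 'a) \<Rightarrow> 'b"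
  have bc: "b \<in> B p \<Longrightarrow> fbasis R b \<in> cF p" for b by (rule fbasis_closed[OF R_cring])
  have tc: "tup z \<in> carrier (fun_module N (B p))" if "lin_map R (F p) N z" for z
    unfolding tup_def using lin_closed[OF that bc] by auto
  have nD: "tup z \<notin> cob_tuples p"
  proof
    assume "tup z \<in> cob_tuples p"
    then obtain z' where z': "lin_map R (F p) N z'" "coboundary p z'" "\<forall>b\<in>B p. tup z b = z' (fbasis R b)" unfolding cob_tuples_def by blast
    have "z f = z' f" if "f \<in> cF p" for f
      by (rule free_lin_unique[OF R_cring modN z z'(1) _ that]) (use z'(3) in \<open>simp add: tup_def\<close>)
    then have "coboundary p z" using z'(2) unfolding coboundary_def by (simp split: nat.splits)
    then show False using nc by simp
  qed
  obtain Q where Q: "submodule Q R N" "\<And>x. x \<in> \<mm> \<Longrightarrow> \<exists>u::nat. \<forall>y\<in>carrier N. (x [^] u) \<odot>\<^bsub>N\<^esub> y \<in> Q"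
    "\<And>v. v \<in> cob_tuples p \<Longrightarrow> \<not> (\<forall>b\<in>B p. tup z b \<ominus>\<^bsub>N\<^esub> v b \<in> Q)"
    by (rule L.cofinite_submodule[OF N fin cob_tuples_submod tc[OF z] nD]) (auto intro: that)
  show thesis
  proof (rule that[OF Q(1,2)])
    fix z' assume z': "lin_map R (F p) N z'" "coboundary p z'"
    have "tup z' \<in> cob_tuples p" unfolding cob_tuples_def using tc[OF z'(1)] z' by (auto simp: tup_def)
    then obtain b where b: "b \<in> B p" "tup z b \<ominus>\<^bsub>N\<^esub> tup z' b \<notin> Q" using Q(3) by blast
    then show "\<exists>f\<in>cF p. z f \<ominus>\<^bsub>N\<^esub> z' f \<notin> Q" using bc by (auto simp: tup_def)
  qed auto
qed

end

text \<open>Naturality of the zigzag in the coresolution.\<close>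

lemma zigzag_transport:
  assumes I: "resolved R Y d N \<eta> A B \<delta> \<epsilon>" and J: "resolved R Y' d' N' \<eta>' A B \<delta> \<epsilon>"
    and \<iota>: "\<And>i. lin_map R (Y i) (Y' i) (\<iota> i)"
    "\<And>i y. y \<in> carrier (Y i) \<Longrightarrow> d' i (\<iota> i y) = \<iota> (Suc i) (d i y)"
  shows "resolved.zigzag R Y d B \<delta> j p c c' \<Longrightarrow> resolved.zigzag R Y' d' B \<delta> j p (\<lambda>f. \<iota> (Suc j) (c f)) (\<lambda>f. \<iota> (Suc 0) (c' f))"
proof -
  interpret I: resolved R Y d N \<eta> A B \<delta> \<epsilon> by (rule I)
  interpret J: resolved R Y' d' N' \<eta>' A B \<delta> \<epsilon> by (rule J)
  have \<iota>0: "\<iota> i \<zero>\<^bsub>Y i\<^esub> = \<zero>\<^bsub>Y' i\<^esub>" for i by (rule lin_zero[OF I.modY J.modY I.subY \<iota>(1)])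
  have coc: "J.cocyc p j (\<lambda>f. \<iota> (Suc j) (c f))" if c: "I.cocyc p j c" for p j c
  proof -
    have "lin_map R (I.F p) (Y' (Suc j)) (\<lambda>f. \<iota> (Suc j) (c f))" by (rule lin_comp[OF I.cocyc_lin[OF c] \<iota>(1)]) simp
    then show ?thesis unfolding J.cocyc_def using I.cocyc_d[OF c] I.cocyc_\<delta>[OF c] \<iota>(2)[OF lin_closed[OF I.cocyc_lin[OF c]]] \<iota>0 by simp
  qed
  show "I.zigzag j p c c' \<Longrightarrow> J.zigzag j p (\<lambda>f. \<iota> (Suc j) (c f)) (\<lambda>f. \<iota> (Suc 0) (c' f))"
  proof (induction j arbitrary: p c)
    case 0 then show ?case by simp
  next
    case (Suc j)
    then obtain c1 where c1: "I.cocyc (Suc p) j c1" "I.zstep p j c c1" "I.zigzag j (Suc p) c1 c'" by auto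
    obtain w where w: "lin_map R (I.F p) (Y (Suc j)) w" "\<forall>f\<in>I.cF p. d (Suc j) (w f) = c f" "\<forall>f\<in>I.cF (Suc p). c1 f = w (\<delta> p f)"
      using c1(2) unfolding I.zstep_def by blast
    have wl: "lin_map R (I.F p) (Y' (Suc j)) (\<lambda>f. \<iota> (Suc j) (w f))" by (rule lin_comp[OF w(1) \<iota>(1)]) simp
    have "J.zstep p j (\<lambda>f. \<iota> (Suc (Suc j)) (c f)) (\<lambda>f. \<iota> (Suc j) (c1 f))" unfolding J.zstep_def
      using wl w \<iota>(2)[OF lin_closed[OF w(1)]] by (intro exI[of _ "\<lambda>f. \<iota> (Suc j) (w f)"]) simp
    then show ?case using coc[OF c1(1)] Suc.IH[OF c1(3)] by auto
  qed
qed

section \<open>Cyclic modules\<close>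

context
  fixes R :: "('a,'r) ring_scheme" (structure) and \<aa>
  assumes cR: "cring R" and \<aa>: "ideal \<aa> R"
begin

interpretation R: cring R by (rule cR)

abbreviation (input) "cyc \<equiv> quo (Rmod R) \<aa>"

lemma cyc_sub: "submodule \<aa> R (Rmod R)" using \<aa> ideal_submod[OF cR] by blast

lemma cyc_module: "Module.module R cyc" by (rule quo_module[OF Rmod_module[OF cR] cyc_sub])

lemma cyc_carrier: "x \<in> carrier cyc \<Longrightarrow> x \<in> carrier R"
  using qrep_closed[OF Rmod_module[OF cR] cyc_sub] by auto

text \<open>The quotient consists of representatives of cosets, hence of elements of \<open>R\<close>; on elements killed by
  \<open>\<aa>\<close> a representative acts like the element that it represents.\<close>

lemma cyc_act:
  assumes E: "Module.module R E" and v: "v \<in> carrier E" "\<And>a. a \<in> \<aa> \<Longrightarrow> a \<odot>\<^bsub>E\<^esub> v = \<zero>\<^bsub>E\<^esub>" and r: "r \<in> carrier R"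
  shows "qrep (Rmod R) \<aa> r \<odot>\<^bsub>E\<^esub> v = r \<odot>\<^bsub>E\<^esub> v"
proof -
  have q: "qrep (Rmod R) \<aa> r \<in> carrier R" "r \<ominus> qrep (Rmod R) \<aa> r \<in> \<aa>"
    using qrep_closed[OF Rmod_module[OF cR] cyc_sub, of r] qrep_diff[OF Rmod_module[OF cR] cyc_sub, of r] r by auto
  have "(r \<odot>\<^bsub>E\<^esub> v) \<ominus>\<^bsub>E\<^esub> (qrep (Rmod R) \<aa> r \<odot>\<^bsub>E\<^esub> v) = \<zero>\<^bsub>E\<^esub>" using mod_diff_smult[OF E r q(1) v(1)] v(2)[OF q(2)] by simp
  then show ?thesis using mod_diff_eq_zero[OF E module.smult_closed[OF E r v(1)] module.smult_closed[OF E q(1) v(1)]] by simp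
qed

lemma cyc_act_lin:
  assumes E: "Module.module R E" and v: "v \<in> carrier E" "\<And>a. a \<in> \<aa> \<Longrightarrow> a \<odot>\<^bsub>E\<^esub> v = \<zero>\<^bsub>E\<^esub>"
  shows "lin_map R cyc E (\<lambda>x. x \<odot>\<^bsub>E\<^esub> v)"
proof -
  interpret E: module R E by (rule E)
  show ?thesis
    by (rule linI) (use cyc_carrier v(1) cyc_act[OF E v] in \<open>auto simp: E.smult_l_distr E.smult_assoc1 simp del: quo_simps(1)\<close>)
qed

lemma cyc_gen: "qrep (Rmod R) \<aa> \<one> \<in> carrier cyc" by simp

lemma cyc_smult_gen: "r \<in> carrier R \<Longrightarrow> r \<odot>\<^bsub>cyc\<^esub> qrep (Rmod R) \<aa> \<one> = qrep (Rmod R) \<aa> r"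
  using lin_smult[OF qrep_lin[OF Rmod_module[OF cR] cyc_sub], of r "\<one>"] by simp

lemma cyc_span: "submodule_generated R cyc {qrep (Rmod R) \<aa> \<one>} = carrier cyc"
proof
  show "submodule_generated R cyc {qrep (Rmod R) \<aa> \<one>} \<subseteq> carrier cyc"
    by (rule span_least[OF submod_carrier[OF cyc_module]]) (use cyc_gen in simp)
  show "carrier cyc \<subseteq> submodule_generated R cyc {qrep (Rmod R) \<aa> \<one>}"
  proof
    fix x assume "x \<in> carrier cyc"
    then obtain r where r: "r \<in> carrier R" "x = qrep (Rmod R) \<aa> r" by auto
    have "r \<odot>\<^bsub>cyc\<^esub> qrep (Rmod R) \<aa> \<one> \<in> submodule_generated R cyc {qrep (Rmod R) \<aa> \<one>}"
      by (rule submod_smult[OF span_submod[OF cyc_module] r(1)]) (use cyc_gen span_incl[of "{qrep (Rmod R) \<aa> \<one>}" R cyc] in auto)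
    then show "x \<in> submodule_generated R cyc {qrep (Rmod R) \<aa> \<one>}" using cyc_smult_gen[OF r(1)] r(2) by simp
  qed
qed

lemma cyc_resolution:
  assumes NR: "noeth R (Rmod R)"
  obtains B :: "nat \<Rightarrow> nat set" and \<delta> \<epsilon> where "free_resolution R cyc B \<delta> \<epsilon>" "\<And>i. finite (B i)"
proof (rule finite_free_resolution[OF cR NR cyc_module _ _ cyc_span infinite_UNIV_nat])
  show "{qrep (Rmod R) \<aa> \<one>} \<subseteq> carrier cyc" using cyc_gen by simp
qed (use that in auto)

end

context local_coresolution
begin

text \<open>On the side of the free resolution a nonzero class in \<open>Ext\<^sup>i(R/\<aa>, N)\<close> is a cocycle \<open>F\<^sub>i \<rightarrow> N\<close> outside
  the coboundaries. The submodule \<open>Q\<close> of \<open>cofinite_submodule\<close> keeps it outside modulo \<open>Q\<close>, and as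
  coboundaries of \<open>N/Q\<close> lift to coboundaries of \<open>N\<close>, the class is nonzero in \<open>Ext\<^sup>i(R/\<aa>, N/Q)\<close>. The
  zigzag carries this back to the injective side.\<close>

lemma detection:
  assumes N: "noeth R N" and \<aa>: "ideal \<aa> R" and e: "e \<in> carrier (Y (Suc i))" "d (Suc i) e = \<zero>\<^bsub>Y (Suc (Suc i))\<^esub>" "\<And>a. a \<in> \<aa> \<Longrightarrow> a \<odot>\<^bsub>Y (Suc i)\<^esub> e = \<zero>\<^bsub>Y (Suc i)\<^esub>"
    and nt: "\<And>e'. e' \<in> carrier (Y i) \<Longrightarrow> (\<And>a. a \<in> \<aa> \<Longrightarrow> a \<odot>\<^bsub>Y i\<^esub> e' = \<zero>\<^bsub>Y i\<^esub>) \<Longrightarrow> d i e' \<noteq> e"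
  obtains Q where "submodule Q R N" "\<And>x. x \<in> \<mm> \<Longrightarrow> \<exists>u::nat. \<forall>y\<in>carrier N. (x [^] u) \<odot>\<^bsub>N\<^esub> y \<in> Q"
    "\<And>(Y' :: nat \<Rightarrow> ('a,'e) module) d' \<eta>' \<iota> s. coresolution R Y' d' (quo N Q) \<eta>' \<Longrightarrow>
       (\<And>i. lin_map R (Y i) (Y' i) (\<iota> i)) \<Longrightarrow>
       (\<And>i y. y \<in> carrier (Y i) \<Longrightarrow> d' i (\<iota> i y) = \<iota> (Suc i) (d i y)) \<Longrightarrow>
       (\<And>x. x \<in> carrier N \<Longrightarrow> \<iota> (Suc 0) (\<eta> x) = \<eta>' (qrep N Q x)) \<Longrightarrow>
       s \<in> carrier (Y' i) \<Longrightarrow> (\<And>a. a \<in> \<aa> \<Longrightarrow> a \<odot>\<^bsub>Y' i\<^esub> s = \<zero>\<^bsub>Y' i\<^esub>) \<Longrightarrow> d' i s \<noteq> \<iota> (Suc i) e"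
proof -
  have MR: "Module.module R (Rmod R)" by (rule Rmod_module[OF cR])
  have sa: "submodule \<aa> R (Rmod R)" using \<aa> ideal_submod[OF cR] by blast
  define A where "A = quo (Rmod R) \<aa>"
  define q where "q = qrep (Rmod R) \<aa>"
  have A: "Module.module R A" unfolding A_def by (rule quo_module[OF MR sa])
  have cA: "carrier A = q ` carrier R" unfolding A_def q_def by simp
  have ql: "lin_map R (Rmod R) A q" unfolding A_def q_def by (rule qrep_lin[OF MR sa])
  have qR: "q r \<in> carrier R" "r \<ominus> q r \<in> \<aa>" if "r \<in> carrier R" for r
    unfolding q_def using qrep_closed[OF MR sa, of r] qrep_diff[OF MR sa, of r] that by auto
  note act_q = cyc_act[OF cR \<aa>, folded q_def]
  note act_lin = cyc_act_lin[OF cR \<aa>, folded A_def]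
  have q1: "q \<one> \<in> carrier A" unfolding cA by simp
  obtain B :: "nat \<Rightarrow> nat set" and \<delta> \<epsilon> where fr: "free_resolution R A B \<delta> \<epsilon>" and finB: "\<And>i. finite (B i)"
    unfolding A_def by (rule cyc_resolution[OF cR \<aa> NR]) (auto intro: that)
  interpret I: resolved R Y d N \<eta> A B \<delta> \<epsilon> by (rule resolved.intro[OF coresolution_axioms resolved_axioms.intro[OF A fr]])
  define \<phi> where "\<phi> x = x \<odot>\<^bsub>Y (Suc i)\<^esub> e" for x
  have \<phi>l: "lin_map R A (Y (Suc i)) \<phi>" unfolding \<phi>_def by (rule act_lin[OF modY e(1,3)])
  have d\<phi>: "d (Suc i) (\<phi> x) = \<zero>\<^bsub>Y (Suc (Suc i))\<^esub>" if "x \<in> carrier A" for x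
  proof -
    have "x \<in> carrier R" using \<open>x \<in> carrier A\<close> qR unfolding cA by auto
    then show ?thesis unfolding \<phi>_def using d_smult[OF _ e(1)] e(2) module.smult_r_null[OF modY] by simp
  qed
  define c where "c f = \<phi> (\<epsilon> f)" for f
  have c: "I.cocyc 0 i c" unfolding c_def by (rule I.cocyc_of_hom[OF \<phi>l d\<phi>])
  have ntriv: "\<not> I.triv 0 i c" unfolding c_def I.triv_hom
  proof
    assume "\<exists>\<psi>. lin_map R A (Y i) \<psi> \<and> (\<forall>x\<in>carrier A. \<phi> x = d i (\<psi> x))"
    then obtain \<psi> where \<psi>: "lin_map R A (Y i) \<psi>" "\<forall>x\<in>carrier A. \<phi> x = d i (\<psi> x)" by blast
    have "d i (\<psi> (q \<one>)) = e" using \<psi>(2) q1 act_q[OF modY e(1,3), of "\<one>"] module.smult_one[OF modY e(1)] unfolding \<phi>_def by simp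
    moreover have "a \<odot>\<^bsub>Y i\<^esub> \<psi> (q \<one>) = \<zero>\<^bsub>Y i\<^esub>" if a: "a \<in> \<aa>" for a
    proof -
      have aR: "a \<in> carrier R" using ideal.Icarr[OF \<aa> a] .
      have "a \<odot>\<^bsub>A\<^esub> q \<one> = q a" using lin_smult[OF ql, of a "\<one>"] aR by simp
      also have "\<dots> = \<zero>\<^bsub>A\<^esub>" unfolding q_def A_def using qrep_zero_iff[OF MR sa, of a] aR a by simp
      finally have "\<psi> (a \<odot>\<^bsub>A\<^esub> q \<one>) = \<zero>\<^bsub>Y i\<^esub>" using lin_zero[OF A modY submod_carrier[OF A] \<psi>(1)] by simp
      then show ?thesis using lin_smult[OF \<psi>(1) aR q1] by simp
    qed
    ultimately show False using nt[OF lin_closed[OF \<psi>(1) q1]] by blast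
  qed
  obtain c' where c': "I.cocyc i 0 c'" "I.zigzag i 0 c c'" using I.zigzag_forward[OF c] by auto
  obtain z where z: "I.cocycle i z" "\<And>f. f \<in> I.cF i \<Longrightarrow> \<eta> (z f) = c' f" using I.cocyc_cocycle[OF c'(1)] by blast
  have zl: "lin_map R (I.F i) N z" using z(1) unfolding I.cocycle_def by blast
  have "\<not> I.coboundary i z" using ntriv I.triv_zigzag[OF c c'(2)] I.triv_coboundary[OF zl z(2)] by simp
  then obtain Q where Q: "submodule Q R N" "\<And>x. x \<in> \<mm> \<Longrightarrow> \<exists>u::nat. \<forall>y\<in>carrier N. (x [^] u) \<odot>\<^bsub>N\<^esub> y \<in> Q"
    "\<And>z'. lin_map R (I.F i) N z' \<Longrightarrow> I.coboundary i z' \<Longrightarrow> \<exists>f\<in>I.cF i. z f \<ominus>\<^bsub>N\<^esub> z' f \<notin> Q"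
    by (rule I.noncoboundary_detected[OF local_noetherian_axioms N finB zl]) (auto intro: that)
  show thesis
  proof (rule that[OF Q(1,2)])
    fix Y' :: "nat \<Rightarrow> ('a,'e) module" and d' \<eta>' \<iota> s
    assume J: "coresolution R Y' d' (quo N Q) \<eta>'"
      and \<iota>: "\<And>i. lin_map R (Y i) (Y' i) (\<iota> i)" "\<And>i y. y \<in> carrier (Y i) \<Longrightarrow> d' i (\<iota> i y) = \<iota> (Suc i) (d i y)"
        "\<And>x. x \<in> carrier N \<Longrightarrow> \<iota> (Suc 0) (\<eta> x) = \<eta>' (qrep N Q x)"
      and s: "s \<in> carrier (Y' i)" "\<And>a. a \<in> \<aa> \<Longrightarrow> a \<odot>\<^bsub>Y' i\<^esub> s = \<zero>\<^bsub>Y' i\<^esub>"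
    interpret J: resolved R Y' d' "quo N Q" \<eta>' A B \<delta> \<epsilon> by (rule resolved.intro[OF J resolved_axioms.intro[OF A fr]])
    note qNl = qrep_lin[OF modN Q(1)]
    show "d' i s \<noteq> \<iota> (Suc i) e"
    proof
      assume ds: "d' i s = \<iota> (Suc i) e"
      have \<phi>': "lin_map R A (Y' (Suc i)) (\<lambda>x. \<iota> (Suc i) (\<phi> x))" by (rule lin_comp[OF \<phi>l \<iota>(1)]) simp
      have \<iota>0: "\<iota> k \<zero>\<^bsub>Y k\<^esub> = \<zero>\<^bsub>Y' k\<^esub>" for k by (rule lin_zero[OF modY J.modY subY \<iota>(1)])
      have d\<phi>': "d' (Suc i) (\<iota> (Suc i) (\<phi> x)) = \<zero>\<^bsub>Y' (Suc (Suc i))\<^esub>" if "x \<in> carrier A" for x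
        using \<iota>(2)[OF lin_closed[OF \<phi>l that]] d\<phi>[OF that] \<iota>0 by simp
      have cc: "J.cocyc 0 i (\<lambda>f. \<iota> (Suc i) (c f))" unfolding c_def by (rule J.cocyc_of_hom[OF \<phi>' d\<phi>'])
      have "\<iota> (Suc i) (\<phi> x) = d' i (x \<odot>\<^bsub>Y' i\<^esub> s)" if "x \<in> carrier A" for x
      proof -
        have "x \<in> carrier R" using \<open>x \<in> carrier A\<close> qR unfolding cA by auto
        then show ?thesis unfolding \<phi>_def using lin_smult[OF \<iota>(1) _ e(1)] J.d_smult[OF _ s(1)] ds by simp
      qed
      then have "J.triv 0 i (\<lambda>f. \<iota> (Suc i) (c f))" unfolding c_def using J.triv_hom[of i "\<lambda>x. \<iota> (Suc i) (\<phi> x)"] act_lin[OF J.modY s] by blast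
      moreover have "J.zigzag i 0 (\<lambda>f. \<iota> (Suc i) (c f)) (\<lambda>f. \<iota> (Suc 0) (c' f))"
        by (rule zigzag_transport[OF I.resolved_axioms J.resolved_axioms \<iota>(1,2) c'(2)])
      ultimately have t: "J.triv i 0 (\<lambda>f. \<iota> (Suc 0) (c' f))" using J.triv_zigzag[OF cc] by simp
      have zQ: "lin_map R (I.F i) (quo N Q) (\<lambda>f. qrep N Q (z f))" by (rule lin_comp[OF zl qNl]) simp
      have "J.coboundary i (\<lambda>f. qrep N Q (z f))"
        using J.triv_coboundary[OF zQ, of "\<lambda>f. \<iota> (Suc 0) (c' f)"] t \<iota>(3)[OF lin_closed[OF zl]] z(2) by simp
      then have "\<exists>z'. lin_map R (I.F i) N z' \<and> I.coboundary i z' \<and> (\<forall>f\<in>I.cF i. qrep N Q (z f) = qrep N Q (z' f))"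
      proof (cases i)
        case 0
        assume "J.coboundary i (\<lambda>f. qrep N Q (z f))"
        then have "\<forall>f\<in>I.cF i. qrep N Q (z f) = qrep N Q \<zero>\<^bsub>N\<^esub>" unfolding J.coboundary_def 0 by simp
        then show ?thesis using lin_zero_map[OF I.modF modN submod_carrier[OF modN]] I.coboundary_zero by (intro exI[of _ "\<lambda>f. \<zero>\<^bsub>N\<^esub>"]) blast
      next
        case (Suc k)
        assume "J.coboundary i (\<lambda>f. qrep N Q (z f))"
        then obtain v where v: "lin_map R (I.F k) (quo N Q) v" "\<forall>f\<in>I.cF i. qrep N Q (z f) = v (\<delta> k f)"
          unfolding J.coboundary_def Suc by auto
        obtain v' where v': "lin_map R (I.F k) N v'" "\<And>f. f \<in> I.cF k \<Longrightarrow> qrep N Q (v' f) = v f"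
        proof (rule free_lift[OF cR modN J.modN submod_carrier[OF modN] qNl v(1)])
          show "v f \<in> qrep N Q ` carrier N" if "f \<in> I.cF k" for f using lin_closed[OF v(1) that] by simp
        qed (auto intro: that)
        have l: "lin_map R (I.F i) N (\<lambda>f. v' (\<delta> k f))" unfolding Suc by (rule lin_comp[OF I.\<delta>_lin v'(1)]) simp
        have "I.coboundary i (\<lambda>f. v' (\<delta> k f))" unfolding I.coboundary_def Suc using v'(1) by auto
        moreover have "\<forall>f\<in>I.cF i. qrep N Q (z f) = qrep N Q (v' (\<delta> k f))" using v(2) v'(2)[OF I.\<delta>_closed] Suc by simp
        ultimately show ?thesis using l by blast
      qed
      then obtain z' where z': "lin_map R (I.F i) N z'" "I.coboundary i z'" "\<forall>f\<in>I.cF i. qrep N Q (z f) = qrep N Q (z' f)" by blast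
      obtain f where f: "f \<in> I.cF i" "z f \<ominus>\<^bsub>N\<^esub> z' f \<notin> Q" using Q(3)[OF z'(1,2)] by blast
      then show False using z'(3) qrep_eq_iff[OF modN Q(1) lin_closed[OF zl f(1)] lin_closed[OF z'(1) f(1)]] by simp
    qed
  qed auto
qed

end

section \<open>Propagation of vanishing\<close>

text \<open>The coresolutions of the quotients of \<open>N\<close> are required in the same type as that of \<open>N\<close>, since a
  locale assumption cannot quantify over types.\<close>

locale rich_coresolution = local_coresolution R Y d N \<eta> \<mm>
  for R :: "('a,'r) ring_scheme" (structure) and Y :: "nat \<Rightarrow> ('a,'e) module" and d :: "nat \<Rightarrow> 'e \<Rightarrow> 'e" and N :: "('a,'b,'m) module_scheme" and \<eta> :: "'b \<Rightarrow> 'e" and \<mm> +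
  assumes noethN: "noeth R N"
    and enough: "submodule Q R N \<Longrightarrow> \<exists>(Y' :: nat \<Rightarrow> ('a,'e) module) d' \<eta>'. coresolution R Y' d' (quo N Q) \<eta>'"
begin

lemma no_gap:
  assumes van1: "ext_vanishes \<mm> (Suc a)" and van2: "ext_vanishes \<mm> (Suc (a + c))" and nva: "\<not> ext_vanishes \<mm> a"
  shows "ext_vanishes \<mm> (Suc (Suc (a + c)))"
proof (rule ccontr)
  assume nv: "\<not> ext_vanishes \<mm> (Suc (Suc (a + c)))"
  obtain e where e: "e \<in> carrier (Y (Suc a))" "d (Suc a) e = \<zero>\<^bsub>Y (Suc (Suc a))\<^esub>" "\<And>r. r \<in> \<mm> \<Longrightarrow> r \<odot>\<^bsub>Y (Suc a)\<^esub> e = \<zero>\<^bsub>Y (Suc a)\<^esub>"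
    "\<And>e'. e' \<in> carrier (Y a) \<Longrightarrow> (\<And>r. r \<in> \<mm> \<Longrightarrow> r \<odot>\<^bsub>Y a\<^esub> e' = \<zero>\<^bsub>Y a\<^esub>) \<Longrightarrow> d a e' \<noteq> e"
    using nva unfolding ext_vanishes_def by blast
  obtain Q where Q: "submodule Q R N" "\<And>x. x \<in> \<mm> \<Longrightarrow> \<exists>u::nat. \<forall>y\<in>carrier N. (x [^] u) \<odot>\<^bsub>N\<^esub> y \<in> Q"
    "\<And>(Y' :: nat \<Rightarrow> ('a,'e) module) d' \<eta>' \<iota> s. coresolution R Y' d' (quo N Q) \<eta>' \<Longrightarrow>
       (\<And>i. lin_map R (Y i) (Y' i) (\<iota> i)) \<Longrightarrow>
       (\<And>i y. y \<in> carrier (Y i) \<Longrightarrow> d' i (\<iota> i y) = \<iota> (Suc i) (d i y)) \<Longrightarrow>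
       (\<And>x. x \<in> carrier N \<Longrightarrow> \<iota> (Suc 0) (\<eta> x) = \<eta>' (qrep N Q x)) \<Longrightarrow>
       s \<in> carrier (Y' a) \<Longrightarrow> (\<And>r. r \<in> \<mm> \<Longrightarrow> r \<odot>\<^bsub>Y' a\<^esub> s = \<zero>\<^bsub>Y' a\<^esub>) \<Longrightarrow> d' a s \<noteq> \<iota> (Suc a) e"
    by (rule detection[OF noethN idm e]) (auto intro: that)
  obtain Y' :: "nat \<Rightarrow> ('a,'e) module" and d' \<eta>' where J: "coresolution R Y' d' (quo N Q) \<eta>'" using enough[OF Q(1)] by blast
  obtain \<iota> where \<iota>: "\<And>i. lin_map R (Y i) (Y' i) (\<iota> i)"
    "\<And>i y. y \<in> carrier (Y i) \<Longrightarrow> d' i (\<iota> i y) = \<iota> (Suc i) (d i y)" "\<And>x. x \<in> carrier N \<Longrightarrow> \<iota> (Suc 0) (\<eta> x) = \<eta>' (qrep N Q x)"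
    by (rule comparison[OF J qrep_lin[OF modN Q(1)]]) (auto intro: that)
  have nil: "\<exists>u::nat. \<forall>y\<in>carrier (quo N Q). (x [^] u) \<odot>\<^bsub>quo N Q\<^esub> y = \<zero>\<^bsub>quo N Q\<^esub>" if x: "x \<in> \<mm>" for x
  proof -
    obtain u :: nat where u: "\<forall>y\<in>carrier N. (x [^] u) \<odot>\<^bsub>N\<^esub> y \<in> Q" using Q(2)[OF x] by blast
    interpret N: module R N by (rule modN)
    have p: "x [^] u \<in> carrier R" using m_carr[OF x] by simp
    have "(x [^] u) \<odot>\<^bsub>quo N Q\<^esub> y = \<zero>\<^bsub>quo N Q\<^esub>" if "y \<in> carrier (quo N Q)" for y
    proof -
      have y: "y \<in> carrier N" using \<open>y \<in> carrier (quo N Q)\<close> qrep_closed[OF modN Q(1)] by auto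
      then show ?thesis using qrep_zero_iff[OF modN Q(1) N.smult_closed[OF p y]] u by simp
    qed
    then show ?thesis by blast
  qed
  obtain s where "s \<in> carrier (Y' a)" "\<And>r. r \<in> \<mm> \<Longrightarrow> r \<odot>\<^bsub>Y' a\<^esub> s = \<zero>\<^bsub>Y' a\<^esub>" "d' a s = \<iota> (Suc a) e"
    by (rule gap_trivialises[OF van1 van2 e(1,2,3) nv J \<iota>(1,2) nil]) (auto intro: that)
  then show False using Q(3)[OF J \<iota>] by blast
qed

text \<open>Otherwise the last nonvanishing degree before \<open>n\<close> and the first one after it bound a gap.\<close>

lemma vanishing_persists:
  assumes van: "ext_vanishes \<mm> n" and t: "t \<le> n" "\<not> ext_vanishes \<mm> t" and i: "n \<le> i"
  shows "ext_vanishes \<mm> i"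
proof (rule ccontr)
  assume ni: "\<not> ext_vanishes \<mm> i"
  define a where "a = (GREATEST k. k \<le> n \<and> \<not> ext_vanishes \<mm> k)"
  have a: "a \<le> n \<and> \<not> ext_vanishes \<mm> a" unfolding a_def by (rule GreatestI_nat[of _ t n]) (use t in auto)
  have amax: "k \<le> a" if "k \<le> n" "\<not> ext_vanishes \<mm> k" for k unfolding a_def by (rule Greatest_le_nat[of _ k n]) (use that in auto)
  have an: "a < n" using a van by (metis le_neq_implies_less)
  have van1: "ext_vanishes \<mm> (Suc a)" using amax[of "Suc a"] an by fastforce
  define b where "b = (LEAST k. n \<le> k \<and> \<not> ext_vanishes \<mm> k)"
  have b: "n \<le> b \<and> \<not> ext_vanishes \<mm> b" unfolding b_def by (rule LeastI[of _ i]) (use i ni in auto)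
  have bn: "n < b" using b van by (metis le_neq_implies_less)
  obtain c where c: "b = Suc (Suc (a + c))" using an bn by (metis Suc_leI add_Suc less_imp_Suc_add order_le_less_trans nat_less_le add.commute add_Suc_right)
  have "ext_vanishes \<mm> (Suc (a + c))"
  proof (rule ccontr)
    assume "\<not> ext_vanishes \<mm> (Suc (a + c))"
    then have "b \<le> Suc (a + c)" unfolding b_def using bn c by (intro Least_le) simp
    then show False using c by simp
  qed
  then have "ext_vanishes \<mm> b" unfolding c by (rule no_gap[OF van1 _ conjunct2[OF a]])
  then show False using b by blast
qed

text \<open>Let \<open>\<bb>\<close> be maximal among the ideals for which vanishing fails in some degree \<open>\<ge> n\<close>. Then \<open>\<bb>\<close> is
  properly contained in \<open>\<mm>\<close>; take \<open>x \<in> \<mm>\<close> outside \<open>\<bb>\<close>, so that vanishing holds for \<open>\<dd> = \<bb> + R x\<close>. If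
  \<open>\<cc> = (\<bb> : x)\<close> is larger than \<open>\<bb>\<close>, the exact sequence \<open>R/\<cc> \<rightarrow> R/\<bb> \<rightarrow> R/\<dd>\<close> gives a contradiction. If
  \<open>\<cc> = \<bb>\<close>, it shows that \<open>x\<close> acts surjectively on \<open>Ext(R/\<bb>, N)\<close>. For a finitely generated Ext this
  contradicts Nakayama's lemma; here, \<open>detection\<close> yields a quotient \<open>N/Q\<close> in which a nonzero class
  survives although it is divisible by a power of \<open>x\<close> that is null homotopic.\<close>

lemma ext_vanishes_all_ideals:
  assumes van: "\<And>i. n \<le> i \<Longrightarrow> ext_vanishes \<mm> i" and \<aa>: "ideal \<aa> R" and i: "n \<le> i"
  shows "ext_vanishes \<aa> i"
proof (rule ccontr)
  interpret Ym: module R "Y j" for j by (rule modY)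
  assume bad: "\<not> ext_vanishes \<aa> i"
  define C where "C = {\<bb>. ideal \<bb> R \<and> (\<exists>i\<ge>n. \<not> ext_vanishes \<bb> i)}"
  obtain \<bb> where \<bb>: "\<bb> \<in> C" and max: "\<And>S. S \<in> C \<Longrightarrow> \<bb> \<subseteq> S \<Longrightarrow> S = \<bb>"
  proof (rule noeth_max[OF NR, of \<aa> C])
    show "\<aa> \<in> C" using \<aa> bad i unfolding C_def by blast
    show "submodule S R (Rmod R)" if "S \<in> C" for S using that ideal_submod[OF cR] unfolding C_def by blast
  qed blast
  obtain j where idb: "ideal \<bb> R" and j: "n \<le> j" "\<not> ext_vanishes \<bb> j" using \<bb> unfolding C_def by blast
  have bigger: "ext_vanishes \<cc> k" if "ideal \<cc> R" "\<bb> \<subseteq> \<cc>" "\<cc> \<noteq> \<bb>" "n \<le> k" for \<cc> k using max[of \<cc>] that unfolding C_def by blast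
  obtain e where e: "e \<in> carrier (Y (Suc j))" "d (Suc j) e = \<zero>\<^bsub>Y (Suc (Suc j))\<^esub>" "\<And>r. r \<in> \<bb> \<Longrightarrow> r \<odot>\<^bsub>Y (Suc j)\<^esub> e = \<zero>\<^bsub>Y (Suc j)\<^esub>"
    "\<And>e'. e' \<in> carrier (Y j) \<Longrightarrow> (\<And>r. r \<in> \<bb> \<Longrightarrow> r \<odot>\<^bsub>Y j\<^esub> e' = \<zero>\<^bsub>Y j\<^esub>) \<Longrightarrow> d j e' \<noteq> e"
    using j unfolding ext_vanishes_def by blast
  have bR: "\<bb> \<subseteq> carrier R" using ideal.Icarr[OF idb] by blast
  \<comment> \<open>Vanishing holds for \<open>\<mm>\<close> by assumption, and trivially for the unit ideal.\<close>
  have "\<not> \<mm> \<subseteq> \<bb>"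
  proof
    assume "\<mm> \<subseteq> \<bb>"
    then have "\<bb> = \<mm> \<or> \<bb> = carrier R" using maximalideal.I_maximal[OF maxm idb] bR by blast
    then have "\<bb> = carrier R" using van j by blast
    then have "e = \<zero>\<^bsub>Y (Suc j)\<^esub>" using e(3)[of "\<one>"] e(1) by simp
    then show False using e(4)[of "\<zero>\<^bsub>Y j\<^esub>"] d_zero Ym.smult_r_null[OF subsetD[OF bR]] by simp
  qed
  then obtain x where x: "x \<in> \<mm>" "x \<notin> \<bb>" by blast
  have xR: "x \<in> carrier R" by (rule m_carr[OF x(1)])
  have MR: "Module.module R (Rmod R)" by (rule Rmod_module[OF cR])
  have sb: "submodule \<bb> R (Rmod R)" using idb ideal_submod[OF cR] by blast
  define X' where "X' = (\<lambda>r. r \<odot>\<^bsub>Rmod R\<^esub> x) ` carrier (Rmod R)"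
  have X': "submodule X' R (Rmod R)" unfolding X'_def
    by (rule lin_image[OF MR MR submod_carrier[OF MR] lin_cyclic[OF MR]]) (use xR in simp)
  define \<dd> where "\<dd> = msum (Rmod R) \<bb> X'"
  have "x = \<one> \<odot>\<^bsub>Rmod R\<^esub> x" using xR by simp
  then have xX: "x \<in> X'" unfolding X'_def by auto
  have \<dd>: "ideal \<dd> R" "\<bb> \<subseteq> \<dd>" "x \<in> \<dd>"
    unfolding \<dd>_def ideal_submod[OF cR] using msum_submod[OF MR sb X'] xX by auto
  have dv: "ext_vanishes \<dd> k" if "n \<le> k" for k by (rule bigger[OF \<dd>(1,2)]) (use \<dd>(3) x that in auto)
  have dk: "r \<odot>\<^bsub>Y k\<^esub> y = \<zero>\<^bsub>Y k\<^esub>" if r: "r \<in> \<dd>" and y: "y \<in> carrier (Y k)" "x \<odot>\<^bsub>Y k\<^esub> y = \<zero>\<^bsub>Y k\<^esub>" "\<And>a. a \<in> \<bb> \<Longrightarrow> a \<odot>\<^bsub>Y k\<^esub> y = \<zero>\<^bsub>Y k\<^esub>" for r k y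
  proof -
    obtain a t where at: "a \<in> \<bb>" "t \<in> carrier R" "r = a \<oplus> t \<otimes> x" using r unfolding \<dd>_def msum_def X'_def by auto
    have "a \<in> carrier R" using at bR by blast
    then show ?thesis unfolding at(3) using at(2) xR y y(3)[OF at(1)] by (simp add: Ym.smult_l_distr Ym.smult_assoc1)
  qed
  define \<cc> where "\<cc> = {r\<in>carrier R. r \<odot>\<^bsub>Rmod R\<^esub> x \<in> \<bb>}"
  have \<cc>: "ideal \<cc> R" unfolding \<cc>_def by (rule annihilator_ideal[OF MR sb]) (use xR in simp)
  have b\<cc>: "\<bb> \<subseteq> \<cc>" unfolding \<cc>_def using bR ideal.I_r_closed[OF idb _ xR] by auto
  show False
  proof (cases "\<cc> = \<bb>")
    case False
    have cv: "ext_vanishes \<cc> j" by (rule bigger[OF \<cc> b\<cc> False j(1)])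
    obtain e1 where e1: "e1 \<in> carrier (Y j)" "\<And>r. r \<in> \<cc> \<Longrightarrow> r \<odot>\<^bsub>Y j\<^esub> e1 = \<zero>\<^bsub>Y j\<^esub>" "d j e1 = x \<odot>\<^bsub>Y (Suc j)\<^esub> e"
    proof (rule ext_vanishesD[OF cv, of "x \<odot>\<^bsub>Y (Suc j)\<^esub> e"])
      show "x \<odot>\<^bsub>Y (Suc j)\<^esub> e \<in> carrier (Y (Suc j))" using xR e by simp
      show "d (Suc j) (x \<odot>\<^bsub>Y (Suc j)\<^esub> e) = \<zero>\<^bsub>Y (Suc (Suc j))\<^esub>" using d_smult[OF xR e(1)] e(2) xR by simp
      fix r assume "r \<in> \<cc>"
      then have "r \<in> carrier R" "r \<otimes> x \<in> \<bb>" unfolding \<cc>_def by auto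
      then show "r \<odot>\<^bsub>Y (Suc j)\<^esub> (x \<odot>\<^bsub>Y (Suc j)\<^esub> e) = \<zero>\<^bsub>Y (Suc j)\<^esub>" using e(3) xR e(1) Ym.smult_assoc1 by metis
    qed blast
    obtain e2 where e2: "e2 \<in> carrier (Y j)" "x \<odot>\<^bsub>Y j\<^esub> e2 = e1" "\<And>a. a \<in> \<bb> \<Longrightarrow> a \<odot>\<^bsub>Y j\<^esub> e2 = \<zero>\<^bsub>Y j\<^esub>"
    proof (rule baer_solve[OF cR baerY idb xR e1(1)])
      show "r \<odot>\<^bsub>Y j\<^esub> e1 = \<zero>\<^bsub>Y j\<^esub>" if "r \<in> carrier R" "r \<otimes> x \<in> \<bb>" for r using e1(2) that unfolding \<cc>_def by simp
    qed blast
    have de2: "d j e2 \<in> carrier (Y (Suc j))" by (rule d_closed[OF e2(1)])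
    obtain e3 where e3: "e3 \<in> carrier (Y j)" "\<And>r. r \<in> \<dd> \<Longrightarrow> r \<odot>\<^bsub>Y j\<^esub> e3 = \<zero>\<^bsub>Y j\<^esub>" "d j e3 = e \<ominus>\<^bsub>Y (Suc j)\<^esub> d j e2"
    proof (rule ext_vanishesD[OF dv[OF j(1)], of "e \<ominus>\<^bsub>Y (Suc j)\<^esub> d j e2"])
      show c: "e \<ominus>\<^bsub>Y (Suc j)\<^esub> d j e2 \<in> carrier (Y (Suc j))" using e(1) de2 by simp
      show "d (Suc j) (e \<ominus>\<^bsub>Y (Suc j)\<^esub> d j e2) = \<zero>\<^bsub>Y (Suc (Suc j))\<^esub>"
        using d_diff[OF e(1) de2] e(2) dd[OF e2(1)] mod_diff_self[OF modY] by simp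
      fix r assume r: "r \<in> \<dd>"
      show "r \<odot>\<^bsub>Y (Suc j)\<^esub> (e \<ominus>\<^bsub>Y (Suc j)\<^esub> d j e2) = \<zero>\<^bsub>Y (Suc j)\<^esub>"
      proof (rule dk[OF r c])
        show "x \<odot>\<^bsub>Y (Suc j)\<^esub> (e \<ominus>\<^bsub>Y (Suc j)\<^esub> d j e2) = \<zero>\<^bsub>Y (Suc j)\<^esub>"
          using mod_smult_diff[OF modY xR e(1) de2] d_smult[OF xR e2(1)] e2(2) e1(3) mod_diff_self[OF modY Ym.smult_closed[OF xR de2]] by simp
        fix a assume a: "a \<in> \<bb>"
        then have aR: "a \<in> carrier R" using bR by blast
        show "a \<odot>\<^bsub>Y (Suc j)\<^esub> (e \<ominus>\<^bsub>Y (Suc j)\<^esub> d j e2) = \<zero>\<^bsub>Y (Suc j)\<^esub>"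
          using mod_smult_diff[OF modY aR e(1) de2] d_smult[OF aR e2(1)] e2(3)[OF a] e(3)[OF a] d_zero mod_diff_self[OF modY Ym.smult_closed[OF aR de2]] by simp
      qed
    qed blast
    have "d j (e3 \<oplus>\<^bsub>Y j\<^esub> e2) = e" using d_add[OF e3(1) e2(1)] e3(3) mod_diff_add[OF modY e(1) de2] by simp
    moreover have "a \<odot>\<^bsub>Y j\<^esub> (e3 \<oplus>\<^bsub>Y j\<^esub> e2) = \<zero>\<^bsub>Y j\<^esub>" if a: "a \<in> \<bb>" for a
    proof -
      have "a \<in> carrier R" "a \<in> \<dd>" using a bR \<dd>(2) by auto
      then show ?thesis using e3 e2 a by (simp add: Ym.smult_r_distr)
    qed
    ultimately show False using e(4) Ym.M.a_closed[OF e3(1) e2(1)] by blast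
  next
    case True
    have divide: "\<exists>y\<in>carrier (Y (Suc j)). d (Suc j) y = \<zero>\<^bsub>Y (Suc (Suc j))\<^esub> \<and> (\<forall>a\<in>\<bb>. a \<odot>\<^bsub>Y (Suc j)\<^esub> y = \<zero>\<^bsub>Y (Suc j)\<^esub>) \<and> x \<odot>\<^bsub>Y (Suc j)\<^esub> y = w"
      if w: "w \<in> carrier (Y (Suc j))" "d (Suc j) w = \<zero>\<^bsub>Y (Suc (Suc j))\<^esub>" "\<And>a. a \<in> \<bb> \<Longrightarrow> a \<odot>\<^bsub>Y (Suc j)\<^esub> w = \<zero>\<^bsub>Y (Suc j)\<^esub>" for w
    proof -
      obtain e0 where e0: "e0 \<in> carrier (Y (Suc j))" "x \<odot>\<^bsub>Y (Suc j)\<^esub> e0 = w" "\<And>a. a \<in> \<bb> \<Longrightarrow> a \<odot>\<^bsub>Y (Suc j)\<^esub> e0 = \<zero>\<^bsub>Y (Suc j)\<^esub>"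
      proof (rule baer_solve[OF cR baerY idb xR w(1)])
        show "r \<odot>\<^bsub>Y (Suc j)\<^esub> w = \<zero>\<^bsub>Y (Suc j)\<^esub>" if "r \<in> carrier R" "r \<otimes> x \<in> \<bb>" for r
          using w(3)[of r] that True unfolding \<cc>_def by auto
      qed blast
      have de0: "d (Suc j) e0 \<in> carrier (Y (Suc (Suc j)))" by (rule d_closed[OF e0(1)])
      obtain e3 where e3: "e3 \<in> carrier (Y (Suc j))" "\<And>r. r \<in> \<dd> \<Longrightarrow> r \<odot>\<^bsub>Y (Suc j)\<^esub> e3 = \<zero>\<^bsub>Y (Suc j)\<^esub>" "d (Suc j) e3 = d (Suc j) e0"
      proof (rule ext_vanishesD[OF dv[of "Suc j"] de0 dd[OF e0(1)]])
        fix r assume r: "r \<in> \<dd>"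
        show "r \<odot>\<^bsub>Y (Suc (Suc j))\<^esub> d (Suc j) e0 = \<zero>\<^bsub>Y (Suc (Suc j))\<^esub>"
        proof (rule dk[OF r de0])
          show "x \<odot>\<^bsub>Y (Suc (Suc j))\<^esub> d (Suc j) e0 = \<zero>\<^bsub>Y (Suc (Suc j))\<^esub>" using d_smult[OF xR e0(1)] e0(2) w(2) by simp
          show "a \<odot>\<^bsub>Y (Suc (Suc j))\<^esub> d (Suc j) e0 = \<zero>\<^bsub>Y (Suc (Suc j))\<^esub>" if "a \<in> \<bb>" for a
            using d_smult[OF subsetD[OF bR that] e0(1)] e0(3)[OF that] d_zero by simp
        qed
      qed (use j in auto)
      show ?thesis
      proof (intro bexI[of _ "e0 \<ominus>\<^bsub>Y (Suc j)\<^esub> e3"] conjI ballI)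
        show "e0 \<ominus>\<^bsub>Y (Suc j)\<^esub> e3 \<in> carrier (Y (Suc j))" using e0 e3 by simp
        show "d (Suc j) (e0 \<ominus>\<^bsub>Y (Suc j)\<^esub> e3) = \<zero>\<^bsub>Y (Suc (Suc j))\<^esub>" using d_diff[OF e0(1) e3(1)] e3(3) mod_diff_self[OF modY de0] by simp
        show "x \<odot>\<^bsub>Y (Suc j)\<^esub> (e0 \<ominus>\<^bsub>Y (Suc j)\<^esub> e3) = w"
          using mod_smult_diff[OF modY xR e0(1) e3(1)] e0(2) e3(2)[OF \<dd>(3)] mod_diff_zero[OF modY w(1)] by simp
        fix a assume a: "a \<in> \<bb>"
        then show "a \<odot>\<^bsub>Y (Suc j)\<^esub> (e0 \<ominus>\<^bsub>Y (Suc j)\<^esub> e3) = \<zero>\<^bsub>Y (Suc j)\<^esub>"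
          using mod_smult_diff[OF modY subsetD[OF bR a] e0(1) e3(1)] e0(3)[OF a] e3(2)[OF subsetD[OF \<dd>(2) a]] mod_diff_self[OF modY Ym.M.zero_closed] by simp
      qed
    qed
    have pw: "\<exists>y\<in>carrier (Y (Suc j)). d (Suc j) y = \<zero>\<^bsub>Y (Suc (Suc j))\<^esub> \<and> (\<forall>a\<in>\<bb>. a \<odot>\<^bsub>Y (Suc j)\<^esub> y = \<zero>\<^bsub>Y (Suc j)\<^esub>) \<and> (x [^] u) \<odot>\<^bsub>Y (Suc j)\<^esub> y = e" for u :: nat
    proof (induction u)
      case 0 then show ?case using e by (intro bexI[of _ e]) auto
    next
      case (Suc u)
      then obtain y where y: "y \<in> carrier (Y (Suc j))" "d (Suc j) y = \<zero>\<^bsub>Y (Suc (Suc j))\<^esub>" "\<forall>a\<in>\<bb>. a \<odot>\<^bsub>Y (Suc j)\<^esub> y = \<zero>\<^bsub>Y (Suc j)\<^esub>" "(x [^] u) \<odot>\<^bsub>Y (Suc j)\<^esub> y = e" by blast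
      obtain y' where y': "y' \<in> carrier (Y (Suc j))" "d (Suc j) y' = \<zero>\<^bsub>Y (Suc (Suc j))\<^esub>" "\<forall>a\<in>\<bb>. a \<odot>\<^bsub>Y (Suc j)\<^esub> y' = \<zero>\<^bsub>Y (Suc j)\<^esub>" "x \<odot>\<^bsub>Y (Suc j)\<^esub> y' = y"
        using divide[OF y(1,2)] y(3) by blast
      have "(x [^] Suc u) \<odot>\<^bsub>Y (Suc j)\<^esub> y' = e" using y'(1,4) y(4) xR by (simp add: Ym.smult_assoc1)
      then show ?case using y' by blast
    qed
    obtain Q where Q: "submodule Q R N" "\<And>x. x \<in> \<mm> \<Longrightarrow> \<exists>u::nat. \<forall>y\<in>carrier N. (x [^] u) \<odot>\<^bsub>N\<^esub> y \<in> Q"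
      "\<And>(Y' :: nat \<Rightarrow> ('a,'e) module) d' \<eta>' \<iota> s. coresolution R Y' d' (quo N Q) \<eta>' \<Longrightarrow>
         (\<And>i. lin_map R (Y i) (Y' i) (\<iota> i)) \<Longrightarrow>
         (\<And>i y. y \<in> carrier (Y i) \<Longrightarrow> d' i (\<iota> i y) = \<iota> (Suc i) (d i y)) \<Longrightarrow>
         (\<And>x. x \<in> carrier N \<Longrightarrow> \<iota> (Suc 0) (\<eta> x) = \<eta>' (qrep N Q x)) \<Longrightarrow>
         s \<in> carrier (Y' j) \<Longrightarrow> (\<And>r. r \<in> \<bb> \<Longrightarrow> r \<odot>\<^bsub>Y' j\<^esub> s = \<zero>\<^bsub>Y' j\<^esub>) \<Longrightarrow> d' j s \<noteq> \<iota> (Suc j) e"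
      by (rule detection[OF noethN idb e]) (auto intro: that)
    obtain Y' :: "nat \<Rightarrow> ('a,'e) module" and d' \<eta>' where J: "coresolution R Y' d' (quo N Q) \<eta>'" using enough[OF Q(1)] by blast
    interpret J: coresolution R Y' d' "quo N Q" \<eta>' by (rule J)
    obtain \<iota> where \<iota>: "\<And>i. lin_map R (Y i) (Y' i) (\<iota> i)"
      "\<And>i y. y \<in> carrier (Y i) \<Longrightarrow> d' i (\<iota> i y) = \<iota> (Suc i) (d i y)" "\<And>x. x \<in> carrier N \<Longrightarrow> \<iota> (Suc 0) (\<eta> x) = \<eta>' (qrep N Q x)"
      by (rule comparison[OF J qrep_lin[OF modN Q(1)]]) (auto intro: that)
    obtain u :: nat where u: "\<forall>y\<in>carrier N. (x [^] u) \<odot>\<^bsub>N\<^esub> y \<in> Q" using Q(2)[OF x(1)] by blast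
    have pR: "x [^] u \<in> carrier R" using xR by simp
    obtain \<sigma> where \<sigma>: "\<And>i. lin_map R (Y' (Suc i)) (Y' i) (\<sigma> i)"
      "\<And>i y. y \<in> carrier (Y' (Suc i)) \<Longrightarrow> (x [^] u) \<odot>\<^bsub>Y' (Suc i)\<^esub> y = d' i (\<sigma> i y) \<oplus>\<^bsub>Y' (Suc i)\<^esub> \<sigma> (Suc i) (d' (Suc i) y)"
    proof (rule J.multiplication_null_homotopic[OF pR])
      fix y assume "y \<in> carrier (quo N Q)"
      then have y: "y \<in> carrier N" using qrep_closed[OF modN Q(1)] by auto
      then show "(x [^] u) \<odot>\<^bsub>quo N Q\<^esub> y = \<zero>\<^bsub>quo N Q\<^esub>" using qrep_zero_iff[OF modN Q(1) module.smult_closed[OF modN pR y]] u by simp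
    qed blast
    obtain y where y: "y \<in> carrier (Y (Suc j))" "d (Suc j) y = \<zero>\<^bsub>Y (Suc (Suc j))\<^esub>" "\<forall>a\<in>\<bb>. a \<odot>\<^bsub>Y (Suc j)\<^esub> y = \<zero>\<^bsub>Y (Suc j)\<^esub>" "(x [^] u) \<odot>\<^bsub>Y (Suc j)\<^esub> y = e"
      using pw by blast
    have \<iota>0: "\<iota> k \<zero>\<^bsub>Y k\<^esub> = \<zero>\<^bsub>Y' k\<^esub>" for k by (rule lin_zero[OF modY J.modY subY \<iota>(1)])
    have \<sigma>0: "\<sigma> k \<zero>\<^bsub>Y' (Suc k)\<^esub> = \<zero>\<^bsub>Y' k\<^esub>" for k by (rule lin_zero[OF J.modY J.modY J.subY \<sigma>(1)])
    have iy: "\<iota> (Suc j) y \<in> carrier (Y' (Suc j))" by (rule lin_closed[OF \<iota>(1) y(1)])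
    have sy: "\<sigma> j (\<iota> (Suc j) y) \<in> carrier (Y' j)" by (rule lin_closed[OF \<sigma>(1) iy])
    have "d' (Suc j) (\<iota> (Suc j) y) = \<zero>\<^bsub>Y' (Suc (Suc j))\<^esub>" using \<iota>(2)[OF y(1)] y(2) \<iota>0 by simp
    then have "(x [^] u) \<odot>\<^bsub>Y' (Suc j)\<^esub> \<iota> (Suc j) y = d' j (\<sigma> j (\<iota> (Suc j) y))"
      using \<sigma>(2)[OF iy] \<sigma>0 J.d_closed[OF sy] module.axioms(2)[OF J.modY] abelian_monoid.r_zero[OF abelian_group.axioms(1)[OF module.axioms(2)[OF J.modY]] J.d_closed[OF sy]] by simp
    then have eq: "d' j (\<sigma> j (\<iota> (Suc j) y)) = \<iota> (Suc j) e" using lin_smult[OF \<iota>(1) pR y(1)] y(4) by simp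
    have "r \<odot>\<^bsub>Y' j\<^esub> \<sigma> j (\<iota> (Suc j) y) = \<zero>\<^bsub>Y' j\<^esub>" if r: "r \<in> \<bb>" for r
      using lin_smult[OF \<sigma>(1) subsetD[OF bR r] iy] lin_smult[OF \<iota>(1) subsetD[OF bR r] y(1)] y(3) r \<iota>0[of "Suc j"] \<sigma>0[of j] by metis
    then show False using Q(3)[OF J \<iota> sy] eq by blast
  qed
qed

end

context coresolution
begin

text \<open>By Baer's criterion: a map from \<open>\<aa>\<close> to the cocycles is multiplication by some \<open>e \<in> I\<^sup>n\<close>. Then \<open>d e\<close> is a
  cocycle killed by \<open>\<aa>\<close>, so \<open>e\<close> can be corrected by an element killed by \<open>\<aa>\<close> to become a cocycle.\<close>

lemma cosyzygy_injective:
  assumes van: "\<And>\<aa>. ideal \<aa> R \<Longrightarrow> ext_vanishes \<aa> (Suc n)"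
  defines "Z \<equiv> {y\<in>carrier (Y (Suc n)). d (Suc n) y = \<zero>\<^bsub>Y (Suc (Suc n))\<^esub>}"
  shows "baer R ((Y (Suc n))\<lparr>carrier := Z\<rparr>)"
proof -
  interpret Ym: module R "Y j" for j by (rule modY)
  have Z: "submodule Z R (Y (Suc n))" unfolding Z_def using lin_kernel[OF modY modY subY d_lin] .
  show ?thesis
  proof (rule baerI[OF R_cring submod_module[OF modY Z]])
    fix \<aa> \<phi> assume \<aa>: "ideal \<aa> R" and "lin R (Rmod R) \<aa> ((Y (Suc n))\<lparr>carrier := Z\<rparr>) (carrier ((Y (Suc n))\<lparr>carrier := Z\<rparr>)) \<phi>"
    then have \<phi>: "lin R (Rmod R) \<aa> (Y (Suc n)) Z \<phi>" unfolding lin_def by simp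
    obtain e0 where e0: "e0 \<in> carrier (Y (Suc n))" "\<And>r. r \<in> \<aa> \<Longrightarrow> \<phi> r = r \<odot>\<^bsub>Y (Suc n)\<^esub> e0"
      by (rule baer_ideal[OF R_cring baerY \<aa> lin_mono[OF \<phi> order_refl submod_subset[OF Z]]]) (auto intro: that)
    have aR: "r \<in> carrier R" if "r \<in> \<aa>" for r using ideal.Icarr[OF \<aa> that] .
    have de0: "d (Suc n) e0 \<in> carrier (Y (Suc (Suc n)))" by (rule d_closed[OF e0(1)])
    obtain e3 where e3: "e3 \<in> carrier (Y (Suc n))" "\<And>r. r \<in> \<aa> \<Longrightarrow> r \<odot>\<^bsub>Y (Suc n)\<^esub> e3 = \<zero>\<^bsub>Y (Suc n)\<^esub>" "d (Suc n) e3 = d (Suc n) e0"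
    proof (rule ext_vanishesD[OF van[OF \<aa>] de0 dd[OF e0(1)]])
      fix r assume r: "r \<in> \<aa>"
      show "r \<odot>\<^bsub>Y (Suc (Suc n))\<^esub> d (Suc n) e0 = \<zero>\<^bsub>Y (Suc (Suc n))\<^esub>"
        using d_smult[OF aR[OF r] e0(1)] lin_closed[OF \<phi> r] e0(2)[OF r] unfolding Z_def by simp
    qed blast
    have "e0 \<ominus>\<^bsub>Y (Suc n)\<^esub> e3 \<in> Z" unfolding Z_def using e0(1) e3(1) d_diff[OF e0(1) e3(1)] e3(3) mod_diff_self[OF modY de0] by simp
    moreover have "\<phi> r = r \<odot>\<^bsub>Y (Suc n)\<^esub> (e0 \<ominus>\<^bsub>Y (Suc n)\<^esub> e3)" if r: "r \<in> \<aa>" for r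
      using mod_smult_diff[OF modY aR[OF r] e0(1) e3(1)] e3(2)[OF r] e0(2)[OF r] aR[OF r] e0(1) mod_diff_zero[OF modY] by simp
    ultimately show "\<exists>e\<in>carrier ((Y (Suc n))\<lparr>carrier := Z\<rparr>). \<forall>r\<in>\<aa>. \<phi> r = r \<odot>\<^bsub>(Y (Suc n))\<lparr>carrier := Z\<rparr>\<^esub> e" by auto
  qed
qed

end

section \<open>Depth\<close>

text \<open>The zerodivisors on \<open>N/Q\<close> are the union
  of the maximal annihilators \<open>mx\<close>, which are prime, and \<open>\<mm>\<close> is none of them. To bring finiteness and prime
  avoidance together, take a maximal submodule \<open>S\<close> in the family \<open>C\<close>: some finite set of maximal
  annihilators has its intersection killing \<open>S\<close> modulo \<open>Q\<close>, and some \<open>x \<in> \<mm>\<close> avoids all of them. If \<open>x\<close>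
  were a zerodivisor, it would lie in a further maximal annihilator \<open>p = An y\<close>; adding \<open>y\<close> to \<open>S\<close> and
  replacing \<open>x\<close> by \<open>x + b\<close>, with \<open>b\<close> in all the previous annihilators but not in \<open>p\<close>, would enlarge \<open>S\<close>.\<close>

lemma (in local_noetherian) regular_element:
  assumes N: "noeth R N" and Q: "submodule Q R N"
    and soc: "\<And>y. y \<in> carrier N \<Longrightarrow> (\<And>r. r \<in> \<mm> \<Longrightarrow> r \<odot>\<^bsub>N\<^esub> y \<in> Q) \<Longrightarrow> y \<in> Q"
  obtains x where "x \<in> \<mm>" "\<And>y. y \<in> carrier N \<Longrightarrow> x \<odot>\<^bsub>N\<^esub> y \<in> Q \<Longrightarrow> y \<in> Q"
proof -
  have MN: "Module.module R N" using N unfolding noeth_def by blast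
  interpret N: module R N by (rule MN)
  have MR: "Module.module R (Rmod R)" by (rule Rmod_module[OF cR])
  \<comment> \<open>\<open>An y\<close> is the annihilator of \<open>y\<close> modulo \<open>Q\<close>; \<open>mx\<close> singles out the maximal ones.\<close>
  define An where "An y = {r\<in>carrier R. r \<odot>\<^bsub>N\<^esub> y \<in> Q}" for y
  have idA: "ideal (An y) R" if "y \<in> carrier N" for y unfolding An_def by (rule annihilator_ideal[OF MN Q that])
  define mx where "mx p \<longleftrightarrow> (\<exists>y\<in>carrier N. y \<notin> Q \<and> p = An y \<and> (\<forall>y'\<in>carrier N. y' \<notin> Q \<longrightarrow> p \<subseteq> An y' \<longrightarrow> An y' = p))" for p
  define C where "C = {S. submodule S R N \<and> (\<exists>P x. finite P \<and> (\<forall>p\<in>P. mx p) \<and> x \<in> \<mm> \<and> (\<forall>p\<in>P. x \<notin> p) \<and>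
      (\<forall>r\<in>carrier R. (\<forall>p\<in>P. r \<in> p) \<longrightarrow> (\<forall>s\<in>S. r \<odot>\<^bsub>N\<^esub> s \<in> Q)))}"
  have zm: "\<zero> \<in> \<mm>" using additive_subgroup.zero_closed[OF ideal.axioms(1)[OF idm]] .
  have "Q \<in> C" unfolding C_def using Q submod_smult[OF Q] zm by (intro CollectI conjI exI[of _ "{}"] exI[of _ "\<zero>"]) auto
  then obtain S where SC: "S \<in> C" and Smax: "\<And>T. T \<in> C \<Longrightarrow> S \<subseteq> T \<Longrightarrow> T = S"
    by (rule noeth_max[OF N]) (auto simp: C_def)
  have S: "submodule S R N" using SC unfolding C_def by simp
  obtain P x where P: "finite P" "\<forall>p\<in>P. mx p" and x: "x \<in> \<mm>" "\<forall>p\<in>P. x \<notin> p"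
    and kill0: "\<forall>r\<in>carrier R. (\<forall>p\<in>P. r \<in> p) \<longrightarrow> (\<forall>s\<in>S. r \<odot>\<^bsub>N\<^esub> s \<in> Q)" using SC unfolding C_def by auto
  have kill: "r \<odot>\<^bsub>N\<^esub> s \<in> Q" if "r \<in> carrier R" "\<forall>p\<in>P. r \<in> p" "s \<in> S" for r s using kill0 that by auto
  have xR: "x \<in> carrier R" by (rule m_carr[OF x(1)])
  show thesis
  proof (rule that[OF x(1)])
    fix y0 assume y0: "y0 \<in> carrier N" "x \<odot>\<^bsub>N\<^esub> y0 \<in> Q"
    show "y0 \<in> Q"
    proof (rule ccontr)
      assume y0Q: "y0 \<notin> Q"
      define D where "D = {An y |y. y \<in> carrier N \<and> y \<notin> Q \<and> An y0 \<subseteq> An y}"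
      obtain p where p: "p \<in> D" and pmax: "\<And>T. T \<in> D \<Longrightarrow> p \<subseteq> T \<Longrightarrow> T = p"
      proof (rule noeth_max[OF NR, of "An y0" D])
        show "An y0 \<in> D" unfolding D_def using y0 y0Q by blast
        show "submodule T R (Rmod R)" if "T \<in> D" for T using that idA ideal_submod[OF cR] unfolding D_def by blast
      qed blast
      obtain y where y: "y \<in> carrier N" "y \<notin> Q" "p = An y" "An y0 \<subseteq> p" using p unfolding D_def by blast
      have ymax: "An y' = p" if "y' \<in> carrier N" "y' \<notin> Q" "p \<subseteq> An y'" for y'
        using pmax[of "An y'"] that y(4) unfolding D_def by blast
      have mxp: "mx p" unfolding mx_def using y ymax by blast
      have idp: "ideal p R" unfolding y(3) by (rule idA[OF y(1)])
      have xp: "x \<in> p" using y(4) y0 xR unfolding An_def by blast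
      then have pP: "p \<notin> P" using x by blast
      have prime: "r \<in> p" if rs: "r \<in> carrier R" "s \<in> carrier R" "r \<otimes> s \<in> p" "s \<notin> p" for r s
      proof -
        have sy: "s \<odot>\<^bsub>N\<^esub> y \<in> carrier N" "s \<odot>\<^bsub>N\<^esub> y \<notin> Q" using rs y unfolding An_def by auto
        have "p \<subseteq> An (s \<odot>\<^bsub>N\<^esub> y)"
        proof
          fix t assume "t \<in> p"
          then have t: "t \<in> carrier R" "t \<odot>\<^bsub>N\<^esub> y \<in> Q" unfolding y(3) An_def by auto
          then show "t \<in> An (s \<odot>\<^bsub>N\<^esub> y)" unfolding An_def using mod_smult_comm[OF MN t(1) rs(2) y(1)] submod_smult[OF Q rs(2) t(2)] by simp
        qed
        then have "An (s \<odot>\<^bsub>N\<^esub> y) = p" by (rule ymax[OF sy])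
        moreover have "r \<in> An (s \<odot>\<^bsub>N\<^esub> y)" using rs(1,3) y(1) rs(2) unfolding y(3) An_def by (simp add: N.smult_assoc1)
        ultimately show ?thesis by simp
      qed
      have "\<exists>b\<in>\<mm>. b \<notin> p \<and> (\<forall>p'\<in>P'. b \<in> p')" if "P' \<subseteq> P" for P'
        using finite_subset[OF that P(1)] that
      proof (induction P' rule: finite_induct)
        case empty
        have "\<not> \<mm> \<subseteq> p"
        proof
          assume "\<mm> \<subseteq> p"
          then have "r \<odot>\<^bsub>N\<^esub> y \<in> Q" if "r \<in> \<mm>" for r using that unfolding y(3) An_def by blast
          then show False using soc[OF y(1)] y(2) by blast
        qed
        then show ?case by blast
      next
        case (insert p' P')
        then obtain b where b: "b \<in> \<mm>" "b \<notin> p" "\<forall>p'\<in>P'. b \<in> p'" by auto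
        have mp': "mx p'" using insert.prems P(2) by blast
        then obtain y' where y': "y' \<in> carrier N" "p' = An y'" "\<forall>y''\<in>carrier N. y'' \<notin> Q \<longrightarrow> p' \<subseteq> An y'' \<longrightarrow> An y'' = p'" unfolding mx_def by blast
        have idp': "ideal p' R" unfolding y'(2) by (rule idA[OF y'(1)])
        have "\<not> p' \<subseteq> p" using y'(3) y pP insert.prems by blast
        then obtain c where c: "c \<in> p'" "c \<notin> p" by blast
        have cR': "c \<in> carrier R" using ideal.Icarr[OF idp' c(1)] .
        have bR: "b \<in> carrier R" by (rule m_carr[OF b(1)])
        have "c \<otimes> b \<in> \<mm>" using ideal.I_l_closed[OF idm b(1) cR'] .
        moreover have "c \<otimes> b \<notin> p" using prime[OF cR' bR] b(2) c(2) by blast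
        moreover have "c \<otimes> b \<in> q" if q: "q \<in> insert p' P'" for q
        proof (cases "q = p'")
          case True then show ?thesis using ideal.I_r_closed[OF idp' c(1) bR] by simp
        next
          case False
          then have "q \<in> P'" using q by blast
          then have "mx q" "b \<in> q" using insert.prems P(2) b(3) by auto
          then have "ideal q R" using idA unfolding mx_def by blast
          then show ?thesis using ideal.I_l_closed[OF _ \<open>b \<in> q\<close> cR'] by blast
        qed
        ultimately show ?case by blast
      qed
      then obtain b where b: "b \<in> \<mm>" "b \<notin> p" "\<forall>p'\<in>P. b \<in> p'" by blast
      have bR: "b \<in> carrier R" by (rule m_carr[OF b(1)])
      have idP: "ideal p' R" if p': "p' \<in> P" for p'
      proof -
        have "mx p'" using P(2) p' by blast
        then obtain y' where "y' \<in> carrier N" "p' = An y'" unfolding mx_def by blast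
        then show ?thesis using idA by simp
      qed
      have sumin: "a \<in> I" if "ideal I R" "a \<in> carrier R" "c \<in> I" "a \<oplus> c \<in> I" for a c I
      proof -
        have sI: "submodule I R (Rmod R)" using that(1) ideal_submod[OF cR] by blast
        have "(a \<oplus> c) \<ominus> c \<in> I" using submod_diff[OF MR sI that(4,3)] by simp
        moreover have "(a \<oplus> c) \<ominus> c = a" using mod_add_diff[OF MR, of a c] that(2) ideal.Icarr[OF that(1,3)] by simp
        ultimately show ?thesis by simp
      qed
      have x'm: "x \<oplus> b \<in> \<mm>" using additive_subgroup.a_closed[OF ideal.axioms(1)[OF idm] x(1) b(1)] .
      have x'P: "x \<oplus> b \<notin> p'" if "p' \<in> insert p P" for p'
      proof
        assume a: "x \<oplus> b \<in> p'"
        show False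
        proof (cases "p' = p")
          case True
          then have "b \<oplus> x \<in> p" using a xR bR by (simp add: R.a_comm)
          then show False using sumin[OF idp bR xp] b(2) by blast
        next
          case False
          then have p'P: "p' \<in> P" using \<open>p' \<in> insert p P\<close> by blast
          then show False using sumin[OF idP[OF p'P] xR _ a] b(3) x(2) by blast
        qed
      qed
      define Ry where "Ry = (\<lambda>r. r \<odot>\<^bsub>N\<^esub> y) ` carrier (Rmod R)"
      have Ry: "submodule Ry R N" unfolding Ry_def by (rule lin_image[OF MR MN submod_carrier[OF MR] lin_cyclic[OF MN y(1)]])
      have "msum N S Ry \<in> C"
        unfolding C_def
      proof (intro CollectI conjI exI[of _ "insert p P"] exI[of _ "x \<oplus> b"] ballI impI)
        show "submodule (msum N S Ry) R N" by (rule msum_submod(1)[OF MN S Ry])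
        fix r s assume r: "r \<in> carrier R" "\<forall>q\<in>insert p P. r \<in> q" and "s \<in> msum N S Ry"
        then obtain u t where ut: "u \<in> S" "t \<in> carrier R" "s = u \<oplus>\<^bsub>N\<^esub> t \<odot>\<^bsub>N\<^esub> y" unfolding msum_def Ry_def by auto
        have uc: "u \<in> carrier N" using ut submod_subset[OF S] by blast
        have "r \<in> p" using r(2) by simp
        then have "r \<odot>\<^bsub>N\<^esub> y \<in> Q" unfolding y(3) An_def by simp
        then have "t \<odot>\<^bsub>N\<^esub> (r \<odot>\<^bsub>N\<^esub> y) \<in> Q" by (rule submod_smult[OF Q ut(2)])
        then have "r \<odot>\<^bsub>N\<^esub> (t \<odot>\<^bsub>N\<^esub> y) \<in> Q" using mod_smult_comm[OF MN r(1) ut(2) y(1)] by simp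
        moreover have "r \<odot>\<^bsub>N\<^esub> u \<in> Q" using kill[OF r(1) _ ut(1)] r(2) by simp
        ultimately show "r \<odot>\<^bsub>N\<^esub> s \<in> Q" unfolding ut(3) using submod_add[OF Q] r(1) ut(2) uc y(1) by (simp add: N.smult_r_distr)
      qed (use P mxp x'm x'P in auto)
      \<comment> \<open>By maximality \<open>y\<close> lies in \<open>S\<close>, so the element \<open>b\<close> kills it modulo \<open>Q\<close>, although \<open>b \<notin> p\<close>.\<close>
      then have "msum N S Ry = S" using Smax msum_submod(2)[OF MN S Ry] by blast
      moreover have "y \<in> Ry" using y(1) unfolding Ry_def by (intro image_eqI[of _ _ "\<one>"]) auto
      ultimately have "y \<in> S" using msum_submod(3)[OF MN S Ry] by blast
      then have "b \<odot>\<^bsub>N\<^esub> y \<in> Q" using kill[OF bR b(3)] by blast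
      then show False using b(2) bR unfolding y(3) An_def by blast
    qed
  qed
qed

lemma (in local_noetherian) nakayama_proper:
  assumes N: "noeth R N" and nz: "carrier N \<noteq> {\<zero>\<^bsub>N\<^esub>}"
  obtains V where "submodule V R N" "V \<noteq> carrier N" "\<And>x y. x \<in> \<mm> \<Longrightarrow> y \<in> carrier N \<Longrightarrow> x \<odot>\<^bsub>N\<^esub> y \<in> V"
proof -
  have MN: "Module.module R N" using N unfolding noeth_def by blast
  define C where "C = {V. submodule V R N \<and> V \<noteq> carrier N}"
  obtain V where VC: "V \<in> C" and Vmax: "\<And>T. T \<in> C \<Longrightarrow> V \<subseteq> T \<Longrightarrow> T = V"
    by (rule noeth_max[OF N, of "{\<zero>\<^bsub>N\<^esub>}" C]) (use submod_zero_set[OF MN] nz in \<open>auto simp: C_def\<close>)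
  have V: "submodule V R N" "V \<noteq> carrier N" using VC unfolding C_def by auto
  show thesis
  proof (rule that[OF V])
    fix x y assume x: "x \<in> \<mm>" and y: "y \<in> carrier N"
    show "x \<odot>\<^bsub>N\<^esub> y \<in> V"
    proof (cases "y \<in> V")
      case True then show ?thesis by (rule submod_smult[OF V(1) m_carr[OF x]])
    next
      case False
      show ?thesis
      proof (rule maximal_avoiding(1)[OF N V(1) y False _ x])
        show "T = V" if "submodule T R N" "V \<subseteq> T" "y \<notin> T" for T
          using Vmax[of T] that y unfolding C_def by blast
      qed
    qed
  qed
qed

context resolved
begin

text \<open>\<open>Ext\<^sup>i(A, N/Q) = 0\<close>, expressed by maps into \<open>N\<close> modulo \<open>Q\<close>. Iterated quotients are avoided in this
  way.\<close>

definition relative_vanishes :: "'b set \<Rightarrow> nat \<Rightarrow> bool" where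
  "relative_vanishes Q i \<longleftrightarrow> (\<forall>z. lin_map R (F i) N z \<longrightarrow> (\<forall>f\<in>cF (Suc i). z (\<delta> i f) \<in> Q) \<longrightarrow>
     (\<exists>z'. lin_map R (F i) N z' \<and> coboundary i z' \<and> (\<forall>f\<in>cF i. z f \<ominus>\<^bsub>N\<^esub> z' f \<in> Q)))"

text \<open>The long exact sequence of \<open>0 \<rightarrow> N/Q \<rightarrow> N/Q \<rightarrow> N/(Q + x N) \<rightarrow> 0\<close>, chased on representatives: if
  \<open>z \<delta> = q + x u\<close> with \<open>q\<close> in \<open>Q\<close>, then \<open>u\<close> is a cocycle modulo \<open>Q\<close> because \<open>x\<close> is regular, hence a
  coboundary \<open>v \<delta>\<close> modulo \<open>Q\<close>, and \<open>z - x v\<close> is a cocycle modulo \<open>Q\<close>.\<close>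

lemma relative_vanishes_regular:
  assumes Q: "submodule Q R N" and v0: "relative_vanishes Q i" and v1: "relative_vanishes Q (Suc i)"
    and x: "x \<in> carrier R" and reg: "\<And>y. y \<in> carrier N \<Longrightarrow> x \<odot>\<^bsub>N\<^esub> y \<in> Q \<Longrightarrow> y \<in> Q"
  shows "relative_vanishes (msum N Q ((\<lambda>y. x \<odot>\<^bsub>N\<^esub> y) ` carrier N)) i"
  unfolding relative_vanishes_def
proof (intro allI impI)
  interpret N: module R N by (rule modN)
  let ?T = "(\<lambda>y. x \<odot>\<^bsub>N\<^esub> y) ` carrier N"
  note sN = submod_carrier[OF modN]
  fix z assume z: "lin_map R (F i) N z" and z\<delta>: "\<forall>f\<in>cF (Suc i). z (\<delta> i f) \<in> msum N Q ?T"
  have bc: "b \<in> B (Suc i) \<Longrightarrow> fbasis R b \<in> cF (Suc i)" for b by (rule fbasis_closed[OF R_cring])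
  have "\<forall>b. \<exists>y w. b \<in> B (Suc i) \<longrightarrow> y \<in> Q \<and> w \<in> carrier N \<and> z (\<delta> i (fbasis R b)) = y \<oplus>\<^bsub>N\<^esub> x \<odot>\<^bsub>N\<^esub> w"
    using z\<delta> bc unfolding msum_def by blast
  then obtain y w where yw: "\<And>b. b \<in> B (Suc i) \<Longrightarrow> y b \<in> Q" "\<And>b. b \<in> B (Suc i) \<Longrightarrow> w b \<in> carrier N"
    "\<And>b. b \<in> B (Suc i) \<Longrightarrow> z (\<delta> i (fbasis R b)) = y b \<oplus>\<^bsub>N\<^esub> x \<odot>\<^bsub>N\<^esub> w b" by metis
  obtain q where q: "lin_map R (F (Suc i)) (N\<lparr>carrier := Q\<rparr>) q" "\<And>b. b \<in> B (Suc i) \<Longrightarrow> q (fbasis R b) = y b"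
    by (rule free_lin_exists[OF R_cring submod_module[OF modN Q], of "B (Suc i)" y]) (use yw in auto)
  have qQ: "lin R (F (Suc i)) (cF (Suc i)) N Q q" using q(1) unfolding lin_def by simp
  have qN: "lin_map R (F (Suc i)) N q" by (rule lin_mono[OF qQ order_refl submod_subset[OF Q]])
  obtain u where u: "lin_map R (F (Suc i)) N u" "\<And>b. b \<in> B (Suc i) \<Longrightarrow> u (fbasis R b) = w b"
    by (rule free_lin_exists[OF R_cring modN, of "B (Suc i)" w]) (use yw in auto)
  have xu: "lin_map R (F (Suc i)) N (\<lambda>f. x \<odot>\<^bsub>N\<^esub> u f)" by (rule lin_pointwise_smult[OF modF modN order_refl sN u(1) x])
  have zd: "lin_map R (F (Suc i)) N (\<lambda>f. z (\<delta> i f))" by (rule lin_comp[OF \<delta>_lin z]) simp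
  have eq: "z (\<delta> i f) = q f \<oplus>\<^bsub>N\<^esub> x \<odot>\<^bsub>N\<^esub> u f" if "f \<in> cF (Suc i)" for f
    by (rule free_lin_unique[OF R_cring modN zd lin_pointwise_add[OF modF modN order_refl sN qN xu] _ that]) (use yw(3) q(2) u(2) in simp)
  have "u (\<delta> (Suc i) f) \<in> Q" if f: "f \<in> cF (Suc (Suc i))" for f
  proof (rule reg)
    have df: "\<delta> (Suc i) f \<in> cF (Suc i)" by (rule \<delta>_closed[OF f])
    show uc: "u (\<delta> (Suc i) f) \<in> carrier N" by (rule lin_closed[OF u(1) df])
    have "z (\<delta> i (\<delta> (Suc i) f)) = \<zero>\<^bsub>N\<^esub>" unfolding \<delta>\<delta>[OF f] by (rule lin_zero[OF modF modN subF z])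
    then have "\<zero>\<^bsub>N\<^esub> = q (\<delta> (Suc i) f) \<oplus>\<^bsub>N\<^esub> x \<odot>\<^bsub>N\<^esub> u (\<delta> (Suc i) f)" using eq[OF df] by simp
    then have "x \<odot>\<^bsub>N\<^esub> u (\<delta> (Suc i) f) = \<ominus>\<^bsub>N\<^esub> q (\<delta> (Suc i) f)"
      using N.M.minus_equality[of "x \<odot>\<^bsub>N\<^esub> u (\<delta> (Suc i) f)" "q (\<delta> (Suc i) f)"] lin_closed[OF qN df] x uc by (simp add: N.M.a_comm)
    then show "x \<odot>\<^bsub>N\<^esub> u (\<delta> (Suc i) f) \<in> Q" using submod_neg[OF modN Q lin_closed[OF qQ df]] by simp
  qed
  then obtain u' where u': "lin_map R (F (Suc i)) N u'" "coboundary (Suc i) u'" "\<forall>f\<in>cF (Suc i). u f \<ominus>\<^bsub>N\<^esub> u' f \<in> Q"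
    using v1 u(1) unfolding relative_vanishes_def by blast
  obtain v where v: "lin_map R (F i) N v" "\<forall>f\<in>cF (Suc i). u' f = v (\<delta> i f)" using u'(2) unfolding coboundary_def by auto
  have xv: "lin_map R (F i) N (\<lambda>f. x \<odot>\<^bsub>N\<^esub> v f)" by (rule lin_pointwise_smult[OF modF modN order_refl sN v(1) x])
  define t where "t f = z f \<ominus>\<^bsub>N\<^esub> x \<odot>\<^bsub>N\<^esub> v f" for f
  have tl: "lin_map R (F i) N t" unfolding t_def by (rule lin_pointwise_diff[OF modF modN order_refl sN z xv])
  have "t (\<delta> i f) \<in> Q" if f: "f \<in> cF (Suc i)" for f
  proof -
    have c: "q f \<in> carrier N" "u f \<in> carrier N" "u' f \<in> carrier N" using lin_closed[OF qN f] lin_closed[OF u(1) f] lin_closed[OF u'(1) f] by auto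
    have "t (\<delta> i f) = (q f \<oplus>\<^bsub>N\<^esub> x \<odot>\<^bsub>N\<^esub> u f) \<ominus>\<^bsub>N\<^esub> x \<odot>\<^bsub>N\<^esub> u' f" unfolding t_def using eq[OF f] v(2) f by simp
    also have "\<dots> = q f \<oplus>\<^bsub>N\<^esub> x \<odot>\<^bsub>N\<^esub> (u f \<ominus>\<^bsub>N\<^esub> u' f)" using c x by (simp add: a_minus_def N.M.a_assoc N.smult_r_distr N.smult_r_minus)
    finally show ?thesis using submod_add[OF Q lin_closed[OF qQ f] submod_smult[OF Q x]] u'(3) f by simp
  qed
  then obtain z' where z': "lin_map R (F i) N z'" "coboundary i z'" "\<forall>f\<in>cF i. t f \<ominus>\<^bsub>N\<^esub> z' f \<in> Q"
    using v0 tl unfolding relative_vanishes_def by blast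
  have "z f \<ominus>\<^bsub>N\<^esub> z' f \<in> msum N Q ?T" if f: "f \<in> cF i" for f
  proof -
    have c: "z f \<in> carrier N" "v f \<in> carrier N" "z' f \<in> carrier N" using lin_closed[OF z f] lin_closed[OF v(1) f] lin_closed[OF z'(1) f] by auto
    have "(t f \<ominus>\<^bsub>N\<^esub> z' f) \<oplus>\<^bsub>N\<^esub> x \<odot>\<^bsub>N\<^esub> v f = z f \<ominus>\<^bsub>N\<^esub> z' f"
      unfolding t_def using c x by (simp add: a_minus_def N.M.a_ac N.M.r_neg N.M.r_neg1 N.M.r_neg2)
    then show ?thesis using msumI[of "t f \<ominus>\<^bsub>N\<^esub> z' f" Q "x \<odot>\<^bsub>N\<^esub> v f" ?T N] z'(3) f c by auto
  qed
  then show "\<exists>z'. lin_map R (F i) N z' \<and> coboundary i z' \<and> (\<forall>f\<in>cF i. z f \<ominus>\<^bsub>N\<^esub> z' f \<in> msum N Q ?T)" using z' by blast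
qed

end

lemma ideal_smult_snoc:
  assumes N: "Module.module R N" and I: "I \<subseteq> carrier R" and x: "x \<in> carrier R"
  shows "ideal_smult R N (insert x I) (carrier N) = msum N (ideal_smult R N I (carrier N)) ((\<lambda>y. x \<odot>\<^bsub>N\<^esub> y) ` carrier N)"
proof
  interpret N: module R N by (rule N)
  let ?G = "\<lambda>I. (\<lambda>(a, y). a \<odot>\<^bsub>N\<^esub> y) ` (I \<times> carrier N)"
  let ?T = "(\<lambda>y. x \<odot>\<^bsub>N\<^esub> y) ` carrier N"
  have Gc: "?G J \<subseteq> carrier N" if "J \<subseteq> carrier R" for J using that by auto
  have Q: "submodule (ideal_smult R N I (carrier N)) R N" unfolding ideal_smult_def by (rule span_submod[OF N Gc[OF I]])
  have T: "submodule ?T R N" by (rule lin_image[OF N N submod_carrier[OF N] lin_smult_map[OF N submod_carrier[OF N] x]])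
  note ms = msum_submod[OF N Q T]
  show "ideal_smult R N (insert x I) (carrier N) \<subseteq> msum N (ideal_smult R N I (carrier N)) ?T"
    unfolding ideal_smult_def[of R N "insert x I"]
  proof (rule span_least[OF ms(1)])
    show "?G (insert x I) \<subseteq> msum N (ideal_smult R N I (carrier N)) ?T"
    proof
      fix t assume "t \<in> ?G (insert x I)"
      then obtain a y where ay: "a \<in> insert x I" "y \<in> carrier N" "t = a \<odot>\<^bsub>N\<^esub> y" by auto
      show "t \<in> msum N (ideal_smult R N I (carrier N)) ?T"
      proof (cases "a = x")
        case True then show ?thesis using ay ms(3) by auto
      next
        case False
        then have "t \<in> ?G I" using ay by auto
        then have "t \<in> ideal_smult R N I (carrier N)" unfolding ideal_smult_def using span_incl by fastforce
        then show ?thesis using ms(2) by blast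
      qed
    qed
  qed
  have S: "submodule (ideal_smult R N (insert x I) (carrier N)) R N" unfolding ideal_smult_def by (rule span_submod[OF N Gc]) (use x I in auto)
  have "ideal_smult R N I (carrier N) \<subseteq> ideal_smult R N (insert x I) (carrier N)"
    unfolding ideal_smult_def[of R N I]
  proof (rule span_least[OF S])
    have "?G I \<subseteq> ?G (insert x I)" by auto
    then show "?G I \<subseteq> ideal_smult R N (insert x I) (carrier N)" unfolding ideal_smult_def using span_incl by fastforce
  qed
  moreover have "?T \<subseteq> ideal_smult R N (insert x I) (carrier N)"
  proof -
    have "?T \<subseteq> ?G (insert x I)" by auto
    then show ?thesis unfolding ideal_smult_def using span_incl by fastforce
  qed
  ultimately show "msum N (ideal_smult R N I (carrier N)) ?T \<subseteq> ideal_smult R N (insert x I) (carrier N)"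
    unfolding msum_def using submod_add[OF S] by blast
qed

context local_coresolution
begin

text \<open>\<open>Ext\<^sup>0(k, N/Q) = 0\<close> says that \<open>N/Q\<close> has zero socle, so there is a regular element \<open>x\<close>, and the vanishing in
  all but the top degree passes on to \<open>Q + x N\<close>.\<close>

lemma depth_of_vanishing:
  assumes N: "noeth R N" and nz: "carrier N \<noteq> {\<zero>\<^bsub>N\<^esub>}" and van: "\<And>i. i \<le> n \<Longrightarrow> ext_vanishes \<mm> i"
  shows "enat (Suc n) \<le> depth R \<mm> N"
proof -
  interpret N: module R N by (rule modN)
  have MR: "Module.module R (Rmod R)" by (rule Rmod_module[OF cR])
  have sm: "submodule \<mm> R (Rmod R)" using idm ideal_submod[OF cR] by blast
  define A where "A = quo (Rmod R) \<mm>"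
  define q where "q = qrep (Rmod R) \<mm>"
  have A: "Module.module R A" unfolding A_def by (rule cyc_module[OF cR idm])
  have q1: "q \<one> \<in> carrier A" unfolding A_def q_def by simp
  have Aq: "x \<in> carrier R" "x \<odot>\<^bsub>A\<^esub> q \<one> = x" if xA: "x \<in> carrier A" for x
  proof -
    show x: "x \<in> carrier R" using cyc_carrier[OF cR idm] xA unfolding A_def by blast
    obtain r where r: "r \<in> carrier R" "x = q r" using xA unfolding A_def q_def by auto
    then show "x \<odot>\<^bsub>A\<^esub> q \<one> = x" using cyc_smult_gen[OF cR idm x] qrep_idem[OF MR sm, of r] unfolding A_def q_def by simp
  qed
  have qm: "a \<odot>\<^bsub>A\<^esub> q \<one> = \<zero>\<^bsub>A\<^esub>" if a: "a \<in> \<mm>" for a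
    using cyc_smult_gen[OF cR idm m_carr[OF a]] qrep_zero_iff[OF MR sm, of a] m_carr[OF a] a unfolding A_def q_def by simp
  obtain B :: "nat \<Rightarrow> nat set" and \<delta> \<epsilon> where fr: "free_resolution R A B \<delta> \<epsilon>"
    unfolding A_def by (rule cyc_resolution[OF cR idm NR]) (auto intro: that)
  interpret I: resolved R Y d N \<eta> A B \<delta> \<epsilon> by (rule resolved.intro[OF coresolution_axioms resolved_axioms.intro[OF A fr]])
  have hv: "maps_lift A (carrier A) i" if i: "i \<le> n" for i
    unfolding maps_lift_def
  proof (intro allI impI)
    fix \<phi> assume \<phi>: "lin_map R A (Y (Suc i)) \<phi>" "\<forall>x\<in>carrier A. d (Suc i) (\<phi> x) = \<zero>\<^bsub>Y (Suc (Suc i))\<^esub>"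
    have \<phi>x: "\<phi> x = x \<odot>\<^bsub>Y (Suc i)\<^esub> \<phi> (q \<one>)" if "x \<in> carrier A" for x using lin_smult[OF \<phi>(1) Aq(1)[OF that] q1] Aq(2)[OF that] by simp
    obtain e' where e': "e' \<in> carrier (Y i)" "\<And>a. a \<in> \<mm> \<Longrightarrow> a \<odot>\<^bsub>Y i\<^esub> e' = \<zero>\<^bsub>Y i\<^esub>" "d i e' = \<phi> (q \<one>)"
    proof (rule ext_vanishesD[OF van[OF i] lin_closed[OF \<phi>(1) q1]])
      show "d (Suc i) (\<phi> (q \<one>)) = \<zero>\<^bsub>Y (Suc (Suc i))\<^esub>" using \<phi>(2) q1 by blast
      fix a assume a: "a \<in> \<mm>"
      show "a \<odot>\<^bsub>Y (Suc i)\<^esub> \<phi> (q \<one>) = \<zero>\<^bsub>Y (Suc i)\<^esub>"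
        using lin_smult[OF \<phi>(1) m_carr[OF a] q1] qm[OF a] lin_zero[OF A modY submod_carrier[OF A] \<phi>(1)] by simp
    qed blast
    have "lin_map R A (Y i) (\<lambda>x. x \<odot>\<^bsub>Y i\<^esub> e')" unfolding A_def by (rule cyc_act_lin[OF cR idm modY e'(1,2)])
    moreover have "\<phi> x = d i (x \<odot>\<^bsub>Y i\<^esub> e')" if "x \<in> carrier A" for x using \<phi>x[OF that] d_smult[OF Aq(1)[OF that] e'(1)] e'(3) by simp
    ultimately show "\<exists>\<psi>. lin_map R A (Y i) \<psi> \<and> (\<forall>x\<in>carrier A. \<phi> x = d i (\<psi> x))" by blast
  qed
  have base: "I.relative_vanishes {\<zero>\<^bsub>N\<^esub>} i" if i: "i \<le> n" for i
    unfolding I.relative_vanishes_def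
  proof (intro allI impI)
    fix z assume z: "lin_map R (I.F i) N z" "\<forall>f\<in>I.cF (Suc i). z (\<delta> i f) \<in> {\<zero>\<^bsub>N\<^esub>}"
    then have "I.cocycle i z" unfolding I.cocycle_def by simp
    then have "I.coboundary i z" using hv[OF i] I.balance by blast
    then show "\<exists>z'. lin_map R (I.F i) N z' \<and> I.coboundary i z' \<and> (\<forall>f\<in>I.cF i. z f \<ominus>\<^bsub>N\<^esub> z' f \<in> {\<zero>\<^bsub>N\<^esub>})"
      using z(1) mod_diff_self[OF modN lin_closed[OF z(1)]] by (intro exI[of _ z]) simp
  qed
  have soc: "y \<in> Q" if Q: "submodule Q R N" and v: "I.relative_vanishes Q 0" and y: "y \<in> carrier N" "\<And>r. r \<in> \<mm> \<Longrightarrow> r \<odot>\<^bsub>N\<^esub> y \<in> Q" for Q y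
  proof -
    define E where "E = quo N Q"
    have E: "Module.module R E" unfolding E_def by (rule quo_module[OF modN Q])
    have pl: "lin_map R N E (qrep N Q)" unfolding E_def by (rule qrep_lin[OF modN Q])
    define w where "w = qrep N Q y"
    have wE: "w \<in> carrier E" unfolding w_def by (rule lin_closed[OF pl y(1)])
    have zE: "qrep N Q t = \<zero>\<^bsub>E\<^esub> \<longleftrightarrow> t \<in> Q" if "t \<in> carrier N" for t unfolding E_def using qrep_zero_iff[OF modN Q that] by simp
    have mw: "a \<odot>\<^bsub>E\<^esub> w = \<zero>\<^bsub>E\<^esub>" if a: "a \<in> \<mm>" for a
      unfolding w_def using lin_smult[OF pl m_carr[OF a] y(1)] zE[OF N.smult_closed[OF m_carr[OF a] y(1)]] y(2)[OF a] by simp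
    have gl: "lin_map R A E (\<lambda>x. x \<odot>\<^bsub>E\<^esub> w)" unfolding A_def by (rule cyc_act_lin[OF cR idm E wE mw])
    have g\<epsilon>: "lin_map R (I.F 0) E (\<lambda>f. \<epsilon> f \<odot>\<^bsub>E\<^esub> w)" by (rule lin_comp[OF I.\<epsilon>_lin gl]) simp
    obtain z where z: "lin_map R (I.F 0) N z" "\<And>f. f \<in> I.cF 0 \<Longrightarrow> qrep N Q (z f) = \<epsilon> f \<odot>\<^bsub>E\<^esub> w"
    proof (rule free_lift[OF cR modN E submod_carrier[OF modN] pl g\<epsilon>])
      show "\<epsilon> f \<odot>\<^bsub>E\<^esub> w \<in> qrep N Q ` carrier N" if "f \<in> I.cF 0" for f using lin_closed[OF g\<epsilon> that] unfolding E_def by simp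
    qed blast
    have "z (\<delta> 0 f) \<in> Q" if f: "f \<in> I.cF (Suc 0)" for f
    proof -
      have df: "\<delta> 0 f \<in> I.cF 0" by (rule I.\<delta>_closed[OF f])
      have "qrep N Q (z (\<delta> 0 f)) = \<zero>\<^bsub>A\<^esub> \<odot>\<^bsub>E\<^esub> w" using z(2)[OF df] I.\<epsilon>\<delta>[OF f] by simp
      also have "\<dots> = \<zero>\<^bsub>E\<^esub>" by (rule lin_zero[OF A E submod_carrier[OF A] gl])
      finally show ?thesis using zE[OF lin_closed[OF z(1) df]] by simp
    qed
    then obtain z' where z': "lin_map R (I.F 0) N z'" "I.coboundary 0 z'" "\<forall>f\<in>I.cF 0. z f \<ominus>\<^bsub>N\<^esub> z' f \<in> Q"
      using v z(1) unfolding I.relative_vanishes_def by blast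
    obtain f where f: "f \<in> I.cF 0" "\<epsilon> f = q \<one>" using I.\<epsilon>_surj q1 by (metis imageE)
    have "z' f = \<zero>\<^bsub>N\<^esub>" using z'(2) f(1) unfolding I.coboundary_def by simp
    then have "z f \<in> Q" using z'(3) f(1) mod_diff_zero[OF modN lin_closed[OF z(1) f(1)]] by force
    then have "q \<one> \<odot>\<^bsub>E\<^esub> w = \<zero>\<^bsub>E\<^esub>" using z(2)[OF f(1)] f(2) zE[OF lin_closed[OF z(1) f(1)]] by simp
    then have "w = \<zero>\<^bsub>E\<^esub>" using cyc_act[OF cR idm E wE mw, of "\<one>"] module.smult_one[OF E wE] unfolding q_def by simp
    then show "y \<in> Q" using zE[OF y(1)] unfolding w_def by simp
  qed
  let ?Q = "\<lambda>xs. ideal_smult R N (set xs) (carrier N)"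
  have Qs: "submodule (?Q xs) R N" if "set xs \<subseteq> carrier R" for xs
    unfolding ideal_smult_def by (rule span_submod[OF modN]) (use that in auto)
  have mR: "\<mm> \<subseteq> carrier R" using m_carr by blast
  \<comment> \<open>Each regular element costs one degree of vanishing: after \<open>k\<close> steps the degrees \<open>\<le> n - k\<close> are left.\<close>
  have "\<exists>xs. length xs = k \<and> set xs \<subseteq> \<mm> \<and> (\<forall>i<k. \<forall>y\<in>carrier N. xs ! i \<odot>\<^bsub>N\<^esub> y \<in> ?Q (take i xs) \<longrightarrow> y \<in> ?Q (take i xs)) \<and>
     (\<forall>i. i + k \<le> n \<longrightarrow> I.relative_vanishes (?Q xs) i)" if "k \<le> Suc n" for k
    using that
  proof (induction k)
    case 0
    have "?Q [] = {\<zero>\<^bsub>N\<^esub>}"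
    proof
      show "?Q [] \<subseteq> {\<zero>\<^bsub>N\<^esub>}" unfolding ideal_smult_def by (rule span_least[OF submod_zero_set[OF modN]]) simp
      show "{\<zero>\<^bsub>N\<^esub>} \<subseteq> ?Q []" using submod_zero[OF Qs[of "[]"]] by simp
    qed
    then show ?case using base by (intro exI[of _ "[]"]) simp
  next
    case (Suc k)
    then obtain xs where xs: "length xs = k" "set xs \<subseteq> \<mm>" "\<forall>i<k. \<forall>y\<in>carrier N. xs ! i \<odot>\<^bsub>N\<^esub> y \<in> ?Q (take i xs) \<longrightarrow> y \<in> ?Q (take i xs)"
      "\<And>i. i + k \<le> n \<Longrightarrow> I.relative_vanishes (?Q xs) i" by auto
    have xsR: "set xs \<subseteq> carrier R" using xs(2) mR by blast
    have v0: "I.relative_vanishes (?Q xs) 0" by (rule xs(4)) (use Suc.prems in simp)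
    obtain x where x: "x \<in> \<mm>" "\<And>y. y \<in> carrier N \<Longrightarrow> x \<odot>\<^bsub>N\<^esub> y \<in> ?Q xs \<Longrightarrow> y \<in> ?Q xs"
      by (rule regular_element[OF N Qs[OF xsR] soc[OF Qs[OF xsR] v0]]) (auto intro: that)
    have Qx: "?Q (xs @ [x]) = msum N (?Q xs) ((\<lambda>y. x \<odot>\<^bsub>N\<^esub> y) ` carrier N)"
      using ideal_smult_snoc[OF modN xsR m_carr[OF x(1)]] by simp
    have "I.relative_vanishes (?Q (xs @ [x])) i" if "i + Suc k \<le> n" for i
      unfolding Qx by (rule I.relative_vanishes_regular[OF Qs[OF xsR] xs(4) xs(4) m_carr[OF x(1)] x(2)]) (use that in auto)
    moreover have "\<forall>i<Suc k. \<forall>y\<in>carrier N. (xs @ [x]) ! i \<odot>\<^bsub>N\<^esub> y \<in> ?Q (take i (xs @ [x])) \<longrightarrow> y \<in> ?Q (take i (xs @ [x]))"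
    proof (intro allI impI ballI)
      fix i y assume i: "i < Suc k" and y: "y \<in> carrier N" "(xs @ [x]) ! i \<odot>\<^bsub>N\<^esub> y \<in> ?Q (take i (xs @ [x]))"
      show "y \<in> ?Q (take i (xs @ [x]))"
      proof (cases "i = k")
        case True then show ?thesis using x(2)[OF y(1)] y(2) xs(1) by (simp add: nth_append)
      next
        case False
        then have "i < k" using i by simp
        then show ?thesis using xs(3) y xs(1) by (simp add: nth_append)
      qed
    qed
    ultimately show ?case using xs(1,2) x(1) by (intro exI[of _ "xs @ [x]"]) simp
  qed
  then obtain xs where xs: "length xs = Suc n" "set xs \<subseteq> \<mm>" "\<forall>i<Suc n. \<forall>y\<in>carrier N. xs ! i \<odot>\<^bsub>N\<^esub> y \<in> ?Q (take i xs) \<longrightarrow> y \<in> ?Q (take i xs)" by blast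
  obtain V where V: "submodule V R N" "V \<noteq> carrier N" "\<And>x y. x \<in> \<mm> \<Longrightarrow> y \<in> carrier N \<Longrightarrow> x \<odot>\<^bsub>N\<^esub> y \<in> V" using nakayama_proper[OF N nz] by blast
  have "?Q xs \<subseteq> V" unfolding ideal_smult_def by (rule span_least[OF V(1)]) (use V(3) xs(2) in auto)
  then have "?Q xs \<noteq> carrier N" using V(2) submod_subset[OF V(1)] by blast
  then have "regular_sequence R N xs" unfolding regular_sequence_def using xs mR by auto
  then have "enat (Suc n) \<in> {enat (length xs) | xs. set xs \<subseteq> \<mm> \<and> regular_sequence R N xs}" using xs by (intro CollectI exI[of _ xs]) simp
  then show ?thesis unfolding depth_def using nz by (simp add: Sup_upper)
qed

end

section \<open>Characters\<close>

text \<open>The circle group, written multiplicatively inside the complex numbers, as a module over the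
  integers: a divisible group that contains elements of every finite order, so it is an injective cogenerator.\<close>

definition circle :: "(int, complex) module" where
  "circle = \<lparr>carrier = {z. norm z = 1}, monoid.mult = undefined, one = undefined, ring.zero = 1,
     ring.add = (*), module.smult = (\<lambda>n z. z powi n)\<rparr>"

lemma circle_simps [simp]: "carrier circle = {z. norm z = 1}" "\<zero>\<^bsub>circle\<^esub> = 1" "x \<oplus>\<^bsub>circle\<^esub> y = x * y" "n \<odot>\<^bsub>circle\<^esub> x = x powi n"
  by (simp_all add: circle_def)

lemma circle_module: "Module.module \<Z> circle"
proof (rule moduleI)
  show "cring \<Z>" by (rule int_is_cring)
  show "abelian_group circle"
  proof (rule abelian_groupI)
    show "\<exists>y\<in>carrier circle. y \<oplus>\<^bsub>circle\<^esub> x = \<zero>\<^bsub>circle\<^esub>" if "x \<in> carrier circle" for x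
      using that by (intro bexI[of _ "inverse x"]) (auto simp: norm_inverse intro!: left_inverse)
  qed (auto simp: norm_mult mult_ac)
next
  fix a b :: int and x assume x: "x \<in> carrier circle"
  then have nz: "x \<noteq> 0" by auto
  show "(a \<oplus>\<^bsub>\<Z>\<^esub> b) \<odot>\<^bsub>circle\<^esub> x = a \<odot>\<^bsub>circle\<^esub> x \<oplus>\<^bsub>circle\<^esub> b \<odot>\<^bsub>circle\<^esub> x" using nz by (simp add: power_int_add)
  show "(a \<otimes>\<^bsub>\<Z>\<^esub> b) \<odot>\<^bsub>circle\<^esub> x = a \<odot>\<^bsub>circle\<^esub> (b \<odot>\<^bsub>circle\<^esub> x)" by (simp add: mult.commute[of a b] power_int_mult)
qed (auto simp: norm_power_int power_int_mult_distrib)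

lemma circle_root:
  assumes "norm y = 1" "m \<noteq> 0"
  obtains w :: complex where "norm w = 1" "w powi m = y"
proof -
  have "w powi m = y" if "w = cis (Arg y / of_int m)" for w
  proof -
    have "w powi m = cis (Arg y)" unfolding that using assms(2) by (simp add: cis_power_int)
    also have "\<dots> = y" using cis_Arg[of y] assms(1) by (cases "y = 0") (auto simp: sgn_div_norm)
    finally show ?thesis .
  qed
  then show thesis by (intro that[of "cis (Arg y / of_int m)"]) auto
qed

lemma int_ideal_principal:
  fixes I :: "int set"
  assumes z: "0 \<in> I" and a: "\<And>x y. x \<in> I \<Longrightarrow> y \<in> I \<Longrightarrow> x + y \<in> I" and s: "\<And>r x. x \<in> I \<Longrightarrow> r * x \<in> I"
  obtains m where "m \<in> I" "\<And>x. x \<in> I \<Longrightarrow> m dvd x"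
proof (cases "I = {0}")
  case True then show thesis using that[of 0] by simp
next
  case False
  then obtain x where x: "x \<in> I" "x \<noteq> 0" using z by blast
  define P where "P k \<longleftrightarrow> k > 0 \<and> int k \<in> I" for k
  have "\<bar>x\<bar> \<in> I" using x(1) s[OF x(1), of "-1"] by (simp add: abs_if)
  then have "P (nat \<bar>x\<bar>)" unfolding P_def using x(2) by simp
  then have P: "P (LEAST k. P k)" by (rule LeastI)
  have least: "P k \<Longrightarrow> (LEAST k. P k) \<le> k" for k by (rule Least_le)
  define m where "m = int (LEAST k. P k)"
  have m: "m \<in> I" "m > 0" using P unfolding P_def m_def by auto
  have "m dvd y" if y: "y \<in> I" for y
  proof -
    have "y + (- (y div m)) * m \<in> I" by (rule a[OF y s[OF m(1)]])
    then have "y mod m \<in> I" by (simp add: minus_mult_div_eq_mod [symmetric] mult.commute)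
    moreover have "0 \<le> y mod m" "y mod m < m" using m(2) by auto
    ultimately have "\<not> y mod m > 0" using least[of "nat (y mod m)"] unfolding P_def m_def by force
    then show ?thesis using \<open>0 \<le> y mod m\<close> by (simp add: dvd_eq_mod_eq_0)
  qed
  then show thesis by (rule that[OF m(1)])
qed

text \<open>Ideals of the integers are principal, so that injectivity amounts to divisibility.\<close>

lemma baer_circle: "baer \<Z> circle"
  unfolding baer_def
proof (intro conjI allI impI)
  show "Module.module \<Z> circle" by (rule circle_module)
  fix \<Gamma> assume \<Gamma>: "linrel \<Z> (Rmod \<Z>) circle \<Gamma>" and f: "functional (Rmod \<Z>) circle \<Gamma>"
  have MZ: "Module.module \<Z> (Rmod \<Z>)" by (rule Rmod_module[OF int_is_cring])
  have "\<exists>m. m \<in> Domain \<Gamma> \<and> (\<forall>x\<in>Domain \<Gamma>. m dvd x)"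
  proof (rule int_ideal_principal[of "Domain \<Gamma>"])
    show "0 \<in> Domain \<Gamma>" using linrel_zero[OF \<Gamma>] by auto
    show "x + y \<in> Domain \<Gamma>" if "x \<in> Domain \<Gamma>" "y \<in> Domain \<Gamma>" for x y
      using that linrel_add[OF \<Gamma>] by (fastforce simp: Domain_iff)
    show "r * x \<in> Domain \<Gamma>" if "x \<in> Domain \<Gamma>" for r x
      using that linrel_smult[OF \<Gamma>, of r] by (fastforce simp: Domain_iff)
  qed blast
  then obtain m y where my: "(m,y) \<in> \<Gamma>" and dv: "\<And>x z. (x,z) \<in> \<Gamma> \<Longrightarrow> m dvd x" by blast
  have ny: "norm y = 1" using linrel_sub(2)[OF \<Gamma> my] by simp
  obtain w where w: "norm w = 1" "w powi m = y"
  proof (cases "m = 0")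
    case True
    then have "y = 1" using f my unfolding functional_def by simp
    then show thesis using that[of 1] by simp
  next
    case False then show thesis using circle_root[OF ny] that by blast
  qed
  have "z = w powi x" if xz: "(x,z) \<in> \<Gamma>" for x z
  proof -
    obtain k where k: "x = k * m" using dv[OF xz] by (auto simp: dvd_def mult.commute)
    have "(k * m, y powi k) \<in> \<Gamma>" using linrel_smult[OF \<Gamma> _ my, of k] by simp
    then have "z = y powi k" using functional_unique[OF MZ circle_module \<Gamma> f xz] k by simp
    also have "y powi k = w powi x" unfolding k mult.commute[of k m] power_int_mult w(2) ..
    finally show ?thesis .
  qed
  then show "\<exists>e\<in>carrier circle. \<forall>(r,y)\<in>\<Gamma>. y = r \<odot>\<^bsub>circle\<^esub> e" using w(1) by (intro bexI[of _ w]) auto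
qed

definition int_module :: "('a,'b,'m) module_scheme \<Rightarrow> (int,'b) module" where
  "int_module A = \<lparr>carrier = carrier A, monoid.mult = undefined, one = undefined, ring.zero = \<zero>\<^bsub>A\<^esub>,
     ring.add = ring.add A, module.smult = (\<lambda>n x. add_pow A n x)\<rparr>"

lemma int_module_simps [simp]: "carrier (int_module A) = carrier A" "\<zero>\<^bsub>int_module A\<^esub> = \<zero>\<^bsub>A\<^esub>" "x \<oplus>\<^bsub>int_module A\<^esub> y = x \<oplus>\<^bsub>A\<^esub> y"
  "n \<odot>\<^bsub>int_module A\<^esub> x = add_pow A n x"
  by (simp_all add: int_module_def)

lemma int_module: assumes "abelian_group A" shows "Module.module \<Z> (int_module A)"
proof -
  interpret A: abelian_group A by fact
  show ?thesis
  proof (rule moduleI)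
    show "cring \<Z>" by (rule int_is_cring)
    show "abelian_group (int_module A)"
    proof (rule abelian_groupI)
      show "\<exists>y\<in>carrier (int_module A). y \<oplus>\<^bsub>int_module A\<^esub> x = \<zero>\<^bsub>int_module A\<^esub>" if "x \<in> carrier (int_module A)" for x
        using that A.l_neg[of x] A.a_inv_closed[of x] by auto
    qed (auto simp: A.a_ac)
  next
    fix a b :: int and x y assume "x \<in> carrier (int_module A)" "y \<in> carrier (int_module A)"
    then have c: "x \<in> carrier A" "y \<in> carrier A" by auto
    show "a \<odot>\<^bsub>int_module A\<^esub> x \<in> carrier (int_module A)" using c by simp
    show "(a \<oplus>\<^bsub>\<Z>\<^esub> b) \<odot>\<^bsub>int_module A\<^esub> x = a \<odot>\<^bsub>int_module A\<^esub> x \<oplus>\<^bsub>int_module A\<^esub> b \<odot>\<^bsub>int_module A\<^esub> x"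
      using A.add.int_pow_mult[OF c(1), of a b] by simp
    show "a \<odot>\<^bsub>int_module A\<^esub> (x \<oplus>\<^bsub>int_module A\<^esub> y) = a \<odot>\<^bsub>int_module A\<^esub> x \<oplus>\<^bsub>int_module A\<^esub> a \<odot>\<^bsub>int_module A\<^esub> y"
      using A.add.int_pow_distrib[OF c] by simp
    show "(a \<otimes>\<^bsub>\<Z>\<^esub> b) \<odot>\<^bsub>int_module A\<^esub> x = a \<odot>\<^bsub>int_module A\<^esub> (b \<odot>\<^bsub>int_module A\<^esub> x)"
      using A.add.int_pow_pow[OF c(1), of a b] by (simp add: mult.commute)
    show "\<one>\<^bsub>\<Z>\<^esub> \<odot>\<^bsub>int_module A\<^esub> x = x" using c by simp
  qed
qed

definition character :: "('a,'b,'m) module_scheme \<Rightarrow> 'b set \<Rightarrow> ('b \<Rightarrow> complex) \<Rightarrow> bool" where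
  "character A S \<chi> \<longleftrightarrow> (\<forall>x\<in>S. norm (\<chi> x) = 1) \<and> (\<forall>x\<in>S. \<forall>y\<in>S. \<chi> (x \<oplus>\<^bsub>A\<^esub> y) = \<chi> x * \<chi> y)"

lemma character_extend:
  assumes A: "Module.module R A" and S: "submodule S R A" and \<chi>: "character A S \<chi>"
  obtains \<chi>' where "character A (carrier A) \<chi>'" "\<And>x. x \<in> S \<Longrightarrow> \<chi>' x = \<chi> x"
proof -
  interpret A: module R A by (rule A)
  have M: "Module.module \<Z> (int_module A)" by (rule int_module) (rule A.abelian_group_axioms)
  have pw: "add_pow A k x \<in> S \<and> \<chi> (add_pow A k x) = \<chi> x powi k" if x: "x \<in> S" for k :: int and x
  proof -
    have xc: "x \<in> carrier A" using x submod_subset[OF S] by blast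
    have nx: "norm (\<chi> x) = 1" using \<chi> x unfolding character_def by blast
    then have nz: "\<chi> x \<noteq> 0" by auto
    have z: "\<chi> \<zero>\<^bsub>A\<^esub> = 1"
    proof -
      have "\<chi> \<zero>\<^bsub>A\<^esub> * \<chi> \<zero>\<^bsub>A\<^esub> = \<chi> \<zero>\<^bsub>A\<^esub>" using \<chi> submod_zero[OF S] unfolding character_def by (metis A.M.r_zero A.M.zero_closed)
      moreover have "\<chi> \<zero>\<^bsub>A\<^esub> \<noteq> 0" using \<chi> submod_zero[OF S] unfolding character_def by force
      ultimately show ?thesis by simp
    qed
    have step: "\<chi> (y \<oplus>\<^bsub>A\<^esub> x) = \<chi> y * \<chi> x" if "y \<in> S" for y using \<chi> that x unfolding character_def by blast
    have neg: "\<ominus>\<^bsub>A\<^esub> x \<in> S" by (rule submod_neg[OF A S x])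
    show ?thesis
    proof (induction k rule: int_induct[where k = 0])
      case base then show ?case using submod_zero[OF S] z by (simp add: add_pow_def)
    next
      case (step1 i)
      have "add_pow A (i + 1) x = add_pow A i x \<oplus>\<^bsub>A\<^esub> x" using A.M.add.int_pow_mult[OF xc, of i 1] xc by simp
      then show ?case using step1 step submod_add[OF S _ x] nz by (simp add: power_int_add)
    next
      case (step2 i)
      have e: "add_pow A i x = add_pow A (i - 1) x \<oplus>\<^bsub>A\<^esub> x" using A.M.add.int_pow_mult[OF xc, of "i - 1" 1] xc by simp
      have "add_pow A (i - 1) x = add_pow A i x \<oplus>\<^bsub>A\<^esub> (\<ominus>\<^bsub>A\<^esub> x)"
        unfolding e using xc A.M.add.int_pow_closed[OF xc, of "i - 1"] by (simp add: A.M.a_assoc A.M.r_neg)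
      then have m: "add_pow A (i - 1) x \<in> S" using submod_add[OF S _ neg] step2 by simp
      have "\<chi> x powi i = \<chi> (add_pow A (i - 1) x) * \<chi> x" using step[OF m] e step2 by simp
      then show ?case using m nz by (simp add: power_int_diff)
    qed
  qed
  have S': "submodule S \<Z> (int_module A)"
    by (rule submodI[OF M]) (use submod_subset[OF S] submod_zero[OF S] submod_add[OF S] pw in auto)
  have "lin \<Z> (int_module A) S circle (carrier circle) \<chi>"
    by (rule linI) (use \<chi> pw in \<open>auto simp: character_def\<close>)
  then obtain f where f: "lin_map \<Z> (int_module A) circle f" "\<And>x. x \<in> S \<Longrightarrow> f x = \<chi> x"
    using baer_restrict[OF M S' baer_circle] by blast
  show thesis
    by (rule that[of f]) (use lin_closed[OF f(1)] lin_add[OF f(1)] f(2) in \<open>auto simp: character_def\<close>)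
qed

text \<open>On the cyclic group generated by \<open>g\<close>, send \<open>g\<close> to \<open>-1\<close> if it has infinite order and to a primitive root
  of unity otherwise; then extend by injectivity.\<close>

lemma character_separates:
  assumes A: "Module.module R A" and g: "g \<in> carrier A" "g \<noteq> \<zero>\<^bsub>A\<^esub>"
  obtains \<chi> where "character A (carrier A) \<chi>" "\<chi> g \<noteq> 1"
proof -
  interpret A: module R A by (rule A)
  have M: "Module.module \<Z> (int_module A)" by (rule int_module) (rule A.abelian_group_axioms)
  have MZ: "Module.module \<Z> (Rmod \<Z>)" by (rule Rmod_module[OF int_is_cring])
  have "\<exists>w::complex. norm w = 1 \<and> w \<noteq> 1 \<and> (\<forall>n. add_pow A (n::int) g = \<zero>\<^bsub>A\<^esub> \<longrightarrow> w powi n = 1)"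
  proof -
    let ?I = "{n::int. add_pow A n g = \<zero>\<^bsub>A\<^esub>}"
    obtain m where m: "m \<in> ?I" "\<And>x. x \<in> ?I \<Longrightarrow> m dvd x"
    proof (rule int_ideal_principal[of ?I])
      show "x + y \<in> ?I" if "x \<in> ?I" "y \<in> ?I" for x y using that A.M.add.int_pow_mult[OF g(1), of x y] by simp
      show "r * x \<in> ?I" if "x \<in> ?I" for r x using that A.M.add.int_pow_pow[OF g(1), of r x] by (simp add: mult.commute)
    qed (auto simp: add_pow_def)
    have m1: "\<bar>m\<bar> \<noteq> 1"
    proof
      assume "\<bar>m\<bar> = 1"
      then have "m = 1 \<or> m = -1" by linarith
      then have "add_pow A m g = g \<or> add_pow A m g = \<ominus>\<^bsub>A\<^esub> g" using g(1) A.M.add.int_pow_neg[OF g(1), of 1] by (auto simp: a_inv_def)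
      moreover have "\<ominus>\<^bsub>A\<^esub> g \<noteq> \<zero>\<^bsub>A\<^esub>" using g A.M.r_neg[OF g(1)] A.M.r_zero[OF g(1)] by metis
      ultimately show False using m(1) g(2) by auto
    qed
    define w where "w = (if m = 0 then -1 else cis (2 * pi / of_int m))"
    have "w \<noteq> 1"
    proof (cases "m = 0")
      case False
      have "w \<noteq> 1"
      proof
        assume "w = 1"
        then have "cos (2 * pi / of_int m) = 1" unfolding w_def using False by (simp add: cis_conv_exp[symmetric] complex_eq_iff)
        then obtain k :: int where "2 * pi / of_int m = of_int k * 2 * pi" using cos_one_2pi_int by blast
        then have "(1::real) = of_int (k * m)" using False by (simp add: field_simps)
        then have "k * m = 1" by linarith
        then show False using m1 by (metis abs_mult abs_one zmult_eq_1_iff abs_minus_cancel)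
      qed
      then show ?thesis .
    qed (simp add: w_def)
    moreover have "w powi n = 1" if n0: "add_pow A n g = \<zero>\<^bsub>A\<^esub>" for n :: int
    proof -
      obtain k where k: "n = m * k" using m(2)[of n] n0 by (auto simp: dvd_def)
      show ?thesis
      proof (cases "m = 0")
        case False
        then have "w powi m = 1" unfolding w_def by (simp add: cis_power_int)
        then show ?thesis unfolding k by (simp add: power_int_mult)
      qed (simp add: k)
    qed
    ultimately show ?thesis by (intro exI[of _ w]) (auto simp: w_def)
  qed
  then obtain w :: complex where w: "norm w = 1" "w \<noteq> 1" "\<And>n::int. add_pow A n g = \<zero>\<^bsub>A\<^esub> \<Longrightarrow> w powi n = 1" by blast
  have w0: "w \<in> carrier circle" using w by simp
  have g0: "g \<in> carrier (int_module A)" using g by simp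
  obtain f where f: "lin_map \<Z> (int_module A) circle f"
    "\<And>n. n \<in> carrier (Rmod \<Z>) \<Longrightarrow> f (n \<odot>\<^bsub>int_module A\<^esub> g) = n \<odot>\<^bsub>circle\<^esub> w"
  proof (rule baer_factor[OF MZ submod_carrier[OF MZ] M baer_circle lin_cyclic[OF M g0] lin_cyclic[OF circle_module w0]])
    fix n :: int assume "n \<odot>\<^bsub>int_module A\<^esub> g = \<zero>\<^bsub>int_module A\<^esub>"
    then show "n \<odot>\<^bsub>circle\<^esub> w = \<zero>\<^bsub>circle\<^esub>" using w(3)[of n] by simp
  qed blast
  have "f g = w" using f(2)[of 1] g(1) by simp
  then show thesis
    by (intro that[of f]) (use lin_closed[OF f(1)] lin_add[OF f(1)] w(2) in \<open>auto simp: character_def\<close>)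
qed

section \<open>Small injective modules\<close>

text \<open>A power, with exponent the index type, of the character module of \<open>R\<close>. Such powers are injective and
  contain every module if the exponent is large enough, but they are too large for the type in which
  coresolutions are wanted.
  Functions are \<open>1\<close> outside the carrier of \<open>R\<close>, so that equality is extensional.\<close>

definition dual_module :: "('a,'r) ring_scheme \<Rightarrow> ('a, 'c \<Rightarrow> 'a \<Rightarrow> complex) module" where
  "dual_module R = \<lparr>carrier = {F. \<forall>c. character (Rmod R) (carrier R) (F c) \<and> (\<forall>r. r \<notin> carrier R \<longrightarrow> F c r = 1)},
     monoid.mult = undefined, one = undefined, ring.zero = (\<lambda>c r. 1), ring.add = (\<lambda>F G c r. F c r * G c r),
     module.smult = (\<lambda>s F c r. if r \<in> carrier R then F c (r \<otimes>\<^bsub>R\<^esub> s) else 1)\<rparr>"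

lemma dual_module_simps [simp]:
  "carrier (dual_module R) = {F. \<forall>c. character (Rmod R) (carrier R) (F c) \<and> (\<forall>r. r \<notin> carrier R \<longrightarrow> F c r = 1)}"
  "\<zero>\<^bsub>dual_module R\<^esub> = (\<lambda>c r. 1)" "F \<oplus>\<^bsub>dual_module R\<^esub> G = (\<lambda>c r. F c r * G c r)"
  "s \<odot>\<^bsub>dual_module R\<^esub> F = (\<lambda>c r. if r \<in> carrier R then F c (r \<otimes>\<^bsub>R\<^esub> s) else 1)"
  by (simp_all add: dual_module_def)

lemma dual_module_module: fixes R :: "('a,'r) ring_scheme" (structure)
  assumes "cring R" shows "Module.module R (dual_module R :: ('a, 'c \<Rightarrow> 'a \<Rightarrow> complex) module)"
proof -
  interpret cring R by fact
  have nrm: "norm (F c r) = 1" if "F \<in> carrier (dual_module R)" for F :: "'c \<Rightarrow> 'a \<Rightarrow> complex" and c r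
    using that by (cases "r \<in> carrier R") (auto simp: character_def)
  have add: "F c (r \<oplus> s) = F c r * F c s" if "F \<in> carrier (dual_module R)" "r \<in> carrier R" "s \<in> carrier R" for F :: "'c \<Rightarrow> 'a \<Rightarrow> complex" and c r s
    using that by (auto simp: character_def)
  show ?thesis
  proof (rule moduleI)
    show "cring R" by fact
    show "abelian_group (dual_module R :: ('a, 'c \<Rightarrow> 'a \<Rightarrow> complex) module)"
    proof (rule abelian_groupI)
      fix F :: "'c \<Rightarrow> 'a \<Rightarrow> complex" assume F: "F \<in> carrier (dual_module R)"
      show "\<exists>G\<in>carrier (dual_module R). G \<oplus>\<^bsub>dual_module R\<^esub> F = \<zero>\<^bsub>dual_module R\<^esub>"
      proof (rule bexI[of _ "\<lambda>c r. inverse (F c r)"])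
        have "F c r \<noteq> 0" for c r using nrm[OF F, of c r] by auto
        then show "(\<lambda>c r. inverse (F c r)) \<oplus>\<^bsub>dual_module R\<^esub> F = \<zero>\<^bsub>dual_module R\<^esub>" by simp
        show "(\<lambda>c r. inverse (F c r)) \<in> carrier (dual_module R)" using F by (auto simp: character_def norm_inverse)
      qed
    qed (auto simp: character_def norm_mult mult_ac)
  next
    fix a and F :: "'c \<Rightarrow> 'a \<Rightarrow> complex" assume a: "a \<in> carrier R" and F: "F \<in> carrier (dual_module R)"
    show "a \<odot>\<^bsub>dual_module R\<^esub> F \<in> carrier (dual_module R)" using a nrm[OF F] add[OF F] by (auto simp: character_def l_distr)
    fix b assume b: "b \<in> carrier R"
    show "(a \<oplus> b) \<odot>\<^bsub>dual_module R\<^esub> F = a \<odot>\<^bsub>dual_module R\<^esub> F \<oplus>\<^bsub>dual_module R\<^esub> b \<odot>\<^bsub>dual_module R\<^esub> F"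
      using a b add[OF F] by (auto simp: r_distr fun_eq_iff)
    show "(a \<otimes> b) \<odot>\<^bsub>dual_module R\<^esub> F = a \<odot>\<^bsub>dual_module R\<^esub> (b \<odot>\<^bsub>dual_module R\<^esub> F)" using a b by (auto simp: m_assoc fun_eq_iff)
  next
    fix F :: "'c \<Rightarrow> 'a \<Rightarrow> complex" assume F: "F \<in> carrier (dual_module R)"
    then show "\<one> \<odot>\<^bsub>dual_module R\<^esub> F = F" by (auto simp: fun_eq_iff)
  qed (auto simp: fun_eq_iff)
qed

lemma baer_dual_module: fixes R :: "('a,'r) ring_scheme" (structure)
  assumes R: "cring R" shows "baer R (dual_module R :: ('a, 'c \<Rightarrow> 'a \<Rightarrow> complex) module)"
proof (rule baerI[OF R dual_module_module[OF R]])
  interpret cring R by fact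
  fix \<aa> and \<phi> :: "'a \<Rightarrow> 'c \<Rightarrow> 'a \<Rightarrow> complex" assume \<aa>: "ideal \<aa> R" and \<phi>: "lin R (Rmod R) \<aa> (dual_module R) (carrier (dual_module R)) \<phi>"
  have s\<aa>: "submodule \<aa> R (Rmod R)" using \<aa> ideal_submod[OF R] by blast
  have sub: "r \<in> \<aa> \<Longrightarrow> r \<in> carrier R" for r using submod_subset[OF s\<aa>] by auto
  have "\<exists>\<psi>. character (Rmod R) (carrier R) \<psi> \<and> (\<forall>r\<in>\<aa>. \<psi> r = \<phi> r c \<one>)" for c
  proof (rule character_extend[OF Rmod_module[OF R] s\<aa>])
    show "character (Rmod R) \<aa> (\<lambda>r. \<phi> r c \<one>)"
      unfolding character_def using lin_closed[OF \<phi>] lin_add[OF \<phi>] by (auto simp: character_def)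
  qed auto
  then obtain \<psi> where \<psi>: "\<And>c. character (Rmod R) (carrier R) (\<psi> c)" "\<And>c r. r \<in> \<aa> \<Longrightarrow> \<psi> c r = \<phi> r c \<one>" by metis
  define e where "e = (\<lambda>c r. if r \<in> carrier R then \<psi> c r else 1)"
  have "e \<in> carrier (dual_module R)" using \<psi>(1) by (auto simp: e_def character_def)
  moreover have "\<phi> s = s \<odot>\<^bsub>dual_module R\<^esub> e" if s: "s \<in> \<aa>" for s
  proof (intro ext)
    fix c r
    show "\<phi> s c r = (s \<odot>\<^bsub>dual_module R\<^esub> e) c r"
    proof (cases "r \<in> carrier R")
      case True
      have "\<phi> (r \<otimes> s) = r \<odot>\<^bsub>dual_module R\<^esub> \<phi> s" using lin_smult[OF \<phi> True s] by simp
      moreover have "r \<otimes> s \<in> \<aa>" using submod_smult[OF s\<aa> True s] by simp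
      ultimately show ?thesis using True sub[OF s] \<psi>(2) by (simp add: e_def)
    next
      case False then show ?thesis using lin_closed[OF \<phi> s] by simp
    qed
  qed
  ultimately show "\<exists>e\<in>carrier (dual_module R). \<forall>r\<in>\<aa>. \<phi> r = r \<odot>\<^bsub>dual_module R\<^esub> e" by blast
qed

text \<open>Evaluation: \<open>g\<close> goes to the family \<open>r \<mapsto> \<chi>(r g)\<close>, indexed by the characters \<open>\<chi>\<close> of \<open>G\<close>. It is injective
  because characters separate points.\<close>

lemma embeds_in_dual_module:
  fixes G :: "('a,'b,'m) module_scheme"
  assumes G: "Module.module R G"
  obtains e :: "'b \<Rightarrow> ('b \<Rightarrow> complex) \<Rightarrow> 'a \<Rightarrow> complex"
  where "lin_map R G (dual_module R) e" "inj_on e (carrier G)"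
proof -
  interpret G: module R G by (rule G)
  define e where "e g = (\<lambda>\<chi> r. if r \<in> carrier R \<and> character G (carrier G) \<chi> then \<chi> (r \<odot>\<^bsub>G\<^esub> g) else 1)" for g :: 'b
  have e: "lin_map R G (dual_module R) e"
  proof (rule linI)
    show "e g \<in> carrier (dual_module R)" if "g \<in> carrier G" for g
      using that by (auto simp: e_def character_def G.smult_l_distr)
    show "e (g \<oplus>\<^bsub>G\<^esub> h) = e g \<oplus>\<^bsub>dual_module R\<^esub> e h" if "g \<in> carrier G" "h \<in> carrier G" for g h
      using that by (auto simp: e_def character_def G.smult_r_distr fun_eq_iff)
    show "e (s \<odot>\<^bsub>G\<^esub> g) = s \<odot>\<^bsub>dual_module R\<^esub> e g" if "s \<in> carrier R" "g \<in> carrier G" for s g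
      using that by (auto simp: e_def G.smult_assoc1 fun_eq_iff)
  qed
  have "inj_on e (carrier G)"
  proof (rule inj_onI, rule ccontr)
    fix g h assume gh: "g \<in> carrier G" "h \<in> carrier G" "e g = e h" "g \<noteq> h"
    then have c: "g \<ominus>\<^bsub>G\<^esub> h \<in> carrier G" "g \<ominus>\<^bsub>G\<^esub> h \<noteq> \<zero>\<^bsub>G\<^esub>" using mod_diff_eq_zero[OF G] by auto
    obtain \<chi> where \<chi>: "character G (carrier G) \<chi>" "\<chi> (g \<ominus>\<^bsub>G\<^esub> h) \<noteq> 1" by (rule character_separates[OF G c]) blast
    have "\<chi> g = \<chi> h" using fun_cong[OF fun_cong[OF gh(3)], of \<chi> "\<one>\<^bsub>R\<^esub>"] \<chi>(1) gh(1,2) by (simp add: e_def)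
    moreover have "\<chi> g = \<chi> (g \<ominus>\<^bsub>G\<^esub> h) * \<chi> h" using \<chi>(1) c(1) gh(2) mod_diff_add[OF G gh(1,2)] unfolding character_def by metis
    moreover have "\<chi> h \<noteq> 0" using \<chi>(1) gh(2) unfolding character_def by force
    ultimately show False using \<chi>(2) by simp
  qed
  then show thesis using e that by blast
qed

text \<open>A small injective submodule is cut out of a large one by closing a set of elements under the module
  operations and under the choice of solutions \<open>e\<close> to finite systems \<open>r\<^sub>i e = y\<^sub>i\<close>. Its elements are values of
  the expressions below, and these can be coded in the type that bounds the size.\<close>

datatype ('a,'u) expr = Gen 'u | Sum "('a,'u) expr" "('a,'u) expr" | Scale 'a "('a,'u) expr" | Solve "('a \<times> ('a,'u) expr) list"

primrec expr_value :: "('a,'r) ring_scheme \<Rightarrow> ('a,'e,'m) module_scheme \<Rightarrow> ('u \<Rightarrow> 'e) \<Rightarrow> ('a,'u) expr \<Rightarrow> 'e" where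
  "expr_value R E f (Gen u) = f u"
| "expr_value R E f (Sum s t) = expr_value R E f s \<oplus>\<^bsub>E\<^esub> expr_value R E f t"
| "expr_value R E f (Scale a t) = (if a \<in> carrier R then a \<odot>\<^bsub>E\<^esub> expr_value R E f t else \<zero>\<^bsub>E\<^esub>)"
| "expr_value R E f (Solve l) = (let P = (\<lambda>e. e \<in> carrier E \<and> (\<forall>(r,y)\<in>set (map (map_prod id (expr_value R E f)) l). r \<odot>\<^bsub>E\<^esub> e = y))
     in if \<exists>e. P e then SOME e. P e else \<zero>\<^bsub>E\<^esub>)"

lemma expr_value_closed:
  assumes E: "Module.module R E" and f: "\<And>u. f u \<in> carrier E" shows "expr_value R E f t \<in> carrier E"
proof (induction t)
  interpret module R E by (rule E)
  case (Solve l)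
  have some: "(if \<exists>e. P e then SOME e. P e else \<zero>\<^bsub>E\<^esub>) \<in> carrier E" if P: "\<And>e. P e \<Longrightarrow> e \<in> carrier E" for P
    using P[OF someI_ex[of P]] by auto
  show ?case unfolding expr_value.simps Let_def by (rule some) (erule conjunct1)
next
  interpret module R E by (rule E)
  case (Scale a t) then show ?case by simp
next
  interpret module R E by (rule E)
  case (Sum s t) then show ?case by simp
qed (simp add: f)

lemma hull_submodule:
  assumes E: "Module.module R E" and f: "\<And>u. f u \<in> carrier E" "\<zero>\<^bsub>E\<^esub> \<in> range f"
  shows "submodule (range (expr_value R E f)) R E"
proof (rule submodI[OF E])
  show "range (expr_value R E f) \<subseteq> carrier E" using expr_value_closed[of R E f, OF E f(1)] by blast
  obtain u where "f u = \<zero>\<^bsub>E\<^esub>" using f(2) by force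
  then show "\<zero>\<^bsub>E\<^esub> \<in> range (expr_value R E f)" by (intro image_eqI[of _ _ "Gen u"]) auto
  show "x \<oplus>\<^bsub>E\<^esub> y \<in> range (expr_value R E f)" if xy: "x \<in> range (expr_value R E f)" "y \<in> range (expr_value R E f)" for x y
  proof -
    obtain s t where "x = expr_value R E f s" "y = expr_value R E f t" using xy by blast
    then show ?thesis by (intro image_eqI[of _ _ "Sum s t"]) auto
  qed
  show "a \<odot>\<^bsub>E\<^esub> x \<in> range (expr_value R E f)" if ax: "a \<in> carrier R" "x \<in> range (expr_value R E f)" for a x
  proof -
    obtain t where "x = expr_value R E f t" using ax by blast
    then show ?thesis using ax by (intro image_eqI[of _ _ "Scale a t"]) auto
  qed
qed

text \<open>Ideals are finitely generated, so that extending a map from an ideal to \<open>R\<close> is a finite system of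
  equations. It has a solution in \<open>E\<close>, hence one in the hull.\<close>

lemma hull_baer:
  assumes R: "cring R" "noeth R (Rmod R)" and E: "baer R E" and f: "\<And>u. f u \<in> carrier E" "\<zero>\<^bsub>E\<^esub> \<in> range f"
  defines "D \<equiv> range (expr_value R E f)"
  shows "baer R (E\<lparr>carrier := D\<rparr>)"
proof (rule baerI[OF R(1)])
  have ME: "Module.module R E" by (rule baer_module[OF E])
  interpret E: module R E by (rule ME)
  have MR: "Module.module R (Rmod R)" by (rule Rmod_module[OF R(1)])
  have D: "submodule D R E" unfolding D_def by (rule hull_submodule[OF ME f])
  show "Module.module R (E\<lparr>carrier := D\<rparr>)" by (rule submod_module[OF ME D])
  fix \<aa> \<phi> assume \<aa>: "ideal \<aa> R" and \<phi>0: "lin R (Rmod R) \<aa> (E\<lparr>carrier := D\<rparr>) (carrier (E\<lparr>carrier := D\<rparr>)) \<phi>"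
  then have \<phi>: "lin R (Rmod R) \<aa> E D \<phi>" unfolding lin_def by simp
  have s\<aa>: "submodule \<aa> R (Rmod R)" using \<aa> ideal_submod[OF R(1)] by blast
  have \<phi>E: "lin R (Rmod R) \<aa> E (carrier E) \<phi>" by (rule lin_mono[OF \<phi> order_refl submod_subset[OF D]])
  obtain e0 where e0: "e0 \<in> carrier E" "\<And>r. r \<in> \<aa> \<Longrightarrow> \<phi> r = r \<odot>\<^bsub>E\<^esub> e0" by (rule baer_ideal[OF R(1) E \<aa> \<phi>E]) (auto intro: that)
  obtain F where F: "finite F" "F \<subseteq> \<aa>" "submodule_generated R (Rmod R) F = \<aa>" by (rule noeth_fg[OF R(2) s\<aa>])
  obtain rs where rs: "set rs = F" using finite_list[OF F(1)] by blast
  have "\<exists>t. \<phi> r = expr_value R E f t" if "r \<in> \<aa>" for r using lin_closed[OF \<phi> that] unfolding D_def by blast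
  then obtain t where t: "\<And>r. r \<in> \<aa> \<Longrightarrow> \<phi> r = expr_value R E f (t r)" by metis
  define l where "l = map (\<lambda>r. (r, t r)) rs"
  let ?P = "\<lambda>e. e \<in> carrier E \<and> (\<forall>(r,y)\<in>set (map (map_prod id (expr_value R E f)) l). r \<odot>\<^bsub>E\<^esub> e = y)"
  have P: "?P e \<longleftrightarrow> e \<in> carrier E \<and> (\<forall>r\<in>F. r \<odot>\<^bsub>E\<^esub> e = \<phi> r)" for e using t F(2) rs unfolding l_def by auto
  define e where "e = expr_value R E f (Solve l)"
  have "?P e0" unfolding P using e0 F(2) by auto
  then have ex: "\<exists>e. ?P e" by blast
  have "e = (SOME e. ?P e)" unfolding e_def expr_value.simps Let_def by (rule if_P[OF ex])
  then have "?P e" using someI_ex[OF ex] by simp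
  then have e: "e \<in> carrier E" "\<And>r. r \<in> F \<Longrightarrow> r \<odot>\<^bsub>E\<^esub> e = \<phi> r" unfolding P by auto
  have "\<phi> r = r \<odot>\<^bsub>E\<^esub> e" if r: "r \<in> \<aa>" for r
  proof -
    have cl: "lin R (Rmod R) \<aa> E (carrier E) (\<lambda>r. r \<odot>\<^bsub>E\<^esub> e)" by (rule lin_mono[OF lin_cyclic[OF ME e(1)]]) (use submod_subset[OF s\<aa>] in auto)
    have "submodule {r\<in>\<aa>. (\<phi> r \<ominus>\<^bsub>E\<^esub> r \<odot>\<^bsub>E\<^esub> e) = \<zero>\<^bsub>E\<^esub>} R (Rmod R)"
      by (rule lin_kernel[OF MR ME s\<aa> lin_pointwise_diff[OF MR ME submod_subset[OF s\<aa>] submod_carrier[OF ME] \<phi>E cl]])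
    then have "\<aa> \<subseteq> {r\<in>\<aa>. (\<phi> r \<ominus>\<^bsub>E\<^esub> r \<odot>\<^bsub>E\<^esub> e) = \<zero>\<^bsub>E\<^esub>}" unfolding F(3)[symmetric]
      by (rule span_least) (use F e lin_closed[OF \<phi>E] mod_diff_self[OF ME] in force)
    then show ?thesis using r mod_diff_eq_zero[OF ME lin_closed[OF \<phi>E r] lin_closed[OF cl r]] by blast
  qed
  moreover have "e \<in> D" unfolding D_def e_def by (rule rangeI)
  ultimately show "\<exists>e\<in>carrier (E\<lparr>carrier := D\<rparr>). \<forall>r\<in>\<aa>. \<phi> r = r \<odot>\<^bsub>E\<lparr>carrier := D\<rparr>\<^esub> e" by auto
qed

text \<open>An injective coding of a number and a list of pairs. In position \<open>(a, n)\<close>, where \<open>n\<close> encodes a pair,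
  \<open>(0, _)\<close> holds the number and the length of the list, \<open>(i + 1, 0)\<close> says whether \<open>a\<close> is the first component
  of entry \<open>i\<close>, and \<open>(i + 1, j + 1)\<close> holds the second component of entry \<open>i\<close> at \<open>(a, j)\<close>.\<close>

definition tuple :: "nat \<Rightarrow> ('a \<times> ('a \<times> nat \<Rightarrow> 'b + nat)) list \<Rightarrow> 'a \<times> nat \<Rightarrow> 'b + nat" where
  "tuple k l = (\<lambda>(a,n). case prod_decode n of
      (0, j) \<Rightarrow> Inr (if j = 0 then k else length l)
    | (Suc i, 0) \<Rightarrow> Inr (if i < length l \<and> a = fst (l ! i) then 1 else 0)
    | (Suc i, Suc j) \<Rightarrow> (if i < length l then snd (l ! i) (a,j) else Inr 0))"

lemma tuple_inject: "tuple k l = tuple k' l' \<longleftrightarrow> k = k' \<and> l = l'"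
proof
  assume eq: "tuple k l = tuple k' l'"
  have at: "tuple k l (a, prod_encode p) = tuple k' l' (a, prod_encode p)" for a p using eq by simp
  have "k = k'" using at[of undefined "(0,0)"] by (simp add: tuple_def)
  moreover have len: "length l = length l'" using at[of undefined "(0,1)"] by (simp add: tuple_def)
  moreover have "l ! i = l' ! i" if i: "i < length l" for i
  proof (rule prod_eqI)
    show "fst (l ! i) = fst (l' ! i)" using at[of "fst (l ! i)" "(Suc i,0)"] i len by (simp add: tuple_def split: if_splits)
    show "snd (l ! i) = snd (l' ! i)"
    proof
      fix x :: "'a \<times> nat"
      show "snd (l ! i) x = snd (l' ! i) x" using at[of "fst x" "(Suc i, Suc (snd x))"] i len by (simp add: tuple_def)
    qed
  qed
  ultimately show "k = k' \<and> l = l'" by (auto intro: nth_equalityI)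
qed simp

primrec expr_code :: "('a, 'a \<times> nat \<Rightarrow> 'b + nat) expr \<Rightarrow> 'a \<times> nat \<Rightarrow> 'b + nat" where
  "expr_code (Gen u) = tuple 0 [(undefined, u)]"
| "expr_code (Sum s t) = tuple 1 [(undefined, expr_code s), (undefined, expr_code t)]"
| "expr_code (Scale a t) = tuple 2 [(a, expr_code t)]"
| "expr_code (Solve l) = tuple 3 (map (map_prod id expr_code) l)"

lemma expr_code_inject: "expr_code s = expr_code t \<Longrightarrow> s = t"
proof (induction s arbitrary: t)
  case (Solve l)
  show ?case
  proof (cases t)
    case (Solve l')
    with Solve.prems have "map (map_prod id expr_code) l = map (map_prod id expr_code) l'" by (simp add: tuple_inject)
    then have "l = l'"
    proof (rule list.inj_map_strong[rotated])
      fix p q assume p: "p \<in> set l" "q \<in> set l'" and e: "map_prod id expr_code p = map_prod id expr_code q"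
      have "snd p \<in> Basic_BNFs.snds p" by (cases p) simp
      then show "p = q" using Solve.IH[OF p(1), of "snd p" "snd q"] e by (cases p; cases q) auto
    qed
    then show ?thesis using Solve by simp
  qed (use Solve.prems in \<open>auto simp: tuple_inject\<close>)
next
  case (Gen u) then show ?case by (cases t) (auto simp: tuple_inject)
next
  case (Sum s1 s2) then show ?case by (cases t) (auto simp: tuple_inject)
next
  case (Scale a s) then show ?case by (cases t) (auto simp: tuple_inject)
qed

text \<open>The copy of a module along an injection of its carrier into another type.\<close>

definition transport :: "('b \<Rightarrow> 'u) \<Rightarrow> ('a,'b,'m) module_scheme \<Rightarrow> ('a,'u) module" where
  "transport j A = (let i = the_inv_into (carrier A) j in
     \<lparr>carrier = j ` carrier A, monoid.mult = undefined, one = undefined, ring.zero = j \<zero>\<^bsub>A\<^esub>,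
      ring.add = (\<lambda>x y. j (i x \<oplus>\<^bsub>A\<^esub> i y)), module.smult = (\<lambda>r x. j (r \<odot>\<^bsub>A\<^esub> i x))\<rparr>)"

lemma transport_module:
  assumes A: "Module.module R A" and j: "inj_on j (carrier A)"
  shows "Module.module R (transport j A)" "lin_map R A (transport j A) j"
    "lin_map R (transport j A) A (the_inv_into (carrier A) j)"
    "carrier (transport j A) = j ` carrier A"
proof -
  interpret A: module R A by (rule A)
  let ?i = "the_inv_into (carrier A) j"
  have i: "?i (j x) = x" if "x \<in> carrier A" for x by (rule the_inv_into_f_f[OF j that])
  have S: "carrier (transport j A) = j ` carrier A" "\<zero>\<^bsub>transport j A\<^esub> = j \<zero>\<^bsub>A\<^esub>"
    "\<And>x y. x \<oplus>\<^bsub>transport j A\<^esub> y = j (?i x \<oplus>\<^bsub>A\<^esub> ?i y)" "\<And>r x. r \<odot>\<^bsub>transport j A\<^esub> x = j (r \<odot>\<^bsub>A\<^esub> ?i x)"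
    by (simp_all add: transport_def Let_def)
  show "carrier (transport j A) = j ` carrier A" by (rule S)
  show "Module.module R (transport j A)"
  proof (rule moduleI)
    show "cring R" by (rule A.R.is_cring)
    show "abelian_group (transport j A)"
    proof (rule abelian_groupI)
      fix x assume "x \<in> carrier (transport j A)"
      then obtain y where y: "y \<in> carrier A" "x = j y" unfolding S by blast
      show "\<exists>z\<in>carrier (transport j A). z \<oplus>\<^bsub>transport j A\<^esub> x = \<zero>\<^bsub>transport j A\<^esub>"
        using y by (intro bexI[of _ "j (\<ominus>\<^bsub>A\<^esub> y)"]) (auto simp: S i A.M.l_neg)
    qed (auto simp: S i A.M.a_ac)
  qed (auto simp: S i A.smult_l_distr A.smult_r_distr A.smult_assoc1)
  show "lin_map R A (transport j A) j" by (rule linI) (auto simp: S i)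
  show "lin_map R (transport j A) A ?i" by (rule linI) (auto simp: S i)
qed

lemma baer_retract:
  assumes R: "cring R" and E: "baer R E" and B: "Module.module R B"
    and i: "lin_map R B E i" and p: "lin_map R E B p"
    and pi: "\<And>x. x \<in> carrier B \<Longrightarrow> p (i x) = x"
  shows "baer R B"
proof (rule baerI[OF R B])
  fix \<aa> \<phi> assume \<aa>: "ideal \<aa> R" and \<phi>: "lin R (Rmod R) \<aa> B (carrier B) \<phi>"
  have i\<phi>: "lin R (Rmod R) \<aa> E (carrier E) (\<lambda>r. i (\<phi> r))" by (rule lin_comp[OF \<phi> i order_refl])
  obtain e where e: "e \<in> carrier E" "\<And>r. r \<in> \<aa> \<Longrightarrow> i (\<phi> r) = r \<odot>\<^bsub>E\<^esub> e" by (rule baer_ideal[OF R E \<aa> i\<phi>]) (auto intro: that)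
  have "\<phi> r = r \<odot>\<^bsub>B\<^esub> p e" if r: "r \<in> \<aa>" for r
    using pi[OF lin_closed[OF \<phi> r]] e(2)[OF r] lin_smult[OF p ideal.Icarr[OF \<aa> r] e(1)] by simp
  then show "\<exists>e\<in>carrier B. \<forall>r\<in>\<aa>. \<phi> r = r \<odot>\<^bsub>B\<^esub> e" using lin_closed[OF p e(1)] by blast
qed

lemma embeds_in_small_injective:
  fixes G :: "('a, 'a \<times> nat \<Rightarrow> 'b + nat, 'm) module_scheme"
  assumes R: "cring R" "noeth R (Rmod R)" and G: "Module.module R G"
  obtains J :: "('a, 'a \<times> nat \<Rightarrow> 'b + nat) module" and e
  where "baer R J" "lin_map R G J e" "inj_on e (carrier G)"
proof -
  define E where "E = (dual_module R :: ('a, (('a \<times> nat \<Rightarrow> 'b + nat) \<Rightarrow> complex) \<Rightarrow> 'a \<Rightarrow> complex) module)"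
  obtain e0 where e0: "lin_map R G E e0" "inj_on e0 (carrier G)" unfolding E_def by (rule embeds_in_dual_module[OF G])
  have E: "baer R E" unfolding E_def by (rule baer_dual_module[OF R(1)])
  have ME: "Module.module R E" by (rule baer_module[OF E])
  define f where "f u = (if u \<in> carrier G then e0 u else \<zero>\<^bsub>E\<^esub>)" for u
  have f: "f u \<in> carrier E" for u unfolding f_def using lin_closed[OF e0(1), of u] submod_zero[OF submod_carrier[OF ME]] by (cases "u \<in> carrier G") (simp_all)
  have "f \<zero>\<^bsub>G\<^esub> = \<zero>\<^bsub>E\<^esub>" unfolding f_def using lin_zero[OF G ME submod_carrier[OF G] e0(1)] by (simp)
  then have f0: "\<zero>\<^bsub>E\<^esub> \<in> range f" by (metis rangeI)
  define D where "D = range (expr_value R E f)"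
  let ?D = "E\<lparr>carrier := D\<rparr>"
  have D: "baer R ?D" unfolding D_def by (rule hull_baer[OF R E f f0])
  have MD: "Module.module R ?D" by (rule baer_module[OF D])
  define j where "j x = expr_code (SOME t. expr_value R E f t = x)" for x
  have "inj_on j D"
  proof (rule inj_onI)
    fix x y assume xy: "x \<in> D" "y \<in> D" "j x = j y"
    have s: "expr_value R E f (SOME t. expr_value R E f t = x) = x" if x: "x \<in> D" for x
    proof -
      obtain t where "expr_value R E f t = x" using x unfolding D_def by blast
      then show ?thesis by (rule someI)
    qed
    show "x = y" using arg_cong[OF expr_code_inject[OF xy(3)[unfolded j_def]], of "expr_value R E f"] unfolding s[OF xy(1)] s[OF xy(2)] .
  qed
  then have j: "inj_on j (carrier ?D)" by simp
  note T = transport_module[OF MD j]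
  have "baer R (transport j ?D)"
    by (rule baer_retract[OF R(1) D T(1) T(3) T(2)]) (use T(4) f_the_inv_into_f[OF j] in auto)
  moreover have e1: "lin_map R G ?D e0"
  proof -
    have "e0 x \<in> D" if "x \<in> carrier G" for x
      unfolding D_def using that by (intro image_eqI[of _ _ "Gen x"]) (simp_all add: f_def)
    then show ?thesis using lin_into[OF e0(1), of D] unfolding lin_def by simp
  qed
  then have "lin_map R G (transport j ?D) (\<lambda>x. j (e0 x))" by (rule lin_comp[OF _ T(2) order_refl])
  moreover have "inj_on (\<lambda>x. j (e0 x)) (carrier G)"
    using comp_inj_on[OF e0(2) inj_on_subset[OF j]] lin_closed[OF e1] by (auto simp: comp_def)
  ultimately show thesis by (rule that)
qed

text \<open>The cosyzygies \<open>G i\<close> stay in one type: a module in this type embeds into an injective module in the same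
  type, and quotients do not change the type. The first step needs a copy of \<open>N\<close> there.\<close>

theorem coresolution_exists:
  fixes N :: "('a,'b,'m) module_scheme"
  assumes R: "cring R" "noeth R (Rmod R)" and N: "Module.module R N"
  shows "\<exists>(Y :: nat \<Rightarrow> ('a, 'a \<times> nat \<Rightarrow> 'b + nat) module) d \<eta>. coresolution R Y d N \<eta>"
proof -
  define j0 :: "'b \<Rightarrow> 'a \<times> nat \<Rightarrow> 'b + nat" where "j0 b = (\<lambda>_. Inl b)" for b
  have j0: "inj_on j0 (carrier N)" by (rule inj_onI) (auto simp: j0_def fun_eq_iff)
  note T = transport_module[OF N j0]
  have "\<forall>G. \<exists>p :: ('a, 'a \<times> nat \<Rightarrow> 'b + nat) module \<times> (('a \<times> nat \<Rightarrow> 'b + nat) \<Rightarrow> ('a \<times> nat \<Rightarrow> 'b + nat)). Module.module R (G :: ('a, 'a \<times> nat \<Rightarrow> 'b + nat) module) \<longrightarrow>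
     baer R (fst p) \<and> lin_map R G (fst p) (snd p) \<and> inj_on (snd p) (carrier G)"
  proof
    fix G :: "('a, 'a \<times> nat \<Rightarrow> 'b + nat) module"
    show "\<exists>p :: ('a, 'a \<times> nat \<Rightarrow> 'b + nat) module \<times> (('a \<times> nat \<Rightarrow> 'b + nat) \<Rightarrow> ('a \<times> nat \<Rightarrow> 'b + nat)). Module.module R G \<longrightarrow> baer R (fst p) \<and> lin_map R G (fst p) (snd p) \<and> inj_on (snd p) (carrier G)"
    proof (cases "Module.module R G")
      case True
      obtain J :: "('a, 'a \<times> nat \<Rightarrow> 'b + nat) module" and e where "baer R J" "lin_map R G J e" "inj_on e (carrier G)"
        by (rule embeds_in_small_injective[OF R True])
      then show ?thesis by (intro exI[of _ "(J,e)"]) simp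
    qed simp
  qed
  then obtain P :: "('a, 'a \<times> nat \<Rightarrow> 'b + nat) module \<Rightarrow> ('a, 'a \<times> nat \<Rightarrow> 'b + nat) module \<times> (('a \<times> nat \<Rightarrow> 'b + nat) \<Rightarrow> ('a \<times> nat \<Rightarrow> 'b + nat))" where P: "\<And>G. Module.module R G \<Longrightarrow> baer R (fst (P G)) \<and> lin_map R G (fst (P G)) (snd (P G)) \<and> inj_on (snd (P G)) (carrier G)"
    by metis
  define J where "J G = fst (P G)" for G
  define e where "e G = snd (P G)" for G
  have J: "baer R (J G)" and e: "lin_map R G (J G) (e G)" and inj: "inj_on (e G) (carrier G)" if "Module.module R G" for G
    using P[OF that] unfolding J_def e_def by auto
  define cok where "cok G = quo (J G) (e G ` carrier G)" for G
  have im: "submodule (e G ` carrier G) R (J G)" if "Module.module R G" for G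
    by (rule lin_image[OF that baer_module[OF J[OF that]] submod_carrier[OF that] e[OF that]])
  have nextM: "Module.module R (cok G)" if "Module.module R G" for G
    unfolding cok_def by (rule quo_module[OF baer_module[OF J[OF that]] im[OF that]])
  define G where "G i = (cok ^^ i) (transport j0 N)" for i
  have GS: "G (Suc i) = cok (G i)" for i unfolding G_def by simp
  have G0: "G 0 = transport j0 N" unfolding G_def by simp
  have MG: "Module.module R (G i)" for i
    by (induction i) (simp_all add: GS nextM, simp add: G_def T(1))
  define Z where "Z = (J (G 0))\<lparr>carrier := {\<zero>\<^bsub>J (G 0)\<^esub>}\<rparr>"
  have MZ: "Module.module R Z" unfolding Z_def by (rule submod_module[OF baer_module[OF J[OF MG]] submod_zero_set[OF baer_module[OF J[OF MG]]]])
  define Y where "Y i = (case i of 0 \<Rightarrow> Z | Suc i \<Rightarrow> J (G i))" for i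
  define d where "d i = (case i of 0 \<Rightarrow> (\<lambda>_. \<zero>\<^bsub>J (G 0)\<^esub>) | Suc i \<Rightarrow> (\<lambda>x. e (G (Suc i)) (qrep (J (G i)) (e (G i) ` carrier (G i)) x)))" for i
  have YS: "Y (Suc i) = J (G i)" and Y0: "Y 0 = Z" for i unfolding Y_def by auto
  have dS: "d (Suc i) x = e (G (Suc i)) (qrep (J (G i)) (e (G i) ` carrier (G i)) x)" and d0: "d 0 x = \<zero>\<^bsub>J (G 0)\<^esub>" for i x unfolding d_def by auto
  have MJ: "Module.module R (J (G i))" for i by (rule baer_module[OF J[OF MG]])
  have q: "lin_map R (J (G i)) (G (Suc i)) (qrep (J (G i)) (e (G i) ` carrier (G i)))" for i
    unfolding GS cok_def by (rule qrep_lin[OF MJ im[OF MG]])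
  have eG0: "e (G i) \<zero>\<^bsub>G i\<^esub> = \<zero>\<^bsub>J (G i)\<^esub>" for i by (rule lin_zero[OF MG MJ submod_carrier[OF MG] e[OF MG]])
  have zero: "d (Suc i) x = \<zero>\<^bsub>J (G (Suc i))\<^esub> \<longleftrightarrow> x \<in> e (G i) ` carrier (G i)" if x: "x \<in> carrier (J (G i))" for i x
  proof -
    have "d (Suc i) x = \<zero>\<^bsub>J (G (Suc i))\<^esub> \<longleftrightarrow> qrep (J (G i)) (e (G i) ` carrier (G i)) x = \<zero>\<^bsub>G (Suc i)\<^esub>"
      unfolding dS eG0[of "Suc i", symmetric]
      by (rule inj_on_eq_iff[OF inj[OF MG] lin_closed[OF q x] submod_zero[OF submod_carrier[OF MG]]])
    also have "\<dots> \<longleftrightarrow> x \<in> e (G i) ` carrier (G i)"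
      using qrep_zero_iff[OF MJ im[OF MG] x] unfolding GS cok_def by simp
    finally show ?thesis .
  qed
  have bZ: "baer R Z"
  proof (rule baerI[OF R(1) MZ])
    fix \<aa> \<phi> assume \<phi>: "lin R (Rmod R) \<aa> Z (carrier Z) \<phi>"
    interpret Z: module R Z by (rule MZ)
    interpret cring R by (rule R(1))
    show "\<exists>e\<in>carrier Z. \<forall>r\<in>\<aa>. \<phi> r = r \<odot>\<^bsub>Z\<^esub> e" if \<aa>: "ideal \<aa> R"
    proof (intro bexI[of _ "\<zero>\<^bsub>Z\<^esub>"] ballI)
      fix r assume r: "r \<in> \<aa>"
      have "\<phi> r = \<zero>\<^bsub>J (G 0)\<^esub>" using lin_closed[OF \<phi> r] unfolding Z_def by simp
      also have "\<dots> = \<zero>\<^bsub>Z\<^esub>" unfolding Z_def by simp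
      also have "\<dots> = r \<odot>\<^bsub>Z\<^esub> \<zero>\<^bsub>Z\<^esub>" using ideal.Icarr[OF \<aa> r] by simp
      finally show "\<phi> r = r \<odot>\<^bsub>Z\<^esub> \<zero>\<^bsub>Z\<^esub>" .
    qed simp
  qed
  have dl: "lin_map R (Y i) (Y (Suc i)) (d i)" for i
  proof (cases i)
    case 0
    have "lin_map R Z (J (G 0)) (\<lambda>_. \<zero>\<^bsub>J (G 0)\<^esub>)" by (rule lin_zero_map[OF MZ MJ submod_carrier[OF MJ]])
    then show ?thesis unfolding 0 Y0 YS d_def by simp
  next
    case (Suc k)
    show ?thesis unfolding Suc YS using lin_comp[OF q[of k] e[OF MG, of "Suc k"] order_refl] unfolding d_def by simp
  qed
  have \<eta>: "lin_map R N (Y (Suc 0)) (\<lambda>x. e (G 0) (j0 x))"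
    unfolding YS by (rule lin_comp[OF T(2)[folded G0] e[OF MG, of 0] order_refl])
  have cG0: "carrier (G 0) = j0 ` carrier N" unfolding G_def using T(4) by simp
  have "coresolution R Y d N (\<lambda>x. e (G 0) (j0 x))"
  proof (intro coresolution.intro injective_complex.intro coresolution_axioms.intro)
    show "cring R" by (rule R)
    show "baer R (Y i)" for i by (cases i) (simp_all add: Y0 YS bZ J[OF MG])
    show "carrier (Y 0) = {\<zero>\<^bsub>Y 0\<^esub>}" unfolding Y0 Z_def by simp
    show "lin_map R (Y i) (Y (Suc i)) (d i)" for i by (rule dl)
    show "d (Suc i) (d i y) = \<zero>\<^bsub>Y (Suc (Suc i))\<^esub>" if y: "y \<in> carrier (Y i)" for i y
    proof -
      have "d i y \<in> e (G i) ` carrier (G i)"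
      proof (cases i)
        case 0
        show ?thesis unfolding 0 d0 using eG0[of 0] submod_zero[OF submod_carrier[OF MG[of 0]]] by (metis imageI)
      next
        case (Suc k)
        show ?thesis unfolding Suc dS using lin_closed[OF q[of k]] y unfolding Suc YS by blast
      qed
      then show ?thesis unfolding YS using zero[of "d i y" i] lin_closed[OF dl y] unfolding YS by blast
    qed
    show "Module.module R N" by (rule N)
    show "lin_map R N (Y (Suc 0)) (\<lambda>x. e (G 0) (j0 x))" by (rule \<eta>)
    show "inj_on (\<lambda>x. e (G 0) (j0 x)) (carrier N)"
      using comp_inj_on[OF j0, of "e (G 0)"] inj[OF MG, of 0] unfolding cG0 by (simp add: comp_def)
    show "y \<in> (\<lambda>x. e (G 0) (j0 x)) ` carrier N" if "y \<in> carrier (Y (Suc 0))" "d (Suc 0) y = \<zero>\<^bsub>Y (Suc (Suc 0))\<^esub>" for y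
      using that zero[of y 0] cG0 unfolding YS by (simp add: image_image)
    show "d (Suc 0) (e (G 0) (j0 x)) = \<zero>\<^bsub>Y (Suc (Suc 0))\<^esub>" if x: "x \<in> carrier N" for x
      using zero[of "e (G 0) (j0 x)" 0] lin_closed[OF \<eta> x] x cG0 unfolding YS by blast
    show "y \<in> d (Suc i) ` carrier (Y (Suc i))" if y: "y \<in> carrier (Y (Suc (Suc i)))" "d (Suc (Suc i)) y = \<zero>\<^bsub>Y (Suc (Suc (Suc i)))\<^esub>" for y i
    proof -
      have "y \<in> e (G (Suc i)) ` carrier (G (Suc i))" using y zero[of y "Suc i"] unfolding YS by blast
      then obtain g where g: "g \<in> carrier (G (Suc i))" "y = e (G (Suc i)) g" by blast
      obtain x where "x \<in> carrier (J (G i))" "g = qrep (J (G i)) (e (G i) ` carrier (G i)) x"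
        using g(1) unfolding GS cok_def by auto
      then show ?thesis unfolding YS g(2) by (intro image_eqI[of _ _ x]) (simp_all add: dS)
    qed
  qed
  then show ?thesis by blast
qed

section \<open>Trivial Ext groups\<close>

text \<open>A trivial quotient group means that every coset of a cocycle is the subgroup of coboundaries. Cocycles of
  the complex are extensional functions, so maps are restricted to the carrier first.\<close>

lemma (in resolved) maps_lift_of_trivial_cohomology:
  assumes triv: "trivial_group (Hom_cohomology R B \<delta> N i)"
  shows "maps_lift A (carrier A) i"
  unfolding balance
proof (intro allI impI)
  interpret N: module R N by (rule modN)
  let ?G = "(Hom_complex R B N i)\<lparr>carrier := cocycles R B \<delta> N i\<rparr>"
  let ?H = "coboundaries R B \<delta> N i"
  let ?o = "\<lambda>x\<in>cF i. \<zero>\<^bsub>N\<^esub>"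
  fix z assume z: "cocycle i z"
  have zl: "lin_map R (F i) N z" and z\<delta>: "\<And>f. f \<in> cF (Suc i) \<Longrightarrow> z (\<delta> i f) = \<zero>\<^bsub>N\<^esub>"
    using z unfolding cocycle_def by auto
  define z' where "z' = restrict z (cF i)"
  have ext: "lin_map R (F p) N g \<Longrightarrow> (\<lambda>x\<in>cF p. g x) \<in> module_homs R (F p) N" for p g
    unfolding module_homs_iff_lin by (erule lin_cong[OF subF]) simp
  have z'c: "z' \<in> carrier (Hom_complex R B N i)" unfolding z'_def Hom_complex_def Hom_group_def using ext[OF zl] by simp
  have "Hom_coboundary R B \<delta> i z' = (\<lambda>x\<in>cF (Suc i). \<zero>\<^bsub>N\<^esub>)"
    unfolding Hom_coboundary_def z'_def using z\<delta> \<delta>_closed[of _ i] by (auto intro!: restrict_ext)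
  then have "z' \<in> cocycles R B \<delta> N i" unfolding cocycles_def kernel_def using z'c by (simp add: Hom_complex_def Hom_group_def)
  then have "?H #>\<^bsub>?G\<^esub> z' \<in> carrier (?G Mod ?H)" unfolding FactGroup_def RCOSETS_def by auto
  moreover have "?H = one (?G Mod ?H)" unfolding FactGroup_def by simp
  ultimately have eq: "?H #>\<^bsub>?G\<^esub> z' = ?H" using triv unfolding trivial_group_def Hom_cohomology_def by auto
  have "?o \<in> ?H"
  proof (cases i)
    case 0 then show ?thesis unfolding coboundaries_def by (simp add: Hom_complex_def Hom_group_def)
  next
    case (Suc p)
    have "(\<lambda>x\<in>cF p. \<zero>\<^bsub>N\<^esub>) \<in> carrier (Hom_complex R B N p)"
      unfolding Hom_complex_def Hom_group_def using ext[OF lin_zero_map[OF modF modN submod_carrier[OF modN]]] by simp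
    moreover have "?o = Hom_coboundary R B \<delta> p (\<lambda>x\<in>cF p. \<zero>\<^bsub>N\<^esub>)" unfolding Suc Hom_coboundary_def using \<delta>_closed[of _ p] by (auto intro!: restrict_ext)
    ultimately show ?thesis unfolding coboundaries_def Suc by auto
  qed
  then have "?o \<otimes>\<^bsub>?G\<^esub> z' \<in> ?H #>\<^bsub>?G\<^esub> z'" unfolding r_coset_def by blast
  moreover have "?o \<otimes>\<^bsub>?G\<^esub> z' = z'"
    unfolding Hom_complex_def Hom_group_def z'_def using lin_closed[OF zl] by (auto intro!: restrict_ext)
  ultimately have zH: "z' \<in> ?H" using eq by simp
  show "coboundary i z"
  proof (cases i)
    case 0
    have z'0: "z' = (\<lambda>x\<in>cF 0. \<zero>\<^bsub>N\<^esub>)" using zH unfolding coboundaries_def 0 by (simp add: Hom_complex_def Hom_group_def)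
    have "z f = \<zero>\<^bsub>N\<^esub>" if "f \<in> cF 0" for f using fun_cong[OF z'0, of f] that unfolding z'_def 0 by simp
    then show ?thesis unfolding coboundary_def 0 by simp
  next
    case (Suc p)
    then obtain v where v: "v \<in> carrier (Hom_complex R B N p)" "z' = Hom_coboundary R B \<delta> p v" using zH unfolding coboundaries_def by auto
    have "lin_map R (F p) N v" using v(1) by (simp add: Hom_complex_def Hom_group_def module_homs_iff_lin)
    moreover have "z f = v (\<delta> p f)" if "f \<in> cF (Suc p)" for f using fun_cong[OF v(2), of f] that unfolding z'_def Suc Hom_coboundary_def by simp
    ultimately show ?thesis unfolding coboundary_def Suc by auto
  qed
qed

text \<open>A free resolution of the required kind exists, so the chosen one is a free resolution.\<close>

lemma (in coresolution) maps_lift_of_trivial_Ext: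
  assumes NR: "noeth R (Rmod R)" and A: "fin_gen_module R A" and triv: "trivial_group (Ext R A N (int i))"
  shows "maps_lift A (carrier A) i"
proof -
  have MA: "Module.module R A" using A unfolding fin_gen_module_def by blast
  obtain S where S: "finite S" "S \<subseteq> carrier A" "submodule_generated R A S = carrier A" using A unfolding fin_gen_module_def by blast
  have inf: "infinite (UNIV :: ('a \<times> 'c \<times> nat) set)" by (simp add: infinite_UNIV_nat finite_prod)
  let ?P = "\<lambda>(B,\<delta>). \<exists>\<epsilon>. free_resolution R A B \<delta> \<epsilon>"
  obtain B0 :: "nat \<Rightarrow> ('a \<times> 'c \<times> nat) set" and \<delta>0 \<epsilon>0 where "free_resolution R A B0 \<delta>0 \<epsilon>0"
    by (rule finite_free_resolution[OF R_cring NR MA S inf]) (auto intro: that)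
  then have ex: "\<exists>p :: (nat \<Rightarrow> ('a \<times> 'c \<times> nat) set) \<times> _. ?P p" by (intro exI[of _ "(B0,\<delta>0)"]) auto
  obtain B :: "nat \<Rightarrow> ('a \<times> 'c \<times> nat) set" and \<delta> where B: "(B,\<delta>) = (SOME (B,\<delta>). \<exists>\<epsilon>. free_resolution R A B \<delta> \<epsilon>)" by (metis surj_pair)
  have "?P (B,\<delta>)" unfolding B by (rule someI_ex[OF ex])
  then obtain \<epsilon> where fr: "free_resolution R A B \<delta> \<epsilon>" by auto
  interpret I: resolved R Y d N \<eta> A B \<delta> \<epsilon> by (rule resolved.intro[OF coresolution_axioms resolved_axioms.intro[OF MA fr]])
  have "trivial_group (Hom_cohomology R B \<delta> N i)" using triv unfolding Ext_def B[symmetric] by simp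
  then have "maps_lift A (carrier A) i" by (rule I.maps_lift_of_trivial_cohomology)
  then show ?thesis .
qed

section \<open>Burch submodules\<close>

text \<open>Since \<open>M\<close> lies in \<open>(M :\<^sub>L \<mm>)\<close>, the two submodules in the Burch condition are comparable, and they can
  differ only if some generator \<open>a y\<close> of the larger one is not in \<open>\<mm> M\<close>.\<close>

lemma (in local_noetherian) burch_element:
  assumes L: "Module.module R L" and burch: "burch_submodule R \<mm> M L"
  obtains a y where "a \<in> \<mm>" "y \<in> carrier L" "\<And>r. r \<in> \<mm> \<Longrightarrow> r \<odot>\<^bsub>L\<^esub> y \<in> M" "a \<odot>\<^bsub>L\<^esub> y \<notin> ideal_smult R L \<mm> M"
proof (rule ccontr)
  assume n: "\<not> thesis"
  let ?C = "module_colon L M \<mm>"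
  have M: "submodule M R L" using burch unfolding burch_submodule_def by blast
  have gen: "(\<lambda>(a, x). a \<odot>\<^bsub>L\<^esub> x) ` (\<mm> \<times> S) \<subseteq> carrier L" if "S \<subseteq> carrier L" for S
    using that module.smult_closed[OF L m_carr] by fast
  have C: "?C \<subseteq> carrier L" unfolding module_colon_def by blast
  have MC: "M \<subseteq> ?C" unfolding module_colon_def using submod_subset[OF M] submod_smult[OF M m_carr] by blast
  have "ideal_smult R L \<mm> ?C \<subseteq> ideal_smult R L \<mm> M"
    unfolding ideal_smult_def[of R L \<mm> ?C]
  proof (rule span_least)
    show "submodule (ideal_smult R L \<mm> M) R L" unfolding ideal_smult_def by (rule span_submod[OF L gen[OF submod_subset[OF M]]])
    show "(\<lambda>(a, x). a \<odot>\<^bsub>L\<^esub> x) ` (\<mm> \<times> ?C) \<subseteq> ideal_smult R L \<mm> M" using n that unfolding module_colon_def by fast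
  qed
  moreover have "ideal_smult R L \<mm> M \<subseteq> ideal_smult R L \<mm> ?C"
    unfolding ideal_smult_def[of R L \<mm> M]
  proof (rule span_least)
    show "submodule (ideal_smult R L \<mm> ?C) R L" unfolding ideal_smult_def by (rule span_submod[OF L gen[OF C]])
    have "(\<lambda>(a, x). a \<odot>\<^bsub>L\<^esub> x) ` (\<mm> \<times> M) \<subseteq> (\<lambda>(a, x). a \<odot>\<^bsub>L\<^esub> x) ` (\<mm> \<times> ?C)" using MC by blast
    then show "(\<lambda>(a, x). a \<odot>\<^bsub>L\<^esub> x) ` (\<mm> \<times> M) \<subseteq> ideal_smult R L \<mm> ?C" unfolding ideal_smult_def by (rule order_trans[OF _ span_incl])
  qed
  ultimately show False using burch unfolding burch_submodule_def by blast
qed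

text \<open>A submodule \<open>V\<close> of \<open>M\<close> that contains \<open>\<mm> M\<close> and is maximal without \<open>t\<close> satisfies \<open>M = V + R t\<close>, so \<open>M/V\<close>
  is the residue field with basis \<open>t\<close>. The map sends \<open>w\<close> to \<open>r e\<close> where \<open>w - r t \<in> V\<close>; the coefficient
  \<open>r\<close> is unique modulo \<open>\<mm>\<close>, which kills \<open>e\<close>.\<close>

lemma (in local_noetherian) residue_field_map:
  assumes L: "noeth R L" and M: "submodule M R L" and t: "t \<in> M" "t \<notin> ideal_smult R L \<mm> M"
    and E: "Module.module R E" and e: "e \<in> carrier E" "\<And>r. r \<in> \<mm> \<Longrightarrow> r \<odot>\<^bsub>E\<^esub> e = \<zero>\<^bsub>E\<^esub>"
  obtains \<phi> where "lin R L M E (carrier E) \<phi>" "\<phi> t = e" "\<And>x. x \<in> M \<Longrightarrow> \<exists>r\<in>carrier R. \<phi> x = r \<odot>\<^bsub>E\<^esub> e"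
proof -
  have modL: "Module.module R L" using L unfolding noeth_def by blast
  interpret L: module R L by (rule modL)
  interpret E: module R E by (rule E)
  have Mc: "x \<in> M \<Longrightarrow> x \<in> carrier L" for x using submod_subset[OF M] by blast
  let ?m = "ideal_smult R L \<mm> M"
  have gen: "(\<lambda>(a, x). a \<odot>\<^bsub>L\<^esub> x) ` (\<mm> \<times> M) \<subseteq> M" using submod_smult[OF M m_carr] by fast
  have sm: "submodule ?m R L" unfolding ideal_smult_def by (rule span_submod[OF modL order_trans[OF gen submod_subset[OF M]]])
  have mM: "?m \<subseteq> M" unfolding ideal_smult_def by (rule span_least[OF M gen])
  have mem: "r \<odot>\<^bsub>L\<^esub> x \<in> ?m" if "r \<in> \<mm>" "x \<in> M" for r x
  proof -
    have "r \<odot>\<^bsub>L\<^esub> x \<in> (\<lambda>(a, x). a \<odot>\<^bsub>L\<^esub> x) ` (\<mm> \<times> M)" using that by auto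
    then show ?thesis unfolding ideal_smult_def by (rule subsetD[OF span_incl])
  qed
  define C where "C = {V. submodule V R L \<and> ?m \<subseteq> V \<and> V \<subseteq> M \<and> t \<notin> V}"
  obtain V where VC: "V \<in> C" and Vmax: "\<And>T. T \<in> C \<Longrightarrow> V \<subseteq> T \<Longrightarrow> T = V"
    by (rule noeth_max[OF L, of ?m C]) (use sm mM t in \<open>auto simp: C_def\<close>)
  have V: "submodule V R L" "?m \<subseteq> V" "V \<subseteq> M" "t \<notin> V" using VC unfolding C_def by auto
  have tL: "t \<in> carrier L" by (rule Mc[OF t(1)])
  have Vc: "x \<in> V \<Longrightarrow> x \<in> carrier L" for x using Mc V(3) by blast
  have small: "r \<in> \<mm>" if r: "r \<in> carrier R" "r \<odot>\<^bsub>L\<^esub> t \<in> V" for r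
    using mem_of_unit_smult[OF modL V(1) tL r(1) _ r(2)] V(4) by blast
  have ex: "\<exists>r. r \<in> carrier R \<and> w \<ominus>\<^bsub>L\<^esub> r \<odot>\<^bsub>L\<^esub> t \<in> V" if w: "w \<in> M" for w
  proof (cases "w \<in> V")
    case True
    then show ?thesis using Mc[OF w] tL by (intro exI[of _ "\<zero>"]) (simp add: mod_diff_zero[OF modL])
  next
    case False
    let ?Rw = "(\<lambda>r. r \<odot>\<^bsub>L\<^esub> w) ` carrier (Rmod R)"
    have Rw: "submodule ?Rw R L" by (rule lin_image[OF Rmod_module[OF cR] modL submod_carrier[OF Rmod_module[OF cR]] lin_cyclic[OF modL Mc[OF w]]])
    have wRw: "w \<in> ?Rw" using Mc[OF w] by (intro image_eqI[of _ _ "\<one>"]) auto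
    note ms = msum_submod[OF modL V(1) Rw]
    have "msum L V ?Rw \<subseteq> M" using V(3) submod_add[OF M] submod_smult[OF M _ w] unfolding msum_def by auto
    moreover have "msum L V ?Rw \<noteq> V" using ms(3) wRw False by blast
    ultimately have "msum L V ?Rw \<notin> C" using Vmax ms(2) by blast
    then have "t \<in> msum L V ?Rw" using ms(1,2) V(2) \<open>msum L V ?Rw \<subseteq> M\<close> unfolding C_def by blast
    then obtain v r where vr: "v \<in> V" "r \<in> carrier R" "t = v \<oplus>\<^bsub>L\<^esub> r \<odot>\<^bsub>L\<^esub> w" unfolding msum_def by auto
    have "r \<notin> \<mm>"
    proof
      assume "r \<in> \<mm>"
      then have "r \<odot>\<^bsub>L\<^esub> w \<in> V" using mem[OF _ w] V(2) by blast
      then show False using submod_add[OF V(1) vr(1)] vr(3) V(4) by simp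
    qed
    then obtain s where s: "s \<in> carrier R" "s \<otimes> r = \<one>" using unit_of_notin[OF vr(2)] by blast
    have "s \<odot>\<^bsub>L\<^esub> t = s \<odot>\<^bsub>L\<^esub> v \<oplus>\<^bsub>L\<^esub> w"
      using s vr Vc[OF vr(1)] Mc[OF w] by (simp add: L.smult_r_distr L.smult_assoc1[symmetric])
    then have "w \<ominus>\<^bsub>L\<^esub> s \<odot>\<^bsub>L\<^esub> t = \<ominus>\<^bsub>L\<^esub> (s \<odot>\<^bsub>L\<^esub> v)"
      using s(1) Vc[OF vr(1)] Mc[OF w] by (simp add: a_minus_def L.M.minus_add L.M.a_ac L.M.r_neg L.M.r_neg1 L.M.r_neg2)
    then show ?thesis using s(1) submod_neg[OF modL V(1) submod_smult[OF V(1) s(1) vr(1)]] by auto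
  qed
  define c where "c w = (SOME r. r \<in> carrier R \<and> w \<ominus>\<^bsub>L\<^esub> r \<odot>\<^bsub>L\<^esub> t \<in> V)" for w
  have c: "c w \<in> carrier R" "w \<ominus>\<^bsub>L\<^esub> c w \<odot>\<^bsub>L\<^esub> t \<in> V" if "w \<in> M" for w
    using someI_ex[OF ex[OF that]] unfolding c_def by auto
  have key: "c w \<odot>\<^bsub>E\<^esub> e = r \<odot>\<^bsub>E\<^esub> e" if w: "w \<in> M" and r: "r \<in> carrier R" "w \<ominus>\<^bsub>L\<^esub> r \<odot>\<^bsub>L\<^esub> t \<in> V" for w r
  proof -
    have cR': "c w \<in> carrier R" by (rule c(1)[OF w])
    have "(w \<ominus>\<^bsub>L\<^esub> r \<odot>\<^bsub>L\<^esub> t) \<ominus>\<^bsub>L\<^esub> (w \<ominus>\<^bsub>L\<^esub> c w \<odot>\<^bsub>L\<^esub> t) \<in> V" by (rule submod_diff[OF modL V(1) r(2) c(2)[OF w]])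
    moreover have "(w \<ominus>\<^bsub>L\<^esub> r \<odot>\<^bsub>L\<^esub> t) \<ominus>\<^bsub>L\<^esub> (w \<ominus>\<^bsub>L\<^esub> c w \<odot>\<^bsub>L\<^esub> t) = (c w \<ominus> r) \<odot>\<^bsub>L\<^esub> t"
      using cR' r(1) tL Mc[OF w] by (simp add: a_minus_def L.smult_l_distr L.smult_l_minus L.M.minus_add L.M.a_ac L.M.r_neg L.M.r_neg1 L.M.r_neg2)
    ultimately have "c w \<ominus> r \<in> \<mm>" using small[of "c w \<ominus> r"] cR' r(1) by simp
    then have "(c w \<ominus> r) \<odot>\<^bsub>E\<^esub> e = \<zero>\<^bsub>E\<^esub>" by (rule e(2))
    then show ?thesis using cR' r(1) e(1) by (simp add: mod_diff_smult[OF E] mod_diff_eq_zero[OF E])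
  qed
  have "lin R L M E (carrier E) (\<lambda>w. c w \<odot>\<^bsub>E\<^esub> e)"
  proof (rule linI)
    fix x y assume xy: "x \<in> M" "y \<in> M"
    show "c (x \<oplus>\<^bsub>L\<^esub> y) \<odot>\<^bsub>E\<^esub> e = c x \<odot>\<^bsub>E\<^esub> e \<oplus>\<^bsub>E\<^esub> c y \<odot>\<^bsub>E\<^esub> e"
    proof -
      have "(x \<oplus>\<^bsub>L\<^esub> y) \<ominus>\<^bsub>L\<^esub> (c x \<oplus> c y) \<odot>\<^bsub>L\<^esub> t = (x \<ominus>\<^bsub>L\<^esub> c x \<odot>\<^bsub>L\<^esub> t) \<oplus>\<^bsub>L\<^esub> (y \<ominus>\<^bsub>L\<^esub> c y \<odot>\<^bsub>L\<^esub> t)"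
        using c(1)[OF xy(1)] c(1)[OF xy(2)] Mc[OF xy(1)] Mc[OF xy(2)] tL by (simp add: L.smult_l_distr mod_diff_add_diff[OF modL])
      also have "\<dots> \<in> V" by (rule submod_add[OF V(1) c(2)[OF xy(1)] c(2)[OF xy(2)]])
      finally show ?thesis using key[OF submod_add[OF M xy], of "c x \<oplus> c y"] c(1)[OF xy(1)] c(1)[OF xy(2)] e(1) by (simp add: E.smult_l_distr)
    qed
  next
    fix s x assume s: "s \<in> carrier R" and x: "x \<in> M"
    have "s \<odot>\<^bsub>L\<^esub> x \<ominus>\<^bsub>L\<^esub> (s \<otimes> c x) \<odot>\<^bsub>L\<^esub> t = s \<odot>\<^bsub>L\<^esub> (x \<ominus>\<^bsub>L\<^esub> c x \<odot>\<^bsub>L\<^esub> t)"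
      using s c(1)[OF x] Mc[OF x] tL by (simp add: mod_smult_diff[OF modL] L.smult_assoc1)
    also have "\<dots> \<in> V" by (rule submod_smult[OF V(1) s c(2)[OF x]])
    finally show "c (s \<odot>\<^bsub>L\<^esub> x) \<odot>\<^bsub>E\<^esub> e = s \<odot>\<^bsub>E\<^esub> (c x \<odot>\<^bsub>E\<^esub> e)"
      using key[OF submod_smult[OF M s x], of "s \<otimes> c x"] s c(1)[OF x] e(1) by (simp add: E.smult_assoc1)
  qed (use c(1) e(1) in simp)
  moreover have "c t \<odot>\<^bsub>E\<^esub> e = e"
    using key[OF t(1), of "\<one>"] tL e(1) submod_zero[OF V(1)] by (simp add: mod_diff_self[OF modL])
  ultimately show thesis using c(1) by (intro that[of "\<lambda>w. c w \<odot>\<^bsub>E\<^esub> e"]) auto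
qed

text \<open>The argument sketched at the beginning. The part about \<open>\<chi>\<close> is the vanishing of \<open>Ext\<^sup>n(L/M, N)\<close>, phrased
  with maps on \<open>L\<close> that are zero on \<open>M\<close>.\<close>

theorem (in local_coresolution) burch_ext_vanishes:
  assumes L: "noeth R L" and burch: "burch_submodule R \<mm> M L"
    and Mn: "maps_lift L M n" and Mn1: "\<And>k. n = Suc k \<Longrightarrow> maps_lift L M k" and Ln: "maps_lift L (carrier L) n"
  shows "ext_vanishes \<mm> n"
  unfolding ext_vanishes_def
proof (intro ballI impI)
  have modL: "Module.module R L" using L unfolding noeth_def by blast
  interpret L: module R L by (rule modL)
  interpret Ym: module R "Y j" for j by (rule modY)
  have M: "submodule M R L" using burch unfolding burch_submodule_def by blast
  have Mc: "x \<in> M \<Longrightarrow> x \<in> carrier L" for x using submod_subset[OF M] by blast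
  note sY = submod_carrier[OF modY]
  fix e assume e: "e \<in> carrier (Y (Suc n))" "d (Suc n) e = \<zero>\<^bsub>Y (Suc (Suc n))\<^esub>" "\<forall>a\<in>\<mm>. a \<odot>\<^bsub>Y (Suc n)\<^esub> e = \<zero>\<^bsub>Y (Suc n)\<^esub>"
  obtain a y where a: "a \<in> \<mm>" and y: "y \<in> carrier L" "\<And>r. r \<in> \<mm> \<Longrightarrow> r \<odot>\<^bsub>L\<^esub> y \<in> M" and ay: "a \<odot>\<^bsub>L\<^esub> y \<notin> ideal_smult R L \<mm> M"
    by (rule burch_element[OF modL burch]) (auto intro: that)
  have aR: "a \<in> carrier R" by (rule m_carr[OF a])
  obtain \<phi> where \<phi>: "lin R L M (Y (Suc n)) (carrier (Y (Suc n))) \<phi>" "\<phi> (a \<odot>\<^bsub>L\<^esub> y) = e" "\<And>x. x \<in> M \<Longrightarrow> \<exists>r\<in>carrier R. \<phi> x = r \<odot>\<^bsub>Y (Suc n)\<^esub> e"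
    by (rule residue_field_map[OF L M y(2)[OF a] ay modY e(1)]) (use e(3) in \<open>auto intro: that\<close>)
  have "d (Suc n) (\<phi> x) = \<zero>\<^bsub>Y (Suc (Suc n))\<^esub>" if x: "x \<in> M" for x
  proof -
    obtain r where r: "r \<in> carrier R" "\<phi> x = r \<odot>\<^bsub>Y (Suc n)\<^esub> e" using \<phi>(3)[OF x] by blast
    then show ?thesis using d_smult[OF r(1) e(1)] e(2) by simp
  qed
  then obtain \<psi> where \<psi>: "lin R L M (Y n) (carrier (Y n)) \<psi>" "\<And>x. x \<in> M \<Longrightarrow> \<phi> x = d n (\<psi> x)"
    using Mn \<phi>(1) unfolding maps_lift_def by blast
  obtain \<psi>' where \<psi>': "lin_map R L (Y n) \<psi>'" "\<And>x. x \<in> M \<Longrightarrow> \<psi>' x = \<psi> x"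
    by (rule baer_restrict[OF modL M baerY \<psi>(1)]) (auto intro: that)
  define \<chi> where "\<chi> x = d n (a \<odot>\<^bsub>Y n\<^esub> \<psi>' x)" for x
  have \<chi>: "lin_map R L (Y (Suc n)) \<chi>"
    unfolding \<chi>_def by (rule lin_comp[OF lin_pointwise_smult[OF modL modY order_refl sY \<psi>'(1) aR] d_lin order_refl])
  \<comment> \<open>On \<open>M\<close> the map \<open>\<phi>\<close> takes values in \<open>R e\<close>, which \<open>a\<close> kills.\<close>
  have \<chi>M: "\<chi> x = \<zero>\<^bsub>Y (Suc n)\<^esub>" if x: "x \<in> M" for x
  proof -
    obtain r where r: "r \<in> carrier R" "\<phi> x = r \<odot>\<^bsub>Y (Suc n)\<^esub> e" using \<phi>(3)[OF x] by blast
    have "\<chi> x = a \<odot>\<^bsub>Y (Suc n)\<^esub> \<phi> x" unfolding \<chi>_def using d_smult[OF aR lin_closed[OF \<psi>(1) x]] \<psi>(2)[OF x] \<psi>'(2)[OF x] by simp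
    also have "\<dots> = r \<odot>\<^bsub>Y (Suc n)\<^esub> (a \<odot>\<^bsub>Y (Suc n)\<^esub> e)" unfolding r(2) by (rule mod_smult_comm[OF modY aR r(1) e(1)])
    also have "\<dots> = \<zero>\<^bsub>Y (Suc n)\<^esub>" using e(3) a r(1) by simp
    finally show ?thesis .
  qed
  have "d (Suc n) (\<chi> x) = \<zero>\<^bsub>Y (Suc (Suc n))\<^esub>" if x: "x \<in> carrier L" for x
    unfolding \<chi>_def by (rule dd) (use lin_closed[OF \<psi>'(1) x] aR in simp)
  then obtain \<rho> where \<rho>: "lin_map R L (Y n) \<rho>" "\<And>x. x \<in> carrier L \<Longrightarrow> \<chi> x = d n (\<rho> x)"
    using Ln \<chi> unfolding maps_lift_def by blast
  \<comment> \<open>The restriction of \<open>\<rho>\<close> to \<open>M\<close> is a cocycle in degree \<open>n - 1\<close>, hence a boundary, which is subtracted after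
    extending it to \<open>L\<close>.\<close>
  have "\<exists>\<chi>'. lin_map R L (Y n) \<chi>' \<and> (\<forall>x\<in>carrier L. \<chi> x = d n (\<chi>' x)) \<and> (\<forall>x\<in>M. \<chi>' x = \<zero>\<^bsub>Y n\<^esub>)"
  proof (cases n)
    case 0
    then have "\<rho> x = \<zero>\<^bsub>Y n\<^esub>" if "x \<in> M" for x using lin_closed[OF \<rho>(1) Mc[OF that]] carrier_Y0 by simp
    then show ?thesis using \<rho> by blast
  next
    case (Suc k)
    have "lin R L M (Y (Suc k)) (carrier (Y (Suc k))) \<rho>" using lin_mono[OF \<rho>(1) submod_subset[OF M] order_refl] unfolding Suc .
    moreover have "\<forall>x\<in>M. d (Suc k) (\<rho> x) = \<zero>\<^bsub>Y (Suc (Suc k))\<^esub>" using \<rho>(2)[OF Mc] \<chi>M unfolding Suc by simp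
    ultimately obtain \<sigma> where \<sigma>: "lin R L M (Y k) (carrier (Y k)) \<sigma>" "\<forall>x\<in>M. \<rho> x = d k (\<sigma> x)" using Mn1[OF Suc] unfolding maps_lift_def by blast
    obtain \<sigma>' where \<sigma>': "lin_map R L (Y k) \<sigma>'" "\<And>x. x \<in> M \<Longrightarrow> \<sigma>' x = \<sigma> x"
      by (rule baer_restrict[OF modL M baerY \<sigma>(1)]) (auto intro: that)
    have d\<sigma>: "lin_map R L (Y n) (\<lambda>x. d k (\<sigma>' x))" unfolding Suc by (rule lin_comp[OF \<sigma>'(1) d_lin order_refl])
    have "\<chi> x = d n (\<rho> x \<ominus>\<^bsub>Y n\<^esub> d k (\<sigma>' x))" if x: "x \<in> carrier L" for x
    proof -
      have "d n (\<rho> x \<ominus>\<^bsub>Y n\<^esub> d k (\<sigma>' x)) = d n (\<rho> x) \<ominus>\<^bsub>Y (Suc n)\<^esub> d n (d k (\<sigma>' x))"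
        by (rule lin_sub[OF modY modY sY d_lin lin_closed[OF \<rho>(1) x] lin_closed[OF d\<sigma> x]])
      also have "d n (d k (\<sigma>' x)) = \<zero>\<^bsub>Y (Suc n)\<^esub>" unfolding Suc by (rule dd[OF lin_closed[OF \<sigma>'(1) x]])
      finally show ?thesis using \<rho>(2)[OF x] mod_diff_zero[OF modY lin_closed[OF \<chi> x]] by simp
    qed
    moreover have "\<rho> x \<ominus>\<^bsub>Y n\<^esub> d k (\<sigma>' x) = \<zero>\<^bsub>Y n\<^esub>" if x: "x \<in> M" for x
      using \<sigma>(2) \<sigma>'(2)[OF x] x mod_diff_self[OF modY lin_closed[OF \<rho>(1) Mc[OF x]]] by simp
    ultimately show ?thesis
      using lin_pointwise_diff[OF modL modY order_refl sY \<rho>(1) d\<sigma>] by (intro exI[of _ "\<lambda>x. \<rho> x \<ominus>\<^bsub>Y n\<^esub> d k (\<sigma>' x)"]) simp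
  qed
  then obtain \<chi>' where \<chi>': "lin_map R L (Y n) \<chi>'" "\<forall>x\<in>carrier L. \<chi> x = d n (\<chi>' x)" "\<forall>x\<in>M. \<chi>' x = \<zero>\<^bsub>Y n\<^esub>" by blast
  have "r \<odot>\<^bsub>Y n\<^esub> \<chi>' y = \<zero>\<^bsub>Y n\<^esub>" if r: "r \<in> \<mm>" for r
    using lin_smult[OF \<chi>'(1) m_carr[OF r] y(1)] \<chi>'(3) y(2)[OF r] by simp
  moreover have "d n (\<chi>' y) = e"
  proof -
    have "d n (\<chi>' y) = d n (a \<odot>\<^bsub>Y n\<^esub> \<psi>' y)" using \<chi>'(2) y(1) unfolding \<chi>_def by simp
    also have "a \<odot>\<^bsub>Y n\<^esub> \<psi>' y = \<psi>' (a \<odot>\<^bsub>L\<^esub> y)" using lin_smult[OF \<psi>'(1) aR y(1)] by simp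
    also have "\<dots> = \<psi> (a \<odot>\<^bsub>L\<^esub> y)" by (rule \<psi>'(2)[OF y(2)[OF a]])
    finally show ?thesis using \<psi>(2)[OF y(2)[OF a]] \<phi>(2) by simp
  qed
  ultimately show "\<exists>e'\<in>carrier (Y n). (\<forall>a\<in>\<mm>. a \<odot>\<^bsub>Y n\<^esub> e' = \<zero>\<^bsub>Y n\<^esub>) \<and> d n e' = e"
    using lin_closed[OF \<chi>'(1) y(1)] by blast
qed

section \<open>Finite injective dimension\<close>

lemma noeth_of_fin_gen:
  assumes cR: "cring R" and NR: "noeth R (Rmod R)" and A: "fin_gen_module R A"
  shows "noeth R A"
proof -
  have MA: "Module.module R A" using A unfolding fin_gen_module_def by blast
  obtain S where S: "finite S" "S \<subseteq> carrier A" "submodule_generated R A S = carrier A" using A unfolding fin_gen_module_def by blast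
  obtain B :: "nat set" and \<epsilon> where B: "finite B" "lin_map R (free_module R B) A \<epsilon>" "\<epsilon> ` carrier (free_module R B) = carrier A"
    using free_cover[OF cR MA submod_carrier[OF MA] S infinite_UNIV_nat] by blast
  show ?thesis by (rule noeth_image[OF noeth_free[OF cR NR B(1)] MA B(2,3)])
qed

lemma fin_gen_submodule:
  assumes A: "noeth R A" and H: "submodule H R A"
  shows "fin_gen_module R (A\<lparr>carrier := H\<rparr>)"
proof -
  have MA: "Module.module R A" using A unfolding noeth_def by blast
  have MH: "Module.module R (A\<lparr>carrier := H\<rparr>)" by (rule submod_module[OF MA H])
  obtain F where F: "finite F" "F \<subseteq> H" "submodule_generated R A F = H" by (rule noeth_fg[OF A H])
  have sub: "submodule K R A" if K: "submodule K R (A\<lparr>carrier := H\<rparr>)" for K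
    by (rule submodI[OF MA]) (use submod_subset[OF K] submod_subset[OF H] submod_zero[OF K] submod_add[OF K] submod_smult[OF K] in auto)
  have "submodule_generated R (A\<lparr>carrier := H\<rparr>) F = H"
  proof
    show "submodule_generated R (A\<lparr>carrier := H\<rparr>) F \<subseteq> H" using span_least[OF submod_carrier[OF MH]] F(2) by simp
    have "submodule (submodule_generated R (A\<lparr>carrier := H\<rparr>) F) R A" by (rule sub[OF span_submod[OF MH]]) (use F(2) in simp)
    then show "H \<subseteq> submodule_generated R (A\<lparr>carrier := H\<rparr>) F" using span_least[OF _ span_incl] F(3) by blast
  qed
  then show ?thesis unfolding fin_gen_module_def using MH F by auto
qed

text \<open>The complex is cut off at the cocycles in degree \<open>n\<close>, onto which \<open>I\<^sup>n\<^sup>-\<^sup>1\<close> maps by exactness.\<close>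

lemma (in coresolution) injective_dim_le:
  fixes n :: nat
  assumes Z: "baer R ((Y (Suc n))\<lparr>carrier := {y\<in>carrier (Y (Suc n)). d (Suc n) y = \<zero>\<^bsub>Y (Suc (Suc n))\<^esub>}\<rparr>)"
  shows "\<exists>\<eta> (E :: nat \<Rightarrow> ('a,'e) module) \<delta>. injective_resolution R N \<eta> E \<delta> \<and> (\<forall>i>n. carrier (E i) = {\<zero>\<^bsub>E i\<^esub>})"
proof -
  let ?Z = "(Y (Suc n))\<lparr>carrier := {y\<in>carrier (Y (Suc n)). d (Suc n) y = \<zero>\<^bsub>Y (Suc (Suc n))\<^esub>}\<rparr>"
  define E where "E i = (if i < n then Y (Suc i) else if i = n then ?Z else Y 0)" for i
  define \<delta> where "\<delta> i = (if i < n then d (Suc i) else (\<lambda>_. \<zero>\<^bsub>Y 0\<^esub>))" for i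
  have E: "i < n \<Longrightarrow> E i = Y (Suc i)" "E n = ?Z" "n < i \<Longrightarrow> E i = Y 0" for i by (auto simp: E_def)
  have \<delta>: "i < n \<Longrightarrow> \<delta> i = d (Suc i)" "n \<le> i \<Longrightarrow> \<delta> i = (\<lambda>_. \<zero>\<^bsub>Y 0\<^esub>)" for i by (auto simp: \<delta>_def)
  have cE: "carrier (E i) = {y \<in> carrier (Y (Suc i)). i = n \<longrightarrow> d (Suc i) y = \<zero>\<^bsub>Y (Suc (Suc i))\<^esub>}" if "i \<le> n" for i
    using that E(1)[of i] E(2) by (cases "i = n") auto
  have zE: "\<zero>\<^bsub>E i\<^esub> = \<zero>\<^bsub>Y (Suc i)\<^esub>" if "i \<le> n" for i
    using that E(1)[of i] E(2) by (cases "i = n") auto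
  have opsE: "x \<oplus>\<^bsub>E i\<^esub> y = x \<oplus>\<^bsub>Y (Suc i)\<^esub> y" "r \<odot>\<^bsub>E i\<^esub> x = r \<odot>\<^bsub>Y (Suc i)\<^esub> x" if "i \<le> n" for i x y r
    using that E(1)[of i] E(2) by (cases "i = n"; auto)+
  have bE: "baer R (E i)" for i
    using Z baerY E by (cases i n rule: linorder_cases) auto
  have image: "\<delta> i ` carrier (E i) = {y \<in> carrier (E (Suc i)). \<delta> (Suc i) y = \<zero>\<^bsub>E (Suc (Suc i))\<^esub>}" for i
  proof (cases "i < n")
    case False
    have "carrier (E (Suc i)) = {\<zero>\<^bsub>Y 0\<^esub>}" using E(3)[of "Suc i"] False carrier_Y0 by simp
    moreover have "carrier (E i) \<noteq> {}" using submod_zero[OF submod_carrier[OF baer_module[OF bE]]] by blast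
    ultimately show ?thesis using False \<delta>(2) E(3)[of "Suc (Suc i)"] by auto
  next
    case True
    have "\<delta> i ` carrier (E i) = d (Suc i) ` carrier (Y (Suc i))" using True E(1) \<delta>(1) by simp
    also have "\<dots> = {y \<in> carrier (Y (Suc (Suc i))). d (Suc (Suc i)) y = \<zero>\<^bsub>Y (Suc (Suc (Suc i)))\<^esub>}"
      using dd d_closed exact by blast
    also have "\<dots> = {y \<in> carrier (E (Suc i)). \<delta> (Suc i) y = \<zero>\<^bsub>E (Suc (Suc i))\<^esub>}"
    proof (cases "Suc i = n")
      case True then show ?thesis using cE[of "Suc i"] \<delta>(2)[of "Suc i"] E(3)[of "Suc (Suc i)"] by auto
    next
      case False
      then have "Suc i < n" using True by simp
      then show ?thesis using cE[of "Suc i"] \<delta>(1)[of "Suc i"] zE[of "Suc (Suc i)"] by auto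
    qed
    finally show ?thesis .
  qed
  have "injective_resolution R N \<eta> E \<delta>"
    unfolding injective_resolution_def
  proof (intro conjI allI)
    show "injective_module R (E i)" for i by (rule baer_injective_module[OF bE])
    show "\<eta> \<in> module_homs R N (E 0)"
      unfolding module_homs_iff_lin using \<eta>_lin d_\<eta> cE[of 0] opsE[of 0] unfolding lin_def by auto
    show "inj_on \<eta> (carrier N)" by (rule \<eta>_inj)
    show "\<eta> ` carrier N = {x \<in> carrier (E 0). \<delta> 0 x = \<zero>\<^bsub>E 1\<^esub>}"
    proof -
      have "\<eta> ` carrier N = {y \<in> carrier (Y (Suc 0)). d (Suc 0) y = \<zero>\<^bsub>Y (Suc (Suc 0))\<^esub>}"
        using exact_\<eta> d_\<eta> \<eta>_closed by blast
      also have "\<dots> = {x \<in> carrier (E 0). \<delta> 0 x = \<zero>\<^bsub>E 1\<^esub>}"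
        using cE[of 0] E(3)[of "Suc 0"] \<delta>[of 0] zE[of "Suc 0"] by (cases "n = 0") auto
      finally show ?thesis .
    qed
    show "\<delta> i ` carrier (E i) = {x \<in> carrier (E (Suc i)). \<delta> (Suc i) x = \<zero>\<^bsub>E (Suc (Suc i))\<^esub>}" for i by (rule image)
    show "\<delta> i \<in> module_homs R (E i) (E (Suc i))" for i
      unfolding module_homs_iff_lin
    proof (cases "i < n")
      case True
      show "lin_map R (E i) (E (Suc i)) (\<delta> i)"
      proof (rule linI)
        show "\<delta> i x \<in> carrier (E (Suc i))" if "x \<in> carrier (E i)" for x using image[of i] that by blast
      qed (use True cE[of i] opsE[of i] opsE[of "Suc i"] \<delta>(1)[of i] lin_add[OF d_lin[of "Suc i"]] lin_smult[OF d_lin[of "Suc i"]] in auto)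
    next
      case False
      then have e: "E (Suc i) = Y 0" "\<delta> i = (\<lambda>_. \<zero>\<^bsub>Y 0\<^esub>)" using E(3) \<delta>(2) by auto
      show "lin_map R (E i) (E (Suc i)) (\<delta> i)"
        unfolding e by (rule lin_zero_map[OF baer_module[OF bE] modY submod_carrier[OF modY]])
    qed
  qed
  then show ?thesis using E(3) carrier_Y0 by (intro exI[of _ \<eta>] exI[of _ E] exI[of _ \<delta>]) simp
qed

theorem theorem5p3:
  fixes R :: "('a, 'r) ring_scheme"
    and \<mm> :: "'a set"
    and L :: "('a, 'l, 'ls) module_scheme"
    and M :: "'l set"
    and N :: "('a, 'b, 'bs) module_scheme"
    and n :: int
  assumes "noetherian_local_ring R \<mm>"
    and "fin_gen_module R L"
    and "burch_submodule R \<mm> M L"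
    and "fin_gen_module R N"
    and "ereal_of_enat (depth R \<mm> N) \<le> ereal (real_of_int n)"
    and "\<forall>i\<in>{n - 1, n, n + 1}. trivial_group (Ext R (L\<lparr>carrier := M\<rparr>) N i)"
    and "\<forall>j\<in>{n, n + 1}. trivial_group (Ext R L N j)"
  shows "injective_dim R N < \<infinity>"
proof -
  interpret loc: local_noetherian R \<mm> by (rule local_noetherian.intro) fact
  note cR = loc.cR and NR = loc.NR
  have L: "noeth R L" and N: "noeth R N" by (rule noeth_of_fin_gen[OF cR NR]; fact)+
  have modN: "Module.module R N" using N unfolding noeth_def by blast
  have M: "submodule M R L" using assms(3) unfolding burch_submodule_def by blast
  have fgM: "fin_gen_module R (L\<lparr>carrier := M\<rparr>)" by (rule fin_gen_submodule[OF L M])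
  have "0 \<le> ereal_of_enat (depth R \<mm> N)" by simp
  also note assms(5)
  finally have "0 \<le> n" by simp
  then obtain m where m: "n = int m" using nonneg_int_cases by blast
  have dm: "depth R \<mm> N \<le> enat m" using assms(5) unfolding m by (cases "depth R \<mm> N") auto
  then have nz: "carrier N \<noteq> {\<zero>\<^bsub>N\<^esub>}" unfolding depth_def by auto
  obtain Y :: "nat \<Rightarrow> ('a, 'a \<times> nat \<Rightarrow> 'b + nat) module" and d \<eta> where Y: "coresolution R Y d N \<eta>"
    using coresolution_exists[OF cR NR modN] by blast
  interpret Y: rich_coresolution R Y d N \<eta> \<mm>
  proof (intro rich_coresolution.intro local_coresolution.intro rich_coresolution_axioms.intro)
    show "coresolution R Y d N \<eta>" by (rule Y)
    show "local_noetherian R \<mm>" by (rule loc.local_noetherian_axioms)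
    show "noeth R N" by (rule N)
    show "\<exists>(Y' :: nat \<Rightarrow> ('a, 'a \<times> nat \<Rightarrow> 'b + nat) module) d' \<eta>'. coresolution R Y' d' (quo N Q) \<eta>'" if "submodule Q R N" for Q
      by (rule coresolution_exists[OF cR NR quo_module[OF modN that]])
  qed
  have lift: "Y.maps_lift L M i" if "int i \<in> {n - 1, n, n + 1}" for i
  proof -
    have "trivial_group (Ext R (L\<lparr>carrier := M\<rparr>) N (int i))" using assms(6) that by blast
    then show ?thesis using Y.maps_lift_of_trivial_Ext[OF NR fgM, of i] unfolding Y.maps_lift_def lin_def by simp
  qed
  have liftL: "Y.maps_lift L (carrier L) m"
    using Y.maps_lift_of_trivial_Ext[OF NR assms(2), of m] assms(7) m by simp
  have van: "Y.ext_vanishes \<mm> m"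
    by (rule Y.burch_ext_vanishes[OF L assms(3) lift lift liftL]) (auto simp: m)
  have "\<exists>t\<le>m. \<not> Y.ext_vanishes \<mm> t"
  proof (rule ccontr)
    assume "\<not> ?thesis"
    then have "enat (Suc m) \<le> depth R \<mm> N" by (intro Y.depth_of_vanishing[OF N nz]) auto
    then have "enat (Suc m) \<le> enat m" using dm by (rule order_trans)
    then show False by simp
  qed
  then obtain t where t: "t \<le> m" "\<not> Y.ext_vanishes \<mm> t" by blast
  have "Y.ext_vanishes \<mm> i" if "m \<le> i" for i by (rule Y.vanishing_persists[OF van t that])
  then have all: "Y.ext_vanishes \<aa> (Suc m)" if "ideal \<aa> R" for \<aa> using Y.ext_vanishes_all_ideals[of m \<aa> "Suc m"] that by simp
  have "injective_dim R N \<le> enat m"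
    unfolding injective_dim_def
    by (rule Inf_lower) (use Y.injective_dim_le[OF Y.cosyzygy_injective[OF all]] in blast)
  then show ?thesis by (rule order_le_less_trans) simp
qed

end
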